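(* Let $N\ge5$ be an integer and $m=\lfloor N/2\rfloor$. Then, for integers $k\ge0$, $$|L_N(k)|=\frac{R_N^m}{m!\,\mu_0\mu_1\cdots\mu_m\,|\det V_N|}\,k^m+O(k^{m-1}),$$ where $V_N$ is the class matrix for the $\mathbb Q$-rational cuspidal divisor class group of $\Gamma_1(N)$, $\mu_i=|\mathrm{Orb}(\mathfrak c_i)|$ are the sizes of the Galois orbits of cusps, and $R_N=\frac1{24}\sum_{d\mid N}d\,\varphi(d)\,\varphi(N/d)$.
   Context: Notation: $q=e^{2\pi i\tau}$, $\operatorname{Im}\tau>0$; $(x_1,\dots,x_s;q)_\infty=\prod_{i=1}^s\prod_{n\ge0}(1-x_iq^n)$; $\varphi$ is Euler's function; $m=\lfloor N/2\rfloor$. Products: for an even integer $a_0\ge0$ and $\mathbf a=(a_1,\dots,a_m)\in\mathbb Z^m$, $$f^{(N)}_{\mathbf a}(\tau)=q^{\frac N{24}S_1-\frac1{2N}S_2}(q^N;q^N)_\infty^{a_0}\prod_{j=1}^m(q^j,q^{N-j};q^N)_\infty^{a_j},\quad S_1=a_0+2\sum_{j=1}^m a_j,\quad S_2=\sum_{j=1}^m j(N-j)a_j.$$ For an integer $k\ge0$, $L_N(k)$ is the set of all $\mathbf a\in\mathbb Z^m$ such that, with $a_0=2k$, $f^{(N)}_{\mathbf a}\in M_k(\Gamma_1(N))$, the space of holomorphic modular forms of weight $k$ on $\Gamma_1(N)$. Cusps: the cusps of $X_1(N)$ are the $\Gamma_1(N)$-classes $[a/c]$, $\gcd(a,c)=1$,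 and $g([a/c])=\gcd(c,N)$. Every cusp can be written $[a/(gu)]$ with $g\mid N$, $u$ a unit mod $N/g$, $a\in(\mathbb Z/g\mathbb Z)^\times/\{\pm1\}$, $\gcd(a,gu)=1$. The group $\mathrm{Gal}(\mathbb Q(e^{2\pi i/N})/\mathbb Q)\cong(\mathbb Z/N\mathbb Z)^\times$ acts by $\sigma_x[a/(gu)]=[a/(xgu)]$; the orbits correspond to the pairs $(g,a)$ with $g\mid N$, $a\in(\mathbb Z/g\mathbb Z)^\times/\{\pm1\}$, and there are $m+1$ of them. Fix orbit representatives $\mathfrak c_0,\dots,\mathfrak c_m$ with $\mathfrak c_m=[1/N]=[i\infty]$; $\mathrm{Orb}(\mathfrak c_i)$ is the orbit of $\mathfrak c_i$. Matrix $A_N$: writing $\mathfrak c_r=[a/c]$, $g=g(\mathfrak c_r)$, $A_N$ is the $m\times m$ matrix with rows indexed by $0\le r\le m-1$, columns by $1\le j\le m$, and entries $\frac g2B_2(\langle ja/g\rangle)$, where $B_2(x)=x^2-x+\frac16$ and $\langle x\rangle=x-\lfloor x\rfloor$. Matrix $B_N$: $B_5=\begin{pmatrix}16&-5\\-4&5\end{pmatrix}$. If $N\ge6$, put $M=N\gcd(2,N)$, let $r_N\in\{0,1,2\}$ with $r_N\equiv2M\pmod3$, $a_N=\frac{-M+5r_N}3$, $b_N=\frac{M-8r_N}3$, let $\mathbf e_1,\dots,\mathbf e_m$ be the standard basis of $\mathbb Z^m$, and let $j_1<\dots<j_r$ be the multiples of $3$ in $\{3,\dots,m\}$. The columns of $B_N$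 are the $m$ vectors $16\mathbf e_1-4\mathbf e_2$; $\ a_N\mathbf e_1+b_N\mathbf e_2+r_N\mathbf e_3$; $\ \frac{j^2-4}3\mathbf e_1-\frac{j^2-1}3\mathbf e_2+\mathbf e_j$ for $3\le j\le m$, $3\nmid j$; $\ (j_1^2-4)\mathbf e_1-(j_1^2-1)\mathbf e_2+3\mathbf e_{j_1}$; and $\frac{j_t^2-j_1^2}3(\mathbf e_1-\mathbf e_2)-\mathbf e_{j_1}+\mathbf e_{j_t}$ for $2\le t\le r$. Class matrix: $V_N=A_NB_N$, an integer $m\times m$ matrix whose $i$-th column lists the coefficients of the divisor of the $i$-th element of a $\mathbb Z$-basis of the group of modular units on $X_1(N)$ with $\mathbb Q$-rational cuspidal divisors (modulo constants), in the basis $\mathcal F_r=C_r-\mu_rC_m$ ($0\le r\le m-1$) of degree-zero $\mathbb Q$-rational cuspidal divisors, where $C_r=\sum_{\mathfrak c\in\mathrm{Orb}(\mathfrak c_r)}[\mathfrak c]$. *)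

theory Defs
  imports
    "HOL-Complex_Analysis.Complex_Analysis"
    "HOL-Library.Landau_Symbols"
    "HOL-Number_Theory.Totient"
    "Jordan_Normal_Form.Determinant"
begin

section \<open>Modular forms on \<open>\<Gamma>\<^sub>1(N)\<close>\<close>

text \<open>A quadruple \<open>(p, q, r, s)\<close> stands for the matrix with rows \<open>(p, q)\<close> and \<open>(r, s)\<close>.\<close>

definition SL2Z :: "(int \<times> int \<times> int \<times> int) set" where
  "SL2Z = {(p, q, r, s). p * s - q * r = 1}"

definition Gamma1 :: "nat \<Rightarrow> (int \<times> int \<times> int \<times> int) set" where
  "Gamma1 N = {(p, q, r, s) \<in> SL2Z. [p = 1] (mod int N) \<and> [s = 1] (mod int N) \<and> [r = 0] (mod int N)}"

definition upper_half_plane :: "complex set" where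
  "upper_half_plane = {\<tau>. Im \<tau> > 0}"

definition slash :: "nat \<Rightarrow> (complex \<Rightarrow> complex) \<Rightarrow> int \<times> int \<times> int \<times> int \<Rightarrow> complex \<Rightarrow> complex" where
  "slash k f = (\<lambda>(p, q, r, s) \<tau>.
     f ((of_int p * \<tau> + of_int q) / (of_int r * \<tau> + of_int s)) / (of_int r * \<tau> + of_int s) ^ k)"

text \<open>Holomorphy at the cusps is expressed by boundedness of every slash translate near
  \<open>i\<infinity>\<close>. Only the values on the upper half plane matter.\<close>

definition modular_forms :: "nat \<Rightarrow> nat \<Rightarrow> (complex \<Rightarrow> complex) set" where
  "modular_forms k N = {f.
     f holomorphic_on upper_half_plane \<and>
     (\<forall>\<gamma>\<in>Gamma1 N. \<forall>\<tau>\<in>upper_half_plane. slash k f \<gamma> \<tau> = f \<tau>) \<and>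
     (\<forall>\<gamma>\<in>SL2Z. \<exists>C Y. \<forall>\<tau>\<in>upper_half_plane. Im \<tau> \<ge> Y \<longrightarrow> norm (slash k f \<gamma> \<tau>) \<le> C)}"

section \<open>The products and the sets \<open>L\<^sub>N(k)\<close>\<close>

text \<open>The power \<open>q\<^sup>s\<close>, where \<open>q = exp(2\<pi>i\<tau>)\<close>.\<close>

definition qpow :: "complex \<Rightarrow> real \<Rightarrow> complex" where
  "qpow \<tau> s = exp (2 * complex_of_real pi * \<i> * \<tau> * complex_of_real s)"

definition qpoch :: "complex list \<Rightarrow> complex \<Rightarrow> complex" where
  "qpoch xs q = (\<Prod>x\<leftarrow>xs. \<Prod>n. 1 - x * q ^ n)"

text \<open>The exponent vector \<open>(a\<^sub>1, \<dots>, a\<^sub>m)\<close> is a function on the index set \<open>{1..m}\<close>, and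
  \<open>a\<^sub>0\<close> is a separate argument.\<close>

definition exp_S1 :: "nat \<Rightarrow> nat \<Rightarrow> (nat \<Rightarrow> int) \<Rightarrow> int" where
  "exp_S1 N a0 a = int a0 + 2 * (\<Sum>j=1..N div 2. a j)"

definition exp_S2 :: "nat \<Rightarrow> (nat \<Rightarrow> int) \<Rightarrow> int" where
  "exp_S2 N a = (\<Sum>j=1..N div 2. int j * (int N - int j) * a j)"

definition theta_product :: "nat \<Rightarrow> nat \<Rightarrow> (nat \<Rightarrow> int) \<Rightarrow> complex \<Rightarrow> complex" where
  "theta_product N a0 a \<tau> =
     qpow \<tau> (real N / 24 * of_int (exp_S1 N a0 a) - 1 / (2 * real N) * of_int (exp_S2 N a))
     * qpoch [qpow \<tau> N] (qpow \<tau> N) ^ a0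
     * (\<Prod>j=1..N div 2. qpoch [qpow \<tau> j, qpow \<tau> (N - j)] (qpow \<tau> N) powi a j)"

definition L_set :: "nat \<Rightarrow> nat \<Rightarrow> (nat \<Rightarrow> int) set" where
  "L_set N k = {a \<in> {1..N div 2} \<rightarrow>\<^sub>E UNIV. theta_product N (2 * k) a \<in> modular_forms k N}"

section \<open>Cusps and the Galois action\<close>

text \<open>A point \<open>a/c\<close> of the projective line over the rationals is given by a coprime pair
  \<open>(a, c)\<close>, unique up to sign; \<open>cusp N a c\<close> is the class \<open>[a/c]\<close>, as a set of such pairs.\<close>

definition cusp :: "nat \<Rightarrow> int \<Rightarrow> int \<Rightarrow> (int \<times> int) set" where
  "cusp N a c = {(a', c'). \<exists>(p, q, r, s)\<in>Gamma1 N. \<exists>\<epsilon>\<in>{1, -1}.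
     a' = \<epsilon> * (p * a + q * c) \<and> c' = \<epsilon> * (r * a + s * c)}"

definition cusps :: "nat \<Rightarrow> (int \<times> int) set set" where
  "cusps N = {cusp N a c | a c. coprime a c}"

text \<open>\<open>\<sigma>\<^sub>x[a/c] = [a/(xc)]\<close> for \<open>x\<close> coprime to \<open>N\<close>, computed from a representative \<open>a/c\<close> with
  \<open>gcd(a, xc) = 1\<close>. Every cusp has such a representative, and the result depends neither on its
  choice nor on the choice of \<open>x\<close> modulo \<open>N\<close>.\<close>

definition galois_act :: "nat \<Rightarrow> int \<Rightarrow> (int \<times> int) set \<Rightarrow> (int \<times> int) set" where
  "galois_act N x C = (THE D. \<exists>a c. (a, c) \<in> C \<and> coprime a (x * c) \<and> D = cusp N a (x * c))"

definition galois_orbit :: "nat \<Rightarrow> (int \<times> int) set \<Rightarrow> (int \<times> int) set set" where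
  "galois_orbit N C = {galois_act N x C | x. coprime x (int N)}"

text \<open>The cusps \<open>[a\<^sub>r/c\<^sub>r]\<close>, \<open>0 \<le> r \<le> m\<close>, represent the Galois orbits, each once, and the
  last one is \<open>[1/N] = [i\<infinity>]\<close>.\<close>

definition orbit_reps :: "nat \<Rightarrow> (nat \<Rightarrow> int) \<Rightarrow> (nat \<Rightarrow> int) \<Rightarrow> bool" where
  "orbit_reps N a c \<longleftrightarrow>
     (\<forall>r \<le> N div 2. coprime (a r) (c r)) \<and>
     bij_betw (\<lambda>r. galois_orbit N (cusp N (a r) (c r))) {0..N div 2} (galois_orbit N ` cusps N) \<and>
     cusp N (a (N div 2)) (c (N div 2)) = cusp N 1 (int N)"

section \<open>The class matrix\<close>

definition B2 :: "real \<Rightarrow> real" where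
  "B2 x = x\<^sup>2 - x + 1 / 6"

text \<open>Matrix indices start at \<open>0\<close>: column \<open>i\<close> of \<open>A_matrix\<close> belongs to \<open>j = i + 1\<close>.\<close>

definition A_matrix :: "nat \<Rightarrow> (nat \<Rightarrow> int) \<Rightarrow> (nat \<Rightarrow> int) \<Rightarrow> real mat" where
  "A_matrix N a c = Matrix.mat (N div 2) (N div 2) (\<lambda>(r, i).
     let g = gcd (c r) (int N); j = i + 1
     in of_int g / 2 * B2 (frac (real j * of_int (a r) / of_int g)))"

definition e_vec :: "nat \<Rightarrow> nat \<Rightarrow> real Matrix.vec" where
  "e_vec m j = unit_vec m (j - 1)"

definition B_columns :: "nat \<Rightarrow> real Matrix.vec list" where
  "B_columns N =
    (let m = N div 2; e = e_vec m; M = N * gcd 2 N; rN = (2 * M) mod 3;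
         aN = (- real M + 5 * real rN) / 3;
         bN = (real M - 8 * real rN) / 3;
         js = filter (\<lambda>j. 3 dvd j) [3..<m + 1];
         j1 = hd js
     in [16 \<cdot>\<^sub>v e 1 - 4 \<cdot>\<^sub>v e 2,
         aN \<cdot>\<^sub>v e 1 + bN \<cdot>\<^sub>v e 2 + real rN \<cdot>\<^sub>v e 3]
      @ map (\<lambda>j. ((real j ^ 2 - 4) / 3) \<cdot>\<^sub>v e 1 - ((real j ^ 2 - 1) / 3) \<cdot>\<^sub>v e 2 + e j)
          (filter (\<lambda>j. \<not> 3 dvd j) [3..<m + 1])
      @ [(real j1 ^ 2 - 4) \<cdot>\<^sub>v e 1 - (real j1 ^ 2 - 1) \<cdot>\<^sub>v e 2 + 3 \<cdot>\<^sub>v e j1]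
      @ map (\<lambda>j. ((real j ^ 2 - real j1 ^ 2) / 3) \<cdot>\<^sub>v (e 1 - e 2) - e j1 + e j) (tl js))"

definition B_matrix :: "nat \<Rightarrow> real mat" where
  "B_matrix N =
    (if N = 5 then mat_of_rows_list 2 [[16, -5], [-4, 5]]
     else mat_of_cols (N div 2) (B_columns N))"

definition class_matrix :: "nat \<Rightarrow> (nat \<Rightarrow> int) \<Rightarrow> (nat \<Rightarrow> int) \<Rightarrow> real mat" where
  "class_matrix N a c = A_matrix N a c * B_matrix N"

definition R_const :: "nat \<Rightarrow> real" where
  "R_const N = 1 / 24 * (\<Sum>d | d dvd N. real d * real (totient d) * real (totient (N div d)))"

end

theory Submission
  imports Defs
begin

text \<open>Up to a constant, the products are products of Klein forms and a power of \<open>\<eta>\<close>. Hence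
  modularity on \<open>\<Gamma>\<^sub>1(N)\<close> amounts to two congruences for the exponents, that is, to a coset of the
  lattice \<open>B\<^sub>N \<int>\<^sup>m\<close>, and the order of vanishing at \<open>[a/c]\<close> is affine in the exponents, with linear part
  the row of \<open>A\<^sub>N\<close>. The orders at \<open>c\<^sub>0, \<dots>, c\<^bsub>m-1\<^esub>\<close> serve as coordinates. The distribution relation of \<open>B\<^sub>2\<close>
  fixes the sum of all orders, so that non-negativity at \<open>i\<infinity>\<close> becomes the last face of a simplex with
  weights \<open>\<mu>\<^sub>r\<close>, dilated by \<open>k\<close>. All cosets of a sublattice of \<open>\<int>\<^sup>m\<close> have asymptotically the same number of
  points in this simplex, and the index of the sublattice is \<open>|det V\<^sub>N|\<close> up to scaling.

  The determinant is nonzero because the functions \<open>X \<mapsto> B\<^sub>2(\<langle>jX/N\<rangle>)\<close>, \<open>1 \<le> j \<le> m\<close>, are linearly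
  independent, which is read off from their Fourier expansions.\<close>

section \<open>Theta functions and Klein forms\<close>

text \<open>Evaluating Klein forms at N \<tau> conjugates \<Gamma>_1(N) into matrices with first row
  (1 + N t, N b). These move the indices (j/N, 0) by integers, so the Klein forms only acquire roots
  of unity and the automorphy factor, and what remains is the multiplier of \<eta>^2, a 12th root of
  unity; this is the origin of the moduli 12 and N gcd(2, N). The multiplier is in turn derived from
  Klein forms at the 2-division points, and the modular law of Klein forms from Liouville's theorem.

  The coset to be counted depends on k, so the error term has to be uniform in the coset; hence
  cosets are compared by translations of bounded size. As A_N has rational entries, orders are
  scaled by 12 N; the resulting factor (12 N)^m occurs in the index and in the volume and cancels.
  The cusp i\<infinity> is fixed by the Galois group, thus \<mu>_m = 1, which is why the product of
  all m + 1 orbit sizes equals that of the m weights of the simplex.\<close>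

definition ee :: "complex \<Rightarrow> complex" where
  "ee z = exp (2 * of_real pi * \<i> * z)"

lemma ee_add: "ee (z + w) = ee z * ee w"
  by (simp add: ee_def distrib_left exp_add)

lemma ee_minus: "ee (- z) = inverse (ee z)"
  by (simp add: ee_def exp_minus)

lemma ee_diff: "ee (z - w) = ee z / ee w"
  by (simp add: ee_def right_diff_distrib exp_diff)

lemma ee_0 [simp]: "ee 0 = 1"
  by (simp add: ee_def)

lemma ee_nonzero [simp]: "ee z \<noteq> 0"
  by (simp add: ee_def)

lemma norm_ee: "norm (ee z) = exp (- 2 * pi * Im z)"
  by (simp add: ee_def norm_exp_eq_Re)

lemma ee_eq_1_iff: "ee z = 1 \<longleftrightarrow> z \<in> \<int>"
proof
  assume "ee z = 1"
  then obtain n :: int where "Im z = 0" "2 * pi * Re z = of_int (2 * n) * pi"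
    by (auto simp: ee_def exp_eq_1)
  then have "z = of_int n"
    by (auto simp: complex_eq_iff)
  then show "z \<in> \<int>" by simp
next
  assume "z \<in> \<int>"
  then obtain n :: int where "z = of_int n" by (auto elim: Ints_cases)
  then show "ee z = 1"
    by (auto simp: ee_def exp_eq_1)
qed

lemma ee_of_int [simp]: "ee (of_int n) = 1"
  by (simp add: ee_eq_1_iff)

lemma ee_1 [simp]: "ee 1 = 1"
  using ee_of_int[of 1] by simp

lemma ee_of_nat_mult: "ee (of_nat n * z) = ee z ^ n"
  by (induction n) (auto simp: algebra_simps ee_add)

lemma ee_of_int_mult: "ee (of_int n * z) = ee z powi n"
proof (cases "n \<ge> 0")
  case True
  then show ?thesis using ee_of_nat_mult[of "nat n" z] by (simp add: power_int_def)
next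
  case False
  then show ?thesis using ee_of_nat_mult[of "nat (-n)" z]
    by (simp add: power_int_def ee_minus power_inverse) (metis inverse_inverse_eq)
qed

lemma ee_half: "ee (1 / 2) = - 1"
  using exp_pi_i by (simp add: ee_def mult.commute)

lemma ee_holomorphic [holomorphic_intros]:
  "f holomorphic_on A \<Longrightarrow> (\<lambda>z. ee (f z)) holomorphic_on A"
  unfolding ee_def by (intro holomorphic_intros)

lemma norm_ee_less_1: "Im z > 0 \<Longrightarrow> norm (ee z) < 1"
  by (simp add: norm_ee)

section \<open>The infinite products (x; q)_\<infinity>\<close>

definition qp :: "complex \<Rightarrow> complex \<Rightarrow> complex" where
  "qp x q = (\<Prod>n. 1 - x * q ^ n)"

lemma qp_convergent:
  fixes q :: complex
  assumes "norm q < 1"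
  shows "convergent_prod (\<lambda>n. 1 - x * q ^ n)"
proof -
  have "abs_convergent_prod (\<lambda>n. 1 - x * q ^ n)"
    using assms by (auto simp: abs_convergent_prod_conv_summable norm_mult norm_power
      intro!: summable_mult summable_geometric)
  then show ?thesis by (rule abs_convergent_prod_imp_convergent_prod)
qed

lemma qp_rec:
  assumes "norm q < 1"
  shows "qp x q = (1 - x) * qp (x * q) q"
proof -
  have "(\<lambda>n. 1 - x * q ^ n) has_prod ((\<Prod>k<1. 1 - x * q ^ k) * (\<Prod>k. 1 - x * q ^ (k + 1)))"
    by (rule has_prod_ignore_initial_segment') (rule qp_convergent[OF assms])
  then show ?thesis
    unfolding qp_def by (simp add: has_prod_iff mult.assoc)
qed

lemma qp_eq_0_iff:
  assumes "norm q < 1"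
  shows "qp x q = 0 \<longleftrightarrow> (\<exists>n. x * q ^ n = 1)"
proof
  assume *: "qp x q = 0"
  show "\<exists>n. x * q ^ n = 1"
  proof (rule ccontr)
    assume "\<not> ?thesis"
    then have "qp x q \<noteq> 0" unfolding qp_def
      by (intro prodinf_nonzero qp_convergent[OF assms]) (metis eq_iff_diff_eq_0)
    with * show False by simp
  qed
next
  assume "\<exists>n. x * q ^ n = 1"
  then obtain n where n: "1 - x * q ^ n = 0" by auto
  have "(\<lambda>n. 1 - x * q ^ n) has_prod ((\<Prod>k<Suc n. 1 - x * q ^ k) * (\<Prod>k. 1 - x * q ^ (k + Suc n)))"
    by (rule has_prod_ignore_initial_segment') (rule qp_convergent[OF assms])
  then show "qp x q = 0"
    unfolding qp_def using n by (simp add: has_prod_iff)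
qed

lemma qp_LIMSEQ:
  assumes "norm q < 1"
  shows "(\<lambda>n. \<Prod>i<n. 1 - x * q ^ i) \<longlonglongrightarrow> qp x q"
proof -
  have "(\<lambda>n. \<Prod>i\<le>n. 1 - x * q ^ i) \<longlonglongrightarrow> qp x q"
    unfolding qp_def by (rule convergent_prod_LIMSEQ) (rule qp_convergent[OF assms])
  then show ?thesis
    unfolding lessThan_Suc_atMost[symmetric]
    by (subst (asm) filterlim_sequentially_Suc[of "\<lambda>n. \<Prod>i<n. 1 - x * q ^ i"])
qed

text \<open>M-test with the maxima of |f| and |g| on K in the majorant. Both x and q vary with
  \<tau>, so uniformity is required jointly in the two arguments.\<close>

lemma qp_uniform_limit:
  assumes K: "compact K" and f: "continuous_on K f" and g: "continuous_on K g"
    and g1: "\<And>z. z \<in> K \<Longrightarrow> norm (g z) < 1"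
  shows "uniform_limit K (\<lambda>n z. \<Prod>i<n. 1 - f z * g z ^ i) (\<lambda>z. qp (f z) (g z)) sequentially"
proof (cases "K = {}")
  case False
  obtain z0 where z0: "\<And>z. z \<in> K \<Longrightarrow> norm (g z) \<le> norm (g z0)" "z0 \<in> K"
    using continuous_attains_sup[OF K False continuous_on_norm[OF g]] by blast
  obtain z1 where z1: "\<And>z. z \<in> K \<Longrightarrow> norm (f z) \<le> norm (f z1)" "z1 \<in> K"
    using continuous_attains_sup[OF K False continuous_on_norm[OF f]] by blast
  have "uniformly_convergent_on K (\<lambda>N z. \<Sum>n<N. norm ((1 - f z * g z ^ n) - 1))"
  proof (rule Weierstrass_m_test')
    fix n z assume "z \<in> K"
    then show "norm (norm ((1 - f z * g z ^ n) - 1)) \<le> norm (f z1) * norm (g z0) ^ n"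
      using z0 z1 by (auto simp: norm_mult norm_power intro!: mult_mono power_mono)
  next
    show "summable (\<lambda>n. norm (f z1) * norm (g z0) ^ n)"
      using g1 z0 by (intro summable_mult summable_geometric) auto
  qed
  then have "uniformly_convergent_on K (\<lambda>n z. \<Prod>i<n. 1 - f z * g z ^ i)"
    by (intro uniformly_convergent_on_prod' K continuous_intros f g)
  then obtain l where l: "uniform_limit K (\<lambda>n z. \<Prod>i<n. 1 - f z * g z ^ i) l sequentially"
    by (auto simp: uniformly_convergent_on_def)
  have "l z = qp (f z) (g z)" if "z \<in> K" for z
    using tendsto_uniform_limitI[OF l that] qp_LIMSEQ[OF g1[OF that]] LIMSEQ_unique by blast
  then show ?thesis
    using l by (metis (no_types, lifting) uniform_limit_cong')
qed auto

lemma qp_holomorphic: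
  assumes A: "open A" and f: "f holomorphic_on A" and g: "g holomorphic_on A"
    and g1: "\<And>z. z \<in> A \<Longrightarrow> norm (g z) < 1"
  shows "(\<lambda>z. qp (f z) (g z)) holomorphic_on A"
proof (rule holomorphic_uniform_sequence[OF A])
  show "(\<lambda>z. \<Prod>i<n. 1 - f z * g z ^ i) holomorphic_on A" for n
    by (intro holomorphic_intros f g)
next
  fix z assume "z \<in> A"
  then obtain d where d: "d > 0" "cball z d \<subseteq> A"
    using A open_contains_cball by blast
  have "uniform_limit (cball z d) (\<lambda>n z. \<Prod>i<n. 1 - f z * g z ^ i) (\<lambda>z. qp (f z) (g z)) sequentially"
    using d f g g1
    by (intro qp_uniform_limit) (auto intro: holomorphic_on_imp_continuous_on holomorphic_on_subset)
  with d show "\<exists>d>0. cball z d \<subseteq> A \<and>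
      uniform_limit (cball z d) (\<lambda>n z. \<Prod>i<n. 1 - f z * g z ^ i) (\<lambda>z. qp (f z) (g z)) sequentially"
    by blast
qed

text \<open>The real products of 1 - r/2^n and of 1 + r/2^n are bounds that depend on neither x nor
  q. The lower bound is as important as the upper one, since the exponents of the products may be
  negative.\<close>

lemma qp_bounds:
  fixes r :: real
  assumes r: "0 \<le> r" "r < 1"
  obtains c C where "c > 0" "\<And>x q. norm x \<le> r \<Longrightarrow> norm q \<le> 1 / 2 \<Longrightarrow> c \<le> norm (qp x q)"
    "\<And>x q. norm x \<le> r \<Longrightarrow> norm q \<le> 1 / 2 \<Longrightarrow> norm (qp x q) \<le> C"
proof -
  define lo where "lo = (\<lambda>n::nat. 1 - r * (1/2) ^ n)"
  define hi where "hi = (\<lambda>n::nat. 1 + r * (1/2) ^ n)"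
  have summ: "summable (\<lambda>n. r * (1/2) ^ n)"
    by (intro summable_mult summable_geometric) auto
  have rle: "r * (1/2) ^ n \<le> r" "r * (1/2)^n \<ge> 0" for n :: nat
    using r by (auto intro!: mult_left_le power_le_one)
  have lo: "convergent_prod lo" and hi: "convergent_prod hi"
    unfolding lo_def hi_def using r summ
    by (auto intro!: abs_convergent_prod_imp_convergent_prod simp: abs_convergent_prod_conv_summable abs_mult)
  have lopos: "lo n > 0" "lo n \<le> 1" for n
    using rle[of n] r by (auto simp: lo_def)
  have hige: "hi n \<ge> 1" for n using rle[of n] by (auto simp: hi_def)
  have q1: "norm q < 1" if "norm q \<le> 1/2" for q :: complex using that by simp
  have fac: "lo n \<le> norm (1 - x * q ^ n)" "norm (1 - x * q ^ n) \<le> hi n"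
    if "norm x \<le> r" "norm q \<le> 1/2" for n and x q :: complex
  proof -
    have "norm (x * q ^ n) \<le> r * (1/2) ^ n"
      using that r by (auto simp: norm_mult norm_power intro!: mult_mono power_mono)
    then show "lo n \<le> norm (1 - x * q ^ n)" "norm (1 - x * q ^ n) \<le> hi n"
      unfolding lo_def hi_def
      using norm_triangle_ineq2[of 1 "x * q ^ n"] norm_triangle_ineq4[of 1 "x * q ^ n"] by auto
  qed
  show ?thesis
  proof (rule that)
    show "prodinf lo > 0" using lo lopos by (intro less_0_prodinf)
  next
    fix x q :: complex assume xq: "norm x \<le> r" "norm q \<le> 1 / 2"
    have lim: "(\<lambda>n. norm (\<Prod>i<n. 1 - x * q ^ i)) \<longlonglongrightarrow> norm (qp x q)"
      by (intro tendsto_norm qp_LIMSEQ q1 xq)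
    have "prodinf lo \<le> norm (\<Prod>i<n. 1 - x * q ^ i)" for n
    proof -
      have "prodinf lo \<le> (\<Prod>i<n. lo i)"
        using lo lopos by (intro prod_ge_prodinf[OF convergent_prod_has_prod]) (auto intro: less_imp_le)
      also have "\<dots> \<le> norm (\<Prod>i<n. 1 - x * q ^ i)"
        unfolding prod_norm[symmetric] using fac[OF xq] lopos by (intro prod_mono) (auto intro: less_imp_le)
      finally show ?thesis .
    qed
    then show "prodinf lo \<le> norm (qp x q)"
      by (intro LIMSEQ_le_const[OF lim]) auto
    have "norm (\<Prod>i<n. 1 - x * q ^ i) \<le> prodinf hi" for n
    proof -
      have "norm (\<Prod>i<n. 1 - x * q ^ i) \<le> (\<Prod>i<n. hi i)"
        unfolding prod_norm[symmetric] using fac[OF xq] by (intro prod_mono) auto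
      also have "\<dots> \<le> prodinf hi"
        using hi hige by (intro prod_le_prodinf[OF convergent_prod_has_prod])
          (auto intro: order.trans[OF zero_le_one])
      finally show ?thesis .
    qed
    then show "norm (qp x q) \<le> prodinf hi"
      by (intro LIMSEQ_le_const2[OF lim]) auto
  qed
qed

section \<open>The theta function of z and its modular law\<close>

definition thetaK :: "complex \<Rightarrow> complex \<Rightarrow> complex" where
  "thetaK z \<tau> = ee (- z / 2) * (qp (ee z) (ee \<tau>) * qp (ee (\<tau> - z)) (ee \<tau>)) / qp (ee \<tau>) (ee \<tau>) ^ 2"

lemma qp_ee_nonzero:
  assumes "Im \<tau> > 0"
  shows "qp (ee \<tau>) (ee \<tau>) \<noteq> 0"
proof
  assume "qp (ee \<tau>) (ee \<tau>) = 0"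
  then obtain n where "ee \<tau> * ee \<tau> ^ n = 1"
    using qp_eq_0_iff norm_ee_less_1 assms by blast
  then have "ee (of_nat (Suc n) * \<tau>) = 1"
    by (simp only: ee_of_nat_mult power_Suc)
  then have "of_nat (Suc n) * \<tau> \<in> \<int>" by (simp only: ee_eq_1_iff)
  then have "Im (of_nat (Suc n) * \<tau>) = 0" by (metis Im_complex_of_real Ints_cases of_real_of_int_eq)
  with assms show False by simp
qed

lemma thetaK_eq_0_iff:
  assumes \<tau>: "Im \<tau> > 0"
  shows "thetaK z \<tau> = 0 \<longleftrightarrow> (\<exists>m n :: int. z = of_int m * \<tau> + of_int n)"
proof -
  note q1 = norm_ee_less_1[OF \<tau>]
  have "thetaK z \<tau> = 0 \<longleftrightarrow> (\<exists>n::nat. ee z * ee \<tau> ^ n = 1) \<or> (\<exists>n::nat. ee (\<tau> - z) * ee \<tau> ^ n = 1)"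
    using qp_ee_nonzero[OF \<tau>] by (auto simp: thetaK_def qp_eq_0_iff q1)
  also have "(\<lambda>n. ee z * ee \<tau> ^ n) = (\<lambda>n. ee (z + of_nat n * \<tau>))"
    by (simp add: ee_add ee_of_nat_mult)
  also have "(\<lambda>n. ee (\<tau> - z) * ee \<tau> ^ n) = (\<lambda>n. ee (\<tau> - z + of_nat n * \<tau>))"
    by (simp only: ee_add ee_of_nat_mult)
  also have "(\<exists>n. ee (z + of_nat n * \<tau>) = 1) \<or> (\<exists>n. ee (\<tau> - z + of_nat n * \<tau>) = 1) \<longleftrightarrow>
     (\<exists>m n :: int. z = of_int m * \<tau> + of_int n)" (is "?A \<or> ?B \<longleftrightarrow> ?C")
  proof
    assume "?A \<or> ?B"
    then show ?C
    proof
      assume ?A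
      then obtain n :: nat and k :: int where "z + of_nat n * \<tau> = of_int k"
        by (auto simp: ee_eq_1_iff elim!: Ints_cases)
      then have "z = of_int (- int n) * \<tau> + of_int k" by (simp add: algebra_simps)
      then show ?C by blast
    next
      assume ?B
      then obtain n :: nat and k :: int where "\<tau> - z + of_nat n * \<tau> = of_int k"
        by (auto simp: ee_eq_1_iff elim!: Ints_cases)
      then have "z = of_int (int n + 1) * \<tau> + of_int (- k)" by (simp add: algebra_simps)
      then show ?C by blast
    qed
  next
    assume ?C
    then obtain m n :: int where z: "z = of_int m * \<tau> + of_int n" by blast
    \<comment> \<open>The product in e(z) vanishes at the lattice points with m \<le> 0, the one in
      e(\<tau> - z) at those with m \<ge> 1.\<close>
    show "?A \<or> ?B"
    proof (cases "m \<le> 0")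
      case True
      then have "z + of_nat (nat (- m)) * \<tau> = of_int n" using z by simp
      then have "ee (z + of_nat (nat (- m)) * \<tau>) = 1" by simp
      then show ?thesis by blast
    next
      case False
      then have "\<tau> - z + of_nat (nat (m - 1)) * \<tau> = of_int (- n)" using z by (simp add: algebra_simps)
      then have "ee (\<tau> - z + of_nat (nat (m - 1)) * \<tau>) = 1" by (simp only: ee_of_int)
      then show ?thesis by blast
    qed
  qed
  finally show ?thesis .
qed

lemma thetaK_add_1: "thetaK (z + 1) \<tau> = - thetaK z \<tau>"
proof -
  have "ee (- (z + 1) / 2) = - ee (- z / 2)"
    by (simp add: diff_divide_distrib ee_diff ee_half)
  moreover have "ee (z + 1) = ee z" "ee (\<tau> - (z + 1)) = ee (\<tau> - z)"
    by (simp_all add: ee_add ee_diff)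
  ultimately show ?thesis by (simp add: thetaK_def)
qed

text \<open>The shift removes the factor 1 - e(z) from the first product and adds 1 - e(-z) to the
  second; the quotient of the two is -e(-z).\<close>

lemma thetaK_add_tau:
  assumes \<tau>: "Im \<tau> > 0"
  shows "thetaK (z + \<tau>) \<tau> = - ee (- z - \<tau> / 2) * thetaK z \<tau>"
proof -
  note q1 = norm_ee_less_1[OF \<tau>]
  have 1: "qp (ee z) (ee \<tau>) = (1 - ee z) * qp (ee (z + \<tau>)) (ee \<tau>)"
    using qp_rec[OF q1, of "ee z"] by (simp add: ee_add)
  have 2: "qp (ee (\<tau> - (z + \<tau>))) (ee \<tau>) = (1 - inverse (ee z)) * qp (ee (\<tau> - z)) (ee \<tau>)"
    using qp_rec[OF q1, of "ee (-z)"] by (simp add: ee_minus ee_diff ee_add field_simps)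
  have 3: "ee (- (z + \<tau>) / 2) = ee (- z / 2) * ee (- \<tau> / 2)"
    by (simp add: diff_divide_distrib flip: ee_add)
  have 4: "ee (- z - \<tau> / 2) = inverse (ee z) * ee (- \<tau> / 2)"
    by (simp flip: ee_add ee_minus)
  show ?thesis
    unfolding thetaK_def 1 2 3 4 by (simp add: divide_simps) (simp add: algebra_simps)
qed

lemma thetaK_add_of_nat_tau:
  assumes \<tau>: "Im \<tau> > 0"
  shows "thetaK (z + of_nat m * \<tau>) \<tau> = (-1) ^ m * ee (- of_nat m * z - of_nat m ^ 2 * \<tau> / 2) * thetaK z \<tau>"
proof (induction m)
  case (Suc m)
  have "thetaK (z + of_nat (Suc m) * \<tau>) \<tau> = thetaK ((z + of_nat m * \<tau>) + \<tau>) \<tau>"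
    by (simp add: algebra_simps)
  also have "\<dots> = (-1) ^ Suc m * (ee (- (z + of_nat m * \<tau>) - \<tau> / 2) *
      ee (- of_nat m * z - of_nat m ^ 2 * \<tau> / 2)) * thetaK z \<tau>"
    by (subst thetaK_add_tau[OF \<tau>]) (simp add: Suc)
  also have "ee (- (z + of_nat m * \<tau>) - \<tau> / 2) * ee (- of_nat m * z - of_nat m ^ 2 * \<tau> / 2) =
     ee (- of_nat (Suc m) * z - of_nat (Suc m) ^ 2 * \<tau> / 2)"
    by (simp add: algebra_simps power2_eq_square add_divide_distrib flip: ee_add)
  finally show ?case .
qed simp

lemma thetaK_add_of_int_tau:
  assumes \<tau>: "Im \<tau> > 0"
  shows "thetaK (z + of_int m * \<tau>) \<tau> =
    ee (of_int m / 2 - of_int m * z - of_int m ^ 2 * \<tau> / 2) * thetaK z \<tau>"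
proof -
  \<comment> \<open>Signs are written as e(n/2), so that all factors combine by adding
    exponents.\<close>
  have sgn: "(-1) ^ n * ee w = ee (of_nat n / 2 + w)" for n w
    using ee_of_nat_mult[of n "1/2"] by (simp add: ee_half ee_add)
  show ?thesis
  proof (cases "m \<ge> 0")
    case True
    then show ?thesis
      using thetaK_add_of_nat_tau[OF \<tau>, of z "nat m"] by (simp add: sgn algebra_simps)
  next
    case False
    define n where "n = nat (- m)"
    have m: "of_int m = - of_nat n" "m = - int n" using False by (auto simp: n_def)
    define w where "w = z + of_int m * \<tau>"
    have "thetaK z \<tau> = thetaK (w + of_nat n * \<tau>) \<tau>"
      by (simp add: w_def m)
    also have "\<dots> = ee (of_nat n / 2 - of_nat n * w - of_nat n ^ 2 * \<tau> / 2) * thetaK w \<tau>"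
      by (subst thetaK_add_of_nat_tau[OF \<tau>]) (simp add: sgn algebra_simps)
    also have "of_nat n / 2 - of_nat n * w - of_nat n ^ 2 * \<tau> / 2 =
       - (of_int m / 2 - of_int m * z - of_int m ^ 2 * \<tau> / 2)"
      by (simp add: w_def m algebra_simps power2_eq_square flip: add_divide_distrib)
    also have "ee \<dots> = inverse (ee (of_int m / 2 - of_int m * z - of_int m ^ 2 * \<tau> / 2))"
      by (rule ee_minus)
    finally show ?thesis by (simp add: w_def)
  qed
qed

lemma thetaK_add_of_int:
  shows "thetaK (z + of_int n) \<tau> = ee (of_int n / 2) * thetaK z \<tau>"
proof -
  have nat: "thetaK (z + of_nat n) \<tau> = ee (of_nat n / 2) * thetaK z \<tau>" for n z
  proof (induction n)
    case (Suc n)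
    have "thetaK (z + of_nat (Suc n)) \<tau> = thetaK ((z + of_nat n) + 1) \<tau>" by (simp add: algebra_simps)
    also have "\<dots> = (ee (1/2) * ee (of_nat n / 2)) * thetaK z \<tau>"
      by (simp only: thetaK_add_1 Suc ee_half) simp
    also have "ee (1/2) * ee (of_nat n / 2) = ee (of_nat (Suc n) / 2)"
      by (simp add: add_divide_distrib flip: ee_add)
    finally show ?case .
  qed simp
  show ?thesis
  proof (cases "n \<ge> 0")
    case True then show ?thesis using nat[of z "nat n"] by simp
  next
    case False then show ?thesis using nat[of "z + of_int n" "nat (- n)"]
      by (simp add: ee_minus field_simps)
  qed
qed

lemma thetaK_quasi_period:
  assumes \<tau>: "Im \<tau> > 0"
  shows "thetaK (z + (of_int m * \<tau> + of_int n)) \<tau> =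
    ee (of_int (m + n) / 2 - of_int m * z - of_int m ^ 2 * \<tau> / 2) * thetaK z \<tau>"
proof -
  have "thetaK (z + (of_int m * \<tau> + of_int n)) \<tau> = thetaK ((z + of_int m * \<tau>) + of_int n) \<tau>"
    by (simp add: algebra_simps)
  also have "\<dots> = ee (of_int n / 2) * ee (of_int m / 2 - of_int m * z - of_int m ^ 2 * \<tau> / 2) * thetaK z \<tau>"
    by (simp only: thetaK_add_of_int thetaK_add_of_int_tau[OF \<tau>] mult.assoc)
  also have "ee (of_int n / 2) * ee (of_int m / 2 - of_int m * z - of_int m ^ 2 * \<tau> / 2) =
    ee (of_int (m + n) / 2 - of_int m * z - of_int m ^ 2 * \<tau> / 2)"
    by (simp add: algebra_simps add_divide_distrib flip: ee_add)
  finally show ?thesis .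
qed

lemma thetaK_holomorphic_z:
  assumes \<tau>: "Im \<tau> > 0"
  shows "(\<lambda>z. thetaK z \<tau>) holomorphic_on UNIV"
  unfolding thetaK_def using qp_ee_nonzero[OF \<tau>] norm_ee_less_1[OF \<tau>]
  by (intro holomorphic_intros qp_holomorphic) auto

lemma thetaK_0 [simp]: "Im \<tau> > 0 \<Longrightarrow> thetaK 0 \<tau> = 0"
  by (subst thetaK_eq_0_iff) (auto intro!: exI[of _ 0])

text \<open>Up to a constant, \<open>thetaK\<close> is \<theta>_1 / \<eta>^3: dividing by (q; q)^2
  makes the derivative at 0 independent of \<tau>, so that the modular law carries no multiplier.
  Splitting off the factor 1 - e(z) leaves a function with value 1 at 0.\<close>

lemma thetaK_deriv_0:
  assumes \<tau>: "Im \<tau> > 0"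
  shows "((\<lambda>z. thetaK z \<tau>) has_field_derivative - 2 * of_real pi * \<i>) (at 0)"
proof -
  note q1 = norm_ee_less_1[OF \<tau>]
  define g where "g = (\<lambda>z. ee (- z / 2) * (qp (ee (z + \<tau>)) (ee \<tau>) * qp (ee (\<tau> - z)) (ee \<tau>)) / qp (ee \<tau>) (ee \<tau>) ^ 2)"
  have eq: "thetaK z \<tau> = (1 - ee z) * g z" for z
    using qp_rec[OF q1, of "ee z"] by (simp add: thetaK_def g_def ee_add)
  have "g holomorphic_on UNIV"
    unfolding g_def using qp_ee_nonzero[OF \<tau>] norm_ee_less_1[OF \<tau>]
    by (intro holomorphic_intros qp_holomorphic) auto
  then have g': "(g has_field_derivative deriv g 0) (at 0)"
    by (simp add: holomorphic_derivI)
  have g0: "g 0 = 1"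
    using qp_ee_nonzero[OF \<tau>] by (simp add: g_def power2_eq_square)
  have "((\<lambda>z. (1 - ee z) * g z) has_field_derivative - 2 * of_real pi * \<i>) (at 0)"
    unfolding ee_def by (rule derivative_eq_intros g' refl | simp add: g0)+
  then show ?thesis by (simp add: eq)
qed

text \<open>The value type is left open, so that the lemma also applies to the predicate that a
  quasi-periodic function vanishes.\<close>

lemma int_translate_invariant:
  fixes H :: "complex \<Rightarrow> 'a"
  assumes H: "\<And>z. H (z + w) = H z"
  shows "H (z + of_int m * w) = H z"
proof -
  have n: "H (z + of_nat n * w) = H z" for z n
  proof (induction n)
    case (Suc n)
    have "H (z + of_nat (Suc n) * w) = H ((z + of_nat n * w) + w)" by (simp add: algebra_simps)
    then show ?case by (simp only: H Suc)
  qed simp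
  show ?thesis
    using n[of z "nat m"] n[of "z + of_int m * w" "nat (- m)"] by (cases "m \<ge> 0") auto
qed

text \<open>An elliptic function without poles is constant.\<close>

lemma quasi_periodic_ratio_constant:
  fixes F G Ma Mb :: "complex \<Rightarrow> complex"
  assumes F: "F holomorphic_on UNIV" and G: "G holomorphic_on UNIV"
    and w: "Im (wb / wa) \<noteq> 0"
    and F1: "\<And>z. F (z + wa) = Ma z * F z" and G1: "\<And>z. G (z + wa) = Ma z * G z"
    and F2: "\<And>z. F (z + wb) = Mb z * F z" and G2: "\<And>z. G (z + wb) = Mb z * G z"
    and M: "\<And>z. Ma z \<noteq> 0" "\<And>z. Mb z \<noteq> 0"
    and G0: "\<And>z. G z = 0 \<Longrightarrow> \<exists>m n :: int. z = of_int m * wa + of_int n * wb"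
    and zero: "F 0 = 0" "G 0 = 0"
    and F': "(F has_field_derivative a) (at 0)" and G': "(G has_field_derivative b) (at 0)" and b: "b \<noteq> 0"
  shows "b * F z = a * G z"
proof -
  \<comment> \<open>At the zeros of G the quotient gets its limit at 0. These zeros are lattice
    points, so with this value H is periodic everywhere.\<close>
  define H where "H = (\<lambda>z. if G z = 0 then a / b else F z / G z)"
  have H1: "H (z + wa) = H z" and H2: "H (z + wb) = H z" for z
    using M by (auto simp: H_def F1 F2 G1 G2)
  have per: "H (z + (of_int m * wa + of_int n * wb)) = H z" for z m n
    using int_translate_invariant[of H, OF H2, of "z + of_int m * wa" n]
      int_translate_invariant[of H, OF H1, of z m] by (simp add: add.assoc)
  have contG: "isCont G z" for z
    using holomorphic_on_imp_continuous_on[OF G] by (simp add: continuous_on_eq_continuous_at)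
  have off: "H field_differentiable at z" if "G z \<noteq> 0" for z
  proof -
    have "eventually (\<lambda>y. G y \<noteq> 0) (nhds z)"
      using contG[of z] that by (intro tendsto_imp_eventually_ne) (auto simp: isCont_def tendsto_at_iff_tendsto_nhds)
    then have ev: "eventually (\<lambda>y. F y / G y = H y) (nhds z)"
      by eventually_elim (auto simp: H_def)
    have "(\<lambda>y. F y / G y) field_differentiable at z"
      using F G that by (intro field_differentiable_divide) (auto simp: holomorphic_on_def)
    then show ?thesis
      using DERIV_cong_ev[OF refl ev refl] by (simp add: field_differentiable_def)
  qed
  have at0: "H field_differentiable at 0"
  proof -
    have limF: "((\<lambda>y. F y / y) \<longlongrightarrow> a) (at 0)" and limG: "((\<lambda>y. G y / y) \<longlongrightarrow> b) (at 0)"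
      using F' G' zero by (auto simp: has_field_derivative_iff)
    have "((\<lambda>y. (F y / y) / (G y / y)) \<longlongrightarrow> a / b) (at 0)"
      by (intro tendsto_divide limF limG b)
    then have lim: "((\<lambda>y. F y / G y) \<longlongrightarrow> a / b) (at 0)"
      by (rule Lim_transform_eventually) (auto simp: eventually_at_filter)
    have "eventually (\<lambda>y. G y / y \<noteq> 0) (at 0)"
      using limG b by (metis tendsto_imp_eventually_ne)
    then obtain d where d: "d > 0" "\<And>y. y \<noteq> 0 \<Longrightarrow> dist y 0 < d \<Longrightarrow> G y \<noteq> 0"
      by (auto simp: eventually_at)
    have "(\<lambda>y. if y = 0 then a / b else F y / G y) holomorphic_on ball 0 d"
    proof (rule removable_singularity)
      show "(\<lambda>y. F y / G y) holomorphic_on ball 0 d - {0}"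
        using F G d by (intro holomorphic_on_divide) (auto intro: holomorphic_on_subset simp: dist_commute)
    qed (use lim in auto)
    moreover have "(if y = 0 then a / b else F y / G y) = H y" if "y \<in> ball 0 d" for y
      using d(2)[of y] that zero by (auto simp: H_def dist_commute)
    ultimately have "H holomorphic_on ball 0 d"
      using holomorphic_transform by blast
    then show ?thesis
      using d(1) by (auto simp: holomorphic_on_open field_differentiable_def)
  qed
  \<comment> \<open>The other zeros of G are translates of 0, where H looks the same by
    periodicity.\<close>
  have "H field_differentiable at z" for z
  proof (cases "G z = 0")
    case True
    then obtain m n :: int where z: "z = of_int m * wa + of_int n * wb" using G0 by blast
    have "H y = (H \<circ> (\<lambda>y. y - z)) y" for y
      using per[of "y - z" m n] by (simp add: z[symmetric])
    then have "H = H \<circ> (\<lambda>y. y - z)" by blast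
    moreover have "(H \<circ> (\<lambda>y. y - z)) field_differentiable at z"
      using at0 by (intro field_differentiable_compose field_differentiable_diff
          field_differentiable_ident field_differentiable_const) simp
    ultimately show ?thesis by simp
  qed (use off in auto)
  then have holH: "H holomorphic_on UNIV"
    by (auto simp: holomorphic_on_def)
  have wa: "wa \<noteq> 0" using w by auto
  have "bounded (range H)"
  proof -
    \<comment> \<open>The closed period parallelogram. Since wb / wa is not real, wa and wb form a
      real basis, and every z is moved into P by taking fractional parts of its coordinates.\<close>
    define P where "P = (\<lambda>(s::real, t::real). of_real s * wa + of_real t * wb) ` ({0..1} \<times> {0..1})"
    have "compact P"
      unfolding P_def case_prod_unfold by (intro compact_continuous_image continuous_intros compact_Times) auto
    then have "bounded (H ` P)"
      using holH by (intro compact_imp_bounded compact_continuous_image)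
        (auto intro: holomorphic_on_imp_continuous_on holomorphic_on_subset)
    moreover have "range H \<subseteq> H ` P"
    proof safe
      fix z
      define t where "t = Im (z / wa) / Im (wb / wa)"
      define s where "s = Re (z / wa - of_real t * (wb / wa))"
      have "u = of_real (Re (u - of_real (Im u / Im r) * r)) + of_real (Im u / Im r) * r"
        if "Im r \<noteq> 0" for u r
        using that by (simp add: complex_eq_iff)
      from this[OF w] have "z / wa = of_real s + of_real t * (wb / wa)"
        unfolding s_def t_def .
      then have z: "z = of_real s * wa + of_real t * wb" using wa by (simp add: field_simps)
      define z' where "z' = of_real (frac s) * wa + of_real (frac t) * wb"
      have "z = z' + (of_int \<lfloor>s\<rfloor> * wa + of_int \<lfloor>t\<rfloor> * wb)"
        unfolding z z'_def by (simp add: frac_def algebra_simps)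
      then have "H z = H z'" by (simp add: per)
      moreover have "z' \<in> P"
        unfolding P_def z'_def by (rule image_eqI[of _ _ "(frac s, frac t)"])
          (auto simp: frac_lt_1 less_imp_le)
      ultimately show "H z \<in> H ` P" by auto
    qed
    ultimately show ?thesis using bounded_subset by blast
  qed
  then obtain k where k: "\<And>z. H z = k"
    using Liouville_theorem[OF holH] by (auto simp: constant_on_def)
  have "H 0 = a / b" using zero by (simp add: H_def)
  then have "H z = a / b" using k by metis
  show ?thesis
  proof (cases "G z = 0")
    case False
    then show ?thesis using \<open>H z = a / b\<close> b by (simp add: H_def field_simps)
  next
    case True
    then obtain m n :: int where z: "z = of_int m * wa + of_int n * wb" using G0 by blast
    \<comment> \<open>At a lattice point H says nothing about F; the vanishing of F there is carried
      over from 0 by the multipliers, which have no zeros.\<close>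
    have "(F (0 + of_int m * wa) = 0) = (F 0 = 0)"
      by (rule int_translate_invariant) (auto simp: F1 M)
    moreover have "(F (of_int m * wa + of_int n * wb) = 0) = (F (of_int m * wa) = 0)"
      by (rule int_translate_invariant) (auto simp: F2 M)
    ultimately have "F z = 0" using zero by (simp add: z)
    with True show ?thesis by simp
  qed
qed

lemma ee_cong: "x - y \<in> \<int> \<Longrightarrow> ee x = ee y"
  using ee_diff[of x y] by (simp add: ee_eq_1_iff[symmetric])

lemma ee_cong_half:
  assumes "even k" "x - y = of_int k / 2"
  shows "ee x = ee y"
proof -
  obtain l where "k = 2 * l" using assms by blast
  then have "x - y = of_int l" using assms by simp
  then show ?thesis by (auto intro!: ee_cong)
qed

lemma moebius_denom_nonzero:
  fixes a b c d :: int
  assumes "a * d - b * c = 1" "Im \<tau> > 0"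
  shows "of_int c * \<tau> + of_int d \<noteq> 0"
proof
  assume *: "of_int c * \<tau> + of_int d = 0"
  then have "Im (of_int c * \<tau> + of_int d) = 0" by (simp only: zero_complex.simps)
  then have "c = 0" using assms by simp
  with * assms show False by simp
qed

lemma Im_moebius:
  fixes a b c d :: int
  assumes det: "a * d - b * c = 1" and "Im \<tau> > 0"
  shows "Im ((of_int a * \<tau> + of_int b) / (of_int c * \<tau> + of_int d)) =
    Im \<tau> / norm (of_int c * \<tau> + of_int d) ^ 2"
proof -
  have det': "of_int a * of_int d - of_int b * of_int c = (1 :: real)"
    using det by (metis of_int_1 of_int_diff of_int_mult)
  have "of_int a * Im \<tau> * (of_int c * Re \<tau> + of_int d) - (of_int a * Re \<tau> + of_int b) * (of_int c * Im \<tau>) =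
    Im \<tau> * (of_int a * of_int d - of_int b * of_int c)" by (simp add: algebra_simps)
  also have "\<dots> = Im \<tau>" by (simp only: det' mult_1_right)
  finally show ?thesis by (simp add: Im_divide cmod_power2)
qed

lemma Im_moebius_pos:
  fixes a b c d :: int
  assumes det: "a * d - b * c = 1" and "Im \<tau> > 0"
  shows "Im ((of_int a * \<tau> + of_int b) / (of_int c * \<tau> + of_int d)) > 0"
  unfolding Im_moebius[OF assms] using assms moebius_denom_nonzero[OF assms] by simp

text \<open>The number is (c + 1) (d + 1) - 2, and c and d cannot both be even.\<close>

lemma not_both_even_parity:
  fixes c d :: int
  assumes "a * d - b * c = 1"
  shows "even (c + d + c * d - 1)"
proof -
  have "odd (a * d - b * c)" using assms by simp
  then have "\<not> (even c \<and> even d)" by auto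
  then show ?thesis by (cases "even c"; cases "even d") simp_all
qed

text \<open>After multiplication by a Gaussian factor both sides have the same multipliers under a
  basis of the lattice, and the zeros of the right-hand one are lattice points, so
  \<open>quasi_periodic_ratio_constant\<close> applies. The constant 1 / w is the quotient of the
  derivatives at 0.\<close>

lemma thetaK_modular:
  fixes a b c d :: int
  assumes det: "a * d - b * c = 1" and \<tau>: "Im \<tau> > 0"
  defines "w \<equiv> of_int c * \<tau> + of_int d"
  shows "thetaK (z / w) ((of_int a * \<tau> + of_int b) / w) = ee (of_int c * z ^ 2 / (2 * w)) * thetaK z \<tau> / w"
proof -
  define w' where "w' = of_int a * \<tau> + of_int b"
  define \<tau>' where "\<tau>' = w' / w"
  have \<tau>': "Im \<tau>' > 0" unfolding \<tau>'_def w'_def w_def by (rule Im_moebius_pos[OF det \<tau>])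
  have w: "w \<noteq> 0" unfolding w_def by (rule moebius_denom_nonzero[OF det \<tau>])
  have det': "of_int a * of_int d - of_int b * of_int c = (1 :: complex)"
    using det by (metis of_int_1 of_int_diff of_int_mult)
  have w'w: "1 + of_int c * w' = of_int a * w"
    unfolding w_def w'_def det'[symmetric] by (simp add: algebra_simps)
  \<comment> \<open>The Gaussian factor is put on this side, so that F and G get equal multipliers.
    The periods w and w' are used because they move z / w by 1 and \<tau>'.\<close>
  define F where "F = (\<lambda>z. thetaK (z / w) \<tau>' * ee (- of_int c * z ^ 2 / (2 * w)))"
  define G where "G = (\<lambda>z. thetaK z \<tau>)"
  define M1 where "M1 = (\<lambda>z. - ee (- of_int c * z - of_int c * w / 2))"
  define M2 where "M2 = (\<lambda>z. - ee (- of_int a * z - of_int a * w' / 2))"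
  have "(- 2 * of_real pi * \<i>) * F z = (- 2 * of_real pi * \<i> / w) * G z"
  proof (rule quasi_periodic_ratio_constant[where F = F and G = G and Ma = M1 and Mb = M2 and wa = w and wb = w'])
    have "(\<lambda>z. thetaK z \<tau>') \<circ> (\<lambda>z. z / w) holomorphic_on UNIV"
      using w by (intro holomorphic_on_compose_gen[where t = UNIV] thetaK_holomorphic_z \<tau>' holomorphic_intros) auto
    then show "F holomorphic_on UNIV"
      using w unfolding F_def by (intro holomorphic_intros) (auto simp: o_def)
    show "G holomorphic_on UNIV" unfolding G_def by (rule thetaK_holomorphic_z[OF \<tau>])
    show "Im (w' / w) \<noteq> 0" using \<tau>' unfolding \<tau>'_def by simp
  next
    fix z
    have "F (z + w) = - (thetaK (z / w) \<tau>' * ee (- of_int c * (z + w) ^ 2 / (2 * w)))"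
      using w by (simp add: F_def add_divide_distrib thetaK_add_1)
    also have "- of_int c * (z + w) ^ 2 / (2 * w) =
        - of_int c * z ^ 2 / (2 * w) + (- of_int c * z - of_int c * w / 2)"
      using w by (simp add: field_simps power2_eq_square)
    finally show "F (z + w) = M1 z * F z" by (simp only: F_def M1_def ee_add) simp
    \<comment> \<open>For G, the period w = c \<tau> + d is a general quasi-period; its
      half-integral constant agrees with 1/2 by the parity of c + d + c d - 1.\<close>
    have "ee (of_int (c + d) / 2 - of_int c * z - of_int c ^ 2 * \<tau> / 2) =
        ee (1 / 2 + (- of_int c * z - of_int c * w / 2))"
    proof (rule ee_cong_half)
      show "even (c + d + c * d - 1)" using not_both_even_parity[OF det] .
    qed (simp add: w_def field_simps power2_eq_square)
    then show "G (z + w) = M1 z * G z"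
      unfolding G_def w_def thetaK_quasi_period[OF \<tau>] by (simp only: M1_def ee_add ee_half w_def) simp
    have "F (z + w') = thetaK (z / w + \<tau>') \<tau>' * ee (- of_int c * (z + w') ^ 2 / (2 * w))"
      by (simp add: F_def add_divide_distrib \<tau>'_def)
    also have "\<dots> = - (thetaK (z / w) \<tau>' *
        ee (- (z / w) - \<tau>' / 2 + - of_int c * (z + w') ^ 2 / (2 * w)))"
      by (simp only: thetaK_add_tau[OF \<tau>'] ee_add) simp
    also have "- (z / w) - \<tau>' / 2 + - of_int c * (z + w') ^ 2 / (2 * w) =
        - of_int c * z ^ 2 / (2 * w) - (z + w' / 2) * (1 + of_int c * w') / w"
      using w by (simp add: field_simps power2_eq_square \<tau>'_def)
    also have "\<dots> = - of_int c * z ^ 2 / (2 * w) + (- of_int a * z - of_int a * w' / 2)"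
      unfolding w'w using w by (simp add: field_simps)
    finally show "F (z + w') = M2 z * F z" by (simp only: F_def M2_def ee_add) simp
    have "ee (of_int (a + b) / 2 - of_int a * z - of_int a ^ 2 * \<tau> / 2) =
        ee (1 / 2 + (- of_int a * z - of_int a * w' / 2))"
    proof (rule ee_cong_half)
      show "even (a + b + a * b - 1)"
        using not_both_even_parity[of "- c" b "- d" a] det by (simp add: algebra_simps)
    qed (simp add: w'_def field_simps power2_eq_square)
    then show "G (z + w') = M2 z * G z"
      unfolding G_def w'_def thetaK_quasi_period[OF \<tau>] by (simp only: M2_def ee_add ee_half w'_def) simp
    show "M1 z \<noteq> 0" "M2 z \<noteq> 0" by (simp_all add: M1_def M2_def)
  next
    fix z assume "G z = 0"
    then obtain m n :: int where z: "z = of_int m * \<tau> + of_int n"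
      using thetaK_eq_0_iff[OF \<tau>] by (auto simp: G_def)
    \<comment> \<open>Inverting the matrix expresses \<tau> and 1 through w and w', so both pairs
      generate the same lattice.\<close>
    have 1: "of_int d * w' - of_int b * w = \<tau> * (of_int a * of_int d - of_int b * of_int c)"
        "of_int a * w - of_int c * w' = of_int a * of_int d - of_int b * of_int c"
      by (simp_all add: w_def w'_def algebra_simps)
    have "z = of_int m * (of_int d * w' - of_int b * w) + of_int n * (of_int a * w - of_int c * w')"
      unfolding 1 det' z by simp
    also have "\<dots> = of_int (n * a - m * b) * w + of_int (m * d - n * c) * w'"
      by (simp add: algebra_simps)
    finally show "\<exists>m n :: int. z = of_int m * w + of_int n * w'" by blast
  next
    show "F 0 = 0" "G 0 = 0" using \<tau> \<tau>' by (simp_all add: F_def G_def)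
    show "(G has_field_derivative - 2 * of_real pi * \<i>) (at 0)"
      unfolding G_def by (rule thetaK_deriv_0[OF \<tau>])
    have 1: "((\<lambda>z. thetaK (z / w) \<tau>') has_field_derivative (- 2 * of_real pi * \<i>) * (1 / w)) (at 0)"
      by (rule DERIV_chain'[where f = "\<lambda>z. z / w" and g = "\<lambda>z. thetaK z \<tau>'"])
        (use w thetaK_deriv_0[OF \<tau>'] in \<open>auto intro!: derivative_eq_intros\<close>)
    show "(F has_field_derivative - 2 * of_real pi * \<i> / w) (at 0)"
      unfolding F_def ee_def using w \<tau>' by (auto intro!: derivative_eq_intros 1)
  qed auto
  then have "F z = G z / w" using w by (simp add: field_simps)
  then have "thetaK (z / w) \<tau>' * ee (- of_int c * z ^ 2 / (2 * w)) * ee (of_int c * z ^ 2 / (2 * w)) =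
      ee (of_int c * z ^ 2 / (2 * w)) * thetaK z \<tau> / w"
    by (simp add: F_def G_def)
  moreover have "ee (- of_int c * z ^ 2 / (2 * w)) * ee (of_int c * z ^ 2 / (2 * w)) = 1"
    by (simp flip: ee_add)
  ultimately show ?thesis by (simp add: \<tau>'_def w'_def mult.assoc)
qed

section \<open>Klein forms\<close>

definition klein :: "real \<Rightarrow> real \<Rightarrow> complex \<Rightarrow> complex" where
  "klein u v \<tau> = ee (of_real u * (of_real u * \<tau> + of_real v) / 2) * thetaK (of_real u * \<tau> + of_real v) \<tau>"

text \<open>The factor e(u z / 2) in \<open>klein\<close> is designed to absorb the Gaussian factor
  of \<open>thetaK_modular\<close>: with (u', v') the row vector (u, v) times the matrix and z = u'
  \<tau> + v', one has u + c z = u' w. What is left is the exact weight -1.\<close>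

lemma klein_modular:
  fixes a b c d :: int
  assumes det: "a * d - b * c = 1" and \<tau>: "Im \<tau> > 0"
  shows "klein u v ((of_int a * \<tau> + of_int b) / (of_int c * \<tau> + of_int d)) =
    klein (u * of_int a + v * of_int c) (u * of_int b + v * of_int d) \<tau> / (of_int c * \<tau> + of_int d)"
proof -
  define w where "w = of_int c * \<tau> + of_int d"
  define w' where "w' = of_int a * \<tau> + of_int b"
  define u' v' where "u' = u * of_int a + v * of_int c" and "v' = u * of_int b + v * of_int d"
  define z where "z = of_real u' * \<tau> + of_real v'"
  have w: "w \<noteq> 0" unfolding w_def by (rule moebius_denom_nonzero[OF det \<tau>])
  have det': "of_int a * of_int d - of_int b * of_int c = (1 :: complex)"
    using det by (metis of_int_1 of_int_diff of_int_mult)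
  have z: "of_real u * (w' / w) + of_real v = z / w"
    using w by (simp add: z_def u'_def v'_def w_def w'_def field_simps)
  have "of_real u' * w - of_int c * z =
      of_real u * (of_int a * of_int d - of_int b * of_int c)"
    unfolding z_def w_def u'_def v'_def by (simp add: algebra_simps)
  then have u: "of_real u + of_int c * z = of_real u' * w"
    unfolding det' by (simp add: algebra_simps)
  have "of_real u * (z / w) / 2 + of_int c * z ^ 2 / (2 * w) = z * (of_real u + of_int c * z) / (2 * w)"
    using w by (simp add: field_simps power2_eq_square)
  also have "\<dots> = of_real u' * z / 2" unfolding u using w by simp
  finally have e: "ee (of_real u * (z / w) / 2) * ee (of_int c * z ^ 2 / (2 * w)) = ee (of_real u' * z / 2)"
    by (simp only: ee_add[symmetric])
  have "klein u v (w' / w) = ee (of_real u * (z / w) / 2) * thetaK (z / w) (w' / w)"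
    by (simp only: klein_def z)
  also have "\<dots> = (ee (of_real u * (z / w) / 2) * ee (of_int c * z ^ 2 / (2 * w))) * thetaK z \<tau> / w"
    unfolding w_def w'_def thetaK_modular[OF det \<tau>] by simp
  also have "\<dots> = klein u' v' \<tau> / w"
    unfolding e by (simp add: klein_def z_def)
  finally show ?thesis unfolding w_def w'_def u'_def v'_def .
qed

text \<open>The quasi-period factor of \<open>thetaK\<close> and the change of the exponential
  cancel in all terms that contain \<tau>; only a constant of modulus 1 remains, a root of unity for
  rational u and v.\<close>

lemma klein_shift:
  assumes \<tau>: "Im \<tau> > 0"
  shows "klein (u + of_int m) (v + of_int n) \<tau> =
    ee (of_int (m + n + m * n) / 2 + of_real (u * of_int n - of_int m * v) / 2) * klein u v \<tau>"
proof -
  define z where "z = of_real u * \<tau> + of_real v"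
  have z: "of_real (u + of_int m) * \<tau> + of_real (v + of_int n) = z + (of_int m * \<tau> + of_int n)"
    by (simp add: z_def algebra_simps)
  have "klein (u + of_int m) (v + of_int n) \<tau> =
    ee (of_real (u + of_int m) * (z + (of_int m * \<tau> + of_int n)) / 2) *
    ee (of_int (m + n) / 2 - of_int m * z - of_int m ^ 2 * \<tau> / 2) * thetaK z \<tau>"
    unfolding klein_def z thetaK_quasi_period[OF \<tau>] by simp
  also have "ee (of_real (u + of_int m) * (z + (of_int m * \<tau> + of_int n)) / 2) *
      ee (of_int (m + n) / 2 - of_int m * z - of_int m ^ 2 * \<tau> / 2) =
    ee (of_int (m + n + m * n) / 2 + of_real (u * of_int n - of_int m * v) / 2) * ee (of_real u * z / 2)"
    unfolding z_def
    by (simp add: algebra_simps power2_eq_square add_divide_distrib diff_divide_distrib flip: ee_add)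
  finally show ?thesis by (simp only: klein_def z_def mult.assoc)
qed

lemma norm_ee_of_real [simp]: "norm (ee (of_real x)) = 1"
  by (simp add: norm_ee)

lemma norm_klein_shift:
  assumes "Im \<tau> > 0"
  shows "norm (klein (u + of_int m) (v + of_int n) \<tau>) = norm (klein u v \<tau>)"
proof -
  have "of_int (m + n + m * n) / 2 + of_real (u * of_int n - of_int m * v) / 2 =
    complex_of_real (of_int (m + n + m * n) / 2 + (u * of_int n - of_int m * v) / 2)" by simp
  then show ?thesis
    unfolding klein_shift[OF assms] norm_mult by (simp only: norm_ee_of_real)
qed

lemma klein_nonzero:
  assumes \<tau>: "Im \<tau> > 0" and uv: "\<not> (u \<in> \<int> \<and> v \<in> \<int>)"
  shows "klein u v \<tau> \<noteq> 0"
proof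
  assume "klein u v \<tau> = 0"
  then obtain m n :: int where *: "of_real u * \<tau> + of_real v = of_int m * \<tau> + of_int n"
    using thetaK_eq_0_iff[OF \<tau>] by (auto simp: klein_def)
  then have "Im (of_real u * \<tau> + of_real v) = Im (of_int m * \<tau> + of_int n)" by simp
  then have "u = of_int m" using \<tau> by simp
  moreover from this * have "complex_of_real v = of_int n" by simp
  then have "v = of_int n" by (metis of_real_eq_iff of_real_of_int_eq)
  ultimately show False using uv by simp
qed

lemma upper_half_plane_iff [simp]: "\<tau> \<in> upper_half_plane \<longleftrightarrow> Im \<tau> > 0"
  by (simp add: upper_half_plane_def)

lemma open_upper_half_plane [simp]: "open upper_half_plane"
  unfolding upper_half_plane_def by (rule open_halfspace_Im_gt)

lemma convex_upper_half_plane: "convex upper_half_plane"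
  unfolding upper_half_plane_def by (rule convex_halfspace_Im_gt)

lemma klein_holomorphic: "klein u v holomorphic_on upper_half_plane"
  unfolding klein_def thetaK_def
  by (intro holomorphic_intros qp_holomorphic) (auto simp: qp_ee_nonzero intro!: norm_ee_less_1)

lemma norm_ee_le_half:
  assumes "Im \<tau> \<ge> 1"
  shows "norm (ee \<tau>) \<le> 1 / 2"
proof -
  have "2 \<le> 1 + 2 * pi * Im \<tau>"
    using pi_gt3 assms mult_mono[of 1 "2 * pi" 1 "Im \<tau>"] by simp
  also have "\<dots> \<le> exp (2 * pi * Im \<tau>)" by (rule exp_ge_add_one_self)
  finally have "inverse (exp (2 * pi * Im \<tau>)) \<le> inverse 2" by (intro le_imp_inverse_le) auto
  then show ?thesis by (simp add: norm_ee exp_minus)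
qed

text \<open>Once \<open>qp_rec\<close> has split off 1 - e(z), the products have arguments within a
  fixed radius below 1. For u = 0 the factor 1 - e(z) is a constant, nonzero because v is not an
  integer; for u > 0 it is bounded away from 0. The exponentials in front contribute the exponent
  u^2 - u.\<close>

lemma klein_bounds_frac:
  assumes u: "0 \<le> u" "u < 1" and uv: "\<not> (u \<in> \<int> \<and> v \<in> \<int>)"
  obtains c C where "c > 0"
    "\<And>\<tau>. Im \<tau> \<ge> 1 \<Longrightarrow> c * exp (- pi * Im \<tau> * (u ^ 2 - u)) \<le> norm (klein u v \<tau>)"
    "\<And>\<tau>. Im \<tau> \<ge> 1 \<Longrightarrow> norm (klein u v \<tau>) \<le> C * exp (- pi * Im \<tau> * (u ^ 2 - u))"
proof -
  define z where "z = (\<lambda>\<tau>. of_real u * \<tau> + of_real v :: complex)"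
  \<comment> \<open>For Im \<tau> \<ge> 1 the modulus of e(\<tau> - z) is at most exp(-2 \<pi> (1 -
    u)), which is below 1 because u < 1; the 1/2 covers e(\<tau>).\<close>
  define r where "r = max (1/2) (exp (- 2 * pi * (1 - u)))"
  have r: "0 \<le> r" "r < 1" using u by (auto simp: r_def)
  obtain c1 C1 where 1: "c1 > 0" "\<And>x q. norm x \<le> r \<Longrightarrow> norm q \<le> 1 / 2 \<Longrightarrow> c1 \<le> norm (qp x q)"
    "\<And>x q. norm x \<le> r \<Longrightarrow> norm q \<le> 1 / 2 \<Longrightarrow> norm (qp x q) \<le> C1"
    using qp_bounds[OF r] by metis
  have q: "norm (ee \<tau>) \<le> 1/2" "norm (ee \<tau>) \<le> r" if "Im \<tau> \<ge> 1" for \<tau>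
    using norm_ee_le_half[OF that] by (auto simp: r_def)
  have zr: "norm (ee (\<tau> - z \<tau>)) \<le> r" if "Im \<tau> \<ge> 1" for \<tau>
  proof -
    have "(1 - u) * 1 \<le> (1 - u) * Im \<tau>" using u that by (intro mult_left_mono) auto
    then have "exp (- 2 * pi * ((1 - u) * Im \<tau>)) \<le> exp (- 2 * pi * (1 - u))" by simp
    moreover have "norm (ee (\<tau> - z \<tau>)) = exp (- 2 * pi * ((1 - u) * Im \<tau>))"
      by (simp add: norm_ee z_def algebra_simps)
    ultimately show ?thesis by (metis max.coboundedI2 r_def)
  qed
  obtain c2 C2 where 2: "c2 > 0" "\<And>\<tau>. Im \<tau> \<ge> 1 \<Longrightarrow> c2 \<le> norm (1 - ee (z \<tau>))"
    "\<And>\<tau>. Im \<tau> \<ge> 1 \<Longrightarrow> norm (1 - ee (z \<tau>)) \<le> C2"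
  proof (cases "u = 0")
    case True
    then have "ee (of_real v) \<noteq> 1"
      using uv unfolding ee_eq_1_iff by (metis Ints_0 complex_is_Int_iff Re_complex_of_real Ints_of_int)
    then show ?thesis using that[of "norm (1 - ee (of_real v))" "norm (1 - ee (of_real v))"] True
      by (simp add: z_def)
  next
    case False
    then have e1: "exp (- 2 * pi * u) < 1" using u by simp
    have e2: "norm (ee (z \<tau>)) \<le> exp (- 2 * pi * u)" if "Im \<tau> \<ge> 1" for \<tau>
    proof -
      have "u * 1 \<le> u * Im \<tau>" using u that by (intro mult_left_mono) auto
      then show ?thesis by (simp add: norm_ee z_def)
    qed
    have e3: "1 - norm (ee (z \<tau>)) \<le> norm (1 - ee (z \<tau>))"
        "norm (1 - ee (z \<tau>)) \<le> 1 + norm (ee (z \<tau>))" for \<tau>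
      using norm_triangle_ineq2[of 1 "ee (z \<tau>)"] norm_triangle_ineq4[of 1 "ee (z \<tau>)"] by simp_all
    show ?thesis
    proof (rule that)
      show "1 - exp (- 2 * pi * u) > 0" using e1 by simp
      show "1 - exp (- 2 * pi * u) \<le> norm (1 - ee (z \<tau>))" if "Im \<tau> \<ge> 1" for \<tau>
        using e2[OF that] e3[of \<tau>] by linarith
      show "norm (1 - ee (z \<tau>)) \<le> 2" if "Im \<tau> \<ge> 1" for \<tau>
        using e1 e2[OF that] e3[of \<tau>] by linarith
    qed
  qed
  have zq: "norm (ee (z \<tau>) * ee \<tau>) \<le> r" if "Im \<tau> \<ge> 1" for \<tau>
  proof -
    have "norm (ee (z \<tau>)) \<le> 1" using u that by (simp add: norm_ee z_def)
    then have "norm (ee (z \<tau>)) * norm (ee \<tau>) \<le> 1 * r" using q(2)[OF that] by (intro mult_mono) auto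
    then show ?thesis by (simp add: norm_mult)
  qed
  define P where "P = (\<lambda>\<tau>. norm (1 - ee (z \<tau>)) * norm (qp (ee (z \<tau>) * ee \<tau>) (ee \<tau>)) *
    norm (qp (ee (\<tau> - z \<tau>)) (ee \<tau>)) / norm (qp (ee \<tau>) (ee \<tau>)) ^ 2)"
  have eq: "norm (klein u v \<tau>) = P \<tau> * exp (- pi * Im \<tau> * (u ^ 2 - u))" if "Im \<tau> \<ge> 1" for \<tau>
  proof -
    have "norm (ee \<tau>) < 1" using q[OF that] by linarith
    then have "qp (ee (z \<tau>)) (ee \<tau>) = (1 - ee (z \<tau>)) * qp (ee (z \<tau>) * ee \<tau>) (ee \<tau>)"
      by (rule qp_rec)
    moreover have "norm (ee (of_real u * z \<tau> / 2)) * norm (ee (- z \<tau> / 2)) = exp (- pi * Im \<tau> * (u ^ 2 - u))"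
      by (simp add: norm_ee z_def power2_eq_square algebra_simps flip: exp_add)
    moreover have "klein u v \<tau> = ee (of_real u * z \<tau> / 2) * (ee (- z \<tau> / 2) *
        (qp (ee (z \<tau>)) (ee \<tau>) * qp (ee (\<tau> - z \<tau>)) (ee \<tau>)) / qp (ee \<tau>) (ee \<tau>) ^ 2)"
      by (simp add: klein_def thetaK_def z_def)
    ultimately show ?thesis
      by (simp add: P_def norm_mult norm_divide norm_power)
  qed
  have Q: "c1 ^ 2 \<le> norm (qp (ee \<tau>) (ee \<tau>)) ^ 2" "norm (qp (ee \<tau>) (ee \<tau>)) ^ 2 \<le> C1 ^ 2" "0 < norm (qp (ee \<tau>) (ee \<tau>)) ^ 2"
    if "Im \<tau> \<ge> 1" for \<tau>
  proof -
    have *: "c1 \<le> norm (qp (ee \<tau>) (ee \<tau>))" "norm (qp (ee \<tau>) (ee \<tau>)) \<le> C1" using 1 q[OF that] by auto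
    then show "c1 ^ 2 \<le> norm (qp (ee \<tau>) (ee \<tau>)) ^ 2" "norm (qp (ee \<tau>) (ee \<tau>)) ^ 2 \<le> C1 ^ 2"
      using 1(1) by (auto intro!: power_mono)
    show "0 < norm (qp (ee \<tau>) (ee \<tau>)) ^ 2" using * 1(1) by (intro zero_less_power) linarith
  qed
  have C1: "C1 > 0" using 1(2,3)[of 0 0] 1(1) r by simp
  have "Im \<i> \<ge> 1" by simp
  then have C2: "C2 > 0" using 2(1) 2(2,3)[of \<i>] by linarith
  show ?thesis
  proof (rule that)
    show "c2 * c1 * c1 / C1 ^ 2 > 0" using 1(1) 2(1) C1 by simp
    fix \<tau> assume \<tau>: "Im \<tau> \<ge> 1"
    have "c2 * c1 * c1 / C1 ^ 2 \<le> P \<tau>"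
      unfolding P_def using 1 2 zq[OF \<tau>] zr[OF \<tau>] q[OF \<tau>] \<tau> Q[OF \<tau>] 
      by (intro frac_le mult_mono) auto
    then show "c2 * c1 * c1 / C1 ^ 2 * exp (- pi * Im \<tau> * (u ^ 2 - u)) \<le> norm (klein u v \<tau>)"
      unfolding eq[OF \<tau>] by (intro mult_right_mono) auto
    have "P \<tau> \<le> C2 * C1 * C1 / c1 ^ 2"
      unfolding P_def using 1 2 zq[OF \<tau>] zr[OF \<tau>] q[OF \<tau>] \<tau> Q[OF \<tau>] C1 C2
      by (intro frac_le mult_mono) auto
    then show "norm (klein u v \<tau>) \<le> C2 * C1 * C1 / c1 ^ 2 * exp (- pi * Im \<tau> * (u ^ 2 - u))"
      unfolding eq[OF \<tau>] by (intro mult_right_mono) auto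
  qed
qed

lemma klein_bounds:
  assumes uv: "\<not> (u \<in> \<int> \<and> v \<in> \<int>)"
  obtains c C where "c > 0"
    "\<And>\<tau>. Im \<tau> \<ge> 1 \<Longrightarrow> c * exp (- pi * Im \<tau> * (B2 (frac u) - 1 / 6)) \<le> norm (klein u v \<tau>)"
    "\<And>\<tau>. Im \<tau> \<ge> 1 \<Longrightarrow> norm (klein u v \<tau>) \<le> C * exp (- pi * Im \<tau> * (B2 (frac u) - 1 / 6))"
proof -
  have "u \<in> \<int> \<longleftrightarrow> frac u \<in> \<int>" by (simp add: frac_def)
  then have uv': "\<not> (frac u \<in> \<int> \<and> v \<in> \<int>)" using uv by simp
  obtain c C where *: "c > 0"
    "\<And>\<tau>. Im \<tau> \<ge> 1 \<Longrightarrow> c * exp (- pi * Im \<tau> * (frac u ^ 2 - frac u)) \<le> norm (klein (frac u) v \<tau>)"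
    "\<And>\<tau>. Im \<tau> \<ge> 1 \<Longrightarrow> norm (klein (frac u) v \<tau>) \<le> C * exp (- pi * Im \<tau> * (frac u ^ 2 - frac u))"
    using klein_bounds_frac[OF frac_ge_0 frac_lt_1 uv'] by blast
  have "norm (klein u v \<tau>) = norm (klein (frac u) v \<tau>)" if "Im \<tau> \<ge> 1" for \<tau>
    using norm_klein_shift[of \<tau> "frac u" "\<lfloor>u\<rfloor>" v 0] that by (simp add: frac_def)
  with * show ?thesis by (intro that[of c C]) (auto simp: B2_def)
qed

section \<open>The square of \<eta> and its multiplier\<close>

definition eta2 :: "complex \<Rightarrow> complex" where
  "eta2 \<tau> = ee (\<tau> / 12) * qp (ee \<tau>) (ee \<tau>) ^ 2"

lemma eta2_nonzero: "Im \<tau> > 0 \<Longrightarrow> eta2 \<tau> \<noteq> 0"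
  using qp_ee_nonzero by (simp add: eta2_def)

lemma eta2_holomorphic: "eta2 holomorphic_on upper_half_plane"
  unfolding eta2_def by (intro holomorphic_intros qp_holomorphic) (auto intro!: norm_ee_less_1)

lemma eta2_add_1: "eta2 (\<tau> + 1) = ee (1 / 12) * eta2 \<tau>"
  by (simp add: eta2_def ee_add add_divide_distrib)

lemma eta2_bounds:
  obtains c C where "c > 0"
    "\<And>\<tau>. Im \<tau> \<ge> 1 \<Longrightarrow> c * exp (- pi * Im \<tau> / 6) \<le> norm (eta2 \<tau>)"
    "\<And>\<tau>. Im \<tau> \<ge> 1 \<Longrightarrow> norm (eta2 \<tau>) \<le> C * exp (- pi * Im \<tau> / 6)"
proof -
  obtain c C where 1: "c > 0" "\<And>x q. norm x \<le> 1/2 \<Longrightarrow> norm q \<le> 1 / 2 \<Longrightarrow> c \<le> norm (qp x q)"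
    "\<And>x q. norm x \<le> 1/2 \<Longrightarrow> norm q \<le> 1 / 2 \<Longrightarrow> norm (qp x q) \<le> C"
    using qp_bounds[of "1/2"] by auto
  have e: "norm (eta2 \<tau>) = norm (qp (ee \<tau>) (ee \<tau>)) ^ 2 * exp (- pi * Im \<tau> / 6)" for \<tau>
    by (simp add: eta2_def norm_mult norm_power norm_ee)
  have b: "c \<le> norm (qp (ee \<tau>) (ee \<tau>))" "norm (qp (ee \<tau>) (ee \<tau>)) \<le> C" if "Im \<tau> \<ge> 1" for \<tau>
    using 1 norm_ee_le_half[OF that] by auto
  show ?thesis
  proof (rule that)
    show "c ^ 2 > 0" using 1 by simp
    show "c ^ 2 * exp (- pi * Im \<tau> / 6) \<le> norm (eta2 \<tau>)" if "Im \<tau> \<ge> 1" for \<tau>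
      unfolding e using b[OF that] 1(1) by (intro mult_right_mono power_mono) auto
    show "norm (eta2 \<tau>) \<le> C ^ 2 * exp (- pi * Im \<tau> / 6)" if "Im \<tau> \<ge> 1" for \<tau>
      unfolding e using b[OF that] 1(1) by (intro mult_right_mono power_mono) auto
  qed
qed

lemma qp_mult_minus:
  assumes q: "norm q < 1"
  shows "qp x q * qp (- x) q = qp (x ^ 2) (q ^ 2)"
proof -
  have q2: "norm (q ^ 2) < 1" using q by (simp add: norm_power power_less_one_iff)
  have "(\<lambda>n. (\<Prod>i<n. 1 - x * q ^ i) * (\<Prod>i<n. 1 - (- x) * q ^ i)) \<longlonglongrightarrow> qp x q * qp (- x) q"
    by (intro tendsto_mult qp_LIMSEQ q)
  also have "(\<lambda>n. (\<Prod>i<n. 1 - x * q ^ i) * (\<Prod>i<n. 1 - (- x) * q ^ i)) =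
      (\<lambda>n. \<Prod>i<n. 1 - x ^ 2 * (q ^ 2) ^ i)"
    by (simp add: fun_eq_iff algebra_simps power2_eq_square power_mult_distrib flip: prod.distrib)
  finally show ?thesis
    using qp_LIMSEQ[OF q2, of "x ^ 2"] LIMSEQ_unique by blast
qed

lemma qp_split_even_odd:
  assumes q: "norm q < 1"
  shows "qp x q = qp x (q ^ 2) * qp (x * q) (q ^ 2)"
proof -
  have q2: "norm (q ^ 2) < 1" using q by (simp add: norm_power power_less_one_iff)
  have "(\<Prod>i<2 * n. 1 - x * q ^ i) = (\<Prod>i<n. 1 - x * (q ^ 2) ^ i) * (\<Prod>i<n. 1 - x * q * (q ^ 2) ^ i)" for n
    by (induction n) (simp_all add: power_mult mult_ac power2_eq_square power_mult_distrib)
  moreover have "(\<lambda>n. \<Prod>i<2 * n. 1 - x * q ^ i) \<longlonglongrightarrow> qp x q"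
    using LIMSEQ_subseq_LIMSEQ[OF qp_LIMSEQ[OF q], of "\<lambda>n. 2 * n"] by (simp add: strict_mono_def o_def)
  ultimately have "(\<lambda>n. (\<Prod>i<n. 1 - x * (q ^ 2) ^ i) * (\<Prod>i<n. 1 - x * q * (q ^ 2) ^ i)) \<longlonglongrightarrow> qp x q"
    by simp
  moreover have "(\<lambda>n. (\<Prod>i<n. 1 - x * (q ^ 2) ^ i) * (\<Prod>i<n. 1 - x * q * (q ^ 2) ^ i)) \<longlonglongrightarrow>
      qp x (q ^ 2) * qp (x * q) (q ^ 2)"
    by (intro tendsto_mult qp_LIMSEQ q2)
  ultimately show ?thesis using LIMSEQ_unique by blast
qed

text \<open>Euler's identity between partitions into distinct and into odd parts: (q; q) times (-q;
  q) is (q^2; q^2), while (q; q) also splits into its odd and even factors, and (q^2; q^2)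
  cancels.\<close>

lemma qp_euler:
  assumes q: "norm q < 1"
  shows "qp (- q) q * qp q (q ^ 2) = 1"
proof -
  have q2: "norm (q ^ 2) < 1" using q by (simp add: norm_power power_less_one_iff)
  have nz: "qp (q ^ 2) (q ^ 2) \<noteq> 0"
  proof
    assume "qp (q ^ 2) (q ^ 2) = 0"
    then obtain n where "q ^ 2 * (q ^ 2) ^ n = 1" using qp_eq_0_iff[OF q2] by blast
    then have "norm (q ^ 2) ^ Suc n = 1"
      by (metis norm_one norm_power power_Suc)
    with q2 show False by (metis less_irrefl norm_ge_zero power_Suc_less_one power_0_Suc zero_neq_one order_le_less)
  qed
  have "qp (- q) q * qp q q = qp (q ^ 2) (q ^ 2)"
    using qp_mult_minus[OF q, of q] by (simp add: mult.commute)
  moreover have "qp q q = qp q (q ^ 2) * qp (q ^ 2) (q ^ 2)"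
    using qp_split_even_odd[OF q, of q] by (simp add: power2_eq_square)
  ultimately show ?thesis using nz by simp
qed

definition klein_half_prod :: "complex \<Rightarrow> complex" where
  "klein_half_prod \<tau> = klein (1/2) 0 \<tau> * klein 0 (1/2) \<tau> * klein (1/2) (1/2) \<tau>"

text \<open>The square of Weber's identity, up to a constant. It links \<eta> to the Klein forms at
  the three nonzero 2-division points, whose modular law is known, and thereby gives access to the
  multiplier of \<eta>^2.\<close>

lemma klein_half_prod_eta2:
  assumes \<tau>: "Im \<tau> > 0"
  shows "klein_half_prod \<tau> * eta2 \<tau> ^ 3 = 2 * ee (- 3 / 8)"
proof -
  define h where "h = ee (\<tau> / 2)"
  define Q where "Q = qp (ee \<tau>) (ee \<tau>)"
  have Q: "Q \<noteq> 0" unfolding Q_def by (rule qp_ee_nonzero[OF \<tau>])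
  note q1 = norm_ee_less_1[OF \<tau>]
  have h2: "h ^ 2 = ee \<tau>" by (simp add: h_def power2_eq_square flip: ee_add)
  have 1: "klein (1/2) 0 \<tau> = ee (\<tau> / 8) * (ee (- \<tau> / 4) * (qp h (ee \<tau>) * qp h (ee \<tau>)) / Q ^ 2)"
    by (simp add: klein_def thetaK_def h_def Q_def)
  have "ee (\<tau> - 1 / 2) = - ee \<tau>" by (simp add: ee_diff ee_half)
  moreover have "qp (- 1) (ee \<tau>) = 2 * qp (- ee \<tau>) (ee \<tau>)"
    using qp_rec[OF q1, of "- 1"] by simp
  ultimately have 2: "klein 0 (1/2) \<tau> = ee (- 1 / 4) * (2 * qp (- ee \<tau>) (ee \<tau>) * qp (- ee \<tau>) (ee \<tau>)) / Q ^ 2"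
    by (simp add: klein_def thetaK_def Q_def ee_half)
  have h': "ee (\<tau> / 2 + 1 / 2) = - h" "ee (\<tau> - (\<tau> / 2 + 1 / 2)) = - h"
  proof -
    show "ee (\<tau> / 2 + 1 / 2) = - h" by (simp add: ee_add ee_half h_def)
    have "\<tau> - (\<tau> / 2 + 1 / 2) = \<tau> / 2 - 1 / 2" by (simp add: field_simps)
    then show "ee (\<tau> - (\<tau> / 2 + 1 / 2)) = - h" by (simp only: ee_diff ee_half h_def) simp
  qed
  have 3: "klein (1/2) (1/2) \<tau> = ee ((\<tau> + 1) / 8) * (ee (- (\<tau> + 1) / 4) * (qp (- h) (ee \<tau>) * qp (- h) (ee \<tau>)) / Q ^ 2)"
  proof -
    have "complex_of_real (1/2) * \<tau> + complex_of_real (1/2) = \<tau> / 2 + 1 / 2" by simp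
    moreover have "complex_of_real (1/2) * (\<tau> / 2 + 1 / 2) / 2 = (\<tau> + 1) / 8"
        "- (\<tau> / 2 + 1 / 2) / 2 = - (\<tau> + 1) / 4" by (simp_all add: field_simps)
    ultimately show ?thesis by (simp only: klein_def thetaK_def h' Q_def)
  qed
  have "(qp h (ee \<tau>) * qp (- h) (ee \<tau>)) = qp (ee \<tau>) (ee \<tau> ^ 2)"
    using qp_mult_minus[OF q1, of h] h2 by simp
  then have euler: "qp (- ee \<tau>) (ee \<tau>) * (qp h (ee \<tau>) * qp (- h) (ee \<tau>)) = 1"
    using qp_euler[OF q1] by simp
  have "ee (\<tau> / 8) * ee (- \<tau> / 4) * ee (- 1 / 4) * ee ((\<tau> + 1) / 8) * ee (- (\<tau> + 1) / 4) * ee (\<tau> / 12) ^ 3 = ee (- 3 / 8)"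
    by (simp add: power3_eq_cube field_simps flip: ee_add)
  then have "2 * ee (- 3 / 8) = 2 * (ee (\<tau> / 8) * ee (- \<tau> / 4) * ee (- 1 / 4) * ee ((\<tau> + 1) / 8) * ee (- (\<tau> + 1) / 4) * ee (\<tau> / 12) ^ 3) *
      (qp (- ee \<tau>) (ee \<tau>) * (qp h (ee \<tau>) * qp (- h) (ee \<tau>))) ^ 2"
    by (simp only: euler) simp
  also have "\<dots> = klein_half_prod \<tau> * eta2 \<tau> ^ 3"
    unfolding klein_half_prod_def 1 2 3 eta2_def Q_def[symmetric]
    using Q by (simp add: power_mult_distrib power2_eq_square power3_eq_cube)
  finally show ?thesis by simp
qed

definition klein4 :: "complex \<Rightarrow> int \<Rightarrow> int \<Rightarrow> complex" where
  "klein4 \<tau> m n = klein (of_int m / 2) (of_int n / 2) \<tau> ^ 4"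

text \<open>At half-integral indices the constants of \<open>klein_shift\<close> are 4th roots of
  unity, so the fourth power only sees the numerators modulo 2.\<close>

lemma klein4_shift:
  assumes \<tau>: "Im \<tau> > 0"
  shows "klein4 \<tau> (m + 2 * i) (n + 2 * j) = klein4 \<tau> m n"
proof -
  have "klein (of_int (m + 2 * i) / 2) (of_int (n + 2 * j) / 2) \<tau> =
      klein (of_int m / 2 + of_int i) (of_int n / 2 + of_int j) \<tau>"
    by (simp add: add_divide_distrib)
  also have "\<dots> ^ 4 = ee (of_nat 4 * (of_int (i + j + i * j) / 2 + of_real (of_int m / 2 * of_int j - of_int i * (of_int n / 2)) / 2)) *
      klein (of_int m / 2) (of_int n / 2) \<tau> ^ 4"
    unfolding klein_shift[OF \<tau>] power_mult_distrib ee_of_nat_mult ..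
  also have "of_nat 4 * (of_int (i + j + i * j) / 2 + of_real (of_int m / 2 * of_int j - of_int i * (of_int n / 2)) / 2) =
      complex_of_int (2 * (i + j + i * j) + (m * j - i * n))"
    by (simp add: field_simps)
  finally show ?thesis by (simp only: klein4_def ee_of_int mult_1_left)
qed

lemma klein4_mod:
  assumes \<tau>: "Im \<tau> > 0"
  shows "klein4 \<tau> m n = klein4 \<tau> (m mod 2) (n mod 2)"
proof -
  have "m = m mod 2 + 2 * (m div 2)" "n = n mod 2 + 2 * (n div 2)" by simp_all
  then show ?thesis using klein4_shift[OF \<tau>, of "m mod 2" "m div 2" "n mod 2" "n div 2"] by simp
qed

text \<open>A matrix of odd determinant permutes the three nonzero vectors modulo 2, so the fourth
  power of \<open>klein_half_prod\<close> has weight -12 without multiplier;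
  \<open>klein_half_prod_eta2\<close> turns this into weight 12 for the discriminant
  \<eta>^24.\<close>

lemma eta2_power_12_modular:
  fixes a b c d :: int
  assumes det: "a * d - b * c = 1" and \<tau>: "Im \<tau> > 0"
  shows "eta2 ((of_int a * \<tau> + of_int b) / (of_int c * \<tau> + of_int d)) ^ 12 =
    (of_int c * \<tau> + of_int d) ^ 12 * eta2 \<tau> ^ 12"
proof -
  define w where "w = of_int c * \<tau> + of_int d"
  define \<tau>' where "\<tau>' = (of_int a * \<tau> + of_int b) / w"
  have w: "w \<noteq> 0" unfolding w_def by (rule moebius_denom_nonzero[OF det \<tau>])
  have \<tau>': "Im \<tau>' > 0" unfolding \<tau>'_def w_def by (rule Im_moebius_pos[OF det \<tau>])
  define k4 where "k4 = klein4 \<tau>"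
  have P: "klein_half_prod \<tau> ^ 4 = k4 1 0 * k4 0 1 * k4 1 1"
    by (simp add: klein_half_prod_def k4_def klein4_def power_mult_distrib)
  have tr: "klein (of_int m / 2) (of_int n / 2) \<tau>' ^ 4 = k4 (m * a + n * c) (m * b + n * d) / w ^ 4" for m n :: int
    unfolding \<tau>'_def w_def klein_modular[OF det \<tau>] k4_def klein4_def
    by (simp add: power_divide add_divide_distrib)
  have "klein_half_prod \<tau>' ^ 4 = k4 a b * k4 c d * k4 (a + c) (b + d) / w ^ 12"
    using tr[of 1 0] tr[of 0 1] tr[of 1 1] w
    by (simp add: klein_half_prod_def power_mult_distrib flip: power_add)
  also have "k4 a b * k4 c d * k4 (a + c) (b + d) = k4 1 0 * k4 0 1 * k4 1 1"
  proof -
    have m: "k4 m n = k4 (m mod 2) (n mod 2)" for m n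
      unfolding k4_def by (rule klein4_mod[OF \<tau>])
    have p: "m mod 2 = (if even m then 0 else 1)" for m :: int by presburger
    have "odd (a * d - b * c)" using det by simp
    then show ?thesis
      unfolding m[of a b] m[of c d] m[of "a + c" "b + d"] p
      by (cases "even a"; cases "even b"; cases "even c"; cases "even d") simp_all
  qed
  finally have P': "klein_half_prod \<tau>' ^ 4 = klein_half_prod \<tau> ^ 4 / w ^ 12" by (simp add: P)
  have e: "klein_half_prod \<tau> ^ 4 * eta2 \<tau> ^ 12 = klein_half_prod \<tau>' ^ 4 * eta2 \<tau>' ^ 12"
    using arg_cong[OF klein_half_prod_eta2[OF \<tau>], of "\<lambda>x. x ^ 4"]
      arg_cong[OF klein_half_prod_eta2[OF \<tau>'], of "\<lambda>x. x ^ 4"]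
    by (simp add: power_mult_distrib flip: power_mult)
  moreover have "klein_half_prod \<tau> \<noteq> 0"
    using klein_half_prod_eta2[OF \<tau>] by auto
  ultimately have "eta2 \<tau>' ^ 12 = w ^ 12 * eta2 \<tau> ^ 12"
    using w unfolding P' by (simp add: field_simps)
  then show ?thesis by (simp add: \<tau>'_def w_def)
qed

text \<open>Growth at the cusps only involves absolute values, so the 12th root of the law for the
  discriminant can be taken here.\<close>

lemma norm_eta2_modular:
  fixes a b c d :: int
  assumes det: "a * d - b * c = 1" and \<tau>: "Im \<tau> > 0"
  shows "norm (eta2 ((of_int a * \<tau> + of_int b) / (of_int c * \<tau> + of_int d))) =
    norm (of_int c * \<tau> + of_int d) * norm (eta2 \<tau>)"
proof (rule power_eq_imp_eq_base)
  show "norm (eta2 ((of_int a * \<tau> + of_int b) / (of_int c * \<tau> + of_int d))) ^ 12 =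
      (norm (of_int c * \<tau> + of_int d) * norm (eta2 \<tau>)) ^ 12"
    unfolding power_mult_distrib norm_power[symmetric] eta2_power_12_modular[OF assms] norm_mult ..
qed auto

text \<open>The quotient is continuous with values in the 12th roots of unity, hence constant on the
  connected half-plane, and the fixed point \<i> of the inversion determines the constant as -i.
  Only its square is recorded, because the inversion will be applied twice.\<close>

lemma eta2_inversion:
  obtains k where "k ^ 2 = - 1" "\<And>\<tau>. Im \<tau> > 0 \<Longrightarrow> eta2 (- 1 / \<tau>) = k * \<tau> * eta2 \<tau>"
proof -
  define r where "r = (\<lambda>\<tau>. eta2 (- 1 / \<tau>) / (\<tau> * eta2 \<tau>))"
  have Im: "Im (- 1 / \<tau>) > 0" if "Im \<tau> > 0" for \<tau>
    using Im_moebius_pos[of 0 0 "-1" 1 \<tau>] that by simp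
  have r12: "r \<tau> ^ 12 = 1" if "Im \<tau> > 0" for \<tau>
    using eta2_power_12_modular[of 0 0 "-1" 1 \<tau>] eta2_nonzero[OF that] that
    by (auto simp: r_def power_divide power_mult_distrib)
  have "r constant_on upper_half_plane"
  proof (rule continuous_finite_range_constant)
    show "connected upper_half_plane" using convex_upper_half_plane convex_connected by blast
    have "(\<lambda>\<tau>. - 1 / \<tau>) holomorphic_on upper_half_plane"
      by (intro holomorphic_intros) auto
    then have "eta2 \<circ> (\<lambda>\<tau>. - 1 / \<tau>) holomorphic_on upper_half_plane"
      using Im by (intro holomorphic_on_compose_gen[OF _ eta2_holomorphic]) auto
    then have "r holomorphic_on upper_half_plane"
      unfolding r_def using eta2_nonzero
      by (intro holomorphic_intros eta2_holomorphic) (auto simp: o_def)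
    then show "continuous_on upper_half_plane r" by (rule holomorphic_on_imp_continuous_on)
    have "r ` upper_half_plane \<subseteq> {z. z ^ 12 = 1}" using r12 by auto
    moreover have "finite {z::complex. z ^ 12 = 1}" by (rule finite_roots_unity) simp
    ultimately show "finite (r ` upper_half_plane)" by (rule finite_subset)
  qed
  then obtain k where k: "\<And>\<tau>. Im \<tau> > 0 \<Longrightarrow> r \<tau> = k" by (auto simp: constant_on_def)
  have S: "eta2 (- 1 / \<tau>) = k * \<tau> * eta2 \<tau>" if "Im \<tau> > 0" for \<tau>
  proof -
    have "\<tau> * eta2 \<tau> \<noteq> 0" using eta2_nonzero[OF that] that by auto
    then show ?thesis using k[OF that] by (simp add: r_def divide_eq_eq mult.assoc)
  qed
  have "eta2 \<i> = k * \<i> * eta2 \<i>" using S[of \<i>] by (simp add: divide_i)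
  then have "k * \<i> = 1" using eta2_nonzero[of \<i>] by simp
  then have "(k * \<i>) ^ 2 = 1" by simp
  then have "- (k ^ 2) = 1" by (simp add: power_mult_distrib)
  then have "k ^ 2 = - 1" by (metis minus_minus)
  then show ?thesis using S that by blast
qed

text \<open>Inversion, translation by -1 and inversion lead from \<tau> to \<tau> / (\<tau> + 1).
  The resulting e(-1/12) is a primitive 12th root of unity, which is what forces the divisibility by
  12.\<close>

lemma eta2_lower_unipotent:
  assumes \<tau>: "Im \<tau> > 0"
  shows "eta2 (\<tau> / (\<tau> + 1)) = ee (- 1 / 12) * (\<tau> + 1) * eta2 \<tau>"
proof -
  obtain k where k: "k ^ 2 = - 1" and S: "\<And>\<tau>. Im \<tau> > 0 \<Longrightarrow> eta2 (- 1 / \<tau>) = k * \<tau> * eta2 \<tau>"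
    using eta2_inversion by blast
  have nz: "\<tau> \<noteq> 0" "\<tau> + 1 \<noteq> 0" using \<tau> by (auto simp: complex_eq_iff)
  have I: "Im (- 1 / \<tau>) > 0" using Im_moebius_pos[of 0 0 "-1" 1 \<tau>] \<tau> by simp
  define s where "s = - 1 / \<tau> - 1"
  have s: "Im s > 0" using I by (simp add: s_def)
  have snz: "s \<noteq> 0" using s by auto
  have "k * \<tau> * eta2 \<tau> = ee (1 / 12) * eta2 s"
    using eta2_add_1[of s] S[OF \<tau>] by (simp add: s_def)
  then have "eta2 s = ee (- 1 / 12) * (k * \<tau> * eta2 \<tau>)"
    by (simp flip: ee_add mult.assoc)
  moreover have "eta2 (- 1 / s) = k * s * eta2 s" by (rule S[OF s])
  ultimately have "eta2 (- 1 / s) = - (k ^ 2) * ee (- 1 / 12) * (- s * \<tau>) * eta2 \<tau>"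
    by (simp add: power2_eq_square)
  moreover have "- s * \<tau> = \<tau> + 1" using nz by (simp add: s_def field_simps)
  moreover have "- 1 / s = \<tau> / (\<tau> + 1)" using nz snz by (simp add: s_def divide_simps) (simp add: algebra_simps)
  ultimately show ?thesis by (simp only: k) simp
qed

section \<open>Modularity of the products\<close>

lemma ee_sum: "ee (\<Sum>i\<in>A. f i) = (\<Prod>i\<in>A. ee (f i))"
  by (induction A rule: infinite_finite_induct) (simp_all add: ee_add)

lemma power_int_sum:
  fixes x :: "'a :: field"
  assumes "x \<noteq> 0"
  shows "x powi (\<Sum>i\<in>A. f i) = (\<Prod>i\<in>A. x powi f i)"
  using assms by (induction A rule: infinite_finite_induct) (simp_all add: power_int_add)

lemma qpow_eq_ee: "qpow \<tau> s = ee (\<tau> * of_real s)"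
  by (simp add: qpow_def ee_def mult.assoc)

lemma qpoch_eq_qp: "qpoch [x] q = qp x q" "qpoch [x, y] q = qp x q * qp y q"
  by (simp_all add: qpoch_def qp_def)

definition klein_product :: "nat \<Rightarrow> nat \<Rightarrow> (nat \<Rightarrow> int) \<Rightarrow> complex \<Rightarrow> complex" where
  "klein_product N k a \<sigma> = eta2 \<sigma> powi (int k + (\<Sum>j=1..N div 2. a j)) *
     (\<Prod>j=1..N div 2. klein (real j / real N) 0 \<sigma> powi a j)"

text \<open>Completing a pair of products to a Klein form of index (j/N, 0) costs e(s j) and Q^2.
  The prefactor is made for this: its S_2 part cancels the e(s j), and its S_1 part joins the powers
  of Q to form powers of \<eta>^2. Since a_0 = 2k is even, \<eta>^2 rather than \<eta> is the
  building block.\<close>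

lemma theta_product_eq_klein_product:
  assumes N: "N > 0" and \<tau>: "Im \<tau> > 0"
  shows "theta_product N (2 * k) a \<tau> = klein_product N k a (of_nat N * \<tau>)"
proof -
  define \<sigma> where "\<sigma> = of_nat N * \<tau>"
  have \<sigma>: "Im \<sigma> > 0" using N \<tau> by (simp add: \<sigma>_def)
  define Q where "Q = qp (ee \<sigma>) (ee \<sigma>)"
  have Q: "Q \<noteq> 0" unfolding Q_def by (rule qp_ee_nonzero[OF \<sigma>])
  define X where "X = (\<lambda>j::nat. qp (ee (of_nat j * \<tau>)) (ee \<sigma>) * qp (ee (\<sigma> - of_nat j * \<tau>)) (ee \<sigma>))"
  define s where "s = (\<lambda>j::nat. of_nat j * (of_nat N - of_nat j) * \<tau> / (2 * of_nat N))"
  define S where "S = (\<Sum>j=1..N div 2. a j)"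
  have kl: "klein (real j / real N) 0 \<sigma> = ee (- s j) * X j / Q ^ 2" for j
  proof -
    have z: "of_real (real j / real N) * \<sigma> + of_real 0 = of_nat j * \<tau>" using N by (simp add: \<sigma>_def)
    have "of_real (real j / real N) * (of_nat j * \<tau>) / 2 + - (of_nat j * \<tau>) / 2 = - s j"
      using N by (simp add: s_def field_simps)
    then have "ee (- s j) = ee (of_real (real j / real N) * (of_nat j * \<tau>) / 2) * ee (- (of_nat j * \<tau>) / 2)"
      by (simp only: ee_add[symmetric])
    then show ?thesis unfolding klein_def z thetaK_def by (simp add: X_def Q_def mult.assoc)
  qed
  have X: "X j = klein (real j / real N) 0 \<sigma> * ee (s j) * Q ^ 2" for j
    unfolding kl using Q by (simp add: ee_minus field_simps)
  have qX: "qpoch [qpow \<tau> j, qpow \<tau> (real N - real j)] (qpow \<tau> N) = X j" for j :: nat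
  proof -
    have "\<tau> * of_real (real N - real j) = \<sigma> - of_nat j * \<tau>"
      by (simp add: \<sigma>_def algebra_simps)
    then show ?thesis unfolding qpoch_eq_qp qpow_eq_ee X_def by (simp add: \<sigma>_def mult.commute)
  qed
  have e1: "(\<Prod>j=1..N div 2. ee (s j) powi a j) = ee (of_int (exp_S2 N a) * \<tau> / (2 * of_nat N))"
  proof -
    have "(\<Prod>j=1..N div 2. ee (s j) powi a j) = ee (\<Sum>j=1..N div 2. of_int (a j) * s j)"
      by (simp only: ee_sum ee_of_int_mult)
    also have "(\<Sum>j=1..N div 2. of_int (a j) * s j) = of_int (exp_S2 N a) * \<tau> / (2 * of_nat N)"
      unfolding exp_S2_def s_def
      by (simp add: sum_distrib_left sum_divide_distrib mult_ac)
    finally show ?thesis .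
  qed
  have "theta_product N (2 * k) a \<tau> =
     ee (\<tau> * of_real (real N / 24 * of_int (exp_S1 N (2 * k) a) - 1 / (2 * real N) * of_int (exp_S2 N a)))
     * Q ^ (2 * k) * (\<Prod>j=1..N div 2. X j powi a j)"
  proof -
    have "(\<Prod>j=1..N div 2. qpoch [qpow \<tau> j, qpow \<tau> (real N - real j)] (qpow \<tau> N) powi a j) = (\<Prod>j=1..N div 2. X j powi a j)"
      by (intro prod.cong refl) (simp only: qX)
    moreover have "qpow \<tau> N = ee \<sigma>" by (simp add: qpow_eq_ee \<sigma>_def mult.commute)
    ultimately show ?thesis
      unfolding theta_product_def by (simp only: qpoch_eq_qp Q_def) (simp only: qpow_eq_ee)
  qed
  also have "(\<Prod>j=1..N div 2. X j powi a j) =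
     (\<Prod>j=1..N div 2. klein (real j / real N) 0 \<sigma> powi a j) *
      ee (of_int (exp_S2 N a) * \<tau> / (2 * of_nat N)) * (Q ^ 2) powi S"
    unfolding X power_int_mult_distrib prod.distrib e1 S_def
    using Q by (simp add: power_int_sum)
  also have "ee (\<tau> * of_real (real N / 24 * of_int (exp_S1 N (2 * k) a) - 1 / (2 * real N) * of_int (exp_S2 N a))) =
     ee (of_int (int k + S) * (\<sigma> / 12)) * ee (- (of_int (exp_S2 N a) * \<tau> / (2 * of_nat N)))"
    unfolding ee_add[symmetric] exp_S1_def S_def[symmetric]
    by (rule arg_cong[of _ _ ee]) (simp add: \<sigma>_def field_simps)
  also have "Q ^ (2 * k) = (Q ^ 2) powi int k" by (simp add: power_mult)
  finally have "theta_product N (2 * k) a \<tau> = ee (\<sigma> / 12) powi (int k + S) * ((Q ^ 2) powi int k * (Q ^ 2) powi S) *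
     (\<Prod>j=1..N div 2. klein (real j / real N) 0 \<sigma> powi a j)"
    unfolding ee_of_int_mult ee_minus by simp
  also have "(Q ^ 2) powi int k * (Q ^ 2) powi S = (Q ^ 2) powi (int k + S)"
    by (rule power_int_add[symmetric]) (use Q in auto)
  finally show ?thesis
    by (simp add: klein_product_def \<sigma>_def[symmetric] eta2_def Q_def power_int_mult_distrib S_def)
qed

text \<open>Since gcd(j x, j y) = j, integrality of both entries would give N dvd j, against 0 < j <
  N. So no Klein form in the product has an integral index, before or after a matrix of SL_2(Z) is
  applied.\<close>

lemma klein_index_nonint:
  fixes x y :: int
  assumes xy: "coprime x y" and j: "j \<in> {1..N div 2}"
  shows "\<not> (real j / real N * of_int x \<in> \<int> \<and> real j / real N * of_int y \<in> \<int>)"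
proof
  have N: "N > 0" "j < N" "j > 0" using j by auto
  have dvd: "int N dvd int j * z" if "real j / real N * of_int z \<in> \<int>" for z
  proof -
    from that obtain l :: int where "real j / real N * of_int z = of_int l" by (auto elim: Ints_cases)
    then have "real_of_int (int j * z) = of_int (int N * l)" using N by (simp add: field_simps)
    then show ?thesis by (metis dvd_triv_left of_int_eq_iff)
  qed
  assume "real j / real N * of_int x \<in> \<int> \<and> real j / real N * of_int y \<in> \<int>"
  then have "int N dvd gcd (int j * x) (int j * y)" using dvd by simp
  then have "int N dvd int j" using xy by (simp add: gcd_mult_left)
  then show False using N by (auto dest: dvd_imp_le)
qed

lemma klein_product_holomorphic: "klein_product N k a holomorphic_on upper_half_plane"
proof -
  have "klein (real j / real N) 0 \<tau> \<noteq> 0" if "j \<in> {1..N div 2}" "Im \<tau> > 0" for j \<tau>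
    using klein_nonzero[OF that(2)] klein_index_nonint[OF _ that(1), of 1 0] by auto
  then show ?thesis
    unfolding klein_product_def
    by (intro holomorphic_intros eta2_holomorphic klein_holomorphic) (auto simp: eta2_nonzero)
qed

lemma theta_product_holomorphic:
  assumes N: "N > 0"
  shows "theta_product N (2 * k) a holomorphic_on upper_half_plane"
proof -
  have "klein_product N k a \<circ> (\<lambda>\<tau>. of_nat N * \<tau>) holomorphic_on upper_half_plane"
    using N by (intro holomorphic_on_compose_gen[OF _ klein_product_holomorphic] holomorphic_intros) auto
  then show ?thesis
    by (rule holomorphic_transform) (simp add: theta_product_eq_klein_product[OF N])
qed

text \<open>The exponent by which the Klein forms with index \<open>j / N\<close> transform under the conjugated
  matrix, whose first row is \<open>1 + N * t, N * b\<close>.\<close>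

definition shift_exponent :: "nat \<Rightarrow> int \<Rightarrow> int \<Rightarrow> nat \<Rightarrow> int" where
  "shift_exponent N t b j = int N * (int j * t + int j * b + int j * t * (int j * b)) + int j ^ 2 * b"

text \<open>The index (j/N, 0) goes to (j/N + j t, j b), an integral shift. The \<eta>^2 factor is
  left unevaluated, because necessity and sufficiency of the congruences draw on different facts
  about its multiplier.\<close>

lemma klein_product_Gamma1:
  fixes t b c d :: int
  assumes N: "N > 0" and \<sigma>: "Im \<sigma> > 0" and det: "(1 + int N * t) * d - (int N * b) * c = 1"
  defines "w \<equiv> of_int c * \<sigma> + of_int d"
  shows "klein_product N k a ((of_int (1 + int N * t) * \<sigma> + of_int (int N * b)) / w) =
    eta2 ((of_int (1 + int N * t) * \<sigma> + of_int (int N * b)) / w) powi (int k + (\<Sum>j=1..N div 2. a j)) *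
    ee (of_int (\<Sum>j=1..N div 2. a j * shift_exponent N t b j) / (2 * of_nat N)) *
     (\<Prod>j=1..N div 2. klein (real j / real N) 0 \<sigma> powi a j) / w powi (\<Sum>j=1..N div 2. a j)"
proof -
  have w: "w \<noteq> 0" unfolding w_def by (rule moebius_denom_nonzero[OF det \<sigma>])
  have "klein (real j / real N) 0 ((of_int (1 + int N * t) * \<sigma> + of_int (int N * b)) / w) =
    ee (of_int (shift_exponent N t b j) / (2 * of_nat N)) * klein (real j / real N) 0 \<sigma> / w" for j
  proof -
    have "klein (real j / real N) 0 ((of_int (1 + int N * t) * \<sigma> + of_int (int N * b)) / w) =
      klein (real j / real N + of_int (int j * t)) (0 + of_int (int j * b)) \<sigma> / w"
      unfolding w_def klein_modular[OF det \<sigma>] using N by (simp add: field_simps)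
    also have "klein (real j / real N + of_int (int j * t)) (0 + of_int (int j * b)) \<sigma> =
      ee (of_int (shift_exponent N t b j) / (2 * of_nat N)) * klein (real j / real N) 0 \<sigma>"
      unfolding klein_shift[OF \<sigma>] shift_exponent_def using N
      by (intro arg_cong[where f = "\<lambda>x. ee x * _"]) (simp add: field_simps power2_eq_square)
    finally show ?thesis .
  qed
  then show ?thesis
    unfolding klein_product_def using w
    by (simp add: power_int_mult_distrib power_int_divide_distrib prod.distrib prod_dividef power_int_sum
      sum_divide_distrib ee_sum flip: ee_of_int_mult)
qed

text \<open>The last equation is the determinant of the matrix conjugated by diag(N, 1), which is
  the one that acts on N \<tau>.\<close>

lemma theta_product_mem_Gamma1:
  assumes N: "N > 0" and \<gamma>: "(p, q, r, s) \<in> Gamma1 N"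
  obtains t c where "p = 1 + int N * t" "r = int N * c"
    "(1 + int N * t) * s - (int N * q) * c = 1"
proof -
  from \<gamma> have 1: "[p = 1] (mod int N)" "[r = 0] (mod int N)" "p * s - q * r = 1"
    by (auto simp: Gamma1_def SL2Z_def)
  then obtain t where "p - 1 = int N * t" by (auto simp: cong_iff_dvd_diff)
  then have t: "p = 1 + int N * t" by simp
  obtain c where c: "r = int N * c" using 1 by (auto simp: cong_0_iff)
  show ?thesis by (rule that[OF t c]) (use 1 t c in \<open>auto simp: algebra_simps\<close>)
qed

lemma theta_product_Gamma1:
  fixes q s t c :: int
  assumes N: "N > 0" and \<tau>: "Im \<tau> > 0" and det: "(1 + int N * t) * s - (int N * q) * c = 1"
  defines "w \<equiv> of_int (int N * c) * \<tau> + of_int s"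
  defines "\<sigma> \<equiv> of_nat N * \<tau>"
  shows "theta_product N (2 * k) a ((of_int (1 + int N * t) * \<tau> + of_int q) / w) =
    eta2 ((of_int (1 + int N * t) * \<sigma> + of_int (int N * q)) / (of_int c * \<sigma> + of_int s))
      powi (int k + (\<Sum>j=1..N div 2. a j)) *
    ee (of_int (\<Sum>j=1..N div 2. a j * shift_exponent N t q j) / (2 * of_nat N)) *
     (\<Prod>j=1..N div 2. klein (real j / real N) 0 \<sigma> powi a j) / w powi (\<Sum>j=1..N div 2. a j)"
proof -
  have det2: "(1 + int N * t) * s - q * (int N * c) = 1" using det by (simp add: algebra_simps)
  have \<sigma>: "Im \<sigma> > 0" using N \<tau> by (simp add: \<sigma>_def)
  have w: "w = of_int c * \<sigma> + of_int s" by (simp add: w_def \<sigma>_def)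
  have "Im ((of_int (1 + int N * t) * \<tau> + of_int q) / w) > 0"
    unfolding w_def by (rule Im_moebius_pos[OF det2 \<tau>])
  then have "theta_product N (2 * k) a ((of_int (1 + int N * t) * \<tau> + of_int q) / w) =
      klein_product N k a (of_nat N * ((of_int (1 + int N * t) * \<tau> + of_int q) / w))"
    by (rule theta_product_eq_klein_product[OF N])
  also have "of_nat N * ((of_int (1 + int N * t) * \<tau> + of_int q) / w) =
      (of_int (1 + int N * t) * \<sigma> + of_int (int N * q)) / w"
    by (simp add: \<sigma>_def algebra_simps add_divide_distrib)
  also have "klein_product N k a \<dots> = 
    eta2 ((of_int (1 + int N * t) * \<sigma> + of_int (int N * q)) / w)
      powi (int k + (\<Sum>j=1..N div 2. a j)) *
    ee (of_int (\<Sum>j=1..N div 2. a j * shift_exponent N t q j) / (2 * of_nat N)) *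
     (\<Prod>j=1..N div 2. klein (real j / real N) 0 \<sigma> powi a j) / w powi (\<Sum>j=1..N div 2. a j)"
    unfolding w by (rule klein_product_Gamma1[OF N \<sigma> det])
  finally show ?thesis by (simp only: w)
qed

lemma klein_index_product_nonzero:
  assumes "Im \<sigma> > 0"
  shows "(\<Prod>j=1..N div 2. klein (real j / real N) 0 \<sigma> powi a j) \<noteq> 0"
  using klein_nonzero[OF assms] klein_index_nonint[of 1 0 _ N] by (auto simp: power_int_eq_0_iff)

lemma ee_rational_eq_1_iff:
  assumes "n > (0::nat)"
  shows "ee (of_int z / of_nat n) = 1 \<longleftrightarrow> int n dvd z"
proof
  assume "ee (of_int z / of_nat n) = 1"
  then obtain l where "complex_of_int z / of_nat n = of_int l"
    by (auto simp: ee_eq_1_iff elim!: Ints_cases)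
  then have "complex_of_int z = of_int (int n * l)" using assms by (simp add: field_simps)
  then show "int n dvd z" by (simp only: of_int_eq_iff) simp
next
  assume "int n dvd z"
  then obtain l where "z = int n * l" by blast
  then have "complex_of_int z / of_nat n = of_int l" using assms by simp
  then show "ee (of_int z / of_nat n) = 1" by simp
qed

text \<open>With L the sum of j a_j and S that of j^2 a_j, the left side is 2N dvd N L + S, and S
  and L have the same parity. For even N either side forces L to be even, so N L drops out modulo
  2N; for odd N the divisibility by 2 is automatic. This explains the modulus N gcd(2, N).\<close>

lemma dvd_sum_shift_exponent_iff:
  fixes a :: "nat \<Rightarrow> int"
  assumes N: "N > 0"
  shows "int (2 * N) dvd (\<Sum>j\<in>A. a j * (int j * int N + int j ^ 2)) \<longleftrightarrow>
    int (N * gcd 2 N) dvd (\<Sum>j\<in>A. int j ^ 2 * a j)"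
proof -
  define S where "S = (\<Sum>j\<in>A. int j ^ 2 * a j)"
  define L where "L = (\<Sum>j\<in>A. int j * a j)"
  have e: "(\<Sum>j\<in>A. a j * (int j * int N + int j ^ 2)) = int N * L + S"
    by (simp add: S_def L_def sum_distrib_left algebra_simps sum.distrib)
  have "even (\<Sum>j\<in>A. int j ^ 2 * a j - int j * a j)" by (intro dvd_sum) simp
  then have par: "even (S - L)" by (simp add: S_def L_def sum_subtractf)
  show ?thesis
  proof (cases "even N")
    case True
    then have g: "gcd 2 N = 2" by (simp add: gcd_nat.absorb1)
    have "int (2 * N) dvd int N * L + S \<longleftrightarrow> int (2 * N) dvd S"
    proof
      assume *: "int (2 * N) dvd int N * L + S"
      then have "even (int N * L + S)" by (rule dvd_trans[rotated]) simp
      then have "even L" using True par by simp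
      then have "int (2 * N) dvd int N * L" by (auto elim!: evenE)
      with * show "int (2 * N) dvd S" by (simp add: dvd_add_right_iff)
    next
      assume *: "int (2 * N) dvd S"
      then have "even S" by (rule dvd_trans[rotated]) simp
      then have "even L" using par by simp
      then have "int (2 * N) dvd int N * L" by (auto elim!: evenE)
      with * show "int (2 * N) dvd int N * L + S" by simp
    qed
    then show ?thesis unfolding e g S_def[symmetric] by (simp add: mult.commute)
  next
    case False
    then have c: "coprime (2::int) (int N)" by simp
    then have g: "gcd 2 N = 1" using False by (simp add: coprime_iff_gcd_eq_1[symmetric])
    have "even (int N * L + S)" using par False by simp
    then have "int (2 * N) dvd int N * L + S \<longleftrightarrow> int N dvd int N * L + S"
      using divides_mult[OF _ _ c] by (auto intro: dvd_mult_right)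
    then show ?thesis
      unfolding e g S_def[symmetric] by (simp add: dvd_add_right_iff[of "int N" "int N * L" S])
  qed
qed

text \<open>Two matrices suffice for necessity: for (1, 0; N, 1) the Klein constants are trivial,
  which isolates the multiplier of \<eta>^2, and translation by 1 then isolates the Klein constants.
  Sufficiency rests on the weight 12 of the discriminant and a parity argument.\<close>

lemma slash_theta_product_invariant_iff:
  assumes N: "N > 0"
  shows "(\<forall>\<gamma>\<in>Gamma1 N. \<forall>\<tau>\<in>upper_half_plane. slash k (theta_product N (2 * k) a) \<gamma> \<tau> = theta_product N (2 * k) a \<tau>)
     \<longleftrightarrow> 12 dvd int k + (\<Sum>j=1..N div 2. a j) \<and> int (N * gcd 2 N) dvd (\<Sum>j=1..N div 2. int j ^ 2 * a j)"
    (is "?L \<longleftrightarrow> ?R")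
proof
  assume L: ?L
  define n where "n = int k + (\<Sum>j=1..N div 2. a j)"
  \<comment> \<open>One point is enough, as the multipliers are constants and no factor vanishes
    there. The point is \<tau> = \<i>.\<close>
  define \<sigma> where "\<sigma> = of_nat N * \<i>"
  define K where "K = (\<Prod>j=1..N div 2. klein (real j / real N) 0 \<sigma> powi a j)"
  have \<sigma>: "Im \<sigma> > 0" using N by (simp add: \<sigma>_def)
  have K: "K \<noteq> 0" unfolding K_def by (rule klein_index_product_nonzero[OF \<sigma>])
  have \<theta>: "theta_product N (2 * k) a \<i> = eta2 \<sigma> powi n * K"
    by (simp add: theta_product_eq_klein_product[OF N] klein_product_def n_def K_def \<sigma>_def)
  have \<theta>0: "eta2 \<sigma> powi n \<noteq> 0" using eta2_nonzero[OF \<sigma>] by simp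
  have n12: "12 dvd n"
  proof -
    define w where "w = \<sigma> + 1"
    have w: "w \<noteq> 0" using \<sigma> by (auto simp: w_def complex_eq_iff)
    have "(1, 0, int N, 1) \<in> Gamma1 N" by (simp add: Gamma1_def SL2Z_def cong_0_iff)
    then have "slash k (theta_product N (2 * k) a) (1, 0, int N, 1) \<i> = theta_product N (2 * k) a \<i>"
      using L by simp
    then have "theta_product N (2 * k) a (\<i> / w) = w ^ k * theta_product N (2 * k) a \<i>"
      using w by (simp add: slash_def w_def \<sigma>_def field_simps)
    moreover have "theta_product N (2 * k) a (\<i> / w) = eta2 (\<sigma> / (\<sigma> + 1)) powi n * K / w powi (\<Sum>j=1..N div 2. a j)"
      using theta_product_Gamma1[OF N, of \<i> 0 1 0 1 k a]
      by (simp add: w_def \<sigma>_def n_def K_def shift_exponent_def)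
    moreover have "w ^ k = w powi n / w powi (\<Sum>j=1..N div 2. a j)"
      using w by (simp add: n_def power_int_add)
    ultimately have "eta2 (\<sigma> / (\<sigma> + 1)) powi n * K / w powi (\<Sum>j=1..N div 2. a j) =
        w powi n / w powi (\<Sum>j=1..N div 2. a j) * (eta2 \<sigma> powi n * K)"
      by (simp only: \<theta>)
    then have "eta2 (\<sigma> / (\<sigma> + 1)) powi n = w powi n * eta2 \<sigma> powi n"
      using K w by (simp add: divide_simps)
    moreover have "eta2 (\<sigma> / (\<sigma> + 1)) powi n = ee (- 1 / 12) powi n * (w powi n * eta2 \<sigma> powi n)"
      unfolding eta2_lower_unipotent[OF \<sigma>] w_def by (simp add: power_int_mult_distrib)
    ultimately have "ee (- 1 / 12) powi n = 1"
      using w eta2_nonzero[OF \<sigma>] by simp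
    then have "ee (of_int (- n) / of_nat 12) = 1" by (simp flip: ee_of_int_mult)
    then show ?thesis by (subst (asm) ee_rational_eq_1_iff) simp_all
  qed
  have "ee (of_int (\<Sum>j=1..N div 2. a j * (int j * int N + int j ^ 2)) / of_nat (2 * N)) = 1"
  proof -
    have "(1, 1, 0, 1) \<in> Gamma1 N" by (simp add: Gamma1_def SL2Z_def cong_0_iff)
    then have "slash k (theta_product N (2 * k) a) (1, 1, 0, 1) \<i> = theta_product N (2 * k) a \<i>"
      using L by simp
    then have "theta_product N (2 * k) a (\<i> + 1) = theta_product N (2 * k) a \<i>"
      by (simp add: slash_def)
    moreover have "theta_product N (2 * k) a (\<i> + 1) = eta2 (\<sigma> + of_nat N) powi n *
       ee (of_int (\<Sum>j=1..N div 2. a j * (int j * int N + int j ^ 2)) / of_nat (2 * N)) * K"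
      using theta_product_Gamma1[OF N, of \<i> 0 1 1 0 k a]
      by (simp add: \<sigma>_def n_def K_def shift_exponent_def mult.commute)
    \<comment> \<open>The factor \<eta>^2 contributes e(N n / 12), which is 1 by the divisibility
      just obtained.\<close>
    moreover have "eta2 (\<sigma> + of_nat N) powi n = eta2 \<sigma> powi n"
    proof -
      have "eta2 (\<sigma> + of_nat l) = ee (of_nat l * (1 / 12)) * eta2 \<sigma>" for l
      proof (induction l)
        case (Suc l)
        have "eta2 (\<sigma> + of_nat (Suc l)) = eta2 ((\<sigma> + of_nat l) + 1)" by (simp add: algebra_simps)
        then show ?case by (simp only: eta2_add_1 Suc ee_of_nat_mult power_Suc mult.assoc)
      qed simp
      then have "eta2 (\<sigma> + of_nat N) = ee (1 / 12) ^ N * eta2 \<sigma>" by (simp only: ee_of_nat_mult)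
      moreover have "(x ^ N) powi n = (x powi n) ^ N" for x :: complex
        by (simp only: power_int_of_nat[symmetric] power_int_mult[symmetric] mult.commute)
      ultimately have "eta2 (\<sigma> + of_nat N) powi n = (ee (1 / 12) powi n) ^ N * eta2 \<sigma> powi n"
        by (simp only: power_int_mult_distrib)
      moreover have "ee (1 / 12) powi n = 1"
      proof -
        have "ee (of_int n / of_nat 12) = 1" by (subst ee_rational_eq_1_iff) (use n12 in simp_all)
        then show ?thesis by (simp flip: ee_of_int_mult)
      qed
      ultimately show ?thesis by simp
    qed
    ultimately have "eta2 \<sigma> powi n * ee (of_int (\<Sum>j=1..N div 2. a j * (int j * int N + int j ^ 2)) / of_nat (2 * N)) * K =
        eta2 \<sigma> powi n * K"
      by (simp only: \<theta>)
    then show ?thesis using \<theta>0 K eta2_nonzero[OF \<sigma>] by (simp del: of_int_sum)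
  qed
  then have "int (2 * N) dvd (\<Sum>j=1..N div 2. a j * (int j * int N + int j ^ 2))"
    by (subst (asm) ee_rational_eq_1_iff) (use N in simp_all)
  then show ?R
    using n12 dvd_sum_shift_exponent_iff[OF N] unfolding n_def by blast
next
  assume R: ?R
  then obtain l where l: "int k + (\<Sum>j=1..N div 2. a j) = 12 * l" by auto
  have div: "int (2 * N) dvd (\<Sum>j=1..N div 2. a j * (int j * int N + int j ^ 2))"
    using R dvd_sum_shift_exponent_iff[OF N] by blast
  show ?L
  proof (intro ballI)
    fix \<gamma> \<tau> assume \<gamma>: "\<gamma> \<in> Gamma1 N" and "\<tau> \<in> upper_half_plane"
    then have \<tau>: "Im \<tau> > 0" by simp
    obtain p q r s where \<gamma>': "\<gamma> = (p, q, r, s)" by (cases \<gamma>)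
    obtain t c where t: "p = 1 + int N * t" and c: "r = int N * c"
      and det: "(1 + int N * t) * s - (int N * q) * c = 1"
      using theta_product_mem_Gamma1[OF N, of p q r s] \<gamma> \<gamma>' by auto
    define \<sigma> where "\<sigma> = of_nat N * \<tau>"
    have \<sigma>: "Im \<sigma> > 0" using N \<tau> by (simp add: \<sigma>_def)
    define w where "w = of_int (int N * c) * \<tau> + of_int s"
    have w': "w = of_int c * \<sigma> + of_int s" by (simp add: w_def \<sigma>_def)
    have w: "w \<noteq> 0" unfolding w' by (rule moebius_denom_nonzero[OF det \<sigma>])
    define S where "S = (\<Sum>j=1..N div 2. a j)"
    have "(\<Sum>j=1..N div 2. a j * shift_exponent N t q j) =
       q * (\<Sum>j=1..N div 2. a j * (int j * int N + int j ^ 2)) +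
       int N * (t * (\<Sum>j=1..N div 2. a j * (int j + int j ^ 2 * q)))"
      by (simp add: shift_exponent_def sum_distrib_left algebra_simps power2_eq_square flip: sum.distrib)
    \<comment> \<open>The part of the exponent beyond the translation carries the factor N, so only
      parity matters. If t is odd and q even, the determinant forces N to be even, and then the
      congruence for the squares yields the parity.\<close>
    moreover have "even (t * (\<Sum>j=1..N div 2. a j * (int j + int j ^ 2 * q)))"
    proof (cases "even t \<or> odd q")
      case True
      then show ?thesis
      proof
        assume "odd q"
        then have "even (\<Sum>j=1..N div 2. a j * (int j + int j ^ 2 * q))" by (intro dvd_sum) simp
        then show ?thesis by simp
      qed simp
    next
      case False
      then have "odd (1 + int N * t)" using det by (metis dvd_diff even_mult_iff odd_one)
      then have "even N" using False by simp
      moreover have "even (\<Sum>j=1..N div 2. int j ^ 2 * a j)"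
        using R \<open>even N\<close> by (auto intro: dvd_trans[of 2 "int (N * gcd 2 N)"])
      moreover have "even ((\<Sum>j=1..N div 2. a j * (int j + int j ^ 2 * q)) - (\<Sum>j=1..N div 2. int j ^ 2 * a j))"
        unfolding sum_subtractf[symmetric] using False by (intro dvd_sum) auto
      ultimately show ?thesis by simp
    qed
    ultimately have dv: "int (2 * N) dvd (\<Sum>j=1..N div 2. a j * shift_exponent N t q j)"
      using div by (auto elim!: evenE intro!: dvd_add dvd_mult)
    have "ee (of_int (\<Sum>j=1..N div 2. a j * shift_exponent N t q j) / of_nat (2 * N)) = 1"
      using N dv by (subst ee_rational_eq_1_iff) auto
    then have ee1: "ee (of_int (\<Sum>j=1..N div 2. a j * shift_exponent N t q j) / (2 * of_nat N)) = 1"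
      by simp
    have p12: "x powi (12 * l) = (x ^ 12) powi l" for x :: complex
      by (simp add: power_int_mult)
    have et: "eta2 ((of_int (1 + int N * t) * \<sigma> + of_int (int N * q)) / (of_int c * \<sigma> + of_int s)) powi (int k + S) =
       w powi (int k + S) * eta2 \<sigma> powi (int k + S)"
      unfolding l[folded S_def] p12 eta2_power_12_modular[OF det \<sigma>] w' by (simp add: power_int_mult_distrib)
    have "theta_product N (2 * k) a ((of_int p * \<tau> + of_int q) / w) =
       w powi (int k + S) * eta2 \<sigma> powi (int k + S) *
       (\<Prod>j=1..N div 2. klein (real j / real N) 0 \<sigma> powi a j) / w powi S"
      using theta_product_Gamma1[OF N \<tau> det, of k a]
      unfolding w_def[symmetric] \<sigma>_def[symmetric] S_def[symmetric] ee1 et t by simp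
    also have "\<dots> = w ^ k * theta_product N (2 * k) a \<tau>"
      unfolding theta_product_eq_klein_product[OF N \<tau>] klein_product_def \<sigma>_def[symmetric] S_def[symmetric]
      using w by (simp add: power_int_add)
    finally show "slash k (theta_product N (2 * k) a) \<gamma> \<tau> = theta_product N (2 * k) a \<tau>"
      using w by (simp add: slash_def \<gamma>' c w_def)
  qed
qed

section \<open>Growth at the cusps\<close>

definition decays_like :: "(complex \<Rightarrow> real) \<Rightarrow> real \<Rightarrow> bool" where
  "decays_like f e \<longleftrightarrow> (\<exists>c>0. \<exists>C>0. \<forall>\<tau>. Im \<tau> \<ge> 1 \<longrightarrow>
     c * exp (- 2 * pi * e * Im \<tau>) \<le> f \<tau> \<and> f \<tau> \<le> C * exp (- 2 * pi * e * Im \<tau>))"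

lemma decays_likeI:
  assumes "c > 0" "\<And>\<tau>. Im \<tau> \<ge> 1 \<Longrightarrow> c * exp (- 2 * pi * e * Im \<tau>) \<le> f \<tau>"
    "\<And>\<tau>. Im \<tau> \<ge> 1 \<Longrightarrow> f \<tau> \<le> C * exp (- 2 * pi * e * Im \<tau>)"
  shows "decays_like f e"
proof -
  have "Im \<i> \<ge> 1" by simp
  then have "c * exp (- 2 * pi * e * Im \<i>) \<le> C * exp (- 2 * pi * e * Im \<i>)"
    using assms(2,3) order.trans by blast
  then have "C > 0" using assms(1) by simp
  then show ?thesis unfolding decays_like_def using assms by blast
qed

lemma decays_like_mult:
  assumes "decays_like f d" "decays_like g e"
  shows "decays_like (\<lambda>\<tau>. f \<tau> * g \<tau>) (d + e)"
proof -
  obtain c C where f: "c > 0" "C > 0" "\<And>\<tau>. Im \<tau> \<ge> 1 \<Longrightarrow> c * exp (- 2 * pi * d * Im \<tau>) \<le> f \<tau>"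
    "\<And>\<tau>. Im \<tau> \<ge> 1 \<Longrightarrow> f \<tau> \<le> C * exp (- 2 * pi * d * Im \<tau>)"
    using assms(1) unfolding decays_like_def by blast
  obtain b B where g: "b > 0" "B > 0" "\<And>\<tau>. Im \<tau> \<ge> 1 \<Longrightarrow> b * exp (- 2 * pi * e * Im \<tau>) \<le> g \<tau>"
    "\<And>\<tau>. Im \<tau> \<ge> 1 \<Longrightarrow> g \<tau> \<le> B * exp (- 2 * pi * e * Im \<tau>)"
    using assms(2) unfolding decays_like_def by blast
  have E: "x * y * exp (- 2 * pi * (d + e) * t) = (x * exp (- 2 * pi * d * t)) * (y * exp (- 2 * pi * e * t))" for x y t
    by (simp add: algebra_simps flip: exp_add)
  show ?thesis
  proof (rule decays_likeI)
    show "c * b > 0" using f g by simp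
    fix \<tau> assume \<tau>: "Im \<tau> \<ge> 1"
    have pos: "0 \<le> c * exp (- 2 * pi * d * Im \<tau>)" "0 \<le> b * exp (- 2 * pi * e * Im \<tau>)" using f g by auto
    show "c * b * exp (- 2 * pi * (d + e) * Im \<tau>) \<le> f \<tau> * g \<tau>"
      unfolding E using f(3)[OF \<tau>] g(3)[OF \<tau>] pos by (intro mult_mono) linarith+
    show "f \<tau> * g \<tau> \<le> C * B * exp (- 2 * pi * (d + e) * Im \<tau>)"
      unfolding E using f(3,4)[OF \<tau>] g(3,4)[OF \<tau>] pos by (intro mult_mono) linarith+
  qed
qed

lemma decays_like_const: "c > 0 \<Longrightarrow> decays_like (\<lambda>_. c) 0"
  by (rule decays_likeI[of c _ _ c]) auto

lemma decays_like_power: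
  "decays_like f e \<Longrightarrow> decays_like (\<lambda>\<tau>. f \<tau> ^ n) (of_nat n * e)"
proof (induction n)
  case (Suc n)
  then show ?case using decays_like_mult[of f e "\<lambda>\<tau>. f \<tau> ^ n" "of_nat n * e"] by (simp add: algebra_simps)
qed (use decays_like_const[of 1] in simp)

text \<open>This is the reason for the two-sided form of \<open>decays_like\<close>: the bounds
  change places, so negative exponents are covered.\<close>

lemma decays_like_inverse:
  assumes "decays_like f e"
  shows "decays_like (\<lambda>\<tau>. inverse (f \<tau>)) (- e)"
proof -
  obtain c C where f: "c > 0" "C > 0" "\<And>\<tau>. Im \<tau> \<ge> 1 \<Longrightarrow> c * exp (- 2 * pi * e * Im \<tau>) \<le> f \<tau>"
    "\<And>\<tau>. Im \<tau> \<ge> 1 \<Longrightarrow> f \<tau> \<le> C * exp (- 2 * pi * e * Im \<tau>)"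
    using assms unfolding decays_like_def by blast
  have E: "inverse x * exp (- 2 * pi * - e * t) = inverse (x * exp (- 2 * pi * e * t))" for x t
    by (simp add: exp_minus)
  show ?thesis
  proof (rule decays_likeI)
    show "inverse C > 0" using f by simp
    fix \<tau> assume \<tau>: "Im \<tau> \<ge> 1"
    have pos: "0 < c * exp (- 2 * pi * e * Im \<tau>)" using f by auto
    show "inverse C * exp (- 2 * pi * - e * Im \<tau>) \<le> inverse (f \<tau>)"
      unfolding E using f(3,4)[OF \<tau>] pos by (intro le_imp_inverse_le) linarith+
    show "inverse (f \<tau>) \<le> inverse c * exp (- 2 * pi * - e * Im \<tau>)"
      unfolding E using f(3,4)[OF \<tau>] pos by (intro le_imp_inverse_le) linarith+
  qed
qed

lemma decays_like_power_int:
  assumes "decays_like f e"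
  shows "decays_like (\<lambda>\<tau>. f \<tau> powi n) (of_int n * e)"
proof (cases "n \<ge> 0")
  case True
  then show ?thesis using decays_like_power[OF assms, of "nat n"] by (simp add: power_int_def)
next
  case False
  then show ?thesis using decays_like_power[OF decays_like_inverse[OF assms], of "nat (- n)"]
    by (simp add: power_int_def)
qed

lemma decays_like_prod:
  assumes "finite A" "\<And>i. i \<in> A \<Longrightarrow> decays_like (f i) (e i)"
  shows "decays_like (\<lambda>\<tau>. \<Prod>i\<in>A. f i \<tau>) (\<Sum>i\<in>A. e i)"
  using assms
proof (induction A rule: finite_induct)
  case (insert x F)
  then show ?case using decays_like_mult[of "f x" "e x"] by simp
qed (use decays_like_const[of 1] in simp)

lemma klein_decays_like:
  assumes uv: "\<not> (u \<in> \<int> \<and> v \<in> \<int>)"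
  shows "decays_like (\<lambda>\<tau>. norm (klein u v \<tau>)) (B2 (frac u) / 2 - 1 / 12)"
proof -
  obtain c C where *: "c > 0"
    "\<And>\<tau>. Im \<tau> \<ge> 1 \<Longrightarrow> c * exp (- pi * Im \<tau> * (B2 (frac u) - 1 / 6)) \<le> norm (klein u v \<tau>)"
    "\<And>\<tau>. Im \<tau> \<ge> 1 \<Longrightarrow> norm (klein u v \<tau>) \<le> C * exp (- pi * Im \<tau> * (B2 (frac u) - 1 / 6))"
    using klein_bounds[OF uv] by metis
  have E: "- 2 * pi * (B2 (frac u) / 2 - 1 / 12) * t = - pi * t * (B2 (frac u) - 1 / 6)" for t
    by (simp add: algebra_simps)
  show ?thesis
    using * by (intro decays_likeI[of c _ _ C]) (simp_all only: E)
qed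

lemma eta2_decays_like: "decays_like (\<lambda>\<tau>. norm (eta2 \<tau>)) (1 / 12)"
proof -
  obtain c C where *: "c > 0"
    "\<And>\<tau>. Im \<tau> \<ge> 1 \<Longrightarrow> c * exp (- pi * Im \<tau> / 6) \<le> norm (eta2 \<tau>)"
    "\<And>\<tau>. Im \<tau> \<ge> 1 \<Longrightarrow> norm (eta2 \<tau>) \<le> C * exp (- pi * Im \<tau> / 6)"
    using eta2_bounds by metis
  then show ?thesis by (intro decays_likeI[of c _ _ C]) simp_all
qed

lemma decays_like_bounded_iff:
  assumes f: "decays_like f e"
  shows "(\<exists>C Y. \<forall>\<tau>. Im \<tau> \<ge> Y \<longrightarrow> f \<tau> \<le> C) \<longleftrightarrow> 0 \<le> e"
proof
  obtain c C where *: "c > 0" "C > 0" "\<And>\<tau>. Im \<tau> \<ge> 1 \<Longrightarrow> c * exp (- 2 * pi * e * Im \<tau>) \<le> f \<tau>"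
    "\<And>\<tau>. Im \<tau> \<ge> 1 \<Longrightarrow> f \<tau> \<le> C * exp (- 2 * pi * e * Im \<tau>)"
    using f unfolding decays_like_def by blast
  { assume "0 \<le> e"
    have "f \<tau> \<le> C" if "Im \<tau> \<ge> 1" for \<tau>
    proof -
      have "C * exp (- 2 * pi * e * Im \<tau>) \<le> C * 1"
        using \<open>0 \<le> e\<close> that *(2) by (intro mult_left_mono) auto
      then show ?thesis using *(4)[OF that] by simp
    qed
    then show "\<exists>C Y. \<forall>\<tau>. Im \<tau> \<ge> Y \<longrightarrow> f \<tau> \<le> C" by blast }
  assume "\<exists>C Y. \<forall>\<tau>. Im \<tau> \<ge> Y \<longrightarrow> f \<tau> \<le> C"
  then obtain D Y where D: "\<And>\<tau>. Im \<tau> \<ge> Y \<Longrightarrow> f \<tau> \<le> D" by blast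
  show "0 \<le> e"
  proof (rule ccontr)
    assume "\<not> 0 \<le> e"
    then have e: "- (2 * pi * e) > 0" by (simp add: mult_pos_neg)
    \<comment> \<open>Large enough that the inequality 1 + x \<le> exp x alone pushes the value at i
      y above D.\<close>
    define y where "y = max (max 1 Y) (\<bar>D\<bar> / c / (- (2 * pi * e)))"
    have y: "y \<ge> 1" "y \<ge> Y" "\<bar>D\<bar> / c / (- (2 * pi * e)) \<le> y" by (auto simp: y_def)
    have "\<bar>D\<bar> / c \<le> y * (- (2 * pi * e))" using y(3) by (subst (asm) pos_divide_le_eq[OF e])
    also have "\<dots> < exp (- 2 * pi * e * y)"
      using exp_ge_add_one_self[of "- 2 * pi * e * y"] by (simp add: mult_ac)
    finally have "\<bar>D\<bar> < c * exp (- 2 * pi * e * y)"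
      using *(1) by (simp add: pos_divide_less_eq mult.commute)
    also have "\<dots> \<le> f (Complex 0 y)" using *(3)[of "Complex 0 y"] y by simp
    also have "\<dots> \<le> D" using D[of "Complex 0 y"] y by simp
    finally show False by simp
  qed
qed

text \<open>The order of vanishing at the cusp up to a positive factor, measured in the coordinate
  \<tau>' of the next lemma. The -1/12 of each Klein form cancels against the 1/12 that \<eta>^2
  contributes for each unit of \<open>a j\<close>, so that only k / 12 is left.\<close>

definition cusp_order :: "nat \<Rightarrow> nat \<Rightarrow> (nat \<Rightarrow> int) \<Rightarrow> int \<Rightarrow> int \<Rightarrow> real" where
  "cusp_order N k a p g = real k / 12 + 1 / 2 * (\<Sum>j=1..N div 2. of_int (a j) * B2 (frac (real j * of_int p / of_int g)))"

lemma Im_affine_int: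
  "Im ((of_int g * \<tau> + of_int B) / of_int D) = of_int g * Im \<tau> / of_int D"
proof -
  have "(of_int g * \<tau> + of_int B) / of_int D = (of_int g * \<tau> + of_int B) / of_real (real_of_int D)" by simp
  then show ?thesis by (simp only: Im_divide_of_real) simp
qed

text \<open>Because of the argument N \<tau>, the matrix to decompose is (N p, N q; r, s) = (x, y;
  z, v) (g, B; 0, D) with the first factor in SL_2(Z). The modular laws for that factor apply at
  \<tau>' = (g \<tau> + B) / D, and Im \<tau>' is a positive multiple of Im \<tau>.\<close>

lemma slash_theta_product_bounded_iff:
  assumes N: "N > 0" and \<gamma>: "(p, q, r, s) \<in> SL2Z"
  shows "(\<exists>C Y. \<forall>\<tau>\<in>upper_half_plane. Im \<tau> \<ge> Y \<longrightarrow> norm (slash k (theta_product N (2 * k) a) (p, q, r, s) \<tau>) \<le> C)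
     \<longleftrightarrow> 0 \<le> cusp_order N k a p (gcd r (int N))"
proof -
  have det: "p * s - q * r = 1" using \<gamma> by (simp add: SL2Z_def)
  define g where "g = gcd r (int N)"
  have g: "g > 0" using N by (simp add: g_def)
  obtain z where z: "r = g * z" unfolding g_def by (metis dvdE gcd_dvd1)
  obtain D where D: "int N = g * D" unfolding g_def by (metis dvdE gcd_dvd2)
  have Dpos: "D > 0" using N g D by (metis of_nat_0_less_iff zero_less_mult_pos)
  have zD: "coprime z D"
  proof -
    have "z = r div g" "D = int N div g" using g by (simp_all add: z D)
    then show ?thesis unfolding g_def using N by (simp only:) (rule div_gcd_coprime, simp)
  qed
  \<comment> \<open>Bezout for the coprime numbers z and D solves the bottom row; the top row then
    determines x and y.\<close>
  obtain B v where Bv: "z * B + v * D = s"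
  proof -
    obtain u w where uw: "u * z + w * D = 1" using zD bezout_int[of z D] by auto
    have "z * (u * s) + (w * s) * D = (u * z + w * D) * s" by (simp add: algebra_simps)
    also have "\<dots> = s" by (simp add: uw)
    finally show ?thesis using that by blast
  qed
  define x y where "x = p * D" and "y = g * q - p * B"
  have det2: "x * v - y * z = 1"
  proof -
    have "x * v - y * z = p * (z * B + v * D) - q * (g * z)" by (simp add: x_def y_def algebra_simps)
    then show ?thesis using det by (simp add: Bv z)
  qed
  have xy: "coprime x y"
  proof (rule coprimeI)
    fix d assume "d dvd x" "d dvd y"
    then have "d dvd x * v - y * z" by simp
    then show "is_unit d" by (simp add: det2)
  qed
  define n where "n = int k + (\<Sum>j=1..N div 2. a j)"
  define G where "G = (\<lambda>\<tau>. (1 / real_of_int D) ^ k * (norm (eta2 \<tau>) powi n *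
     (\<Prod>j=1..N div 2. norm (klein (real j / real N * of_int x) (real j / real N * of_int y) \<tau>) powi a j)))"
  have eq: "norm (slash k (theta_product N (2 * k) a) (p, q, r, s) \<tau>) = G ((of_int g * \<tau> + of_int B) / of_int D)"
    if \<tau>: "Im \<tau> > 0" for \<tau>
  proof -
    define \<tau>' where "\<tau>' = (of_int g * \<tau> + of_int B) / of_int D"
    have \<tau>': "Im \<tau>' > 0" using g Dpos \<tau> by (simp add: \<tau>'_def Im_affine_int)
    define w where "w = of_int r * \<tau> + of_int s"
    have w: "w \<noteq> 0" unfolding w_def by (rule moebius_denom_nonzero[OF det \<tau>])
    define w'' where "w'' = of_int z * \<tau>' + of_int v"
    have "of_int D * w'' = of_int z * (of_int D * \<tau>') + of_int (v * D)" by (simp add: w''_def algebra_simps)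
    also have "of_int D * \<tau>' = of_int g * \<tau> + of_int B" using Dpos by (simp add: \<tau>'_def)
    also have "of_int z * (of_int g * \<tau> + of_int B) + of_int (v * D) = of_int (g * z) * \<tau> + of_int (z * B + v * D)"
      by (simp add: algebra_simps)
    also have "\<dots> = w" by (simp only: z[symmetric] Bv w_def)
    finally have ww: "w = of_int D * w''" by simp
    then have w'': "w'' \<noteq> 0" using w by auto
    have "of_nat N * ((of_int p * \<tau> + of_int q) / w) = of_int (int N) * (of_int p * \<tau> + of_int q) / w" by simp
    also have "\<dots> = of_int g * (of_int p * \<tau> + of_int q) / w''"
      unfolding ww D using Dpos w'' by simp
    also have "of_int g * (of_int p * \<tau> + of_int q) = of_int x * \<tau>' + of_int y"
      using Dpos by (simp add: x_def y_def \<tau>'_def field_simps)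
    finally have tr: "of_nat N * ((of_int p * \<tau> + of_int q) / w) = (of_int x * \<tau>' + of_int y) / w''" .
    have "Im ((of_int p * \<tau> + of_int q) / w) > 0" unfolding w_def by (rule Im_moebius_pos[OF det \<tau>])
    then have "slash k (theta_product N (2 * k) a) (p, q, r, s) \<tau> = klein_product N k a ((of_int x * \<tau>' + of_int y) / w'') / w ^ k"
      unfolding slash_def by (simp only: prod.case w_def[symmetric] theta_product_eq_klein_product[OF N] tr)
    also have "norm \<dots> = (norm w'' * norm (eta2 \<tau>')) powi n *
        (\<Prod>j=1..N div 2. (norm (klein (real j / real N * of_int x) (real j / real N * of_int y) \<tau>') / norm w'') powi a j) / norm w ^ k"
      unfolding klein_product_def w''_def norm_mult norm_divide norm_power norm_power_int prod_norm[symmetric]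
        norm_eta2_modular[OF det2 \<tau>'] klein_modular[OF det2 \<tau>'] n_def by simp
    also have "\<dots> = G \<tau>'"
    proof -
      have nw: "norm w'' \<noteq> 0" using w'' by simp
      have "(norm w'') powi n = norm w'' ^ k * norm w'' powi (\<Sum>j=1..N div 2. a j)"
        using nw by (simp add: n_def power_int_add)
      moreover have "(\<Prod>j=1..N div 2. norm w'' powi a j) = norm w'' powi (\<Sum>j=1..N div 2. a j)"
        using nw by (simp add: power_int_sum)
      moreover have "(W ^ k * S * A) * (P / S) / (of_int D ^ k * W ^ k) = (1 / of_int D) ^ k * (A * P)"
        if "W \<noteq> 0" "S \<noteq> 0" for W S A P :: real
        using that by (simp add: power_one_over)
      moreover have "norm (complex_of_int D) = of_int D" using Dpos by simp
      ultimately show ?thesis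
        using nw unfolding G_def ww norm_mult power_mult_distrib power_int_mult_distrib power_int_divide_distrib prod_dividef
        by (simp only: power_int_not_zero simp_thms)
    qed
    finally show ?thesis unfolding \<tau>'_def .
  qed
  have fr: "frac (real j / real N * of_int x) = frac (real j * of_int p / of_int g)" for j
  proof -
    have "real N = of_int g * of_int D" using D by (metis of_int_mult of_int_of_nat_eq)
    then show ?thesis using Dpos g by (simp add: x_def field_simps)
  qed
  have dec: "decays_like G (cusp_order N k a p g)"
  proof -
    have "decays_like G (0 + (of_int n * (1 / 12) + (\<Sum>j=1..N div 2. of_int (a j) *
        (B2 (frac (real j / real N * of_int x)) / 2 - 1 / 12))))"
      unfolding G_def using Dpos klein_index_nonint[OF xy]
      by (intro decays_like_mult decays_like_prod decays_like_power_int eta2_decays_like klein_decays_like decays_like_const) auto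
    also have "0 + (of_int n * (1 / 12) + (\<Sum>j=1..N div 2. of_int (a j) *
        (B2 (frac (real j / real N * of_int x)) / 2 - 1 / 12))) = cusp_order N k a p g"
      unfolding cusp_order_def n_def fr
      by (simp add: algebra_simps sum_subtractf sum_divide_distrib sum_distrib_left flip: sum_divide_distrib)
    finally show ?thesis .
  qed
  have "(\<exists>C Y. \<forall>\<tau>\<in>upper_half_plane. Im \<tau> \<ge> Y \<longrightarrow> norm (slash k (theta_product N (2 * k) a) (p, q, r, s) \<tau>) \<le> C)
     \<longleftrightarrow> (\<exists>C Y. \<forall>\<tau>. Im \<tau> \<ge> Y \<longrightarrow> G \<tau> \<le> C)"
  proof
    assume "\<exists>C Y. \<forall>\<tau>\<in>upper_half_plane. Im \<tau> \<ge> Y \<longrightarrow> norm (slash k (theta_product N (2 * k) a) (p, q, r, s) \<tau>) \<le> C"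
    then obtain C Y where CY: "\<And>\<tau>. Im \<tau> > 0 \<Longrightarrow> Im \<tau> \<ge> Y \<Longrightarrow> G ((of_int g * \<tau> + of_int B) / of_int D) \<le> C"
      using eq unfolding Ball_def upper_half_plane_iff by metis
    have "G \<tau> \<le> C" if "Im \<tau> \<ge> max 1 (Y * g / D)" for \<tau>
    proof -
      define t where "t = (of_int D * \<tau> - of_int B) / of_int g"
      have Imt: "Im t = D * Im \<tau> / g" using Im_affine_int[of D \<tau> "- B" g] by (simp add: t_def)
      have "\<tau> = (of_int g * t + of_int B) / of_int D" using g Dpos by (simp add: t_def)
      moreover have "Im t > 0" using that g Dpos by (simp add: Imt)
      moreover have "Im t \<ge> Y" using that g Dpos by (simp add: Imt field_simps)
      ultimately show ?thesis using CY by metis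
    qed
    then show "\<exists>C Y. \<forall>\<tau>. Im \<tau> \<ge> Y \<longrightarrow> G \<tau> \<le> C" by blast
  next
    assume "\<exists>C Y. \<forall>\<tau>. Im \<tau> \<ge> Y \<longrightarrow> G \<tau> \<le> C"
    then obtain C Y where CY: "\<And>\<tau>. Im \<tau> \<ge> Y \<Longrightarrow> G \<tau> \<le> C" by blast
    have "norm (slash k (theta_product N (2 * k) a) (p, q, r, s) \<tau>) \<le> C" if "Im \<tau> > 0" "Im \<tau> \<ge> Y * D / g" for \<tau>
      unfolding eq[OF that(1)] using that(2) g Dpos
      by (intro CY) (simp add: Im_affine_int field_simps)
    then show "\<exists>C Y. \<forall>\<tau>\<in>upper_half_plane. Im \<tau> \<ge> Y \<longrightarrow> norm (slash k (theta_product N (2 * k) a) (p, q, r, s) \<tau>) \<le> C"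
      unfolding Ball_def upper_half_plane_iff by blast
  qed
  then show ?thesis using decays_like_bounded_iff[OF dec] by (simp add: g_def)
qed

text \<open>The order depends only on the first column (p, r), and the coprime pairs are exactly the
  columns that extend to a matrix of SL_2(Z).\<close>

theorem theta_product_modular_iff:
  assumes N: "N > 0"
  shows "theta_product N (2 * k) a \<in> modular_forms k N \<longleftrightarrow>
     12 dvd int k + (\<Sum>j=1..N div 2. a j) \<and> int (N * gcd 2 N) dvd (\<Sum>j=1..N div 2. int j ^ 2 * a j) \<and>
     (\<forall>p r. coprime p r \<longrightarrow> 0 \<le> cusp_order N k a p (gcd r (int N)))"
proof -
  have "(\<forall>\<gamma>\<in>SL2Z. \<exists>C Y. \<forall>\<tau>\<in>upper_half_plane. Im \<tau> \<ge> Y \<longrightarrow> norm (slash k (theta_product N (2 * k) a) \<gamma> \<tau>) \<le> C)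
    \<longleftrightarrow> (\<forall>p q r s. (p, q, r, s) \<in> SL2Z \<longrightarrow> 0 \<le> cusp_order N k a p (gcd r (int N)))"
    using slash_theta_product_bounded_iff[OF N, of _ _ _ _ k a] by (auto simp: Ball_def split_paired_All)
  also have "\<dots> \<longleftrightarrow> (\<forall>p r. coprime p r \<longrightarrow> 0 \<le> cusp_order N k a p (gcd r (int N)))"
  proof -
    have "coprime p r \<longleftrightarrow> (\<exists>q s. (p, q, r, s) \<in> SL2Z)" for p r
    proof
      assume "coprime p r"
      then obtain u v where "u * p + v * r = 1" by (metis bezout_int coprime_iff_gcd_eq_1)
      then have "(p, - v, r, u) \<in> SL2Z" by (simp add: SL2Z_def algebra_simps)
      then show "\<exists>q s. (p, q, r, s) \<in> SL2Z" by blast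
    next
      assume "\<exists>q s. (p, q, r, s) \<in> SL2Z"
      then obtain q s where "p * s - q * r = 1" by (auto simp: SL2Z_def)
      then show "coprime p r" by (metis coprimeI dvd_diff dvd_mult dvd_mult2)
    qed
    then show ?thesis by blast
  qed
  finally show ?thesis
    using slash_theta_product_invariant_iff[OF N, of k a] theta_product_holomorphic[OF N]
    unfolding modular_forms_def by blast
qed

section \<open>Independence of the Bernoulli functions\<close>

lemma sum_ee_residues:
  fixes y :: int
  assumes N: "N > 0"
  shows "(\<Sum>l<N. ee (of_int y * of_nat l / of_nat N)) = (if int N dvd y then of_nat N else 0)"
proof -
  define x where "x = ee (of_int y / of_nat N)"
  have pw: "ee (of_int y * of_nat l / of_nat N) = x ^ l" for l
    by (simp add: x_def mult.commute flip: ee_of_nat_mult)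
  have xN: "x ^ N = 1" using N by (simp add: x_def flip: ee_of_nat_mult)
  have x1: "x = 1 \<longleftrightarrow> int N dvd y"
  proof
    assume "x = 1"
    then obtain l where "complex_of_int y / of_nat N = of_int l"
      by (auto simp: x_def ee_eq_1_iff elim!: Ints_cases)
    then have "complex_of_int y = of_int (int N * l)" using N by (simp add: field_simps)
    then show "int N dvd y" by (simp only: of_int_eq_iff) simp
  next
    assume "int N dvd y"
    then obtain l where "y = int N * l" by blast
    then have "complex_of_int y / of_nat N = of_int l" using N by simp
    then show "x = 1" by (simp add: x_def)
  qed
  show ?thesis
  proof (cases "x = 1")
    case True
    then show ?thesis using x1 by (simp add: pw)
  next
    case False
    then show ?thesis using x1 xN by (simp add: pw geometric_sum)
  qed
qed

section \<open>Finite Fourier expansion of B_2\<close>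

definition sin_weight :: "nat \<Rightarrow> nat \<Rightarrow> real" where
  "sin_weight N l = 1 / (2 * sin (pi * real l / real N) ^ 2)"

definition sin_sum :: "nat \<Rightarrow> int \<Rightarrow> complex" where
  "sin_sum N y = (\<Sum>l=1..<N. of_real (sin_weight N l) * ee (of_int y * of_nat l / of_nat N))"

text \<open>The factor N^2 makes the second differences equal to 2 off the multiples of N, and
  subtracting 1/6 makes the mean over a period vanish.\<close>

definition scaled_B2 :: "nat \<Rightarrow> int \<Rightarrow> real" where
  "scaled_B2 N y = real N ^ 2 * B2 (frac (of_int y / real N)) - 1 / 6"

lemma sin_pos: "0 < l \<Longrightarrow> l < N \<Longrightarrow> sin (pi * real l / real N) > 0"
  by (intro sin_gt_zero) (simp_all add: field_simps)

lemma ee_add_minus: "ee (of_real x) + ee (- of_real x) = of_real (2 - 4 * sin (pi * x) ^ 2)"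
proof -
  have "ee (of_real x) + ee (- of_real x) = 2 * cos (of_real (2 * (pi * x)))"
    by (simp add: ee_def cos_exp_eq mult_ac)
  also have "\<dots> = of_real (2 * cos (2 * (pi * x)))" unfolding cos_of_real by simp
  finally show ?thesis by (simp add: cos_double_sin)
qed

text \<open>On e(y l / N) the second difference acts as -4 sin^2(\<pi> l / N), which the weight
  turns into -2 for every l; a geometric sum remains.\<close>

lemma sin_sum_second_difference:
  assumes N: "N > 0"
  shows "sin_sum N (y + 1) - 2 * sin_sum N y + sin_sum N (y - 1) = of_real (if int N dvd y then 2 - 2 * real N else 2)"
proof -
  have "sin_sum N (y + 1) - 2 * sin_sum N y + sin_sum N (y - 1) =
    (\<Sum>l=1..<N. - 2 * ee (of_int y * of_nat l / of_nat N))"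
    unfolding sin_sum_def sum_distrib_left sum_subtractf[symmetric] sum.distrib[symmetric]
  proof (intro sum.cong refl)
    fix l assume l: "l \<in> {1..<N}"
    define E where "E = ee (of_int y * of_nat l / of_nat N)"
    define x where "x = real l / real N"
    have x: "of_nat l / of_nat N = complex_of_real x" by (simp add: x_def)
    have "ee (of_int (y + 1) * of_nat l / of_nat N) = E * ee (of_real x)"
      "ee (of_int (y - 1) * of_nat l / of_nat N) = E * ee (- of_real x)"
      unfolding E_def x[symmetric] ee_add[symmetric] by (simp_all add: field_simps add_divide_distrib diff_divide_distrib)
    then have "of_real (sin_weight N l) * ee (of_int (y + 1) * of_nat l / of_nat N) - 2 * (of_real (sin_weight N l) * E) +
       of_real (sin_weight N l) * ee (of_int (y - 1) * of_nat l / of_nat N) =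
       of_real (sin_weight N l) * E * (ee (of_real x) + ee (- of_real x) - 2)"
      by (simp add: algebra_simps)
    also have "\<dots> = of_real (sin_weight N l * (- 4 * sin (pi * x) ^ 2)) * E"
      unfolding ee_add_minus by simp
    also have "sin_weight N l * (- 4 * sin (pi * x) ^ 2) = - 2"
      using sin_pos[of l N] l by (simp add: sin_weight_def x_def)
    finally show "of_real (sin_weight N l) * ee (of_int (y + 1) * of_nat l / of_nat N) - 2 * (of_real (sin_weight N l) * E) +
       of_real (sin_weight N l) * ee (of_int (y - 1) * of_nat l / of_nat N) = - 2 * E" by simp
  qed
  also have "\<dots> = - 2 * (\<Sum>l=1..<N. ee (of_int y * of_nat l / of_nat N))" by (simp add: sum_distrib_left)
  also have "(\<Sum>l=1..<N. ee (of_int y * of_nat l / of_nat N)) = (\<Sum>l<N. ee (of_int y * of_nat l / of_nat N)) - 1"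
    using N by (simp add: lessThan_atLeast0 sum.atLeast_Suc_lessThan)
  finally show ?thesis by (simp add: sum_ee_residues[OF N])
qed

lemma scaled_B2_mod: "N > 0 \<Longrightarrow> scaled_B2 N (y mod int N) = scaled_B2 N y"
proof -
  assume N: "N > 0"
  have "real_of_int y = of_int (y mod int N) + real N * of_int (y div int N)"
    by (metis mod_mult_div_eq of_int_add of_int_mult of_int_of_nat_eq)
  then have "of_int y / real N = of_int (y mod int N) / real N + of_int (y div int N)"
    using N by (simp add: add_divide_distrib)
  then have "frac (of_int y / real N) = frac (of_int (y mod int N) / real N)" by (simp add: frac_def)
  then show ?thesis by (simp add: scaled_B2_def)
qed

text \<open>The end point y = N is included, so that the second difference at N - 1 can be computed
  from the polynomial alone.\<close>

lemma scaled_B2_eq: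
  assumes "0 \<le> y" "y \<le> int N" and N: "N > 0"
  shows "scaled_B2 N y = of_int y ^ 2 - real N * of_int y + (real N ^ 2 - 1) / 6"
proof (cases "y = int N")
  case True
  then show ?thesis using N by (simp add: scaled_B2_def B2_def power2_eq_square field_simps)
next
  case False
  then have "frac (of_int y / real N) = of_int y / real N"
    using assms by (simp add: frac_eq)
  then show ?thesis using N unfolding scaled_B2_def B2_def
    by (simp only:) (simp add: power2_eq_square field_simps)
qed

lemma scaled_B2_second_difference:
  assumes N: "N > 0"
  shows "scaled_B2 N (y + 1) - 2 * scaled_B2 N y + scaled_B2 N (y - 1) = (if int N dvd y then 2 - 2 * real N else 2)"
proof -
  define x where "x = y mod int N"
  have x: "0 \<le> x" "x < int N" using N by (auto simp: x_def)
  have s: "scaled_B2 N (y + t) = scaled_B2 N (x + t)" for t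
    using scaled_B2_mod[OF N, of "y + t"] scaled_B2_mod[OF N, of "x + t"] by (simp add: x_def mod_add_left_eq)
  have dv: "int N dvd y \<longleftrightarrow> x = 0" by (simp add: x_def dvd_eq_mod_eq_0)
  define c where "c = (real N ^ 2 - 1) / 6"
  note eq = scaled_B2_eq[OF _ _ N, folded c_def]
  have "scaled_B2 N (x + 1) - 2 * scaled_B2 N x + scaled_B2 N (x - 1) = (if x = 0 then 2 - 2 * real N else 2)"
  proof (cases "x = 0")
    case True
    have "(- 1) mod int N = (int N - 1) mod int N" using mod_add_self1[of "int N" "-1"] by simp
    then have "scaled_B2 N (- 1) = scaled_B2 N (int N - 1)"
      using scaled_B2_mod[OF N, of "-1"] scaled_B2_mod[OF N, of "int N - 1"] by simp
    then show ?thesis using True N by (simp add: eq power2_eq_square algebra_simps)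
  next
    case False
    then show ?thesis using x N by (simp add: eq power2_eq_square algebra_simps)
  qed
  then show ?thesis using s[of 1] s[of 0] s[of "-1"] dv by simp
qed

lemma sum_scaled_B2:
  assumes N: "N > 0"
  shows "(\<Sum>y<N. scaled_B2 N (int y)) = 0"
proof -
  have "(\<Sum>y<n. real y ^ 2 - M * real y + c) = (real n - 1) * real n * (2 * real n - 1) / 6 - M * real n * (real n - 1) / 2 + real n * c" for n and M c :: real
    by (induction n) (simp_all add: field_simps power2_eq_square)
  note closed = this
  have "(\<Sum>y<N. scaled_B2 N (int y)) = (\<Sum>y<N. real y ^ 2 - real N * real y + (real N ^ 2 - 1) / 6)"
    using N by (intro sum.cong refl) (simp add: scaled_B2_eq)
  also have "\<dots> = 0"
    unfolding closed by (simp add: field_simps power2_eq_square)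
  finally show ?thesis .
qed

lemma sum_sin_sum:
  assumes N: "N > 0"
  shows "(\<Sum>y<N. sin_sum N (int y)) = 0"
proof -
  have "(\<Sum>y<N. sin_sum N (int y)) = (\<Sum>l=1..<N. of_real (sin_weight N l) * (\<Sum>y<N. ee (of_int (int l) * of_nat y / of_nat N)))"
    unfolding sin_sum_def sum_distrib_left by (subst sum.swap) (simp add: mult.commute)
  also have "\<dots> = 0"
    unfolding sum_ee_residues[OF N] by (intro sum.neutral) (auto dest: dvd_imp_le)
  finally show ?thesis .
qed

lemma sin_sum_period: "N > 0 \<Longrightarrow> sin_sum N (y + int N) = sin_sum N y"
  unfolding sin_sum_def
  by (intro sum.cong refl arg_cong[where f = "\<lambda>x. _ * x"] ee_cong) (simp add: field_simps)

text \<open>The finite Fourier expansion of \<open>B2\<close>: both sides are periodic with the same second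
  differences and the same mean.\<close>

lemma scaled_B2_eq_sin_sum:
  assumes N: "N > 0"
  shows "of_real (scaled_B2 N y) = sin_sum N y"
proof -
  define d where "d = (\<lambda>y. complex_of_real (scaled_B2 N y) - sin_sum N y)"
  have per: "d (y + int N) = d y" for y
    using scaled_B2_mod[OF N, of "y + int N"] scaled_B2_mod[OF N, of y] sin_sum_period[OF N, of y]
    by (simp add: d_def)
  have diff2: "d (y + 1) - d y = d y - d (y - 1)" for y
  proof -
    have "d (y + 1) - 2 * d y + d (y - 1) =
       of_real (scaled_B2 N (y + 1) - 2 * scaled_B2 N y + scaled_B2 N (y - 1)) -
       (sin_sum N (y + 1) - 2 * sin_sum N y + sin_sum N (y - 1))"
      by (simp add: d_def)
    also have "\<dots> = 0"
      unfolding sin_sum_second_difference[OF N] scaled_B2_second_difference[OF N] by simp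
    finally show ?thesis by (simp add: algebra_simps)
  qed
  define e where "e = d 1 - d 0"
  \<comment> \<open>Vanishing second differences make d linear on the naturals; periodicity then
    removes the slope, and the mean value the constant.\<close>
  have lin: "d (int n) = d 0 + of_nat n * e \<and> d (int n + 1) - d (int n) = e" for n
  proof (induction n)
    case (Suc n)
    then show ?case using diff2[of "int n + 1"] by (simp add: algebra_simps)
  qed (simp add: e_def)
  have "d (int N) = d 0" using per[of 0] by simp
  then have "e = 0" using lin[of N] N by simp
  then have c: "d (int n) = d 0" for n using lin[of n] by simp
  have "(\<Sum>y<N. d (int y)) = 0"
    unfolding d_def sum_subtractf sum_sin_sum[OF N] of_real_sum[symmetric] sum_scaled_B2[OF N] by simp
  then have "d 0 = 0" using N by (simp add: c)
  then have "d (int n) = 0" for n using c by simp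
  then have "d (y mod int N) = 0" using N by (metis nonneg_int_cases pos_mod_sign of_nat_0_less_iff)
  moreover have "d (y mod int N) = d y"
  proof -
    have "sin_sum N (y mod int N) = sin_sum N y"
      unfolding sin_sum_def
    proof (intro sum.cong refl arg_cong[where f = "\<lambda>x. _ * x"] ee_cong)
      fix l
      have "complex_of_int y = of_int (y mod int N) + of_nat N * of_int (y div int N)"
        by (metis mod_mult_div_eq of_int_add of_int_mult of_int_of_nat_eq)
      then have "of_int (y mod int N) * of_nat l / of_nat N - complex_of_int y * of_nat l / of_nat N = of_int (- (y div int N) * int l)"
        using N by (simp add: field_simps)
      then show "of_int (y mod int N) * of_nat l / of_nat N - complex_of_int y * of_nat l / of_nat N \<in> \<int>"
        by (simp only: Ints_of_int)
    qed
    then show ?thesis by (simp add: d_def scaled_B2_mod[OF N])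
  qed
  ultimately show ?thesis by (simp add: d_def)
qed

lemma B2_frac_uminus: "B2 (frac (- x)) = B2 (frac x)"
proof (cases "x \<in> \<int>")
  case False
  then show ?thesis by (simp add: frac_neg B2_def power2_eq_square algebra_simps)
next
  case True
  then have "frac x = 0" by (simp add: frac_eq_0_iff)
  then show ?thesis by (simp only: frac_neg True if_True)
qed

lemma B2_frac_add_int: "B2 (frac (x + of_int n)) = B2 (frac x)"
  by (simp add: frac_def)

text \<open>By sin x \<le> x it comes down to \<pi>^2 < 12. Compared with the total in
  \<open>sum_sin_weight\<close>, the frequencies 1 and N - 1 together carry more than half of all
  weight.\<close>

lemma sin_weight_1_gt:
  assumes N: "N \<ge> 2"
  shows "sin_weight N 1 > (real N ^ 2 - 1) / 24"
proof -
  have s: "0 < sin (pi / real N)" using sin_pos[of 1 N] N by simp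
  have "sin (pi / real N) \<le> pi / real N" using N by (intro sin_x_le_x) simp
  then have "sin (pi / real N) ^ 2 \<le> (pi / real N) ^ 2" using s by (intro power_mono) auto
  also have "\<dots> = pi ^ 2 / real N ^ 2" by (simp add: power_divide)
  also have "pi ^ 2 < 12"
  proof -
    have "pi < 3.2" using pi_approx by simp
    then have "pi * pi < 3.2 * 3.2" by (intro mult_strict_mono) auto
    then show ?thesis by (simp add: power2_eq_square)
  qed
  finally have "2 * sin (pi / real N) ^ 2 < 24 / real N ^ 2"
    using N by (simp add: divide_strict_right_mono)
  then have "real N ^ 2 / 24 < sin_weight N 1"
    unfolding sin_weight_def using s N by (simp add: field_simps)
  moreover have "(real N ^ 2 - 1) / 24 < real N ^ 2 / 24" by simp
  ultimately show ?thesis by linarith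
qed

lemma sum_sin_weight:
  assumes N: "N > 0"
  shows "(\<Sum>l=1..<N. sin_weight N l) = (real N ^ 2 - 1) / 6"
proof -
  have "complex_of_real (\<Sum>l=1..<N. sin_weight N l) = sin_sum N 0"
    by (simp add: sin_sum_def)
  also have "\<dots> = of_real (scaled_B2 N 0)" by (rule scaled_B2_eq_sin_sum[OF N, symmetric])
  also have "scaled_B2 N 0 = (real N ^ 2 - 1) / 6" using N by (subst scaled_B2_eq) simp_all
  finally show ?thesis by (simp only: of_real_eq_iff)
qed

text \<open>Used with t = l j: every j contributes to at most one s, so the transport of U by a
  frequency l does not increase its L^1 norm.\<close>

lemma card_residue_solutions:
  fixes t :: int
  shows "card {s\<in>{1..<N}. int N dvd t - int s} \<le> 1"
proof -
  have "s = s'" if s: "s \<in> {1..<N}" "s' \<in> {1..<N}" "int N dvd t - int s" "int N dvd t - int s'" for s s'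
  proof -
    have "int N dvd (t - int s') - (t - int s)" by (rule dvd_diff[OF s(4) s(3)])
    then have "int N dvd int s - int s'" by simp
    moreover have "\<bar>int s - int s'\<bar> < int N" using s by auto
    ultimately show ?thesis by (metis dvd_imp_le_int eq_iff_diff_eq_0 not_le of_nat_eq_iff abs_of_nat)
  qed
  then show ?thesis by (simp add: card_le_Suc0_iff_eq)
qed

text \<open>The Fourier coefficients of \<open>B2\<close> at the frequencies \<open>\<plusminus>1\<close> dominate all others together, so the
  averaging operator given by the multiples is invertible in the \<open>L\<^sup>1\<close> norm. This replaces the
  non-vanishing of \<open>L(2, \<chi>)\<close>.\<close>

lemma even_B2_combination_zero:
  fixes U :: "nat \<Rightarrow> real"
  assumes N: "N \<ge> 3" and U0: "U 0 = 0" and even: "\<And>s. 0 < s \<Longrightarrow> s < N \<Longrightarrow> U (N - s) = U s"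
    and zero: "\<And>X :: int. (\<Sum>j<N. U j * B2 (frac (real j * of_int X / real N))) = 0"
    and s: "s < N"
  shows "U s = 0"
proof -
  have N0: "N > 0" using N by simp
  define P where "P = (\<lambda>l j s :: nat. if int N dvd int l * int j - int s then 1 else 0 :: real)"
  \<comment> \<open>The s-th Fourier coefficient, as a function of X, of the vanishing combination.
    The constants 1/6 only affect the coefficient at 0, which 1 \<le> s < N excludes.\<close>
  have R: "(\<Sum>l=1..<N. sin_weight N l * (\<Sum>j<N. U j * P l j s)) = 0" if s: "s \<in> {1..<N}" for s
  proof -
    have hj: "complex_of_real (real N ^ 2 * B2 (frac (real j * of_int X / real N))) - 1 / 6 = sin_sum N (int j * X)" for j X
      using scaled_B2_eq_sin_sum[OF N0, of "int j * X"] by (simp add: scaled_B2_def)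
    have "(\<Sum>j<N. of_real (U j) * sin_sum N (int j * X)) = - (\<Sum>j<N. complex_of_real (U j)) / 6" for X
    proof -
      have "(\<Sum>j<N. of_real (U j) * sin_sum N (int j * X)) =
         of_real (real N ^ 2 * (\<Sum>j<N. U j * B2 (frac (real j * of_int X / real N)))) - (\<Sum>j<N. complex_of_real (U j)) / 6"
        unfolding hj[symmetric] by (simp add: sum_subtractf algebra_simps sum_distrib_left sum_divide_distrib)
      then show ?thesis by (simp only: zero) simp
    qed
    then have "(\<Sum>X<N. ee (of_int (- int s) * of_nat X / of_nat N) * (\<Sum>j<N. of_real (U j) * sin_sum N (int j * int X))) =
       (\<Sum>X<N. ee (of_int (- int s) * of_nat X / of_nat N)) * (- (\<Sum>j<N. complex_of_real (U j)) / 6)"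
      by (simp only: sum_distrib_right)
    also have "\<dots> = 0"
      unfolding sum_ee_residues[OF N0] using s by (auto dest: zdvd_imp_le)
    finally have 0: "(\<Sum>X<N. ee (of_int (- int s) * of_nat X / of_nat N) * (\<Sum>j<N. of_real (U j) * sin_sum N (int j * int X))) = 0" .
    have "(\<Sum>X<N. ee (of_int (- int s) * of_nat X / of_nat N) * (\<Sum>j<N. of_real (U j) * sin_sum N (int j * int X))) =
       (\<Sum>X<N. \<Sum>j<N. \<Sum>l=1..<N. of_real (U j * sin_weight N l) * ee (of_int (int l * int j - int s) * of_nat X / of_nat N))"
    proof -
      have "ee (of_int (int l * int j - int s) * of_nat X / of_nat N) =
          ee (of_int (- int s) * of_nat X / of_nat N) * ee (of_int (int j * int X) * of_nat l / of_nat N)" for X j l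
        unfolding ee_add[symmetric] using N0 by (intro arg_cong[of _ _ ee]) (simp add: field_simps)
      moreover have "x * (y * (z * w)) = (y * z) * (x * w)" for x y z w :: complex by (simp add: mult_ac)
      ultimately show ?thesis
        unfolding sin_sum_def sum_distrib_left by (intro sum.cong refl) (simp only: of_real_mult)
    qed
    also have "\<dots> = (\<Sum>j<N. \<Sum>X<N. \<Sum>l=1..<N. of_real (U j * sin_weight N l) * ee (of_int (int l * int j - int s) * of_nat X / of_nat N))"
      by (rule sum.swap)
    also have "\<dots> = (\<Sum>j<N. \<Sum>l=1..<N. \<Sum>X<N. of_real (U j * sin_weight N l) * ee (of_int (int l * int j - int s) * of_nat X / of_nat N))"
      by (intro sum.cong refl sum.swap)
    also have "\<dots> = (\<Sum>j<N. \<Sum>l=1..<N. of_real (U j * sin_weight N l) * of_real (real N * P l j s))"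
      unfolding sum_distrib_left[symmetric] sum_ee_residues[OF N0] P_def by (intro sum.cong refl) simp
    also have "\<dots> = (\<Sum>l=1..<N. \<Sum>j<N. of_real (U j * sin_weight N l) * of_real (real N * P l j s))"
      by (rule sum.swap)
    also have "\<dots> = of_real (real N * (\<Sum>l=1..<N. sin_weight N l * (\<Sum>j<N. U j * P l j s)))"
      by (simp add: sum_distrib_left mult_ac)
    finally have "complex_of_real (real N * (\<Sum>l=1..<N. sin_weight N l * (\<Sum>j<N. U j * P l j s))) = 0"
      unfolding 0 by (rule sym)
    then have "real N * (\<Sum>l=1..<N. sin_weight N l * (\<Sum>j<N. U j * P l j s)) = 0"
      by (simp only: of_real_eq_0_iff)
    then show ?thesis using N0 unfolding mult_eq_0_iff by simp
  qed
  define T where "T = (\<Sum>s=1..<N. \<bar>U s\<bar>)"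
  have T: "(\<Sum>j<N. \<bar>U j\<bar>) = T"
    using N0 by (simp add: T_def lessThan_atLeast0 sum.atLeast_Suc_lessThan U0)
  have w: "sin_weight N l \<ge> 0" for l by (simp add: sin_weight_def)
  have c1: "sin_weight N (N - 1) = sin_weight N 1"
  proof -
    have "pi * real (N - 1) / real N = pi - pi * real 1 / real N" using N by (simp add: of_nat_diff field_simps)
    then show ?thesis unfolding sin_weight_def by (simp only: sin_pi_minus)
  qed
  \<comment> \<open>The frequencies 1 and N - 1 both return U s, the second one by evenness, so
    their terms add up instead of cancelling.\<close>
  have single: "(\<Sum>j<N. U j * P 1 j s) = U s" "(\<Sum>j<N. U j * P (N - 1) j s) = U s" if s: "s \<in> {1..<N}" for s
  proof -
    have "P 1 j s = (if j = s then 1 else 0)" if "j < N" for j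
    proof -
      have "int N dvd int j - int s \<longleftrightarrow> j = s"
      proof
        assume "int N dvd int j - int s"
        moreover have "\<bar>int j - int s\<bar> < int N" using that s by auto
        ultimately show "j = s" by (metis dvd_imp_le_int eq_iff_diff_eq_0 not_le of_nat_eq_iff abs_of_nat)
      qed simp
      then show ?thesis by (simp add: P_def)
    qed
    then have "(\<Sum>j<N. U j * P 1 j s) = (\<Sum>j<N. if j = s then U j else 0)" by (intro sum.cong) auto
    then show "(\<Sum>j<N. U j * P 1 j s) = U s" using s by simp
    have "P (N - 1) j s = (if j = N - s then 1 else 0)" if "j < N" for j
    proof -
      have e: "int (N - 1) * int j - int s = int N * int j - (int j + int s)"
        using N by (simp add: of_nat_diff algebra_simps)
      have "int N dvd int (N - 1) * int j - int s \<longleftrightarrow> int N dvd int j + int s"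
      proof
        assume "int N dvd int (N - 1) * int j - int s"
        from dvd_diff[OF dvd_triv_left[of "int N" "int j"] this[unfolded e]]
        show "int N dvd int j + int s" by simp
      next
        assume "int N dvd int j + int s"
        then show "int N dvd int (N - 1) * int j - int s"
          unfolding e by (rule dvd_diff[OF dvd_triv_left])
      qed
      also have "\<dots> \<longleftrightarrow> j = N - s"
      proof
        assume *: "int N dvd int j + int s"
        then obtain q where q: "int j + int s = int N * q" by blast
        have "int j + int s < int N * 2" "0 < int j + int s" using s that by auto
        then have "int N * q < int N * 2" "0 < int N * q" unfolding q .
        then have "0 < q" "q < 2" using N0 by (simp_all add: zero_less_mult_iff)
        then have "q = 1" by simp
        then show "j = N - s" using q s by auto
      qed (use s in \<open>simp add: of_nat_diff\<close>)
      finally show ?thesis by (simp add: P_def)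
    qed
    then have "(\<Sum>j<N. U j * P (N - 1) j s) = (\<Sum>j<N. if j = N - s then U j else 0)" by (intro sum.cong) auto
    then show "(\<Sum>j<N. U j * P (N - 1) j s) = U s" using s even[of s] by simp
  qed
  have T0: "T \<ge> 0" by (simp add: T_def sum_nonneg)
  have "T = 0"
  proof -
    \<comment> \<open>N \<ge> 3 keeps the two dominant frequencies distinct.\<close>
    have split: "{1..<N} = insert 1 (insert (N - 1) {2..<N - 1})" using N by auto
    have split_sum: "(\<Sum>l=1..<N. f l) = f 1 + f (N - 1) + (\<Sum>l=2..<N - 1. f l)" for f :: "nat \<Rightarrow> real"
      unfolding split using N by simp
    have "2 * sin_weight N 1 * \<bar>U s\<bar> \<le> (\<Sum>l=2..<N - 1. sin_weight N l * (\<Sum>j<N. \<bar>U j\<bar> * P l j s))"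
      if s: "s \<in> {1..<N}" for s
    proof -
      have "2 * sin_weight N 1 * U s = - (\<Sum>l=2..<N - 1. sin_weight N l * (\<Sum>j<N. U j * P l j s))"
        using R[OF s] unfolding split_sum single[OF s] c1 by linarith
      then have "\<bar>2 * sin_weight N 1 * U s\<bar> = \<bar>\<Sum>l=2..<N - 1. sin_weight N l * (\<Sum>j<N. U j * P l j s)\<bar>" by simp
      also have "\<dots> \<le> (\<Sum>l=2..<N - 1. \<bar>sin_weight N l * (\<Sum>j<N. U j * P l j s)\<bar>)" by (rule sum_abs)
      also have "\<dots> \<le> (\<Sum>l=2..<N - 1. sin_weight N l * (\<Sum>j<N. \<bar>U j\<bar> * P l j s))"
        unfolding abs_mult abs_of_nonneg[OF w]
        by (intro sum_mono mult_left_mono w order.trans[OF sum_abs]) (auto simp: abs_mult P_def)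
      finally show ?thesis using w[of 1] by (simp add: abs_mult)
    qed
    then have "(\<Sum>s=1..<N. 2 * sin_weight N 1 * \<bar>U s\<bar>) \<le>
       (\<Sum>s=1..<N. \<Sum>l=2..<N - 1. sin_weight N l * (\<Sum>j<N. \<bar>U j\<bar> * P l j s))"
      by (intro sum_mono) auto
    also have "\<dots> = (\<Sum>l=2..<N - 1. \<Sum>s=1..<N. sin_weight N l * (\<Sum>j<N. \<bar>U j\<bar> * P l j s))"
      by (rule sum.swap)
    also have "\<dots> = (\<Sum>l=2..<N - 1. sin_weight N l * (\<Sum>j<N. \<bar>U j\<bar> * (\<Sum>s=1..<N. P l j s)))"
      unfolding sum_distrib_left[symmetric]
      by (rule sum.cong[OF refl], rule arg_cong[where f = "\<lambda>x. _ * x"], simp only: sum_distrib_left, rule sum.swap)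
    also have "\<dots> \<le> (\<Sum>l=2..<N - 1. sin_weight N l * (\<Sum>j<N. \<bar>U j\<bar> * 1))"
    proof (intro sum_mono mult_left_mono w)
      fix l j
      have "(\<Sum>s=1..<N. P l j s) = real (card {s\<in>{1..<N}. int N dvd int l * int j - int s})"
        unfolding P_def by (simp add: sum.If_cases Int_def)
      then show "(\<Sum>s=1..<N. P l j s) \<le> 1"
        using card_residue_solutions[of N "int l * int j"] by simp
    qed auto
    also have "\<dots> = ((real N ^ 2 - 1) / 6 - 2 * sin_weight N 1) * T"
    proof -
      have "(\<Sum>l=2..<N - 1. sin_weight N l) = (real N ^ 2 - 1) / 6 - 2 * sin_weight N 1"
        using sum_sin_weight[OF N0] unfolding split_sum c1 by linarith
      then show ?thesis by (simp only: mult_1_right T sum_distrib_right[symmetric])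
    qed
    finally have "2 * sin_weight N 1 * T \<le> ((real N ^ 2 - 1) / 6 - 2 * sin_weight N 1) * T"
      by (simp add: T_def sum_distrib_left)
    then have "(4 * sin_weight N 1 - (real N ^ 2 - 1) / 6) * T \<le> 0" by (simp add: algebra_simps)
    moreover have "4 * sin_weight N 1 - (real N ^ 2 - 1) / 6 > 0" using sin_weight_1_gt[of N] N by simp
    ultimately show ?thesis using T0 by (simp add: mult_le_0_iff)
  qed
  then have "\<forall>s\<in>{1..<N}. \<bar>U s\<bar> = 0" unfolding T_def by (subst (asm) sum_nonneg_eq_0_iff) auto
  then show ?thesis using s U0 by (cases "s = 0") auto
qed

text \<open>B_2 takes the same value at j X / N and (N - j) X / N, so v can be spread evenly over j
  and N - j, which reduces the claim to \<open>even_B2_combination_zero\<close>.\<close>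

lemma B2_combination_zero:
  fixes v :: "nat \<Rightarrow> real"
  assumes N: "N \<ge> 3"
    and zero: "\<And>X :: int. (\<Sum>j=1..N div 2. v j * B2 (frac (real j * of_int X / real N))) = 0"
    and j: "j \<in> {1..N div 2}"
  shows "v j = 0"
proof -
  define A where "A = {1..N div 2}"
  define U where "U = (\<lambda>j. (if j \<in> A then v j else 0) + (if N - j \<in> A then v (N - j) else 0))"
  have "U j = 0"
  proof (rule even_B2_combination_zero[OF N])
    show "U 0 = 0" using N by (auto simp: U_def A_def)
    show "U (N - s) = U s" if "0 < s" "s < N" for s using that by (simp add: U_def)
    show "j < N" using j by auto
  next
    fix X :: int
    define f where "f = (\<lambda>j::nat. B2 (frac (real j * of_int X / real N)))"
    have f: "f (N - j) = f j" if "j \<le> N" for j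
    proof -
      have "real (N - j) * of_int X / real N = - (real j * of_int X / real N) + of_int X"
        using that N by (simp add: of_nat_diff field_simps)
      then show ?thesis unfolding f_def by (simp only: B2_frac_add_int B2_frac_uminus)
    qed
    have A: "A \<subseteq> {1..<N}" by (auto simp: A_def)
    have z: "(\<Sum>j\<in>A. v j * f j) = 0" using zero[of X] by (simp add: A_def f_def)
    have 1: "(\<Sum>j<N. (if j \<in> A then v j else 0) * f j) = (\<Sum>j\<in>A. v j * f j)"
      using A by (intro sum.mono_neutral_cong_right) auto
    have "(\<Sum>j<N. (if N - j \<in> A then v (N - j) else 0) * f j) =
        (\<Sum>j\<in>{1..<N}. (if N - j \<in> A then v (N - j) else 0) * f j)"
      using N by (intro sum.mono_neutral_right) (auto simp: A_def not_le)
    also have "\<dots> = (\<Sum>j\<in>{1..<N}. (if j \<in> A then v j else 0) * f j)"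
      by (rule sum.reindex_bij_witness[where i = "\<lambda>j. N - j" and j = "\<lambda>j. N - j"]) (auto simp: f)
    also have "\<dots> = (\<Sum>j\<in>A. v j * f j)"
      using A by (intro sum.mono_neutral_cong_right) auto
    finally have 2: "(\<Sum>j<N. (if N - j \<in> A then v (N - j) else 0) * f j) = (\<Sum>j\<in>A. v j * f j)" .
    have "(\<Sum>j<N. U j * f j) = 0"
      unfolding U_def distrib_right sum.distrib 1 2 z by simp
    then show "(\<Sum>j<N. U j * B2 (frac (real j * of_int X / real N))) = 0" by (simp only: f_def)
  qed
  \<comment> \<open>The index j = N / 2, for even N, is its own mirror image; there U j is twice v
    j.\<close>
  moreover have "N - j \<in> A \<longleftrightarrow> j = N - j" using j N by (auto simp: A_def)
  ultimately show ?thesis using j by (auto simp: U_def A_def split: if_splits)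
qed

section \<open>Distribution relation of B_2 and sums over residues\<close>

lemma sum_periodic_reindex:
  fixes F :: "int \<Rightarrow> real"
  assumes per: "\<And>x. F (x mod n) = F x" and n: "n > 0"
    and inj: "inj_on (\<lambda>z. \<sigma> z mod n) {0..<n}"
  shows "(\<Sum>z\<in>{0..<n}. F (\<sigma> z)) = (\<Sum>z\<in>{0..<n}. F z)"
proof -
  have sub: "(\<lambda>z. \<sigma> z mod n) ` {0..<n} \<subseteq> {0..<n}" using n by auto
  then have img: "(\<lambda>z. \<sigma> z mod n) ` {0..<n} = {0..<n}"
    using inj by (intro endo_inj_surj) auto
  have "(\<Sum>z\<in>{0..<n}. F z) = (\<Sum>z\<in>(\<lambda>z. \<sigma> z mod n) ` {0..<n}. F z)" by (simp only: img)
  also have "\<dots> = (\<Sum>z\<in>{0..<n}. F (\<sigma> z mod n))" by (simp add: sum.reindex[OF inj])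
  finally show ?thesis by (simp add: per)
qed

lemma sum_periodic_shift:
  fixes F :: "int \<Rightarrow> real"
  assumes per: "\<And>x. F (x mod n) = F x" and n: "n > 0"
  shows "(\<Sum>z\<in>{0..<n}. F (z + k)) = (\<Sum>z\<in>{0..<n}. F z)"
proof (rule sum_periodic_reindex[where F = F and n = n and \<sigma> = "\<lambda>z. z + k", OF per n])
  show "inj_on (\<lambda>z. (z + k) mod n) {0..<n}"
  proof (rule inj_onI)
    fix x y assume *: "x \<in> {0..<n}" "y \<in> {0..<n}" "(x + k) mod n = (y + k) mod n"
    then have "n dvd (x + k) - (y + k)" by (simp add: mod_eq_dvd_iff)
    then have "x mod n = y mod n" by (simp add: mod_eq_dvd_iff)
    then show "x = y" using * by simp
  qed
qed

lemma sum_periodic_scale: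
  fixes F :: "int \<Rightarrow> real"
  assumes per: "\<And>x. F (x mod n) = F x" and n: "n > 0" and u: "coprime u n"
  shows "(\<Sum>z\<in>{0..<n}. F (z * u)) = (\<Sum>z\<in>{0..<n}. F z)"
proof (rule sum_periodic_reindex[where F = F and n = n and \<sigma> = "\<lambda>z. z * u", OF per n])
  show "inj_on (\<lambda>z. (z * u) mod n) {0..<n}"
  proof (rule inj_onI)
    fix x y assume *: "x \<in> {0..<n}" "y \<in> {0..<n}" "(x * u) mod n = (y * u) mod n"
    then have "n dvd (x - y) * u" by (simp add: mod_eq_dvd_iff left_diff_distrib)
    then have "n dvd x - y" using u by (simp add: coprime_commute coprime_dvd_mult_left_iff)
    then have "x mod n = y mod n" by (simp add: mod_eq_dvd_iff)
    then show "x = y" using * by simp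
  qed
qed

lemma B2_frac_periodic:
  fixes c :: real
  assumes n: "n > 0"
  shows "B2 (frac (t + of_int (x mod n) / of_int n)) = B2 (frac (t + of_int x / of_int n))"
proof -
  have "of_int x = of_int (x mod n) + of_int n * real_of_int (x div n)"
    by (metis mod_mult_div_eq of_int_add of_int_mult)
  then have "t + of_int x / of_int n = (t + of_int (x mod n) / of_int n) + of_int (x div n)"
    using n by (simp add: field_simps)
  then show ?thesis by (simp only: B2_frac_add_int)
qed

lemma sum_real_to_int: "(\<Sum>z\<in>{0..<int n}. f (real_of_int z)) = (\<Sum>z<n. f (real z))"
  by (rule sum.reindex_bij_witness[where i = int and j = nat]) auto

text \<open>Write t = (f + k) / n with f the fractional part of n t. Periodicity absorbs the shift
  by k, and then all arguments (f + z) / n lie in [0, 1), where B_2 is a polynomial.\<close>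

lemma B2_distribution:
  assumes n: "n > 0"
  shows "(\<Sum>z\<in>{0..<int n}. B2 (frac (t + of_int z / real n))) = B2 (frac (real n * t)) / real n"
proof -
  define f where "f = frac (real n * t)"
  define k where "k = \<lfloor>real n * t\<rfloor>"
  have f: "0 \<le> f" "f < 1" by (simp_all add: f_def frac_lt_1)
  have t: "t = f / real n + of_int k / real n"
    using n by (simp add: f_def k_def frac_def field_simps)
  define F where "F = (\<lambda>x::int. B2 (frac (f / real n + of_int x / real n)))"
  have "(\<Sum>z\<in>{0..<int n}. B2 (frac (t + of_int z / real n))) = (\<Sum>z\<in>{0..<int n}. F (z + k))"
    by (simp add: F_def t add_divide_distrib algebra_simps)
  also have "\<dots> = (\<Sum>z\<in>{0..<int n}. F z)"
    using n B2_frac_periodic[of "int n" "f / real n"] by (intro sum_periodic_shift) (simp_all add: F_def)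
  also have "\<dots> = (\<Sum>z\<in>{0..<int n}. B2 ((f + of_int z) / real n))"
  proof (intro sum.cong refl)
    fix z assume "z \<in> {0..<int n}"
    then have z: "0 \<le> z" "z \<le> int n - 1" by auto
    then have "real_of_int z \<le> real n - 1" by linarith
    then have "frac ((f + of_int z) / real n) = (f + of_int z) / real n"
      using f z n by (intro frac_eq[THEN iffD2]) auto
    then show "F z = B2 ((f + of_int z) / real n)" by (simp add: F_def add_divide_distrib)
  qed
  also have "\<dots> = (\<Sum>z<n. B2 ((f + real z) / real n))" by (rule sum_real_to_int)
  also have "\<dots> = B2 f / real n"
  proof -
    \<comment> \<open>The factor u is kept apart from the summation bound j, so that induction on j
      applies; afterwards u = 1 / n and j = n.\<close>
    have "(\<Sum>z<j. (u * (f + real z)) ^ 2 - u * (f + real z) + 1 / 6) =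
       u ^ 2 * (real j * f ^ 2 + f * real j * (real j - 1) + (real j - 1) * real j * (2 * real j - 1) / 6)
        - u * (real j * f + real j * (real j - 1) / 2) + real j / 6" for j and u :: real
      by (induction j) (simp_all add: field_simps power2_eq_square)
    note closed = this[of "1 / real n" n]
    have "(\<Sum>z<n. B2 ((f + real z) / real n)) =
        (\<Sum>z<n. (1 / real n * (f + real z)) ^ 2 - 1 / real n * (f + real z) + 1 / 6)"
      by (simp add: B2_def)
    also have "\<dots> = B2 f / real n"
      unfolding closed B2_def using n by (simp add: field_simps power2_eq_square)
    finally show ?thesis .
  qed
  finally show ?thesis by (simp add: f_def)
qed

text \<open>For P the set of primes dividing N this is \<phi>(d) / d with d = gcd(x, N), in a form
  that can be split prime by prime.\<close>

definition euler_factor :: "nat set \<Rightarrow> int \<Rightarrow> real" where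
  "euler_factor P x = (\<Prod>l\<in>P. if int l dvd x then 1 - 1 / real l else 1)"

lemma euler_factor_mod:
  assumes "\<And>l. l \<in> P \<Longrightarrow> int l dvd n"
  shows "euler_factor P (x mod n) = euler_factor P x"
  unfolding euler_factor_def using assms by (intro prod.cong) (simp_all add: dvd_mod_iff)

lemma totient_euler_factor:
  assumes N: "N > 0"
  shows "real (totient (gcd x N)) = real (gcd x N) * euler_factor (prime_factors N) (int x)"
proof -
  have "real (totient (gcd x N)) = real (gcd x N) * (\<Prod>p\<in>prime_factors (gcd x N). 1 - 1 / real p)"
    by (rule totient_formula2)
  also have "(\<Prod>p\<in>prime_factors (gcd x N). 1 - 1 / real p) = euler_factor (prime_factors N) (int x)"
    unfolding euler_factor_def using N
    by (intro prod.mono_neutral_cong_left) (auto simp: in_prime_factors_iff)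
  finally show ?thesis .
qed

lemma sum_split_residues:
  fixes F :: "int \<Rightarrow> real"
  assumes "a > 0" "b > 0"
  shows "(\<Sum>x\<in>{0..<a * b}. F x) = (\<Sum>y\<in>{0..<a}. \<Sum>z\<in>{0..<b}. F (y + a * z))"
proof -
  have "(\<Sum>y\<in>{0..<a}. \<Sum>z\<in>{0..<b}. F (y + a * z)) = (\<Sum>(y, z)\<in>{0..<a} \<times> {0..<b}. F (y + a * z))"
    by (simp add: sum.cartesian_product)
  also have "\<dots> = (\<Sum>x\<in>{0..<a * b}. F x)"
  proof (rule sum.reindex_bij_witness[where i = "\<lambda>x. (x mod a, x div a)" and j = "\<lambda>(y, z). y + a * z"])
    fix yz assume *: "yz \<in> {0..<a} \<times> {0..<b}"
    obtain y z where yz: "yz = (y, z)" by (cases yz)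
    have "a * z \<le> a * (b - 1)" using * yz assms by (intro mult_left_mono) auto
    then have "y + a * z < a * b" using * yz by (simp add: algebra_simps)
    then show "(case yz of (y, z) \<Rightarrow> y + a * z) \<in> {0..<a * b}" using * yz assms by auto
    show "((case yz of (y, z) \<Rightarrow> y + a * z) mod a, (case yz of (y, z) \<Rightarrow> y + a * z) div a) = yz"
      using * yz by auto
  next
    fix x assume x: "x \<in> {0..<a * b}"
    have "a * (x div a) \<le> x"
      using mult_div_mod_eq[of a x] pos_mod_sign[OF assms(1), of x] by linarith
    then have "a * (x div a) < a * b" using x by auto
    then have "x div a < b" using assms by simp
    then show "(x mod a, x div a) \<in> {0..<a} \<times> {0..<b}" using x assms by (auto simp: pos_imp_zdiv_nonneg_iff)
  qed auto
  finally show ?thesis by simp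
qed

text \<open>Choosing a prime that divides \<open>N\<close> to a higher power than \<open>j\<close>, the terms with \<open>p\<close> dividing \<open>X\<close> are
  matched with the others through the distribution relation of \<open>B2\<close>.\<close>

lemma euler_factor_B2_sum_zero_coprime:
  fixes p n :: nat and j :: int
  assumes p: "prime p" and n: "n > 0" and pj: "\<not> int p dvd j"
    and P: "finite P" "p \<in> P" "\<And>l. l \<in> P \<Longrightarrow> prime l \<and> l dvd p * n"
  shows "(\<Sum>x\<in>{0..<int (p * n)}. euler_factor P x * B2 (frac (of_int (j * x) / real (p * n)))) = 0"
proof -
  have p0: "p > 0" using p prime_gt_0_nat by blast
  define P' where "P' = P - {p}"
  have ins: "P = insert p P'" "p \<notin> P'" "finite P'" using P by (auto simp: P'_def)
  have P'n: "int l dvd int n" if "l \<in> P'" for l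
  proof -
    have "prime l" "l dvd p * n" "l \<noteq> p" using that P(3)[of l] by (auto simp: P'_def)
    then show ?thesis using p by (metis int_dvd_int_iff prime_dvd_mult_iff primes_dvd_imp_eq)
  qed
  have P'p: "\<not> l dvd p" "prime l" if "l \<in> P'" for l
    using that P(3)[of l] p by (auto simp: P'_def dest: primes_dvd_imp_eq)
  define w where "w = euler_factor P'"
  define b where "b = (\<lambda>x::int. B2 (frac (of_int (j * x) / real (p * n))))"
  \<comment> \<open>The 1/p in the Euler factor turns the sum into one over all x minus 1/p times
    one over the multiples of p; both will reduce to the same sum at level n.\<close>
  have split: "euler_factor P x = w x - (if int p dvd x then w x / real p else 0)" for x
    unfolding ins(1) w_def euler_factor_def using ins(2,3) by (simp add: algebra_simps)
  have w_per: "w (y + int n * z) = w y" for y z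
  proof -
    have "w (y + int n * z) = w ((y + int n * z) mod int n)" unfolding w_def by (rule euler_factor_mod[OF P'n, symmetric])
    also have "\<dots> = w (y mod int n)" by simp
    also have "\<dots> = w y" unfolding w_def by (rule euler_factor_mod[OF P'n])
    finally show ?thesis .
  qed
  have w_p: "w (int p * y) = w y" for y
    unfolding w_def euler_factor_def
  proof (intro prod.cong refl)
    fix l assume "l \<in> P'"
    then have "coprime (int l) (int p)" using P'p[of l] by (simp add: prime_imp_coprime)
    then show "(if int l dvd int p * y then 1 - 1 / real l else 1) = (if int l dvd y then 1 - 1 / real l else 1)"
      by (simp add: coprime_dvd_mult_right_iff)
  qed
  have "(\<Sum>x\<in>{0..<int n * int p}. w x * b x) = (\<Sum>y\<in>{0..<int n}. \<Sum>z\<in>{0..<int p}. w y * b (y + int n * z))"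
    using n p0 by (subst sum_split_residues) (simp_all add: w_per)
  also have "\<dots> = (\<Sum>y\<in>{0..<int n}. w y * (B2 (frac (of_int (j * y) / real n)) / real p))"
  proof (intro sum.cong refl)
    fix y
    have "(\<Sum>z\<in>{0..<int p}. w y * b (y + int n * z)) =
       w y * (\<Sum>z\<in>{0..<int p}. B2 (frac (of_int (j * y) / real (p * n) + of_int (z * j) / real p)))"
      unfolding sum_distrib_left b_def using n p0
      by (intro sum.cong refl arg_cong[where f = "\<lambda>x. _ * B2 (frac x)"]) (simp add: field_simps)
    \<comment> \<open>As j is invertible modulo p, z j runs through all residues, and the
      distribution relation for p applies.\<close>
    also have "(\<Sum>z\<in>{0..<int p}. B2 (frac (of_int (j * y) / real (p * n) + of_int (z * j) / real p))) =
       (\<Sum>z\<in>{0..<int p}. B2 (frac (of_int (j * y) / real (p * n) + of_int z / real p)))"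
    proof (rule sum_periodic_scale[where F = "\<lambda>z. B2 (frac (of_int (j * y) / real (p * n) + of_int z / real p))"])
      show "coprime j (int p)" using prime_imp_coprime[of "int p" j] p pj by (simp add: coprime_commute)
    qed (use p0 B2_frac_periodic[of "int p" "of_int (j * y) / real (p * n)"] in simp_all)
    also have "\<dots> = B2 (frac (real p * (of_int (j * y) / real (p * n)))) / real p" by (rule B2_distribution[OF p0])
    also have "real p * (of_int (j * y) / real (p * n)) = of_int (j * y) / real n" using p0 by simp
    finally show "(\<Sum>z\<in>{0..<int p}. w y * b (y + int n * z)) = w y * (B2 (frac (of_int (j * y) / real n)) / real p)" .
  qed
  finally have 1: "(\<Sum>x\<in>{0..<int n * int p}. w x * b x) = (\<Sum>y\<in>{0..<int n}. w y * (B2 (frac (of_int (j * y) / real n)) / real p))" .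
  have "(\<Sum>x\<in>{0..<int p * int n}. (if int p dvd x then w x / real p else 0) * b x) =
     (\<Sum>y\<in>{0..<int p}. \<Sum>z\<in>{0..<int n}. (if int p dvd y then w (int p * z) / real p * b (int p * z) else 0))"
    using n p0
  proof (subst sum_split_residues)
    show "(\<Sum>y\<in>{0..<int p}. \<Sum>z\<in>{0..<int n}. (if int p dvd y + int p * z then w (y + int p * z) / real p else 0) * b (y + int p * z)) =
       (\<Sum>y\<in>{0..<int p}. \<Sum>z\<in>{0..<int n}. (if int p dvd y then w (int p * z) / real p * b (int p * z) else 0))"
    proof (intro sum.cong refl)
      fix y z assume "y \<in> {0..<int p}"
      then have "int p dvd y \<longleftrightarrow> y = 0" by (auto dest: zdvd_imp_le)
      then show "(if int p dvd y + int p * z then w (y + int p * z) / real p else 0) * b (y + int p * z) =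
        (if int p dvd y then w (int p * z) / real p * b (int p * z) else 0)"
        by (simp add: dvd_add_left_iff)
    qed
  qed auto
  also have "\<dots> = (\<Sum>y\<in>{0..<int p}. if y = 0 then \<Sum>z\<in>{0..<int n}. w (int p * z) / real p * b (int p * z) else 0)"
  proof (intro sum.cong refl)
    fix y assume "y \<in> {0..<int p}"
    then have "int p dvd y \<longleftrightarrow> y = 0" by (auto dest: zdvd_imp_le)
    then show "(\<Sum>z\<in>{0..<int n}. (if int p dvd y then w (int p * z) / real p * b (int p * z) else 0)) =
       (if y = 0 then \<Sum>z\<in>{0..<int n}. w (int p * z) / real p * b (int p * z) else 0)" by simp
  qed
  also have "\<dots> = (\<Sum>z\<in>{0..<int n}. w (int p * z) / real p * b (int p * z))" using p0 by simp
  also have "\<dots> = (\<Sum>z\<in>{0..<int n}. w z * (B2 (frac (of_int (j * z) / real n)) / real p))"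
    unfolding w_p b_def using p0 by (intro sum.cong refl) simp
  finally have 2: "(\<Sum>x\<in>{0..<int p * int n}. (if int p dvd x then w x / real p else 0) * b x) =
     (\<Sum>z\<in>{0..<int n}. w z * (B2 (frac (of_int (j * z) / real n)) / real p))" .
  have "(\<Sum>x\<in>{0..<int (p * n)}. euler_factor P x * b x) = (\<Sum>x\<in>{0..<int n * int p}. w x * b x) -
     (\<Sum>x\<in>{0..<int p * int n}. (if int p dvd x then w x / real p else 0) * b x)"
    unfolding split by (simp add: left_diff_distrib sum_subtractf mult.commute[of "int n"])
  also have "\<dots> = 0" unfolding 1 2 by simp
  finally show ?thesis by (simp add: b_def)
qed

text \<open>Since N does not divide j, some prime p occurs in j to a lower power than in N.
  Cancelling the power of p in j from j / N lowers the level to p n, with respect to which the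
  summand is periodic; the sum is a multiple of the coprime case.\<close>

lemma euler_factor_B2_sum_zero:
  assumes j: "0 < j" "j < N"
  shows "(\<Sum>x\<in>{0..<int N}. euler_factor (prime_factors N) x * B2 (frac (of_int (int j * x) / real N))) = 0"
proof -
  have N: "N > 0" using j by simp
  obtain p where p: "prime p" "multiplicity p j < multiplicity p N"
  proof -
    have "\<not> N dvd j" using j by (auto dest: dvd_imp_le)
    then show ?thesis using that j N
      by (metis multiplicity_le_imp_dvd not_le of_nat_0_less_iff less_irrefl)
  qed
  define i where "i = multiplicity p j"
  obtain j1 where j1: "j = p ^ i * j1" "\<not> p dvd j1"
    using multiplicity_decompose'[of j p] j p by (metis i_def less_irrefl not_prime_unit)
  have "p ^ Suc i dvd N" using p(2) by (intro multiplicity_dvd') (simp add: i_def)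
  then obtain n where "N = p ^ Suc i * n" by (elim dvdE)
  then have n: "N = p ^ i * (p * n)" by (simp add: mult_ac)
  have p0: "p > 0" using p prime_gt_0_nat by blast
  have n0: "n > 0" using N n by (metis gr0I mult_0_right less_irrefl)
  define P where "P = prime_factors N"
  have Pf: "finite P" "p \<in> P" using p0 n0 p(1) by (auto simp: P_def in_prime_factors_iff n)
  have Pd: "prime l \<and> l dvd p * n" if "l \<in> P" for l
  proof -
    have l: "prime l" "l dvd N" using that by (auto simp: P_def in_prime_factors_iff)
    then have "l dvd p \<or> l dvd p * n" using n by (metis prime_dvd_mult_iff prime_dvd_power)
    then show ?thesis using l by auto
  qed
  then have Pd': "int l dvd int (p * n)" if "l \<in> P" for l using that by (simp only: int_dvd_int_iff)
  define F where "F = (\<lambda>x::int. euler_factor P x * B2 (frac (of_int (int j1 * x) / real (p * n))))"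
  have "(\<Sum>x\<in>{0..<int N}. euler_factor P x * B2 (frac (of_int (int j * x) / real N))) = (\<Sum>x\<in>{0..<int (p * n) * int (p ^ i)}. F x)"
  proof (rule sum.cong)
    show "{0..<int N} = {0..<int (p * n) * int (p ^ i)}" by (simp add: n mult_ac)
  next
    fix x
    have "of_int (int j * x) / real N = of_int (int j1 * x) / real (p * n)"
      unfolding n j1(1) using p0 by simp
    then show "euler_factor P x * B2 (frac (of_int (int j * x) / real N)) = F x" by (simp only: F_def)
  qed
  also have "\<dots> = (\<Sum>y\<in>{0..<int (p * n)}. \<Sum>z\<in>{0..<int (p ^ i)}. F (y + int (p * n) * z))"
    using p0 n0 by (intro sum_split_residues) auto
  also have "\<dots> = (\<Sum>y\<in>{0..<int (p * n)}. \<Sum>z\<in>{0..<int (p ^ i)}. F y)"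
  proof (intro sum.cong refl)
    fix y z
    have "euler_factor P (y + int (p * n) * z) = euler_factor P ((y + int (p * n) * z) mod int (p * n))"
      by (intro euler_factor_mod[symmetric] Pd')
    also have "\<dots> = euler_factor P (y mod int (p * n))" by simp
    also have "\<dots> = euler_factor P y" by (intro euler_factor_mod Pd')
    finally have 1: "euler_factor P (y + int (p * n) * z) = euler_factor P y" .
    have "of_int (int j1 * (y + int (p * n) * z)) / real (p * n) = of_int (int j1 * y) / real (p * n) + of_int (int j1 * z)"
      using p0 n0 by (simp add: field_simps)
    then show "F (y + int (p * n) * z) = F y" by (simp only: F_def 1 B2_frac_add_int)
  qed
  also have "\<dots> = real (p ^ i) * (\<Sum>y\<in>{0..<int (p * n)}. F y)" by (simp add: sum_distrib_left)
  also have "(\<Sum>y\<in>{0..<int (p * n)}. F y) = 0"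
    unfolding F_def using p j1 n0 Pf Pd by (intro euler_factor_B2_sum_zero_coprime) auto
  finally show ?thesis by (simp add: P_def)
qed

lemma sum_by_gcd:
  fixes f :: "nat \<Rightarrow> real"
  assumes N: "N > 0"
  shows "(\<Sum>y\<in>{0<..N}. f y) = (\<Sum>d | d dvd N. \<Sum>y | y \<in> {0<..N} \<and> gcd y N = d. f y)"
proof -
  have "finite {d. d dvd N}" using N by simp
  then have "(\<Sum>d | d dvd N. \<Sum>y | y \<in> {0<..N} \<and> gcd y N = d. f y) = (\<Sum>y\<in>{0<..N}. f y)"
    by (intro sum.group) auto
  then show ?thesis by simp
qed

lemma sum_totatives_gcd:
  fixes G :: "nat \<Rightarrow> nat \<Rightarrow> real"
  assumes N: "N > 0"
  shows "(\<Sum>y\<in>{0<..N}. \<Sum>x\<in>totatives (gcd y N). G (gcd y N) x) =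
    (\<Sum>d | d dvd N. real (totient (N div d)) * (\<Sum>x\<in>totatives d. G d x))"
proof -
  have "(\<Sum>y | y \<in> {0<..N} \<and> gcd y N = d. \<Sum>x\<in>totatives (gcd y N). G (gcd y N) x) =
     real (totient (N div d)) * (\<Sum>x\<in>totatives d. G d x)" if "d dvd N" for d
  proof -
    have "(\<Sum>y | y \<in> {0<..N} \<and> gcd y N = d. \<Sum>x\<in>totatives (gcd y N). G (gcd y N) x) =
       (\<Sum>y | y \<in> {0<..N} \<and> gcd y N = d. \<Sum>x\<in>totatives d. G d x)" by (intro sum.cong) auto
    then show ?thesis using card_gcd_eq_totient[OF N that] by simp
  qed
  then show ?thesis unfolding sum_by_gcd[OF N] by (intro sum.cong) auto
qed

lemma sum_totatives_R_const:
  assumes N: "N > 0"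
  shows "(\<Sum>y\<in>{0<..N}. \<Sum>x\<in>totatives (gcd y N). real (gcd y N)) = 24 * R_const N"
  using sum_totatives_gcd[OF N, of "\<lambda>d x. real d"] by (simp add: R_const_def totient_def[symmetric] mult_ac)

text \<open>For N = d e, the map from x to x e carries the totatives of d to the residues with gcd
  e, where \<phi>(e) is e times the Euler factor. The divisor sum thus becomes a full sum over
  residues modulo N, which \<open>euler_factor_B2_sum_zero\<close> evaluates.\<close>

lemma sum_totatives_B2_zero:
  assumes j: "0 < j" "j < N"
  shows "(\<Sum>y\<in>{0<..N}. \<Sum>x\<in>totatives (gcd y N). real (gcd y N) * B2 (frac (real j * real x / real (gcd y N)))) = 0"
proof -
  have N: "N > 0" using j by simp
  define H where "H = (\<lambda>x::nat. euler_factor (prime_factors N) (int x) * B2 (frac (real j * real x / real N)))"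
  have "(\<Sum>x\<in>{0..<int N}. euler_factor (prime_factors N) x * B2 (frac (of_int (int j * x) / real N))) = (\<Sum>x\<in>{..<N}. H x)"
    unfolding H_def by (rule sum.reindex_bij_witness[where i = int and j = nat]) auto
  then have "(\<Sum>x<N. H x) = 0" using euler_factor_B2_sum_zero[OF j] by simp
  moreover have "(\<Sum>x<N. H x) = (\<Sum>x\<in>{0<..N}. H x)"
  proof -
    have "H N = H 0"
    proof -
      have "euler_factor (prime_factors N) (int N) = euler_factor (prime_factors N) 0"
        unfolding euler_factor_def by (intro prod.cong) auto
      moreover have "frac (real j * real N / real N) = frac (real j * real 0 / real N)" using N by simp
      ultimately show ?thesis by (simp only: H_def of_nat_0)
    qed
    then show ?thesis using N
      by (intro sum.reindex_bij_witness[where i = "\<lambda>x. if x = N then 0 else x" and j = "\<lambda>x. if x = 0 then N else x"])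
        (auto split: if_splits)
  qed
  ultimately have z: "(\<Sum>x\<in>{0<..N}. H x) = 0" by simp
  have "(\<Sum>d | d dvd N. real (totient (N div d)) * (\<Sum>x\<in>totatives d. real d * B2 (frac (real j * real x / real d)))) =
     (\<Sum>e | e dvd N. real N * (\<Sum>y | y \<in> {0<..N} \<and> gcd y N = e. H y))"
  proof (rule sum.reindex_bij_witness[where i = "\<lambda>e. N div e" and j = "\<lambda>d. N div d"])
    fix d assume "d \<in> {d. d dvd N}"
    then have d: "d dvd N" by simp
    then obtain e where e: "N = d * e" by blast
    have pos: "d > 0" "e > 0" using e N by auto
    have Nd: "N div d = e" "N div e = d" using e pos by simp_all
    have "bij_betw (\<lambda>k. k * e) (totatives (N div e)) {k\<in>{0<..N}. gcd k N = e}"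
      by (rule bij_betw_totatives_gcd_eq) (use e N in auto)
    then have "(\<Sum>y | y \<in> {0<..N} \<and> gcd y N = e. H y) = (\<Sum>x\<in>totatives d. H (x * e))"
      unfolding Nd by (intro sum.reindex_bij_betw[symmetric]) simp
    also have "real N * \<dots> = real (totient e) * (\<Sum>x\<in>totatives d. real d * B2 (frac (real j * real x / real d)))"
      unfolding sum_distrib_left
    proof (intro sum.cong refl)
      fix x assume x: "x \<in> totatives d"
      have "gcd (x * e) N = e" using x gcd_mult_distrib_nat[of e x d] by (simp add: e in_totatives_iff mult.commute coprime_iff_gcd_eq_1)
      then have "real (totient e) = real e * euler_factor (prime_factors N) (int (x * e))"
        using totient_euler_factor[OF N, of "x * e"] by simp
      moreover have "real j * real (x * e) / real N = real j * real x / real d"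
        unfolding e using pos by simp
      ultimately show "real N * H (x * e) = real (totient e) * (real d * B2 (frac (real j * real x / real d)))"
        by (simp add: H_def e)
    qed
    finally show "real N * (\<Sum>y | y \<in> {0<..N} \<and> gcd y N = N div d. H y) =
       real (totient (N div d)) * (\<Sum>x\<in>totatives d. real d * B2 (frac (real j * real x / real d)))"
      unfolding Nd .
  qed (use N in \<open>auto elim!: dvdE\<close>)
  also have "\<dots> = 0"
    unfolding sum_distrib_left[symmetric] sum_by_gcd[OF N, symmetric] z by simp
  finally show ?thesis
    using sum_totatives_gcd[OF N, of "\<lambda>d x. real d * B2 (frac (real j * real x / real d))"] by simp
qed

section \<open>Galois orbits of cusps\<close>

text \<open>Take for t the product of the primes of x that do not divide a. A prime of x divides
  exactly one of a and t c: if it divides a, then it divides neither c nor t.\<close>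

lemma coprime_shift:
  fixes a c x :: int
  assumes ac: "coprime a c" and x: "x \<noteq> 0"
  obtains t where "coprime (a + t * c) x"
proof -
  define P where "P = {p\<in>prime_factors x. \<not> p dvd a}"
  define t where "t = \<Prod>P"
  have fin: "finite P" by (simp add: P_def)
  have "coprime (a + t * c) x"
  proof (rule ccontr)
    assume "\<not> coprime (a + t * c) x"
    then have "\<not> is_unit (gcd (a + t * c) x)" unfolding is_unit_gcd .
    moreover have "gcd (a + t * c) x \<noteq> 0" using x by simp
    ultimately obtain p where "p dvd gcd (a + t * c) x" "prime p" using prime_divisor_exists by blast
    then have p: "prime p" "p dvd a + t * c" "p dvd x" by simp_all
    show False
    proof (cases "p dvd a")
      case True
      then have "p dvd t * c" using p(2) by (simp add: dvd_add_right_iff)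
      moreover have "\<not> p dvd t"
      proof
        assume "p dvd t"
        then obtain q where "q \<in> P" "p dvd q"
          using prime_dvd_prod_iff[OF fin p(1), of "\<lambda>x. x"] by (auto simp: t_def)
        then have "p = q" using p(1) by (auto simp: P_def intro: primes_dvd_imp_eq)
        then show False using True \<open>q \<in> P\<close> by (simp add: P_def)
      qed
      ultimately have "p dvd c" using p(1) by (simp add: prime_dvd_mult_iff)
      then have "is_unit p" using True ac by (auto dest: coprime_common_divisor)
      then show False using p(1) not_prime_unit by blast
    next
      case False
      then have "p \<in> P" using p x by (simp add: P_def in_prime_factors_iff)
      then have "p dvd t" unfolding t_def using fin by (intro dvd_prodI) auto
      then show False using False p(2) by (simp add: dvd_add_left_iff)
    qed
  qed
  then show ?thesis using that by blast
qed

section \<open>Congruence criterion for equivalence of cusps\<close>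

definition cusp_sim :: "nat \<Rightarrow> int \<Rightarrow> int \<Rightarrow> int \<Rightarrow> int \<Rightarrow> bool" where
  "cusp_sim N a c a' c' \<longleftrightarrow> (\<exists>\<epsilon>\<in>{1, -1}. [c' = \<epsilon> * c] (mod int N) \<and> [a' = \<epsilon> * a] (mod gcd c (int N)))"

lemma cusp_sim_refl [simp]: "cusp_sim N a c a c"
  unfolding cusp_sim_def by (rule bexI[of _ 1]) auto

lemma gcd_cong_sign:
  fixes c c' n \<epsilon> :: int
  assumes "\<epsilon> \<in> {1, -1}" "[c' = \<epsilon> * c] (mod n)"
  shows "gcd c' n = gcd c n"
proof -
  have "gcd c' n = gcd (\<epsilon> * c) n" using assms(2) by (metis cong_def gcd_mod_left gcd_red_int gcd.commute)
  then show ?thesis using assms(1) by auto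
qed

lemma cusp_sim_gcd: "cusp_sim N a c a' c' \<Longrightarrow> gcd c' (int N) = gcd c (int N)"
  unfolding cusp_sim_def using gcd_cong_sign by blast

lemma sign_cong_sym:
  fixes x y n \<epsilon> :: int
  assumes "\<epsilon> \<in> {1, -1}" "[y = \<epsilon> * x] (mod n)"
  shows "[x = \<epsilon> * y] (mod n)"
proof -
  have "[\<epsilon> * y = \<epsilon> * (\<epsilon> * x)] (mod n)" using assms(2) by (rule cong_scalar_left)
  moreover have "\<epsilon> * (\<epsilon> * x) = x" using assms(1) by auto
  ultimately show ?thesis by (simp add: cong_sym)
qed

lemma cusp_sim_sym:
  assumes "cusp_sim N a c a' c'"
  shows "cusp_sim N a' c' a c"
  using assms cusp_sim_gcd[OF assms] sign_cong_sym unfolding cusp_sim_def by metis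

lemma cusp_sim_trans:
  assumes 1: "cusp_sim N a c a' c'" and 2: "cusp_sim N a' c' a'' c''"
  shows "cusp_sim N a c a'' c''"
proof -
  obtain \<epsilon> where \<epsilon>: "\<epsilon> \<in> {1, -1}" "[c' = \<epsilon> * c] (mod int N)" "[a' = \<epsilon> * a] (mod gcd c (int N))"
    using 1 unfolding cusp_sim_def by blast
  obtain \<delta> where \<delta>: "\<delta> \<in> {1, -1}" "[c'' = \<delta> * c'] (mod int N)" "[a'' = \<delta> * a'] (mod gcd c (int N))"
    using 2 unfolding cusp_sim_def cusp_sim_gcd[OF 1] by blast
  have "[c'' = \<delta> * \<epsilon> * c] (mod int N)" "[a'' = \<delta> * \<epsilon> * a] (mod gcd c (int N))"
    using cong_trans[OF \<delta>(2) cong_scalar_left[OF \<epsilon>(2)]] cong_trans[OF \<delta>(3) cong_scalar_left[OF \<epsilon>(3)]]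
    by (simp_all add: mult.assoc)
  moreover have "\<delta> * \<epsilon> \<in> {1, -1}" using \<delta> \<epsilon> by auto
  ultimately show ?thesis unfolding cusp_sim_def by blast
qed

text \<open>A translation first turns the congruence of numerators modulo gcd(c, N) into one modulo
  N. Both columns are then completed to matrices of determinant 1 that agree modulo N, and the
  quotient of the two is congruent to the identity.\<close>

lemma Gamma1_maps_cong:
  assumes N: "N > 0" and ac: "coprime a c" and ac': "coprime a' c'"
    and cong: "[c' = c] (mod int N)" "[a' = a] (mod gcd c (int N))"
  obtains p q r s where "(p, q, r, s) \<in> Gamma1 N" "a' = p * a + q * c" "c' = r * a + s * c"
proof -
  define g where "g = gcd c (int N)"
  obtain v where "a' - a = g * v" using cong(2) by (auto simp: g_def cong_iff_dvd_diff)
  then have v: "a' = a + g * v" by simp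
  obtain \<alpha> \<beta> where ab: "\<alpha> * c + \<beta> * int N = g" unfolding g_def using bezout_int by blast
  define q0 where "q0 = v * \<alpha>"
  define a1 where "a1 = a + q0 * c"
  have aa1: "[a' = a1] (mod int N)"
  proof -
    have "a' - a1 = int N * (v * \<beta>)" by (simp add: v a1_def q0_def ab[symmetric] algebra_simps)
    then show ?thesis by (simp add: cong_iff_dvd_diff)
  qed
  have "coprime a1 c"
    using ac unfolding a1_def by (metis add.commute coprime_iff_gcd_eq_1 gcd.commute gcd_add_mult mult.commute)
  then obtain d1 b1 where "d1 * a1 + b1 * c = 1" using bezout_int[of a1 c] by (auto simp: coprime_iff_gcd_eq_1)
  then have \<alpha>: "a1 * d1 - (- b1) * c = 1" by (simp add: algebra_simps)
  define b where "b = - b1"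
  have det1: "a1 * d1 - b * c = 1" using \<alpha> by (simp add: b_def)
  obtain d0 b0 where "d0 * a' + b0 * c' = 1" using bezout_int[of a' c'] ac' by (auto simp: coprime_iff_gcd_eq_1)
  then have det0: "a' * d0 - (- b0) * c' = 1" by (simp add: algebra_simps)
  define b' where "b' = - b0"
  have det0: "a' * d0 - b' * c' = 1" using det0 by (simp add: b'_def)
  \<comment> \<open>A completion is unique up to multiples of the first column. By
    \<open>key\<close> the two second columns differ modulo N by a multiple of (a1, c), and t is
    that coefficient, found by Cramer's rule.\<close>
  define t where "t = d1 * (b' - b) - b * (d0 - d1)"
  define b'' where "b'' = b' - t * a'"
  define d'' where "d'' = d0 - t * c'"
  have det2: "a' * d'' - b'' * c' = 1" using det0 by (simp add: b''_def d''_def algebra_simps)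
  obtain e1 where "a' - a1 = int N * e1" using aa1 by (auto simp: cong_iff_dvd_diff)
  then have e1: "a' = a1 + int N * e1" by simp
  obtain e2 where "c' - c = int N * e2" using cong(1) by (auto simp: cong_iff_dvd_diff)
  then have e2: "c' = c + int N * e2" by simp
  define P where "P = a' * d1 - b'' * c"
  define Q where "Q = - a' * b + b'' * a1"
  define R where "R = c' * d1 - d'' * c"
  define S where "S = - c' * b + d'' * a1"
  have key: "int N dvd a1 * (d0 - d1) - c * (b' - b)"
  proof -
    have "a1 * (d0 - d1) - c * (b' - b) = (a1 * d0 - b' * c) - (a1 * d1 - b * c)" by (simp add: algebra_simps)
    also have "a1 * d0 - b' * c = (a' * d0 - b' * c') - int N * (e1 * d0 - b' * e2)"
      by (simp add: e1 e2 algebra_simps)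
    also have "\<dots> - (a1 * d1 - b * c) = int N * (- (e1 * d0 - b' * e2))" by (simp add: det0 det1 algebra_simps)
    finally show ?thesis by simp
  qed
  then obtain z where z: "a1 * (d0 - d1) - c * (b' - b) = int N * z" by blast
  have bb: "int N dvd b'' - b"
  proof -
    have "b'' - b = (b' - b) * (1 - (a1 * d1 - b * c)) + b * (a1 * (d0 - d1) - c * (b' - b)) - int N * (e1 * t)"
      by (simp add: b''_def e1 t_def algebra_simps)
    then show ?thesis unfolding det1 z by simp
  qed
  have dd: "int N dvd d'' - d1"
  proof -
    have "d'' - d1 = (d0 - d1) * (1 - (a1 * d1 - b * c)) + d1 * (a1 * (d0 - d1) - c * (b' - b)) - int N * (e2 * t)"
      by (simp add: d''_def e2 t_def algebra_simps)
    then show ?thesis unfolding det1 z by simp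
  qed
  obtain y1 where y1: "b'' = b + int N * y1" using bb by (metis add.commute diff_add_cancel dvdE)
  obtain y2 where y2: "d'' = d1 + int N * y2" using dd by (metis add.commute diff_add_cancel dvdE)
  have "P - 1 = (a1 * d1 - b * c - 1) + int N * (e1 * d1 - y1 * c)" by (simp add: P_def e1 y1 algebra_simps)
  then have P: "[P = 1] (mod int N)" by (simp add: det1 cong_iff_dvd_diff)
  have "S - 1 = (a1 * d1 - b * c - 1) + int N * (y2 * a1 - e2 * b)" by (simp add: S_def e2 y2 algebra_simps)
  then have S: "[S = 1] (mod int N)" by (simp add: det1 cong_iff_dvd_diff)
  have "R = int N * (e2 * d1 - y2 * c)" by (simp add: R_def e2 y2 algebra_simps)
  then have R: "[R = 0] (mod int N)" by (simp add: cong_0_iff)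
  have "P * S - Q * R = (a' * d'' - b'' * c') * (a1 * d1 - b * c)"
    by (simp add: P_def Q_def R_def S_def algebra_simps)
  then have det: "P * S - Q * R = 1" by (simp add: det1 det2)
  have "(P, P * q0 + Q, R, R * q0 + S) \<in> Gamma1 N"
  proof -
    have "[R * q0 + S = 0 * q0 + 1] (mod int N)" using R S by (intro cong_add cong_mult) auto
    then show ?thesis using P R det by (simp add: Gamma1_def SL2Z_def algebra_simps)
  qed
  moreover have "a' = P * a + (P * q0 + Q) * c"
  proof -
    have "P * a + (P * q0 + Q) * c = P * a1 + Q * c" by (simp add: a1_def algebra_simps)
    also have "\<dots> = a' * (a1 * d1 - b * c)" by (simp add: P_def Q_def algebra_simps)
    finally show ?thesis by (simp add: det1)
  qed
  moreover have "c' = R * a + (R * q0 + S) * c"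
  proof -
    have "R * a + (R * q0 + S) * c = R * a1 + S * c" by (simp add: a1_def algebra_simps)
    also have "\<dots> = c' * (a1 * d1 - b * c)" by (simp add: R_def S_def algebra_simps)
    finally show ?thesis by (simp add: det1)
  qed
  ultimately show ?thesis using that by blast
qed

text \<open>The sign \<epsilon> accounts for (a, c) and (-a, -c) being the same point. One direction
  reduces the action modulo N and modulo gcd(c, N), where q c vanishes; the other is
  \<open>Gamma1_maps_cong\<close>.\<close>

lemma cusp_mem_iff:
  assumes N: "N > 0" and ac: "coprime a c"
  shows "(a', c') \<in> cusp N a c \<longleftrightarrow> coprime a' c' \<and> cusp_sim N a c a' c'"
proof
  assume "(a', c') \<in> cusp N a c"
  then obtain p q r s \<epsilon> where \<gamma>: "(p, q, r, s) \<in> Gamma1 N" and \<epsilon>: "\<epsilon> \<in> {1, -1}"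
    and a': "a' = \<epsilon> * (p * a + q * c)" and c': "c' = \<epsilon> * (r * a + s * c)"
    unfolding cusp_def by blast
  from \<gamma> have det: "p * s - q * r = 1" and p: "[p = 1] (mod int N)" and s: "[s = 1] (mod int N)" and r: "[r = 0] (mod int N)"
    by (auto simp: Gamma1_def SL2Z_def)
  have cop: "coprime a' c'"
  proof (rule coprimeI)
    fix d assume d: "d dvd a'" "d dvd c'"
    have "p * a + q * c = \<epsilon> * a'" "r * a + s * c = \<epsilon> * c'" using \<epsilon> by (auto simp: a' c')
    then have d1: "d dvd p * a + q * c" "d dvd r * a + s * c" using d by simp_all
    have "s * (p * a + q * c) - q * (r * a + s * c) = (p * s - q * r) * a"
        "p * (r * a + s * c) - r * (p * a + q * c) = (p * s - q * r) * c" by (simp_all add: algebra_simps)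
    then have "d dvd a" "d dvd c" using d1 by (metis det dvd_diff dvd_mult mult_1)+
    then show "is_unit d" using ac by (rule coprime_common_divisor[rotated])
  qed
  have "[r * a + s * c = 0 * a + 1 * c] (mod int N)" using r s by (intro cong_add cong_mult) auto
  then have 1: "[c' = \<epsilon> * c] (mod int N)" unfolding c' by (simp add: cong_scalar_left)
  have "[p = 1] (mod gcd c (int N))" using p by (rule cong_dvd_modulus) simp
  moreover have "[c = 0] (mod gcd c (int N))" by (simp add: cong_0_iff)
  ultimately have "[p * a + q * c = 1 * a + q * 0] (mod gcd c (int N))" by (intro cong_add cong_mult) auto
  then have "[a' = \<epsilon> * a] (mod gcd c (int N))" unfolding a' by (simp add: cong_scalar_left)
  with 1 \<epsilon> cop show "coprime a' c' \<and> cusp_sim N a c a' c'" unfolding cusp_sim_def by blast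
next
  assume *: "coprime a' c' \<and> cusp_sim N a c a' c'"
  then obtain \<epsilon> where \<epsilon>: "\<epsilon> \<in> {1, -1}" "[c' = \<epsilon> * c] (mod int N)" "[a' = \<epsilon> * a] (mod gcd c (int N))"
    unfolding cusp_sim_def by blast
  have e2: "\<epsilon> * (\<epsilon> * x) = x" for x :: int using \<epsilon>(1) by auto
  have "coprime (\<epsilon> * a') (\<epsilon> * c')" using * \<epsilon>(1) by auto
  moreover have "[\<epsilon> * c' = c] (mod int N)" "[\<epsilon> * a' = a] (mod gcd c (int N))"
    using cong_scalar_left[OF \<epsilon>(2), of \<epsilon>] cong_scalar_left[OF \<epsilon>(3), of \<epsilon>] by (simp_all add: e2)
  ultimately obtain p q r s where "(p, q, r, s) \<in> Gamma1 N" "\<epsilon> * a' = p * a + q * c" "\<epsilon> * c' = r * a + s * c"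
    using Gamma1_maps_cong[OF N ac, of "\<epsilon> * a'" "\<epsilon> * c'"] by metis
  then have "(p, q, r, s) \<in> Gamma1 N" "a' = \<epsilon> * (p * a + q * c)" "c' = \<epsilon> * (r * a + s * c)"
    using e2[of a'] e2[of c'] by simp_all
  then show "(a', c') \<in> cusp N a c" unfolding cusp_def using \<epsilon>(1) by blast
qed

lemma cusp_eq_iff:
  assumes N: "N > 0" and "coprime a c" "coprime a' c'"
  shows "cusp N a c = cusp N a' c' \<longleftrightarrow> cusp_sim N a c a' c'"
proof
  assume "cusp N a c = cusp N a' c'"
  moreover have "(a', c') \<in> cusp N a' c'" using assms by (simp add: cusp_mem_iff)
  ultimately have "(a', c') \<in> cusp N a c" by simp
  then show "cusp_sim N a c a' c'" using assms by (simp add: cusp_mem_iff)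
next
  assume s: "cusp_sim N a c a' c'"
  have "(x, y) \<in> cusp N a c \<longleftrightarrow> (x, y) \<in> cusp N a' c'" for x y
    using assms cusp_sim_trans[OF s] cusp_sim_trans[OF cusp_sim_sym[OF s]] by (auto simp: cusp_mem_iff)
  then show "cusp N a c = cusp N a' c'" by auto
qed

section \<open>The Galois action on cusps\<close>

lemma cusp_sim_mult:
  assumes x: "coprime x (int N)" and s: "cusp_sim N a c a' c'"
  shows "cusp_sim N a (x * c) a' (x * c')"
proof -
  have g: "gcd (x * c) (int N) = gcd c (int N)"
    using x by (simp add: gcd_mult_left_left_cancel coprime_commute)
  obtain \<epsilon> where \<epsilon>: "\<epsilon> \<in> {1, -1}" "[c' = \<epsilon> * c] (mod int N)" "[a' = \<epsilon> * a] (mod gcd c (int N))"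
    using s unfolding cusp_sim_def by blast
  have "[x * c' = \<epsilon> * (x * c)] (mod int N)" using cong_scalar_left[OF \<epsilon>(2), of x] by (simp add: mult_ac)
  then show ?thesis unfolding cusp_sim_def g using \<epsilon> by blast
qed

text \<open>Any two admissible representatives satisfy the congruence criterion, and scaling the
  denominators by a unit x preserves it; hence the description in \<open>galois_act\<close> is
  unique.\<close>

lemma galois_act_cusp:
  assumes N: "N > 0" and ac: "coprime a c" and x: "coprime x (int N)"
    and mem: "(a0, c0) \<in> cusp N a c" and cop: "coprime a0 (x * c0)"
  shows "galois_act N x (cusp N a c) = cusp N a0 (x * c0)"
  unfolding galois_act_def
proof (rule the_equality)
  show "\<exists>a' c'. (a', c') \<in> cusp N a c \<and> coprime a' (x * c') \<and> cusp N a0 (x * c0) = cusp N a' (x * c')"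
    using mem cop by blast
next
  fix D assume "\<exists>a' c'. (a', c') \<in> cusp N a c \<and> coprime a' (x * c') \<and> D = cusp N a' (x * c')"
  then obtain a1 c1 where 1: "(a1, c1) \<in> cusp N a c" "coprime a1 (x * c1)" "D = cusp N a1 (x * c1)" by blast
  have "cusp_sim N a1 c1 a0 c0"
    using 1(1) mem N ac by (auto simp: cusp_mem_iff intro: cusp_sim_trans cusp_sim_sym)
  then show "D = cusp N a0 (x * c0)"
    unfolding 1(3) cusp_eq_iff[OF N 1(2) cop] using x by (rule cusp_sim_mult[rotated])
qed

text \<open>Denominators with the same gcd g with N differ by a unit modulo N / g, and this unit
  lifts to one modulo N. So the action moves c freely within its gcd and leaves a modulo g, up to
  sign, as the only other invariant.\<close>

lemma galois_orbit_cusp: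
  assumes N: "N > 1" and ac: "coprime a c"
  shows "galois_orbit N (cusp N a c) =
    {cusp N a' c' | a' c'. coprime a' c' \<and> gcd c' (int N) = gcd c (int N) \<and> (\<exists>\<epsilon>\<in>{1, -1}. [a' = \<epsilon> * a] (mod gcd c (int N)))}"
    (is "_ = ?R")
proof -
  define g where "g = gcd c (int N)"
  have N0: "N > 0" using N by simp
  have g: "g > 0" using N0 by (simp add: g_def)
  have act: "\<exists>a0. galois_act N x (cusp N a c) = cusp N a0 (x * c) \<and> coprime a0 (x * c) \<and> [a0 = a] (mod g)"
    if x: "coprime x (int N)" for x
  proof -
    \<comment> \<open>Adding a multiple of c to a stays within the cusp and makes the numerator
      prime to x. The shift requires a nonzero x, which N > 1 ensures.\<close>
    have "x \<noteq> 0" using x N by auto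
    then obtain t where t: "coprime (a + t * c) x" using coprime_shift[OF ac] by blast
    have ac2: "coprime (a + t * c) c"
      using ac by (metis add.commute coprime_iff_gcd_eq_1 gcd.commute gcd_add_mult mult.commute)
    have cop: "coprime (a + t * c) (x * c)" using t ac2 by simp
    have cg: "[a + t * c = a] (mod g)" by (simp add: g_def cong_iff_dvd_diff)
    then have "(a + t * c, c) \<in> cusp N a c"
      unfolding cusp_mem_iff[OF N0 ac] cusp_sim_def g_def using ac2 by (auto intro!: bexI[of _ 1])
    then have "galois_act N x (cusp N a c) = cusp N (a + t * c) (x * c)" using cop by (rule galois_act_cusp[OF N0 ac x])
    then show ?thesis using cop cg by blast
  qed
  have gx: "gcd (x * c) (int N) = g" if "coprime x (int N)" for x
    using that by (simp add: g_def gcd_mult_left_left_cancel coprime_commute)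
  show ?thesis
  proof (intro equalityI subsetI)
    fix D assume "D \<in> galois_orbit N (cusp N a c)"
    then obtain x where x: "coprime x (int N)" "D = galois_act N x (cusp N a c)" by (auto simp: galois_orbit_def)
    obtain a0 where "galois_act N x (cusp N a c) = cusp N a0 (x * c)" "coprime a0 (x * c)" "[a0 = a] (mod g)"
      using act[OF x(1)] by blast
    then have "D = cusp N a0 (x * c) \<and> coprime a0 (x * c) \<and> gcd (x * c) (int N) = gcd c (int N) \<and>
        (\<exists>\<epsilon>\<in>{1, -1}. [a0 = \<epsilon> * a] (mod gcd c (int N)))"
      using gx[OF x(1)] x(2) unfolding g_def by simp
    then show "D \<in> ?R" unfolding mem_Collect_eq by (intro exI)
  next
    fix D assume "D \<in> ?R"
    then have "\<exists>a' c'. D = cusp N a' c' \<and> coprime a' c' \<and> gcd c' (int N) = g \<and> (\<exists>\<epsilon>\<in>{1, -1}. [a' = \<epsilon> * a] (mod g))"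
      unfolding g_def mem_Collect_eq .
    then obtain a' c' where D: "D = cusp N a' c'" "coprime a' c'" "gcd c' (int N) = g"
      and "\<exists>\<epsilon>\<in>{1, -1}. [a' = \<epsilon> * a] (mod g)" by (elim exE conjE)
    then obtain \<epsilon> where \<epsilon>: "\<epsilon> \<in> {1, -1}" "[a' = \<epsilon> * a] (mod g)" by (elim bexE)
    obtain u where u: "c = g * u" unfolding g_def by (metis dvdE gcd_dvd1)
    obtain u' where u': "c' = g * u'" using D(3) by (metis dvdE gcd_dvd1)
    obtain n where n: "int N = g * n" unfolding g_def by (metis dvdE gcd_dvd2)
    have n0: "n > 0" using n N0 g by (metis of_nat_0_less_iff zero_less_mult_pos)
    have un: "coprime u n" 
    proof -
      have "g * gcd u n = g" using g_def unfolding u n by (metis abs_of_pos g gcd_mult_distrib_int)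
      then show ?thesis using g by (simp add: coprime_iff_gcd_eq_1)
    qed
    have u'n: "coprime u' n"
    proof -
      have "g * gcd u' n = g" using D(3) unfolding u' n by (metis abs_of_pos g gcd_mult_distrib_int)
      then show ?thesis using g by (simp add: coprime_iff_gcd_eq_1)
    qed
    obtain v where v: "[u * v = 1] (mod n)" using cong_solve_coprime_int[OF un] by auto
    \<comment> \<open>The quotient \<epsilon> u' / u modulo n = N / g; a multiple of n is then added
      to obtain a unit modulo N.\<close>
    define x0 where "x0 = \<epsilon> * u' * v"
    have "coprime v n" using v by (metis coprime_iff_invertible_int mult.commute)
    then have "coprime x0 n" using u'n \<epsilon>(1) by (auto simp: x0_def)
    then obtain t where t: "coprime (x0 + t * n) (int N)" using coprime_shift[of x0 n "int N"] N0 by auto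
    define x where "x = x0 + t * n"
    have x: "coprime x (int N)" using t by (simp add: x_def)
    have "[x * u = x0 * u] (mod n)" by (simp add: x_def cong_iff_dvd_diff algebra_simps)
    also have "x0 * u = \<epsilon> * u' * (u * v)" by (simp add: x0_def mult_ac)
    also have "[\<epsilon> * u' * (u * v) = \<epsilon> * u' * 1] (mod n)" by (rule cong_scalar_left[OF v])
    finally have "n dvd x * u - \<epsilon> * u'" by (simp add: cong_iff_dvd_diff)
    then have "g * n dvd g * (x * u - \<epsilon> * u')" by (rule mult_dvd_mono[OF dvd_refl])
    then have "[x * c = \<epsilon> * c'] (mod int N)"
      by (simp add: cong_iff_dvd_diff n u u' algebra_simps)
    then have c': "[c' = \<epsilon> * (x * c)] (mod int N)" by (rule sign_cong_sym[OF \<epsilon>(1)])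
    obtain a0 where a0: "galois_act N x (cusp N a c) = cusp N a0 (x * c)" "coprime a0 (x * c)" "[a0 = a] (mod g)"
      using act[OF x] by blast
    have "[a' = \<epsilon> * a0] (mod g)"
      using \<epsilon>(2) cong_scalar_left[OF a0(3), of \<epsilon>] by (metis cong_sym cong_trans)
    then have "cusp_sim N a0 (x * c) a' c'"
      unfolding cusp_sim_def gx[OF x] using c' \<epsilon>(1) by blast
    then have "cusp N a0 (x * c) = cusp N a' c'" unfolding cusp_eq_iff[OF N0 a0(2) D(2)] .
    then have "D = galois_act N x (cusp N a c)" unfolding D(1) a0(1) by (rule sym)
    then show "D \<in> galois_orbit N (cusp N a c)" unfolding galois_orbit_def using x by blast
  qed
qed

text \<open>The pairs \<open>(x, y)\<close> modulo \<open>(gcd(y, N), N)\<close> form a double cover of the set of cusps.\<close>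

definition residue_pairs :: "nat \<Rightarrow> (int \<times> int) set" where
  "residue_pairs N = {(x, y). y \<in> {0<..int N} \<and> x \<in> {0<..gcd y (int N)} \<and> coprime x (gcd y (int N))}"

text \<open>Negation of both entries. Residues are taken in {1..g} and {1..N}, so that g and N stand
  for 0 and must be kept.\<close>

definition neg_pair :: "nat \<Rightarrow> int \<times> int \<Rightarrow> int \<times> int" where
  "neg_pair N = (\<lambda>(x, y). (if x = gcd y (int N) then x else gcd y (int N) - x, if y = int N then y else int N - y))"

definition pair_class :: "nat \<Rightarrow> int \<Rightarrow> int \<Rightarrow> (int \<times> int) set" where
  "pair_class N a g = {(x, y)\<in>residue_pairs N. gcd y (int N) = g \<and> (\<exists>\<epsilon>\<in>{1, -1}. [x = \<epsilon> * a] (mod g))}"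

lemma finite_residue_pairs: "finite (residue_pairs N)"
proof (cases "N = 0")
  case False
  have "residue_pairs N \<subseteq> {0<..int N} \<times> {0<..int N}"
  proof
    fix p assume p: "p \<in> residue_pairs N"
    obtain x y where [simp]: "p = (x, y)" by (cases p)
    have g: "gcd y (int N) \<le> int N" using False by (intro zdvd_imp_le) auto
    have xy: "0 < x" "x \<le> gcd y (int N)" "0 < y" "y \<le> int N" using p by (simp_all add: residue_pairs_def)
    then have "x \<le> int N" using g by linarith
    with xy show "p \<in> {0<..int N} \<times> {0<..int N}" by simp
  qed
  then show ?thesis by (rule finite_subset) simp
qed (simp add: residue_pairs_def)

lemma cong_unique_residue:
  fixes x x' n :: int
  assumes "[x = x'] (mod n)" "x \<in> {0<..n}" "x' \<in> {0<..n}"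
  shows "x = x'"
proof -
  have "n dvd x - x'" using assms(1) by (simp add: cong_iff_dvd_diff)
  moreover have "\<bar>x - x'\<bar> < n" using assms by auto
  ultimately show ?thesis by (metis dvd_imp_le_int eq_iff_diff_eq_0 not_le abs_of_pos assms(2) greaterThanAtMost_iff order.strict_trans2)
qed

lemma gcd_sub_self: "gcd (int N - y) (int N) = gcd y (int N)"
  by (metis gcd.commute gcd_diff1 gcd_neg1 minus_diff_eq gcd_diff2)

text \<open>A fixed point of negation would have 2 y = 0 modulo N, so that g is N or N / 2 and hence
  at least 3 for N \<ge> 5; but a unit x with 2 x = 0 modulo g exists only for g \<le> 2.\<close>

lemma neg_pair_props:
  assumes N: "N \<ge> 5" and p: "(x, y) \<in> residue_pairs N"
  defines "g \<equiv> gcd y (int N)"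
  obtains x' y' where "neg_pair N (x, y) = (x', y')" "(x', y') \<in> residue_pairs N" "gcd y' (int N) = g"
    "[x' = - x] (mod g)" "[y' = - y] (mod int N)" "(x', y') \<noteq> (x, y)"
proof -
  define y' where "y' = (if y = int N then y else int N - y)"
  define x' where "x' = (if x = g then x else g - x)"
  have g: "g > 0" using N by (simp add: g_def)
  have y: "0 < y" "y \<le> int N" and x: "0 < x" "x \<le> g" "coprime x g" using p by (auto simp: residue_pairs_def g_def)
  have gy': "gcd y' (int N) = g" by (simp add: y'_def g_def gcd_sub_self)
  have cx': "coprime x' g"
  proof (cases "x = g")
    case False
    have "gcd (g - x) g = gcd x g" by (metis gcd.commute gcd_diff1 gcd_neg1 minus_diff_eq gcd_diff2)
    then show ?thesis using x(3) False by (simp add: x'_def coprime_iff_gcd_eq_1)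
  qed (use x in \<open>simp add: x'_def\<close>)
  have "(x', y') \<in> residue_pairs N"
    unfolding residue_pairs_def mem_Collect_eq prod.case gy' using x y cx' g by (auto simp: x'_def y'_def)
  moreover have "[x' = - x] (mod g)" by (simp add: x'_def cong_iff_dvd_diff)
  moreover have "[y' = - y] (mod int N)" by (simp add: y'_def cong_iff_dvd_diff)
  moreover have "(x', y') \<noteq> (x, y)"
  proof
    assume "(x', y') = (x, y)"
    then have e: "x' = x" "y' = y" by auto
    have "g \<ge> 3"
    proof (cases "y = int N")
      case True
      then show ?thesis using N by (simp add: g_def)
    next
      case False
      then have Ny: "int N = y * 2" using e by (simp add: y'_def)
      then have "g = y" using y by (simp add: g_def)
      then show ?thesis using N Ny by simp
    qed
    have "x \<noteq> g" using x(3) \<open>g \<ge> 3\<close> by auto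
    then have "g = x * 2" using e by (simp add: x'_def)
    then have "is_unit x" using x(3) by (metis coprime_common_divisor dvd_refl dvd_triv_left)
    then have "x = 1" using x by simp
    then show False using \<open>g = x * 2\<close> \<open>g \<ge> 3\<close> by simp
  qed
  moreover have "neg_pair N (x, y) = (x', y')" by (simp add: neg_pair_def x'_def y'_def g_def)
  ultimately show ?thesis using that gy' by blast
qed

lemma residue_pair_of:
  assumes N: "N > 0" and ac: "coprime a c"
  obtains x y where "(x, y) \<in> residue_pairs N" "[y = c] (mod int N)" "[x = a] (mod gcd c (int N))" "gcd y (int N) = gcd c (int N)"
proof -
  have res: "\<exists>r\<in>{0<..n}. [r = z] (mod n)" if "n > 0" for n z :: int
  proof (cases "n dvd z")
    case True
    then show ?thesis using that by (intro bexI[of _ n]) (auto simp: cong_iff_dvd_diff)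
  next
    case False
    then have "z mod n \<noteq> 0" by (simp add: dvd_eq_mod_eq_0)
    then have "0 < z mod n" "z mod n \<le> n" using pos_mod_sign[OF that, of z] pos_mod_bound[OF that, of z] by linarith+
    then show ?thesis by (intro bexI[of _ "z mod n"]) (auto simp: cong_def)
  qed
  define g where "g = gcd c (int N)"
  have g: "g > 0" using N by (simp add: g_def)
  obtain y where y: "y \<in> {0<..int N}" "[y = c] (mod int N)" using res[of "int N" c] N by auto
  obtain x where x: "x \<in> {0<..g}" "[x = a] (mod g)" using res[of g a] g by auto
  have gy: "gcd y (int N) = g" using gcd_cong_sign[of 1 y c "int N"] y by (simp add: g_def)
  have "coprime a g" using ac unfolding g_def by (metis coprime_divisors dvd_refl gcd_dvd1)
  then have "coprime x g" using x(2) by (metis cong_imp_coprime cong_sym)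
  then have "(x, y) \<in> residue_pairs N" using x y by (simp add: residue_pairs_def gy)
  then show ?thesis using that[of x y] x y gy by (simp add: g_def)
qed

text \<open>The numerator may be any lift of x prime to y, because the cusp depends only on its
  class modulo gcd(y, N).\<close>

definition lift_cusp :: "nat \<Rightarrow> int \<times> int \<Rightarrow> (int \<times> int) set" where
  "lift_cusp N = (\<lambda>(x, y). cusp N (SOME a. coprime a y \<and> [a = x] (mod gcd y (int N))) y)"

lemma lift_cusp_obtain:
  assumes p: "(x, y) \<in> residue_pairs N"
  obtains a where "lift_cusp N (x, y) = cusp N a y" "coprime a y" "[a = x] (mod gcd y (int N))"
proof -
  have "coprime x (gcd y (int N))" "y \<noteq> 0" using p by (auto simp: residue_pairs_def)
  then obtain t where "coprime (x + t * gcd y (int N)) y" using coprime_shift by blast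
  then have "\<exists>a. coprime a y \<and> [a = x] (mod gcd y (int N))"
    by (intro exI[of _ "x + t * gcd y (int N)"]) (simp add: cong_iff_dvd_diff)
  from someI_ex[OF this] show ?thesis
    by (intro that[of "SOME a. coprime a y \<and> [a = x] (mod gcd y (int N))"]) (auto simp: lift_cusp_def)
qed

lemma lift_cusp_eq_iff:
  assumes N: "N \<ge> 5" and p: "p \<in> residue_pairs N" and p': "p' \<in> residue_pairs N"
  shows "lift_cusp N p' = lift_cusp N p \<longleftrightarrow> p' = p \<or> p' = neg_pair N p"
proof -
  obtain x y where xy: "p = (x, y)" by (cases p)
  obtain x' y' where xy': "p' = (x', y')" by (cases p')
  define g where "g = gcd y (int N)"
  have N0: "N > 0" using N by simp
  obtain a where a: "lift_cusp N (x, y) = cusp N a y" "coprime a y" "[a = x] (mod g)"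
    unfolding g_def using lift_cusp_obtain p xy by metis
  obtain a' where a': "lift_cusp N (x', y') = cusp N a' y'" "coprime a' y'" "[a' = x'] (mod gcd y' (int N))"
    using lift_cusp_obtain p' xy' by metis
  obtain u v where uv: "neg_pair N (x, y) = (u, v)" "(u, v) \<in> residue_pairs N" "gcd v (int N) = g"
    "[u = - x] (mod g)" "[v = - y] (mod int N)"
    unfolding g_def using neg_pair_props[OF N p[unfolded xy]] by metis
  have r: "y \<in> {0<..int N}" "x \<in> {0<..g}" "y' \<in> {0<..int N}" "v \<in> {0<..int N}" "u \<in> {0<..g}"
    using p p' uv(2,3) by (auto simp: residue_pairs_def xy xy' g_def)
  have r': "x' \<in> {0<..g}" if "gcd y' (int N) = g" using p' that by (auto simp: residue_pairs_def xy')
  have "lift_cusp N p' = lift_cusp N p \<longleftrightarrow> cusp_sim N a y a' y'"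
    unfolding xy xy' a a' using cusp_eq_iff[OF N0 a(2) a'(2)] by auto
  also have "\<dots> \<longleftrightarrow> p' = p \<or> p' = neg_pair N p"
  proof
    assume s: "cusp_sim N a y a' y'"
    then have g': "gcd y' (int N) = g" by (simp add: cusp_sim_gcd g_def)
    from s consider "[y' = y] (mod int N)" "[a' = a] (mod g)" | "[y' = - y] (mod int N)" "[a' = - a] (mod g)"
      unfolding cusp_sim_def g_def by auto
    then show "p' = p \<or> p' = neg_pair N p"
    proof cases
      case 1
      have "[x' = x] (mod g)" using a(3) a'(3) 1(2) unfolding g' by (metis cong_sym cong_trans)
      then have "x' = x" using r r'[OF g'] by (intro cong_unique_residue)
      moreover have "y' = y" using 1 r by (intro cong_unique_residue)
      ultimately show ?thesis by (simp add: xy xy')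
    next
      case 2
      have "[- a = - x] (mod g)" using a(3) by (simp add: cong_minus_minus_iff)
      then have "[x' = - x] (mod g)" using a'(3) 2(2) unfolding g' by (metis cong_sym cong_trans)
      then have "[x' = u] (mod g)" using uv(4) by (metis cong_sym cong_trans)
      then have "x' = u" using r r'[OF g'] by (intro cong_unique_residue)
      moreover have "[y' = v] (mod int N)" using 2(1) uv(5) by (metis cong_sym cong_trans)
      then have "y' = v" using r by (intro cong_unique_residue)
      ultimately show ?thesis by (simp add: xy xy' uv(1))
    qed
  next
    assume "p' = p \<or> p' = neg_pair N p"
    then consider "x' = x" "y' = y" | "x' = u" "y' = v" by (auto simp: xy xy' uv(1))
    then show "cusp_sim N a y a' y'"
    proof cases
      case 1
      then have "[a' = 1 * a] (mod g)" using a(3) a'(3) by (simp add: g_def) (metis cong_sym cong_trans)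
      then show ?thesis unfolding cusp_sim_def g_def[symmetric] by (intro bexI[of _ 1]) (auto simp: 1)
    next
      case 2
      have "[- a = - x] (mod g)" using a(3) by (simp add: cong_minus_minus_iff)
      moreover have "[a' = u] (mod g)" using a'(3) by (simp add: 2 uv(3))
      ultimately have "[a' = - 1 * a] (mod g)" using uv(4) by simp (metis cong_sym cong_trans)
      then show ?thesis unfolding cusp_sim_def g_def[symmetric] using uv(5) by (intro bexI[of _ "-1"]) (auto simp: 2)
    qed
  qed
  finally show ?thesis .
qed

lemma lift_cusp_image_pair_class:
  assumes N: "N \<ge> 5" and ac: "coprime a c"
  shows "lift_cusp N ` pair_class N a (gcd c (int N)) = galois_orbit N (cusp N a c)"
proof -
  have N0: "N > 0" and N1: "N > 1" using N by auto
  define g where "g = gcd c (int N)"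
  show ?thesis unfolding galois_orbit_cusp[OF N1 ac] g_def[symmetric]
  proof (intro equalityI subsetI)
    fix D assume "D \<in> lift_cusp N ` pair_class N a g"
    then obtain x y where "(x, y) \<in> pair_class N a g" and D: "D = lift_cusp N (x, y)" by auto
    then have "(x, y) \<in> residue_pairs N" "gcd y (int N) = g" "\<exists>\<epsilon>\<in>{1, -1}. [x = \<epsilon> * a] (mod g)"
      by (simp_all add: pair_class_def)
    then obtain \<epsilon> where p: "(x, y) \<in> residue_pairs N" "D = lift_cusp N (x, y)" "gcd y (int N) = g"
      and \<epsilon>: "\<epsilon> \<in> {1, -1}" "[x = \<epsilon> * a] (mod g)" using D by blast
    obtain a' where a': "lift_cusp N (x, y) = cusp N a' y" "coprime a' y" "[a' = x] (mod gcd y (int N))"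
      using lift_cusp_obtain[OF p(1)] by blast
    have "[a' = \<epsilon> * a] (mod g)" using a'(3) \<epsilon>(2) unfolding p(3) by (rule cong_trans)
    then show "D \<in> {cusp N a' c' |a' c'. coprime a' c' \<and> gcd c' (int N) = g \<and> (\<exists>\<epsilon>\<in>{1, - 1}. [a' = \<epsilon> * a] (mod g))}"
      unfolding mem_Collect_eq p(2) a'(1) using \<epsilon>(1) a'(2) p(3) by (intro exI conjI refl) (assumption | blast)+
  next
    fix D assume "D \<in> {cusp N a' c' |a' c'. coprime a' c' \<and> gcd c' (int N) = g \<and> (\<exists>\<epsilon>\<in>{1, - 1}. [a' = \<epsilon> * a] (mod g))}"
    then have "\<exists>a' c'. D = cusp N a' c' \<and> coprime a' c' \<and> gcd c' (int N) = g \<and> (\<exists>\<epsilon>\<in>{1, - 1}. [a' = \<epsilon> * a] (mod g))"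
      unfolding mem_Collect_eq .
    then obtain a' c' where D: "D = cusp N a' c'" "coprime a' c'" "gcd c' (int N) = g"
      and "\<exists>\<epsilon>\<in>{1, -1}. [a' = \<epsilon> * a] (mod g)" by (elim exE conjE)
    then obtain \<epsilon> where \<epsilon>: "\<epsilon> \<in> {1, -1}" "[a' = \<epsilon> * a] (mod g)" by (elim bexE)
    obtain x y where p: "(x, y) \<in> residue_pairs N" "[y = c'] (mod int N)" "[x = a'] (mod g)" "gcd y (int N) = g"
      using residue_pair_of[OF N0 D(2)] D(3) by metis
    obtain a'' where a'': "lift_cusp N (x, y) = cusp N a'' y" "coprime a'' y" "[a'' = x] (mod g)"
      using lift_cusp_obtain[OF p(1)] p(4) by metis
    have "[a'' = 1 * a'] (mod gcd c' (int N))" using a''(3) p(3) D(3) by (auto intro: cong_trans)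
    then have "cusp_sim N a' c' a'' y" unfolding cusp_sim_def using p(2) by (intro bexI[of _ 1]) auto
    then have "cusp N a' c' = cusp N a'' y" unfolding cusp_eq_iff[OF N0 D(2) a''(2)] .
    then have "D = lift_cusp N (x, y)" by (simp add: D(1) a''(1))
    moreover have "(x, y) \<in> pair_class N a g"
    proof -
      have "[x = \<epsilon> * a] (mod g)" using p(3) \<epsilon>(2) by (rule cong_trans)
      then show ?thesis unfolding pair_class_def using p \<epsilon>(1) by blast
    qed
    ultimately show "D \<in> lift_cusp N ` pair_class N a g" by blast
  qed
qed

lemma neg_pair_in_pair_class:
  assumes N: "N \<ge> 5" and p: "p \<in> pair_class N a g"
  shows "neg_pair N p \<in> pair_class N a g" "neg_pair N p \<noteq> p"
proof -
  obtain x y where xy: "p = (x, y)" by (cases p)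
  have r: "(x, y) \<in> residue_pairs N" and g: "gcd y (int N) = g" and "\<exists>\<epsilon>\<in>{1, -1}. [x = \<epsilon> * a] (mod g)"
    using p by (auto simp: pair_class_def xy)
  then obtain \<epsilon> where \<epsilon>: "\<epsilon> \<in> {1, -1}" "[x = \<epsilon> * a] (mod g)" by blast
  obtain u v where uv: "neg_pair N (x, y) = (u, v)" "(u, v) \<in> residue_pairs N" "gcd v (int N) = g"
    "[u = - x] (mod g)" "(u, v) \<noteq> (x, y)"
    using neg_pair_props[OF N r] g by metis
  have "[- x = - (\<epsilon> * a)] (mod g)" using \<epsilon>(2) by (simp add: cong_minus_minus_iff)
  then have "[u = (- \<epsilon>) * a] (mod g)" using uv(4) by (auto intro: cong_trans)
  moreover have "- \<epsilon> \<in> {1, -1}" using \<epsilon>(1) by auto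
  ultimately have "(u, v) \<in> pair_class N a g" unfolding pair_class_def using uv by blast
  then show "neg_pair N p \<in> pair_class N a g" "neg_pair N p \<noteq> p" using uv by (simp_all add: xy)
qed

text \<open>The fibres of \<open>lift_cusp\<close> over the orbit have the form {p, -p}, with two
  elements because negation has no fixed point.\<close>

lemma card_pair_class:
  assumes N: "N \<ge> 5" and ac: "coprime a c"
  shows "card (pair_class N a (gcd c (int N))) = 2 * card (galois_orbit N (cusp N a c))"
proof -
  define A where "A = pair_class N a (gcd c (int N))"
  have sub: "A \<subseteq> residue_pairs N" by (auto simp: A_def pair_class_def)
  have fin: "finite A" using sub finite_residue_pairs finite_subset by blast
  have "card A = (\<Sum>D\<in>lift_cusp N ` A. card {p\<in>A. lift_cusp N p = D})"
    unfolding card_eq_sum by (rule sum.image_gen[OF fin])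
  also have "\<dots> = (\<Sum>D\<in>lift_cusp N ` A. 2)"
  proof (intro sum.cong refl)
    fix D assume "D \<in> lift_cusp N ` A"
    then obtain p where p: "p \<in> A" "D = lift_cusp N p" by blast
    note np = neg_pair_in_pair_class[OF N p(1)[unfolded A_def], folded A_def]
    have "{p'\<in>A. lift_cusp N p' = D} = {p, neg_pair N p}"
    proof -
      have "lift_cusp N p' = D \<longleftrightarrow> p' = p \<or> p' = neg_pair N p" if "p' \<in> A" for p'
        unfolding p(2) using lift_cusp_eq_iff[OF N, of p p'] sub p that by blast
      then show ?thesis using p(1) np(1) by blast
    qed
    then show "card {p'\<in>A. lift_cusp N p' = D} = 2" using np(2) by simp
  qed
  also have "\<dots> = 2 * card (lift_cusp N ` A)" by simp
  finally show ?thesis unfolding A_def lift_cusp_image_pair_class[OF N ac] .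
qed

lemma orbit_reps_cover:
  assumes N: "N > 1" and reps: "orbit_reps N a c" and pr: "coprime p r"
  obtains i where "i \<le> N div 2" "gcd r (int N) = gcd (c i) (int N)"
    "\<exists>\<epsilon>\<in>{1, -1}. [p = \<epsilon> * a i] (mod gcd (c i) (int N))"
proof -
  have N0: "N > 0" using N by simp
  have "galois_orbit N (cusp N p r) \<in> galois_orbit N ` cusps N" using pr by (auto simp: cusps_def)
  then obtain i where i: "i \<le> N div 2" "galois_orbit N (cusp N p r) = galois_orbit N (cusp N (a i) (c i))"
  proof -
    have "(\<lambda>r. galois_orbit N (cusp N (a r) (c r))) ` {0..N div 2} = galois_orbit N ` cusps N"
      using reps unfolding orbit_reps_def bij_betw_def by blast
    with \<open>galois_orbit N (cusp N p r) \<in> galois_orbit N ` cusps N\<close>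
    have "galois_orbit N (cusp N p r) \<in> (\<lambda>r. galois_orbit N (cusp N (a r) (c r))) ` {0..N div 2}" by simp
    then show ?thesis using that by auto
  qed
  have cop: "coprime (a i) (c i)" using reps i by (simp add: orbit_reps_def)
  have "cusp N p r \<in> galois_orbit N (cusp N p r)"
  proof -
    have "cusp N p r = cusp N p r \<and> coprime p r \<and> gcd r (int N) = gcd r (int N) \<and> (\<exists>\<epsilon>\<in>{1, - 1}. [p = \<epsilon> * p] (mod gcd r (int N)))"
      using pr by simp
    then show ?thesis unfolding galois_orbit_cusp[OF N pr] mem_Collect_eq by (intro exI)
  qed
  then have "cusp N p r \<in> galois_orbit N (cusp N (a i) (c i))" using i by simp
  then have "\<exists>a' c'. cusp N p r = cusp N a' c' \<and> coprime a' c' \<and> gcd c' (int N) = gcd (c i) (int N) \<and>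
      (\<exists>\<epsilon>\<in>{1, - 1}. [a' = \<epsilon> * a i] (mod gcd (c i) (int N)))"
    unfolding galois_orbit_cusp[OF N cop] mem_Collect_eq .
  then obtain a' c' \<epsilon> where *: "cusp N p r = cusp N a' c'" "coprime a' c'" "gcd c' (int N) = gcd (c i) (int N)"
    "\<epsilon> \<in> {1, -1}" "[a' = \<epsilon> * a i] (mod gcd (c i) (int N))" by (elim exE conjE bexE)
  have "cusp_sim N a' c' p r" using *(1) cusp_eq_iff[OF N0 *(2) pr] by simp
  then obtain \<delta> where \<delta>: "\<delta> \<in> {1, -1}" "[r = \<delta> * c'] (mod int N)" "[p = \<delta> * a'] (mod gcd (c i) (int N))"
    unfolding cusp_sim_def *(3) by blast
  have "[p = \<delta> * \<epsilon> * a i] (mod gcd (c i) (int N))"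
    using cong_trans[OF \<delta>(3) cong_scalar_left[OF *(5)]] by (simp add: mult.assoc)
  moreover have "\<delta> * \<epsilon> \<in> {1, -1}" using \<delta>(1) *(4) by auto
  moreover have "gcd r (int N) = gcd (c i) (int N)" using gcd_cong_sign[OF \<delta>(1,2)] *(3) by simp
  ultimately show ?thesis using that[OF i(1)] by blast
qed

text \<open>Two classes that meet have the same level and coincide, since equality up to sign is an
  equivalence; they would then have the same orbit as image, against the injectivity in
  \<open>orbit_reps\<close>.\<close>

lemma residue_pairs_orbit_partition:
  assumes N: "N \<ge> 5" and reps: "orbit_reps N a c"
  shows "residue_pairs N = (\<Union>i\<in>{0..N div 2}. pair_class N (a i) (gcd (c i) (int N)))"
    and "\<And>i i'. i \<le> N div 2 \<Longrightarrow> i' \<le> N div 2 \<Longrightarrow> i \<noteq> i' \<Longrightarrow>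
      pair_class N (a i) (gcd (c i) (int N)) \<inter> pair_class N (a i') (gcd (c i') (int N)) = {}"
proof -
  have N1: "N > 1" using N by simp
  have cop: "coprime (a i) (c i)" if "i \<le> N div 2" for i using reps that by (simp add: orbit_reps_def)
  show "residue_pairs N = (\<Union>i\<in>{0..N div 2}. pair_class N (a i) (gcd (c i) (int N)))"
  proof (intro equalityI subsetI)
    fix p assume p: "p \<in> residue_pairs N"
    obtain x y where xy: "p = (x, y)" by (cases p)
    obtain b where b: "lift_cusp N (x, y) = cusp N b y" "coprime b y" "[b = x] (mod gcd y (int N))"
      using lift_cusp_obtain p xy by metis
    obtain i where i: "i \<le> N div 2" "gcd y (int N) = gcd (c i) (int N)"
      "\<exists>\<epsilon>\<in>{1, -1}. [b = \<epsilon> * a i] (mod gcd (c i) (int N))"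
      using orbit_reps_cover[OF N1 reps b(2)] by metis
    then obtain \<epsilon> where \<epsilon>: "\<epsilon> \<in> {1, -1}" "[b = \<epsilon> * a i] (mod gcd (c i) (int N))" by blast
    have "[x = \<epsilon> * a i] (mod gcd (c i) (int N))"
      using cong_trans[OF cong_sym[OF b(3)[unfolded i(2)]] \<epsilon>(2)] .
    then have "(x, y) \<in> pair_class N (a i) (gcd (c i) (int N))"
      unfolding pair_class_def using \<epsilon>(1) p i(2) by (auto simp: xy)
    then show "p \<in> (\<Union>i\<in>{0..N div 2}. pair_class N (a i) (gcd (c i) (int N)))" using i(1) by (auto simp: xy)
  qed (auto simp: pair_class_def)
  fix i i' assume i: "i \<le> N div 2" "i' \<le> N div 2" "i \<noteq> i'"
  show "pair_class N (a i) (gcd (c i) (int N)) \<inter> pair_class N (a i') (gcd (c i') (int N)) = {}"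
  proof (rule ccontr)
    assume "pair_class N (a i) (gcd (c i) (int N)) \<inter> pair_class N (a i') (gcd (c i') (int N)) \<noteq> {}"
    then obtain x y where xy: "(x, y) \<in> pair_class N (a i) (gcd (c i) (int N))" "(x, y) \<in> pair_class N (a i') (gcd (c i') (int N))"
      by auto
    have g: "gcd (c i) (int N) = gcd (c i') (int N)" using xy by (auto simp: pair_class_def)
    define g where "g = gcd (c i') (int N)"
    obtain \<epsilon> where \<epsilon>: "\<epsilon> \<in> {1, -1}" "[x = \<epsilon> * a i] (mod g)" using xy(1) unfolding pair_class_def g g_def by blast
    obtain \<delta> where \<delta>: "\<delta> \<in> {1, -1}" "[x = \<delta> * a i'] (mod g)" using xy(2) unfolding pair_class_def g_def by blast
    have "[a i = \<epsilon> * x] (mod g)" by (rule sign_cong_sym[OF \<epsilon>])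
    also have "[\<epsilon> * x = \<epsilon> * (\<delta> * a i')] (mod g)" by (rule cong_scalar_left[OF \<delta>(2)])
    finally have "[a i = (\<epsilon> * \<delta>) * a i'] (mod g)" by (simp add: mult.assoc)
    moreover have "\<epsilon> * \<delta> \<in> {1, -1}" using \<epsilon>(1) \<delta>(1) by auto
    ultimately have ex: "\<exists>\<epsilon>\<in>{1, -1}. [a i = \<epsilon> * a i'] (mod g)" by blast
    have "pair_class N (a i) g = pair_class N (a i') g"
    proof -
      have sub: "pair_class N b g \<subseteq> pair_class N b' g" if bb': "\<exists>\<epsilon>\<in>{1, -1}. [b = \<epsilon> * b'] (mod g)" for b b'
      proof
        fix q assume q: "q \<in> pair_class N b g"
        obtain u v where [simp]: "q = (u, v)" by (cases q)
        obtain \<epsilon> where \<epsilon>: "\<epsilon> \<in> {1, -1}" "[b = \<epsilon> * b'] (mod g)" using bb' by blast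
        have u: "(u, v) \<in> residue_pairs N" "gcd v (int N) = g" "\<exists>\<epsilon>\<in>{1, -1}. [u = \<epsilon> * b] (mod g)"
          using q by (auto simp: pair_class_def)
        then obtain \<delta> where \<delta>: "\<delta> \<in> {1, -1}" "[u = \<delta> * b] (mod g)" by blast
        have "[u = \<delta> * \<epsilon> * b'] (mod g)"
          using cong_trans[OF \<delta>(2) cong_scalar_left[OF \<epsilon>(2)]] by (simp add: mult.assoc)
        moreover have "\<delta> * \<epsilon> \<in> {1, -1}" using \<epsilon>(1) \<delta>(1) by auto
        ultimately have "\<exists>\<epsilon>\<in>{1, -1}. [u = \<epsilon> * b'] (mod g)" by blast
        then show "q \<in> pair_class N b' g" using u by (simp add: pair_class_def)
      qed
      have "\<exists>\<epsilon>\<in>{1, -1}. [a i' = \<epsilon> * a i] (mod g)" using ex sign_cong_sym by blast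
      from sub[OF ex] sub[OF this] show ?thesis by (rule equalityI)
    qed
    then have "galois_orbit N (cusp N (a i) (c i)) = galois_orbit N (cusp N (a i') (c i'))"
      using lift_cusp_image_pair_class[OF N cop[OF i(1)]] lift_cusp_image_pair_class[OF N cop[OF i(2)]] g by (simp add: g_def)
    then show False using reps i unfolding orbit_reps_def bij_betw_def inj_on_def by auto
  qed
qed

text \<open>\<mu>_i is half the size of the i-th pair class, and G is constant on that class because
  it is even and periodic. Sums over orbits thus become half of sums over residue pairs, which no
  longer mention representatives.\<close>

lemma sum_orbit_reps:
  fixes G :: "int \<Rightarrow> int \<Rightarrow> real"
  assumes N: "N \<ge> 5" and reps: "orbit_reps N a c"
    and G: "\<And>g x x' \<epsilon>. \<epsilon> \<in> {1, -1} \<Longrightarrow> [x' = \<epsilon> * x] (mod g) \<Longrightarrow> g > 0 \<Longrightarrow> G g x' = G g x"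
  shows "(\<Sum>i=0..N div 2. real (card (galois_orbit N (cusp N (a i) (c i)))) * G (gcd (c i) (int N)) (a i)) =
    1 / 2 * (\<Sum>y\<in>{0<..N}. \<Sum>x\<in>totatives (gcd y N). G (int (gcd y N)) (int x))"
proof -
  define A where "A = (\<lambda>i. pair_class N (a i) (gcd (c i) (int N)))"
  define H where "H = (\<lambda>(x, y). G (gcd y (int N)) x)"
  have cop: "coprime (a i) (c i)" if "i \<le> N div 2" for i using reps that by (simp add: orbit_reps_def)
  have fin: "finite (A i)" for i
    by (rule finite_subset[OF _ finite_residue_pairs[of N]]) (auto simp: A_def pair_class_def)
  have "(\<Sum>p\<in>residue_pairs N. H p) = (\<Sum>i\<in>{0..N div 2}. \<Sum>p\<in>A i. H p)"
    unfolding residue_pairs_orbit_partition(1)[OF N reps] A_def[symmetric]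
    using residue_pairs_orbit_partition(2)[OF N reps] fin
    by (intro sum.UNION_disjoint) (auto simp: A_def)
  also have "\<dots> = (\<Sum>i\<in>{0..N div 2}. real (card (A i)) * G (gcd (c i) (int N)) (a i))"
  proof (intro sum.cong refl)
    fix i
    have "H p = G (gcd (c i) (int N)) (a i)" if p: "p \<in> A i" for p
    proof -
      obtain x y where xy: "p = (x, y)" by (cases p)
      have "gcd y (int N) = gcd (c i) (int N)" "\<exists>\<epsilon>\<in>{1, -1}. [x = \<epsilon> * a i] (mod gcd (c i) (int N))"
        using p by (auto simp: A_def pair_class_def xy)
      moreover have "gcd (c i) (int N) > 0" using N by simp
      ultimately show ?thesis using G unfolding H_def xy prod.case by metis
    qed
    then show "(\<Sum>p\<in>A i. H p) = real (card (A i)) * G (gcd (c i) (int N)) (a i)" by simp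
  qed
  also have "\<dots> = 2 * (\<Sum>i=0..N div 2. real (card (galois_orbit N (cusp N (a i) (c i)))) * G (gcd (c i) (int N)) (a i))"
    unfolding sum_distrib_left A_def using card_pair_class[OF N cop] by (intro sum.cong refl) simp
  finally have 1: "(\<Sum>p\<in>residue_pairs N. H p) = \<dots>" .
  have "(\<Sum>y\<in>{0<..N}. \<Sum>x\<in>totatives (gcd y N). G (int (gcd y N)) (int x)) =
     (\<Sum>p\<in>Sigma {0<..N} (\<lambda>y. totatives (gcd y N)). G (int (gcd (fst p) N)) (int (snd p)))"
    by (subst sum.Sigma) (auto simp: case_prod_unfold)
  also have "\<dots> = (\<Sum>p\<in>residue_pairs N. H p)"
  proof -
    have "residue_pairs N = (\<lambda>(y, x). (int x, int y)) ` Sigma {0<..N} (\<lambda>y. totatives (gcd y N))" (is "_ = ?f ` ?S")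
    proof (intro equalityI subsetI)
      fix p assume p: "p \<in> residue_pairs N"
      obtain x y where xy: "p = (x, y)" by (cases p)
      have "0 \<le> x" "0 \<le> y" using p by (auto simp: residue_pairs_def xy)
      then obtain x' y' where xy': "x = int x'" "y = int y'" by (metis nonneg_int_cases)
      have "(y', x') \<in> ?S" using p by (simp add: residue_pairs_def xy xy' in_totatives_iff)
      moreover have "p = ?f (y', x')" by (simp add: xy xy')
      ultimately show "p \<in> ?f ` ?S" by (rule image_eqI[rotated])
    next
      fix p assume "p \<in> ?f ` ?S"
      then show "p \<in> residue_pairs N" by (auto simp: residue_pairs_def in_totatives_iff)
    qed
    moreover have "inj_on ?f ?S" by (auto simp: inj_on_def)
    ultimately show ?thesis by (simp add: sum.reindex case_prod_unfold H_def)
  qed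
  finally show ?thesis using 1 by simp
qed

text \<open>Here g = N, so a' = \<plusminus>1 and c' = 0 modulo N, and the congruence criterion
  identifies all such points. This is \<mu>_m = 1.\<close>

lemma card_galois_orbit_infinity:
  assumes N: "N > 1"
  shows "card (galois_orbit N (cusp N 1 (int N))) = 1"
proof -
  have N0: "N > 0" using N by simp
  have c: "coprime 1 (int N)" by simp
  have "galois_orbit N (cusp N 1 (int N)) = {cusp N 1 (int N)}"
    unfolding galois_orbit_cusp[OF N c]
  proof (intro equalityI subsetI)
    fix D assume "D \<in> {cusp N a' c' |a' c'. coprime a' c' \<and> gcd c' (int N) = gcd (int N) (int N) \<and> (\<exists>\<epsilon>\<in>{1, - 1}. [a' = \<epsilon> * 1] (mod gcd (int N) (int N)))}"
    then have "\<exists>a' c'. D = cusp N a' c' \<and> coprime a' c' \<and> gcd c' (int N) = gcd (int N) (int N) \<and> (\<exists>\<epsilon>\<in>{1, - 1}. [a' = \<epsilon> * 1] (mod gcd (int N) (int N)))"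
      unfolding mem_Collect_eq .
    then obtain a' c' \<epsilon> where D: "D = cusp N a' c'" "coprime a' c'" "gcd c' (int N) = gcd (int N) (int N)"
      "\<epsilon> \<in> {1, -1}" "[a' = \<epsilon> * 1] (mod gcd (int N) (int N))" by (elim exE conjE bexE)
    have "int N dvd c'" using D(3) by (metis gcd_dvd1 gcd_idem_int abs_of_nat)
    then have "[c' = \<epsilon> * int N] (mod int N)" by (auto simp: cong_iff_dvd_diff)
    then have "cusp_sim N 1 (int N) a' c'" unfolding cusp_sim_def using D(4,5) by blast
    then have "cusp N 1 (int N) = cusp N a' c'" unfolding cusp_eq_iff[OF N0 c D(2)] .
    then show "D \<in> {cusp N 1 (int N)}" using D(1) by simp
  next
    fix D assume "D \<in> {cusp N 1 (int N)}"
    then have "D = cusp N 1 (int N) \<and> coprime 1 (int N) \<and> gcd (int N) (int N) = gcd (int N) (int N) \<and> (\<exists>\<epsilon>\<in>{1, - 1}. [1 = \<epsilon> * 1] (mod gcd (int N) (int N)))"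
      by simp
    then show "D \<in> {cusp N a' c' |a' c'. coprime a' c' \<and> gcd c' (int N) = gcd (int N) (int N) \<and> (\<exists>\<epsilon>\<in>{1, - 1}. [a' = \<epsilon> * 1] (mod gcd (int N) (int N)))}"
      unfolding mem_Collect_eq by (intro exI)
  qed
  then show ?thesis by simp
qed

section \<open>Lattice points of a simplex in a coset\<close>

definition lattice_image :: "nat \<Rightarrow> int mat \<Rightarrow> int Matrix.vec set" where
  "lattice_image n W = {W *\<^sub>v x | x. x \<in> carrier_vec n}"

definition coset_reps :: "nat \<Rightarrow> int mat \<Rightarrow> int Matrix.vec set \<Rightarrow> bool" where
  "coset_reps n W S \<longleftrightarrow> finite S \<and> S \<subseteq> carrier_vec n \<and>
     (\<forall>z\<in>carrier_vec n. \<exists>!s. s \<in> S \<and> z - s \<in> lattice_image n W)"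

text \<open>An invertible integer matrix on the right only permutes the coefficient vectors; the
  column operations below are of this kind.\<close>

lemma lattice_image_mult_unimodular:
  assumes W: "W \<in> carrier_mat n n" and U: "U \<in> carrier_mat n n" "U' \<in> carrier_mat n n" "U * U' = 1\<^sub>m n"
  shows "lattice_image n (W * U) = lattice_image n W"
proof (intro equalityI subsetI)
  fix z assume "z \<in> lattice_image n (W * U)"
  then obtain x where x: "x \<in> carrier_vec n" "z = W * U *\<^sub>v x" by (auto simp: lattice_image_def)
  have "z = W *\<^sub>v (U *\<^sub>v x)" unfolding x(2) by (rule assoc_mult_mat_vec[OF W U(1) x(1)])
  moreover have "U *\<^sub>v x \<in> carrier_vec n" using U(1) x(1) by (rule mult_mat_vec_carrier)
  ultimately show "z \<in> lattice_image n W" unfolding lattice_image_def by blast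
next
  fix z assume "z \<in> lattice_image n W"
  then obtain x where x: "x \<in> carrier_vec n" "z = W *\<^sub>v x" by (auto simp: lattice_image_def)
  have Ux: "U' *\<^sub>v x \<in> carrier_vec n" using U(2) x(1) by (rule mult_mat_vec_carrier)
  have "W * U *\<^sub>v (U' *\<^sub>v x) = W *\<^sub>v (U *\<^sub>v (U' *\<^sub>v x))" by (rule assoc_mult_mat_vec[OF W U(1) Ux])
  also have "U *\<^sub>v (U' *\<^sub>v x) = (U * U') *\<^sub>v x" by (rule assoc_mult_mat_vec[OF U(1,2) x(1), symmetric])
  also have "\<dots> = x" unfolding U(3) using x(1) by simp
  finally have "z = W * U *\<^sub>v (U' *\<^sub>v x)" using x(2) by simp
  then show "z \<in> lattice_image n (W * U)" using Ux unfolding lattice_image_def by blast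
qed

lemma lattice_image_addcol:
  fixes W :: "int mat"
  assumes W: "W \<in> carrier_mat n n" and kl: "k < n" "l < n" "k \<noteq> l"
  shows "lattice_image n (addcol a l k W) = lattice_image n W"
    and "Determinant.det (addcol a l k W) = Determinant.det W"
proof -
  have e: "addcol a l k W = W * addrow_mat n a k l" by (rule addcol_mat[OF W kl(1)])
  show "lattice_image n (addcol a l k W) = lattice_image n W"
    unfolding e by (rule lattice_image_mult_unimodular[OF W _ _ addrow_mat_inv[OF kl]]) simp_all
  show "Determinant.det (addcol a l k W) = Determinant.det W"
    unfolding e using W by (subst Determinant.det_mult[of _ n]) (simp_all add: det_addrow_mat[OF kl(3)])
qed

lemma lattice_image_swapcols:
  fixes W :: "int mat"
  assumes W: "W \<in> carrier_mat n n" and kl: "k < n" "l < n" "k \<noteq> l"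
  shows "lattice_image n (swapcols k l W) = lattice_image n W"
    and "\<bar>Determinant.det (swapcols k l W)\<bar> = \<bar>Determinant.det W\<bar>"
proof -
  have e: "swapcols k l W = W * swaprows_mat n k l" by (rule swapcols_mat[OF W kl(1,2)])
  show "lattice_image n (swapcols k l W) = lattice_image n W"
    unfolding e by (rule lattice_image_mult_unimodular[OF W _ _ swaprows_mat_inv[OF kl(1,2)]]) simp_all
  show "\<bar>Determinant.det (swapcols k l W)\<bar> = \<bar>Determinant.det W\<bar>"
    using det_swapcols[OF kl W] by simp
qed

lemma coset_reps_cong:
  "lattice_image n W = lattice_image n W' \<Longrightarrow> coset_reps n W S \<longleftrightarrow> coset_reps n W' S"
  by (simp add: coset_reps_def)

text \<open>The first row is (d, 0), so (t, x) lies in the lattice iff t = d u and x minus u times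
  the column C lies in the lattice of W'. As d is nonzero, t determines u; residues modulo |d| and
  representatives for W' combine freely.\<close>

lemma coset_reps_block:
  fixes C W' :: "int mat"
  assumes d: "d \<noteq> 0" and C: "C \<in> carrier_mat n 1" and W': "W' \<in> carrier_mat n n" and S: "coset_reps n W' S"
  defines "A \<equiv> Matrix.mat 1 1 (\<lambda>_. d)"
  shows "\<exists>T. coset_reps (1 + n) (four_block_mat A (0\<^sub>m 1 n) C W') T \<and> card T = nat \<bar>d\<bar> * card S"
proof -
  define W where "W = four_block_mat A (0\<^sub>m 1 n) C W'"
  define v1 where "v1 = (\<lambda>t :: int. Matrix.vec 1 (\<lambda>_. t))"
  have A: "A \<in> carrier_mat 1 1" by (simp add: A_def)
  have v1c: "v1 t \<in> carrier_vec 1" for t by (simp add: v1_def)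
  have v1_ex: "\<exists>t. x = v1 t" if "x \<in> carrier_vec 1" for x
    using that by (intro exI[of _ "vec_index x 0"]) (auto simp: v1_def)
  have v1_inj: "v1 s = v1 t \<longleftrightarrow> s = t" for s t
    by (auto simp: v1_def dest: arg_cong[where f = "\<lambda>v. vec_index v 0"])
  have Av: "A *\<^sub>v v1 t = v1 (d * t)" for t
    by (rule eq_vecI) (auto simp: A_def v1_def scalar_prod_def)
  have Wv: "W *\<^sub>v (v1 t @\<^sub>v x) = v1 (d * t) @\<^sub>v (C *\<^sub>v v1 t + W' *\<^sub>v x)" if "x \<in> carrier_vec n" for t x
  proof -
    have "0\<^sub>m 1 n *\<^sub>v x = 0\<^sub>v 1" using that by (intro eq_vecI) (auto simp: scalar_prod_def)
    moreover have "v1 (d * t) + 0\<^sub>v 1 = v1 (d * t)" using v1c by simp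
    ultimately show ?thesis
      unfolding W_def using four_block_mat_mult_vec[OF A _ C W' v1c[of t] that, of "0\<^sub>m 1 n"] by (simp add: Av)
  qed
  have app: "\<exists>t x. z = v1 t @\<^sub>v x \<and> x \<in> carrier_vec n" if "z \<in> carrier_vec (1 + n)" for z
  proof -
    have "z = vec_first z 1 @\<^sub>v vec_last z n" using that by simp
    moreover obtain t where "vec_first z 1 = v1 t" using v1_ex[of "vec_first z 1"] by auto
    ultimately show ?thesis by (metis vec_last_carrier)
  qed
  have img: "v1 t @\<^sub>v x \<in> lattice_image (1 + n) W \<longleftrightarrow> (\<exists>u. t = d * u \<and> x - C *\<^sub>v v1 u \<in> lattice_image n W')"
    if x: "x \<in> carrier_vec n" for t x
  proof
    assume "v1 t @\<^sub>v x \<in> lattice_image (1 + n) W"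
    then obtain y where y: "y \<in> carrier_vec (1 + n)" "v1 t @\<^sub>v x = W *\<^sub>v y" by (auto simp: lattice_image_def)
    obtain u y' where y': "y = v1 u @\<^sub>v y'" "y' \<in> carrier_vec n" using app[OF y(1)] by blast
    have "v1 t @\<^sub>v x = v1 (d * u) @\<^sub>v (C *\<^sub>v v1 u + W' *\<^sub>v y')" using y(2) Wv[OF y'(2)] y'(1) by simp
    then have "v1 t = v1 (d * u)" "x = C *\<^sub>v v1 u + W' *\<^sub>v y'" using append_vec_eq[OF v1c v1c] by auto
    moreover from this have "x - C *\<^sub>v v1 u = W' *\<^sub>v y'"
      using C W' y' v1c by (intro eq_vecI) auto
    ultimately show "\<exists>u. t = d * u \<and> x - C *\<^sub>v v1 u \<in> lattice_image n W'"
      using y'(2) by (auto simp: v1_inj lattice_image_def)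
  next
    assume "\<exists>u. t = d * u \<and> x - C *\<^sub>v v1 u \<in> lattice_image n W'"
    then obtain u y where u: "t = d * u" and y: "y \<in> carrier_vec n" "x - C *\<^sub>v v1 u = W' *\<^sub>v y"
      by (auto simp: lattice_image_def)
    have "x = C *\<^sub>v v1 u + (x - C *\<^sub>v v1 u)" using x C by (intro eq_vecI) auto
    then have "v1 t @\<^sub>v x = W *\<^sub>v (v1 u @\<^sub>v y)" using Wv[OF y(1)] y(2) u by simp
    moreover have "v1 u @\<^sub>v y \<in> carrier_vec (1 + n)" by (rule append_carrier_vec[OF v1c y(1)])
    ultimately show "v1 t @\<^sub>v x \<in> lattice_image (1 + n) W" unfolding lattice_image_def by blast
  qed
  define T where "T = (\<lambda>(t, s). v1 t @\<^sub>v s) ` ({0..<\<bar>d\<bar>} \<times> S)"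
  have Sc: "s \<in> carrier_vec n" if "s \<in> S" for s using S that by (auto simp: coset_reps_def)
  have "inj_on (\<lambda>(t, s). v1 t @\<^sub>v s) ({0..<\<bar>d\<bar>} \<times> S)"
    using append_vec_eq[OF v1c v1c] by (auto simp: inj_on_def v1_inj)
  then have card: "card T = nat \<bar>d\<bar> * card S"
    by (simp add: T_def card_image card_cartesian_product)
  have "coset_reps (1 + n) W T"
    unfolding coset_reps_def
  proof (intro conjI ballI)
    show "finite T" using S by (simp add: T_def coset_reps_def)
    show "T \<subseteq> carrier_vec (1 + n)" 
    proof
      fix y assume "y \<in> T"
      then obtain r s where "y = v1 r @\<^sub>v s" "s \<in> S" by (auto simp: T_def)
      then show "y \<in> carrier_vec (1 + n)" using append_carrier_vec[OF v1c Sc] by blast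
    qed
  next
    fix z :: "int Matrix.vec" assume "z \<in> carrier_vec (1 + n)"
    then obtain t x where z: "z = v1 t @\<^sub>v x" "x \<in> carrier_vec n" using app by blast
    have sub: "(v1 t @\<^sub>v x) - (v1 r @\<^sub>v s) = v1 (t - r) @\<^sub>v (x - s)" if "s \<in> carrier_vec n" for r s
      using that z(2) by (intro eq_vecI) (auto simp: v1_def append_vec_def)
    define r0 where "r0 = t mod \<bar>d\<bar>"
    have r0: "r0 \<in> {0..<\<bar>d\<bar>}" using d by (simp add: r0_def)
    have r0d: "(\<exists>u. t - r = d * u) \<longleftrightarrow> r = r0" if "r \<in> {0..<\<bar>d\<bar>}" for r
    proof -
      have "(\<exists>u. t - r = d * u) \<longleftrightarrow> d dvd t - r" by (simp add: dvd_def)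
      also have "\<dots> \<longleftrightarrow> \<bar>d\<bar> dvd t - r" by simp
      also have "\<dots> \<longleftrightarrow> t mod \<bar>d\<bar> = r mod \<bar>d\<bar>" by (simp add: mod_eq_dvd_iff)
      also have "r mod \<bar>d\<bar> = r" using that by simp
      finally show ?thesis by (auto simp: r0_def)
    qed
    then obtain u where u: "t - r0 = d * u" using r0 by blast
    have uu: "t - r0 = d * u' \<longleftrightarrow> u' = u" for u' using u d by auto
    have cx: "x - C *\<^sub>v v1 u \<in> carrier_vec n" using z(2) C v1c by auto
    obtain s0 where s0: "s0 \<in> S" "(x - C *\<^sub>v v1 u) - s0 \<in> lattice_image n W'"
      and s0u: "\<And>s. s \<in> S \<Longrightarrow> (x - C *\<^sub>v v1 u) - s \<in> lattice_image n W' \<Longrightarrow> s = s0"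
      using S cx unfolding coset_reps_def by metis
    have comm: "(x - s) - C *\<^sub>v v1 u = (x - C *\<^sub>v v1 u) - s" if "s \<in> S" for s
      using Sc[OF that] z(2) C by (intro eq_vecI) auto
    have key: "z - (v1 r @\<^sub>v s) \<in> lattice_image (1 + n) W \<longleftrightarrow> r = r0 \<and> s = s0" if rs: "r \<in> {0..<\<bar>d\<bar>}" "s \<in> S" for r s
    proof -
      have xs: "x - s \<in> carrier_vec n" using z(2) Sc[OF rs(2)] by auto
      have "z - (v1 r @\<^sub>v s) \<in> lattice_image (1 + n) W \<longleftrightarrow>
          (\<exists>u. t - r = d * u \<and> (x - s) - C *\<^sub>v v1 u \<in> lattice_image n W')"
        unfolding z(1) sub[OF Sc[OF rs(2)]] img[OF xs] ..
      also have "\<dots> \<longleftrightarrow> r = r0 \<and> (x - s) - C *\<^sub>v v1 u \<in> lattice_image n W'"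
        using r0d[OF rs(1)] uu by metis
      also have "\<dots> \<longleftrightarrow> r = r0 \<and> s = s0"
        unfolding comm[OF rs(2)] using s0 s0u[OF rs(2)] by blast
      finally show ?thesis .
    qed
    show "\<exists>!s. s \<in> T \<and> z - s \<in> lattice_image (1 + n) W"
    proof (rule ex1I[of _ "v1 r0 @\<^sub>v s0"])
      show "v1 r0 @\<^sub>v s0 \<in> T \<and> z - (v1 r0 @\<^sub>v s0) \<in> lattice_image (1 + n) W"
        using key[OF r0 s0(1)] r0 s0(1) by (auto simp: T_def)
    next
      fix s assume s: "s \<in> T \<and> z - s \<in> lattice_image (1 + n) W"
      then obtain r s' where "s = v1 r @\<^sub>v s'" "r \<in> {0..<\<bar>d\<bar>}" "s' \<in> S" by (auto simp: T_def)
      then show "s = v1 r0 @\<^sub>v s0" using key s by auto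
    qed
  qed
  with card show ?thesis unfolding W_def by blast
qed

lemma coset_reps_step:
  fixes W :: "int mat"
  assumes IH: "\<And>V. V \<in> carrier_mat n n \<Longrightarrow> Determinant.det V \<noteq> 0 \<Longrightarrow>
      \<exists>S. coset_reps n V S \<and> card S = nat \<bar>Determinant.det V\<bar>"
    and W: "W \<in> carrier_mat (1 + n) (1 + n)" and det: "Determinant.det W \<noteq> 0"
    and row: "\<And>j. 0 < j \<Longrightarrow> j < 1 + n \<Longrightarrow> W $$ (0, j) = 0"
  shows "\<exists>S. coset_reps (1 + n) W S \<and> card S = nat \<bar>Determinant.det W\<bar>"
proof -
  obtain A1 A2 A3 A4 where split: "split_block W 1 1 = (A1, A2, A3, A4)" by (metis prod_cases4)
  have dims: "dim_row W = 1 + n" "dim_col W = 1 + n" using W by auto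
  note sb = split_block[OF split dims]
  define d where "d = W $$ (0, 0)"
  have A1: "A1 = Matrix.mat 1 1 (\<lambda>_. d)"
    using split dims by (auto simp: split_block_def Let_def d_def)
  have A2: "A2 = 0\<^sub>m 1 n"
    using split dims row by (auto simp: split_block_def Let_def)
  have "Determinant.det W = Determinant.det A1 * Determinant.det A4"
    unfolding sb(5) by (rule det_four_block_mat_upper_right_zero[OF sb(1) A2 sb(3,4)])
  also have "Determinant.det A1 = d" using det_single[of A1] sb(1) by (simp add: A1)
  finally have D: "Determinant.det W = d * Determinant.det A4" .
  then have nz: "d \<noteq> 0" "Determinant.det A4 \<noteq> 0" using det by auto
  obtain S where S: "coset_reps n A4 S" "card S = nat \<bar>Determinant.det A4\<bar>" using IH[OF sb(4) nz(2)] by blast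
  obtain T where T: "coset_reps (1 + n) (four_block_mat A1 A2 A3 A4) T" "card T = nat \<bar>d\<bar> * card S"
    using coset_reps_block[OF nz(1) sb(3,4) S(1)] unfolding A1 A2 by blast
  then show ?thesis using sb(5) S(2) D by (auto simp: abs_mult nat_mult_distrib)
qed

text \<open>Euclid's algorithm on the first row by column operations, then induction on the dimension.\<close>

theorem coset_reps_exist:
  fixes W :: "int mat"
  assumes "W \<in> carrier_mat n n" and "Determinant.det W \<noteq> 0"
  shows "\<exists>S. coset_reps n W S \<and> card S = nat \<bar>Determinant.det W\<bar>"
  using assms
proof (induction n arbitrary: W)
  case 0
  have c0: "carrier_vec 0 = {0\<^sub>v 0 :: int Matrix.vec}" by auto
  have "W *\<^sub>v 0\<^sub>v 0 = 0\<^sub>v 0" using 0 by auto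
  then have "coset_reps 0 W {0\<^sub>v 0}" by (auto simp: coset_reps_def lattice_image_def c0)
  moreover have "Determinant.det W = 1" using 0 by simp
  ultimately show ?case by (intro exI[of _ "{0\<^sub>v 0}"]) simp
next
  case (Suc n)
  \<comment> \<open>The measure that Euclid's algorithm decreases: the sum of absolute values in the
    first row.\<close>
  define \<mu> where "\<mu> = (\<lambda>W :: int mat. nat (\<Sum>j<Suc n. \<bar>W $$ (0, j)\<bar>))"
  have "W \<in> carrier_mat (Suc n) (Suc n) \<Longrightarrow> Determinant.det W \<noteq> 0 \<Longrightarrow>
      \<exists>S. coset_reps (Suc n) W S \<and> card S = nat \<bar>Determinant.det W\<bar>" for W
  proof (induction "\<mu> W" arbitrary: W rule: less_induct)
    case less
    note W = less.prems(1)
    show ?case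
    proof (cases "\<exists>k l. k < Suc n \<and> l < Suc n \<and> k \<noteq> l \<and> W $$ (0, k) \<noteq> 0 \<and> \<bar>W $$ (0, k)\<bar> \<le> \<bar>W $$ (0, l)\<bar>")
      case True
      then obtain k l where kl: "k < Suc n" "l < Suc n" "k \<noteq> l" "W $$ (0, k) \<noteq> 0" "\<bar>W $$ (0, k)\<bar> \<le> \<bar>W $$ (0, l)\<bar>" by blast
      \<comment> \<open>The sign for which one addition of the smaller entry decreases the absolute
        value of the larger one.\<close>
      define a where "a = - sgn (W $$ (0, l)) * sgn (W $$ (0, k))"
      define W2 where "W2 = addcol a l k W"
      have W2: "W2 \<in> carrier_mat (Suc n) (Suc n)" using W by (auto simp: W2_def mat_addcol_def)
      have ent: "W2 $$ (0, j) = (if j = l then a * W $$ (0, k) + W $$ (0, l) else W $$ (0, j))" if "j < Suc n" for j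
        using that W by (auto simp: W2_def)
      have "\<bar>a * W $$ (0, k) + W $$ (0, l)\<bar> < \<bar>W $$ (0, l)\<bar>"
        using kl(4,5) by (auto simp: a_def sgn_if abs_if split: if_splits)
      then have "(\<Sum>j<Suc n. \<bar>W2 $$ (0, j)\<bar>) < (\<Sum>j<Suc n. \<bar>W $$ (0, j)\<bar>)"
        using kl(2) ent by (intro sum_strict_mono_ex1) (auto intro!: bexI[of _ l])
      then have "\<mu> W2 < \<mu> W" unfolding \<mu>_def
        by (intro iffD2[OF nat_less_eq_zless]) (auto intro: sum_nonneg)
      moreover note col = lattice_image_addcol[OF W kl(1,2,3), of a, folded W2_def]
      ultimately have "\<exists>S. coset_reps (Suc n) W2 S \<and> card S = nat \<bar>Determinant.det W2\<bar>"
        using less.hyps[OF _ W2] less.prems(2) by simp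
      then show ?thesis using coset_reps_cong[OF col(1)] col(2) by simp
    next
      case False
      \<comment> \<open>No two nonzero entries are left in the first row, so one column k can be
        moved to the front and the block form applies.\<close>
      obtain k where k: "k < Suc n" "\<And>j. j < Suc n \<Longrightarrow> j \<noteq> k \<Longrightarrow> W $$ (0, j) = 0"
      proof (cases "\<exists>k<Suc n. W $$ (0, k) \<noteq> 0")
        case True
        then obtain k where k: "k < Suc n" "W $$ (0, k) \<noteq> 0" by blast
        have "W $$ (0, j) = 0" if j: "j < Suc n" "j \<noteq> k" for j
        proof (rule ccontr)
          assume "W $$ (0, j) \<noteq> 0"
          then show False using False k j linear[of "\<bar>W $$ (0, j)\<bar>" "\<bar>W $$ (0, k)\<bar>"] by blast
        qed
        then show ?thesis using that k(1) by blast
      qed (use that[of 0] in auto)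
      show ?thesis
      proof (cases "k = 0")
        case True
        then show ?thesis using coset_reps_step[of n W] Suc.IH less.prems k by simp
      next
        case False
        define W2 where "W2 = swapcols k 0 W"
        note sw = lattice_image_swapcols[OF W k(1) _ False, folded W2_def]
        have W2: "W2 \<in> carrier_mat (Suc n) (Suc n)" using W by (simp add: W2_def)
        have "W2 $$ (0, j) = 0" if "0 < j" "j < Suc n" for j
          using that W k False by (auto simp: W2_def)
        moreover have "Determinant.det W2 \<noteq> 0" using sw(2) less.prems(2) by auto
        ultimately have "\<exists>S. coset_reps (Suc n) W2 S \<and> card S = nat \<bar>Determinant.det W2\<bar>"
          using coset_reps_step[of n W2] Suc.IH W2 by simp
        then show ?thesis using coset_reps_cong[OF sw(1)] sw(2) by simp
      qed
    qed
  qed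
  then show ?case using Suc.prems by blast
qed

section \<open>Lattice points of a simplex\<close>

definition lattice_simplex :: "nat \<Rightarrow> (nat \<Rightarrow> real) \<Rightarrow> real \<Rightarrow> int Matrix.vec set" where
  "lattice_simplex n \<mu> T = {y \<in> carrier_vec n. (\<forall>i<n. 0 \<le> vec_index y i) \<and> (\<Sum>i<n. \<mu> i * of_int (vec_index y i)) \<le> T}"

lemma lattice_simplex_Suc:
  assumes \<mu>: "\<And>i. i < Suc n \<Longrightarrow> \<mu> i > 0" and T: "T \<ge> 0"
  shows "lattice_simplex (Suc n) \<mu> T =
    (\<Union>t\<in>{..nat \<lfloor>T / \<mu> 0\<rfloor>}. vCons (int t) ` lattice_simplex n (\<mu> \<circ> Suc) (T - \<mu> 0 * real t))"
proof (intro equalityI subsetI)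
  fix y assume y: "y \<in> lattice_simplex (Suc n) \<mu> T"
  then have yc: "y \<in> carrier_vec (Suc n)" and nn: "\<And>i. i < Suc n \<Longrightarrow> 0 \<le> vec_index y i"
    and le: "(\<Sum>i<Suc n. \<mu> i * of_int (vec_index y i)) \<le> T" by (auto simp: lattice_simplex_def)
  obtain a w where aw: "y = vCons a w" using yc by (cases y) auto
  have w: "w \<in> carrier_vec n" using yc aw by simp
  have a: "a \<ge> 0" using nn[of 0] by (simp add: aw)
  have wn: "0 \<le> vec_index w i" if "i < n" for i using nn[of "Suc i"] that by (simp add: aw)
  have le': "\<mu> 0 * of_int a + (\<Sum>i<n. \<mu> (Suc i) * of_int (vec_index w i)) \<le> T"
    using le unfolding sum.lessThan_Suc_shift by (simp add: aw)
  moreover have "0 \<le> (\<Sum>i<n. \<mu> (Suc i) * of_int (vec_index w i))"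
    using \<mu> wn by (intro sum_nonneg mult_nonneg_nonneg) (auto intro: less_imp_le)
  ultimately have "of_int a \<le> T / \<mu> 0" using \<mu>[of 0] by (simp add: field_simps)
  then have "a \<le> \<lfloor>T / \<mu> 0\<rfloor>" by (simp add: le_floor_iff)
  then have "nat a \<in> {..nat \<lfloor>T / \<mu> 0\<rfloor>}" by auto
  moreover have "w \<in> lattice_simplex n (\<mu> \<circ> Suc) (T - \<mu> 0 * real (nat a))"
    using w wn le' a by (auto simp: lattice_simplex_def)
  moreover have "y = vCons (int (nat a)) w" using a aw by simp
  ultimately show "y \<in> (\<Union>t\<in>{..nat \<lfloor>T / \<mu> 0\<rfloor>}. vCons (int t) ` lattice_simplex n (\<mu> \<circ> Suc) (T - \<mu> 0 * real t))"
    by blast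
next
  fix y assume "y \<in> (\<Union>t\<in>{..nat \<lfloor>T / \<mu> 0\<rfloor>}. vCons (int t) ` lattice_simplex n (\<mu> \<circ> Suc) (T - \<mu> 0 * real t))"
  then obtain t w where y: "y = vCons (int t) w" "w \<in> lattice_simplex n (\<mu> \<circ> Suc) (T - \<mu> 0 * real t)" by blast
  then have w: "w \<in> carrier_vec n" "\<And>i. i < n \<Longrightarrow> 0 \<le> vec_index w i"
    "(\<Sum>i<n. \<mu> (Suc i) * of_int (vec_index w i)) \<le> T - \<mu> 0 * real t" by (auto simp: lattice_simplex_def)
  have "0 \<le> vec_index y i" if "i < Suc n" for i using that w(2) by (cases i) (auto simp: y(1))
  moreover have "(\<Sum>i<Suc n. \<mu> i * of_int (vec_index y i)) \<le> T"
    unfolding sum.lessThan_Suc_shift using w(3) by (simp add: y(1))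
  ultimately show "y \<in> lattice_simplex (Suc n) \<mu> T" using w(1) by (simp add: lattice_simplex_def y(1))
qed

lemma lattice_simplex_empty:
  assumes "\<And>i. i < n \<Longrightarrow> \<mu> i > 0" "T < 0"
  shows "lattice_simplex n \<mu> T = {}"
proof -
  have "0 \<le> (\<Sum>i<n. \<mu> i * of_int (vec_index y i))" if "\<forall>i<n. 0 \<le> vec_index y i" for y :: "int Matrix.vec"
    using that assms by (intro sum_nonneg mult_nonneg_nonneg) (auto intro: less_imp_le)
  then show ?thesis using assms(2) by (force simp: lattice_simplex_def)
qed

lemma finite_lattice_simplex:
  assumes "\<And>i. i < n \<Longrightarrow> \<mu> i > 0"
  shows "finite (lattice_simplex n \<mu> T)"
  using assms
proof (induction n arbitrary: \<mu> T)
  case 0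
  have "lattice_simplex 0 \<mu> T \<subseteq> {0\<^sub>v 0}" by (auto simp: lattice_simplex_def)
  then show ?case using finite_subset by blast
next
  case (Suc n)
  show ?case
  proof (cases "T < 0")
    case True
    then show ?thesis using lattice_simplex_empty[OF Suc.prems True] by simp
  next
    case False
    then show ?thesis using Suc by (subst lattice_simplex_Suc) auto
  qed
qed

lemma card_lattice_simplex_Suc:
  assumes \<mu>: "\<And>i. i < Suc n \<Longrightarrow> \<mu> i > 0" and T: "T \<ge> 0"
  shows "card (lattice_simplex (Suc n) \<mu> T) =
    (\<Sum>t\<le>nat \<lfloor>T / \<mu> 0\<rfloor>. card (lattice_simplex n (\<mu> \<circ> Suc) (T - \<mu> 0 * real t)))"
proof -
  have inj: "inj_on (vCons (a :: int)) A" for a A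
  proof (rule inj_onI)
    fix v w :: "int Matrix.vec" assume *: "vCons a v = vCons a w"
    then have "dim_vec v = dim_vec w" by (metis dim_vec_vCons nat.inject)
    moreover have "vec_index v i = vec_index w i" for i using * by (metis vec_index_vCons_Suc)
    ultimately show "v = w" by (intro eq_vecI) auto
  qed
  have eq: "lattice_simplex (Suc n) \<mu> T =
    (\<Union>t\<in>{..nat \<lfloor>T / \<mu> 0\<rfloor>}. vCons (int t) ` lattice_simplex n (\<mu> \<circ> Suc) (T - \<mu> 0 * real t))"
    using \<mu> T by (rule lattice_simplex_Suc)
  have "card (lattice_simplex (Suc n) \<mu> T) =
      (\<Sum>t\<in>{..nat \<lfloor>T / \<mu> 0\<rfloor>}. card (vCons (int t) ` lattice_simplex n (\<mu> \<circ> Suc) (T - \<mu> 0 * real t)))"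
    unfolding eq
  proof (rule card_UN_disjoint)
    show "\<forall>i\<in>{..nat \<lfloor>T / \<mu> 0\<rfloor>}. finite (vCons (int i) ` lattice_simplex n (\<mu> \<circ> Suc) (T - \<mu> 0 * real i))"
      using \<mu> by (auto intro!: finite_lattice_simplex)
    show "\<forall>i\<in>{..nat \<lfloor>T / \<mu> 0\<rfloor>}. \<forall>j\<in>{..nat \<lfloor>T / \<mu> 0\<rfloor>}. i \<noteq> j \<longrightarrow>
       vCons (int i) ` lattice_simplex n (\<mu> \<circ> Suc) (T - \<mu> 0 * real i) \<inter>
       vCons (int j) ` lattice_simplex n (\<mu> \<circ> Suc) (T - \<mu> 0 * real j) = {}"
      by (auto dest!: arg_cong[where f = "\<lambda>v. vec_index v 0"])
  qed simp
  also have "\<dots> = (\<Sum>t\<le>nat \<lfloor>T / \<mu> 0\<rfloor>. card (lattice_simplex n (\<mu> \<circ> Suc) (T - \<mu> 0 * real t)))"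
    by (intro sum.cong refl card_image inj)
  finally show ?thesis .
qed

text \<open>A discrete substitute for the derivative of x^(n+1): each term of the factored
  difference lies between b^n and a^n.\<close>

lemma power_diff_bounds:
  fixes a b :: real
  assumes "0 \<le> b" "b \<le> a"
  shows "a ^ Suc n - b ^ Suc n \<le> real (Suc n) * (a - b) * a ^ n"
    and "real (Suc n) * (a - b) * b ^ n \<le> a ^ Suc n - b ^ Suc n"
proof -
  have e: "a ^ Suc n - b ^ Suc n = (a - b) * (\<Sum>i<Suc n. a ^ i * b ^ (n - i))"
    using diff_power_eq_sum[of a n b] by simp
  have "(\<Sum>i<Suc n. a ^ i * b ^ (n - i)) \<le> (\<Sum>i<Suc n. a ^ n)"
  proof (rule sum_mono)
    fix i assume i: "i \<in> {..<Suc n}"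
    have "a ^ i * b ^ (n - i) \<le> a ^ i * a ^ (n - i)" using assms by (intro mult_left_mono power_mono) auto
    also have "\<dots> = a ^ n" using i by (simp flip: power_add)
    finally show "a ^ i * b ^ (n - i) \<le> a ^ n" .
  qed
  then have "(a - b) * (\<Sum>i<Suc n. a ^ i * b ^ (n - i)) \<le> (a - b) * (\<Sum>i<Suc n. a ^ n)"
    using assms by (intro mult_left_mono) auto
  then show "a ^ Suc n - b ^ Suc n \<le> real (Suc n) * (a - b) * a ^ n" unfolding e by (simp add: algebra_simps)
  have "(\<Sum>i<Suc n. b ^ n) \<le> (\<Sum>i<Suc n. a ^ i * b ^ (n - i))"
  proof (rule sum_mono)
    fix i assume i: "i \<in> {..<Suc n}"
    have "b ^ n = b ^ i * b ^ (n - i)" using i by (simp flip: power_add)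
    also have "\<dots> \<le> a ^ i * b ^ (n - i)" using assms by (intro mult_right_mono power_mono) auto
    finally show "b ^ n \<le> a ^ i * b ^ (n - i)" .
  qed
  then have "(a - b) * (\<Sum>i<Suc n. b ^ n) \<le> (a - b) * (\<Sum>i<Suc n. a ^ i * b ^ (n - i))"
    using assms by (intro mult_left_mono) auto
  then show "real (Suc n) * (a - b) * b ^ n \<le> a ^ Suc n - b ^ Suc n" unfolding e by (simp add: algebra_simps)
qed

text \<open>The unit cubes based at the lattice points cover the simplex and stay inside the one
  with T enlarged by the sum of weights. The induction realises this by slices along the first
  coordinate, with telescoping differences of powers in place of integrals.\<close>

lemma card_lattice_simplex_bounds:
  assumes "\<And>i. i < n \<Longrightarrow> \<mu> i > 0" and "T \<ge> 0"
  shows "T ^ n / (fact n * (\<Prod>i<n. \<mu> i)) \<le> real (card (lattice_simplex n \<mu> T)) \<and>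
    real (card (lattice_simplex n \<mu> T)) \<le> (T + (\<Sum>i<n. \<mu> i)) ^ n / (fact n * (\<Prod>i<n. \<mu> i))"
  using assms
proof (induction n arbitrary: \<mu> T)
  case 0
  have "lattice_simplex 0 \<mu> T = {0\<^sub>v 0}" using 0 by (auto simp: lattice_simplex_def)
  then show ?case by simp
next
  case (Suc n)
  note \<mu> = Suc.prems(1) and T = Suc.prems(2)
  define m where "m = \<mu> 0"
  have m: "m > 0" using \<mu>[of 0] by (simp add: m_def)
  define K where "K = nat \<lfloor>T / m\<rfloor>"
  define \<mu>' where "\<mu>' = \<mu> \<circ> Suc"
  have \<mu>': "\<mu>' i > 0" if "i < n" for i using \<mu>[of "Suc i"] that by (simp add: \<mu>'_def)
  define P where "P = fact n * (\<Prod>i<n. \<mu>' i)"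
  define s where "s = (\<Sum>i<n. \<mu>' i)"
  have P: "P > 0" unfolding P_def using \<mu>' by (intro mult_pos_pos prod_pos) auto
  have s: "s \<ge> 0" unfolding s_def using \<mu>' by (intro sum_nonneg) (auto intro: less_imp_le)
  have P': "fact (Suc n) * (\<Prod>i<Suc n. \<mu> i) = real (Suc n) * m * P"
    unfolding prod.lessThan_Suc_shift P_def m_def by (simp add: \<mu>'_def mult_ac)
  have s': "(\<Sum>i<Suc n. \<mu> i) = m + s" unfolding sum.lessThan_Suc_shift s_def m_def by (simp add: \<mu>'_def)
  have Kle: "m * real t \<le> T" if "t \<le> K" for t
  proof -
    have "real t \<le> real K" using that by simp
    also have "real K \<le> T / m" using T m by (simp add: K_def)
    finally show ?thesis using m by (simp add: field_simps)
  qed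
  have Kgt: "T < m * real (Suc K)"
  proof -
    have "T / m < real_of_int \<lfloor>T / m\<rfloor> + 1" by linarith
    also have "\<lfloor>T / m\<rfloor> = int K" using T m by (simp add: K_def)
    finally show ?thesis using m by (simp add: field_simps)
  qed
  have IH: "(T - m * real t) ^ n / P \<le> real (card (lattice_simplex n \<mu>' (T - m * real t)))"
    "real (card (lattice_simplex n \<mu>' (T - m * real t))) \<le> (T - m * real t + s) ^ n / P" if "t \<le> K" for t
    using Suc.IH[of \<mu>' "T - m * real t"] \<mu>' Kle[OF that] by (simp_all add: P_def s_def)
  have card: "real (card (lattice_simplex (Suc n) \<mu> T)) =
      (\<Sum>t\<le>K. real (card (lattice_simplex n \<mu>' (T - m * real t))))"
    using card_lattice_simplex_Suc[OF \<mu> T] by (simp add: m_def K_def \<mu>'_def)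
  \<comment> \<open>Cut off at 0, so that the telescoping sum ends exactly: x vanishes just after
    the last slice.\<close>
  define x where "x = (\<lambda>t. max 0 (T - m * real t))"
  have lower: "(x t ^ Suc n - x (Suc t) ^ Suc n) / (real (Suc n) * m) \<le> (T - m * real t) ^ n" if "t \<le> K" for t
  proof -
    have xt: "x t = T - m * real t" using Kle[OF that] by (simp add: x_def)
    have "x (Suc t) \<le> x t" "x t - x (Suc t) \<le> m" using m by (auto simp: x_def algebra_simps max_def)
    then have "x t ^ Suc n - x (Suc t) ^ Suc n \<le> real (Suc n) * (x t - x (Suc t)) * x t ^ n"
      by (intro power_diff_bounds(1)) (auto simp: x_def)
    also have "\<dots> \<le> real (Suc n) * m * x t ^ n"
      using \<open>x t - x (Suc t) \<le> m\<close> by (intro mult_right_mono mult_left_mono zero_le_power) (auto simp: x_def)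
    finally show ?thesis using m by (simp add: xt pos_divide_le_eq mult_ac)
  qed
  have "T ^ Suc n / (real (Suc n) * m * P) = (\<Sum>t\<le>K. (x t ^ Suc n - x (Suc t) ^ Suc n) / (real (Suc n) * m)) / P"
  proof -
    have "(\<Sum>t\<le>K. x t ^ Suc n - x (Suc t) ^ Suc n) = x 0 ^ Suc n - x (Suc K) ^ Suc n"
      by (induction K) auto
    also have "x (Suc K) = 0" using Kgt by (simp add: x_def)
    also have "x 0 = T" using T by (simp add: x_def)
    finally show ?thesis by (simp flip: sum_divide_distrib)
  qed
  also have "\<dots> \<le> (\<Sum>t\<le>K. (T - m * real t) ^ n) / P"
    using lower P by (intro divide_right_mono sum_mono) auto
  also have "\<dots> \<le> real (card (lattice_simplex (Suc n) \<mu> T))"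
    unfolding card sum_divide_distrib using IH(1) by (intro sum_mono) auto
  finally have L: "T ^ Suc n / (real (Suc n) * m * P) \<le> real (card (lattice_simplex (Suc n) \<mu> T))" .
  define z where "z = (\<lambda>t. T - m * real t + s)"
  have upper: "z t ^ n \<le> ((z t + m) ^ Suc n - z t ^ Suc n) / (real (Suc n) * m)" if "t \<le> K" for t
  proof -
    have "0 \<le> z t" using Kle[OF that] s by (simp add: z_def)
    then have "real (Suc n) * (z t + m - z t) * z t ^ n \<le> (z t + m) ^ Suc n - z t ^ Suc n"
      using m by (intro power_diff_bounds(2)) auto
    then show ?thesis using m by (simp add: pos_le_divide_eq mult_ac)
  qed
  have "real (card (lattice_simplex (Suc n) \<mu> T)) \<le> (\<Sum>t\<le>K. z t ^ n) / P"
    unfolding card sum_divide_distrib using IH(2) by (intro sum_mono) (auto simp: z_def)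
  also have "\<dots> \<le> (\<Sum>t\<le>K. ((z t + m) ^ Suc n - z t ^ Suc n) / (real (Suc n) * m)) / P"
    using upper P by (intro divide_right_mono sum_mono) auto
  also have "(\<Sum>t\<le>K. ((z t + m) ^ Suc n - z t ^ Suc n) / (real (Suc n) * m)) =
      ((T + s + m) ^ Suc n - z K ^ Suc n) / (real (Suc n) * m)"
  proof -
    have "(\<Sum>t\<le>K. (z t + m) ^ Suc n - z t ^ Suc n) = (T + s + m) ^ Suc n - z K ^ Suc n"
    proof (induction K)
      case 0 then show ?case by (simp add: z_def)
    next
      case (Suc K)
      have "z (Suc K) + m = z K" by (simp add: z_def algebra_simps)
      then show ?case using Suc by simp
    qed
    then show ?thesis by (simp only: sum_divide_distrib[symmetric])
  qed
  also have "\<dots> \<le> (T + s + m) ^ Suc n / (real (Suc n) * m)"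
    using m s Kle[of K] by (intro divide_right_mono) (auto simp: z_def)
  finally have U: "real (card (lattice_simplex (Suc n) \<mu> T)) \<le> (T + s + m) ^ Suc n / (real (Suc n) * m) / P"
    using P by (simp add: divide_right_mono)
  show ?case unfolding P' s' using L U by (simp add: add_ac)
qed

section \<open>Points of the simplex in a coset\<close>

lemma lattice_image_add:
  assumes W: "W \<in> carrier_mat n n" and "x \<in> lattice_image n W" "y \<in> lattice_image n W"
  shows "x + y \<in> lattice_image n W"
proof -
  obtain u v where uv: "u \<in> carrier_vec n" "v \<in> carrier_vec n" "x = W *\<^sub>v u" "y = W *\<^sub>v v"
    using assms by (auto simp: lattice_image_def)
  then have "x + y = W *\<^sub>v (u + v)" using W by (simp add: mult_add_distrib_mat_vec[of W n n])
  then show ?thesis using uv unfolding lattice_image_def by fastforce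
qed

text \<open>The adjugate matrix provides an integral preimage of det W times any vector.\<close>

lemma det_multiple_in_lattice_image:
  fixes W :: "int mat"
  assumes W: "W \<in> carrier_mat n n" and q: "q \<in> carrier_vec n" and D: "Determinant.det W dvd D"
  shows "D \<cdot>\<^sub>v q \<in> lattice_image n W"
proof -
  obtain e where e: "D = Determinant.det W * e" using D by blast
  have adj: "adj_mat W \<in> carrier_mat n n" "W * adj_mat W = Determinant.det W \<cdot>\<^sub>m 1\<^sub>m n" using adj_mat[OF W] by auto
  have eq: "e \<cdot>\<^sub>v q \<in> carrier_vec n" using q by simp
  have "W *\<^sub>v (adj_mat W *\<^sub>v (e \<cdot>\<^sub>v q)) = (W * adj_mat W) *\<^sub>v (e \<cdot>\<^sub>v q)"
    by (rule assoc_mult_mat_vec[OF W adj(1) eq, symmetric])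
  also have "\<dots> = Determinant.det W \<cdot>\<^sub>v (e \<cdot>\<^sub>v q)" unfolding adj(2) using eq by (intro eq_vecI) simp_all
  also have "\<dots> = D \<cdot>\<^sub>v q" by (simp add: e smult_smult_assoc)
  finally have "D \<cdot>\<^sub>v q = W *\<^sub>v (adj_mat W *\<^sub>v (e \<cdot>\<^sub>v q))" ..
  moreover have "adj_mat W *\<^sub>v (e \<cdot>\<^sub>v q) \<in> carrier_vec n" using adj(1) eq by (rule mult_mat_vec_carrier)
  ultimately show ?thesis unfolding lattice_image_def by blast
qed

definition coset_simplex :: "nat \<Rightarrow> (nat \<Rightarrow> real) \<Rightarrow> real \<Rightarrow> int mat \<Rightarrow> int Matrix.vec \<Rightarrow> int Matrix.vec set" where
  "coset_simplex n \<mu> T W t = {y \<in> lattice_simplex n \<mu> T. y - t \<in> lattice_image n W}"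

text \<open>Multiples of D = |det W| lie in the lattice, so t - s may be reduced modulo D to a
  translation vector with entries in [0, D). It keeps coordinates nonnegative and adds at most D
  times the sum of weights, a bound independent of s, t and T.\<close>

lemma card_coset_simplex_mono:
  fixes W :: "int mat"
  assumes W: "W \<in> carrier_mat n n" and det: "Determinant.det W \<noteq> 0" and \<mu>: "\<And>i. i < n \<Longrightarrow> \<mu> i > 0"
    and s: "s \<in> carrier_vec n" and t: "t \<in> carrier_vec n"
  shows "card (coset_simplex n \<mu> T W s) \<le>
    card (coset_simplex n \<mu> (T + of_int \<bar>Determinant.det W\<bar> * (\<Sum>i<n. \<mu> i)) W t)"
proof -
  define D where "D = \<bar>Determinant.det W\<bar>"
  have D: "D > 0" using det by (simp add: D_def)
  define u where "u = Matrix.vec n (\<lambda>i. (vec_index t i - vec_index s i) mod D)"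
  define q where "q = Matrix.vec n (\<lambda>i. - ((vec_index t i - vec_index s i) div D))"
  have uc: "u \<in> carrier_vec n" "q \<in> carrier_vec n" by (simp_all add: u_def q_def)
  have Dq: "D \<cdot>\<^sub>v q \<in> lattice_image n W"
    by (rule det_multiple_in_lattice_image[OF W uc(2)]) (simp add: D_def)
  show ?thesis
  proof (rule card_inj_on_le[where f = "\<lambda>y. y + u"])
    show "inj_on (\<lambda>y. y + u) (coset_simplex n \<mu> T W s)"
    proof (rule inj_onI)
      fix x y assume xy: "x \<in> coset_simplex n \<mu> T W s" "y \<in> coset_simplex n \<mu> T W s" "x + u = y + u"
      then have c: "x \<in> carrier_vec n" "y \<in> carrier_vec n" by (auto simp: coset_simplex_def lattice_simplex_def)
      have "vec_index x i = vec_index y i" if "i < n" for i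
        using arg_cong[OF xy(3), of "\<lambda>v. vec_index v i"] that c uc by simp
      then show "x = y" using c by (intro eq_vecI) auto
    qed
    show "(\<lambda>y. y + u) ` coset_simplex n \<mu> T W s \<subseteq>
      coset_simplex n \<mu> (T + of_int \<bar>Determinant.det W\<bar> * (\<Sum>i<n. \<mu> i)) W t"
    proof
      fix z assume "z \<in> (\<lambda>y. y + u) ` coset_simplex n \<mu> T W s"
      then obtain y where z: "z = y + u" and y: "y \<in> carrier_vec n" "\<And>i. i < n \<Longrightarrow> 0 \<le> vec_index y i"
        "(\<Sum>i<n. \<mu> i * of_int (vec_index y i)) \<le> T" "y - s \<in> lattice_image n W"
        by (auto simp: coset_simplex_def lattice_simplex_def)
      have "z - t = (y - s) + D \<cdot>\<^sub>v q"
      proof (rule eq_vecI)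
        fix i assume "i < dim_vec ((y - s) + D \<cdot>\<^sub>v q)"
        then have i: "i < n" using uc by simp
        have "vec_index u i = (vec_index t i - vec_index s i) + D * vec_index q i"
          using i by (simp add: u_def q_def minus_div_mult_eq_mod[symmetric] mult.commute)
        then show "vec_index (z - t) i = vec_index ((y - s) + D \<cdot>\<^sub>v q) i"
          using i y s t uc by (simp add: z)
      qed (use y s t uc in \<open>simp add: z\<close>)
      then have "z - t \<in> lattice_image n W" using lattice_image_add[OF W y(4) Dq] by simp
      moreover have "z \<in> carrier_vec n" using y uc by (simp add: z)
      moreover have "0 \<le> vec_index z i" if "i < n" for i
        using y(1) y(2)[OF that] that D by (simp add: z u_def)
      moreover have "(\<Sum>i<n. \<mu> i * of_int (vec_index z i)) \<le> T + of_int D * (\<Sum>i<n. \<mu> i)"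
      proof -
        have "(\<Sum>i<n. \<mu> i * of_int (vec_index z i)) = (\<Sum>i<n. \<mu> i * of_int (vec_index y i)) + (\<Sum>i<n. \<mu> i * of_int (vec_index u i))"
          using y uc by (simp add: z algebra_simps sum.distrib)
        also have "(\<Sum>i<n. \<mu> i * of_int (vec_index u i)) \<le> (\<Sum>i<n. \<mu> i * of_int D)"
        proof (intro sum_mono mult_left_mono)
          fix i assume "i \<in> {..<n}"
          then have "vec_index u i \<le> D" using D by (simp add: u_def less_imp_le)
          then show "real_of_int (vec_index u i) \<le> of_int D" by simp
        qed (use \<mu> in \<open>auto intro: less_imp_le\<close>)
        finally show ?thesis using y(3) by (simp add: sum_distrib_left mult.commute)
      qed
      ultimately show "z \<in> coset_simplex n \<mu> (T + of_int \<bar>Determinant.det W\<bar> * (\<Sum>i<n. \<mu> i)) W t"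
        by (simp add: coset_simplex_def lattice_simplex_def D_def)
    qed
    show "finite (coset_simplex n \<mu> (T + of_int \<bar>Determinant.det W\<bar> * (\<Sum>i<n. \<mu> i)) W t)"
      using finite_lattice_simplex[OF \<mu>] by (simp add: coset_simplex_def)
  qed
qed

text \<open>All cosets contain asymptotically the same number of points of the simplex, because they are
  translates of each other, and together they exhaust it.\<close>

lemma card_coset_simplex_bounds:
  fixes W :: "int mat"
  assumes W: "W \<in> carrier_mat n n" and det: "Determinant.det W \<noteq> 0" and \<mu>: "\<And>i. i < n \<Longrightarrow> \<mu> i > 0"
    and t: "t \<in> carrier_vec n"
  defines "C \<equiv> of_int \<bar>Determinant.det W\<bar> * (\<Sum>i<n. \<mu> i)"
    and "V \<equiv> fact n * (\<Prod>i<n. \<mu> i) * of_int \<bar>Determinant.det W\<bar>"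
  assumes T: "T \<ge> C"
  shows "(T - C) ^ n / V \<le> real (card (coset_simplex n \<mu> T W t))"
    and "real (card (coset_simplex n \<mu> T W t)) \<le> (T + C + (\<Sum>i<n. \<mu> i)) ^ n / V"
proof -
  obtain S where S: "coset_reps n W S" "card S = nat \<bar>Determinant.det W\<bar>"
    using coset_reps_exist[OF W det] by blast
  have finS: "finite S" and Sc: "\<And>s. s \<in> S \<Longrightarrow> s \<in> carrier_vec n" using S(1) by (auto simp: coset_reps_def)
  have total: "card (lattice_simplex n \<mu> T) = (\<Sum>s\<in>S. card (coset_simplex n \<mu> T W s))" for T
  proof -
    have "lattice_simplex n \<mu> T = (\<Union>s\<in>S. coset_simplex n \<mu> T W s)"
      using S(1) unfolding coset_reps_def coset_simplex_def lattice_simplex_def by blast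
    moreover have "card (\<Union>s\<in>S. coset_simplex n \<mu> T W s) = (\<Sum>s\<in>S. card (coset_simplex n \<mu> T W s))"
    proof (rule card_UN_disjoint[OF finS])
      show "\<forall>s\<in>S. finite (coset_simplex n \<mu> T W s)"
        using finite_lattice_simplex[OF \<mu>] by (simp add: coset_simplex_def)
      show "\<forall>s\<in>S. \<forall>s'\<in>S. s \<noteq> s' \<longrightarrow> coset_simplex n \<mu> T W s \<inter> coset_simplex n \<mu> T W s' = {}"
        using S(1) unfolding coset_reps_def coset_simplex_def lattice_simplex_def by blast
    qed
    ultimately show ?thesis by simp
  qed
  define d where "d = real_of_int \<bar>Determinant.det W\<bar>"
  have d: "d > 0" using det by (simp add: d_def)
  have cS: "real (card S) = d" by (simp add: S(2) d_def)
  define P where "P = fact n * (\<Prod>i<n. \<mu> i)"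
  have P: "P > 0" unfolding P_def using \<mu> by (intro mult_pos_pos prod_pos) auto
  have V: "V = P * d" by (simp add: V_def P_def d_def)
  have C0: "C \<ge> 0" unfolding C_def using \<mu> by (intro mult_nonneg_nonneg sum_nonneg) (auto intro: less_imp_le)
  have "real (card (lattice_simplex n \<mu> (T - C))) \<le> (\<Sum>s\<in>S. real (card (coset_simplex n \<mu> T W t)))"
    unfolding total of_nat_sum
    using card_coset_simplex_mono[where T = "T - C" and \<mu> = \<mu>, OF W det \<mu> Sc t, folded C_def] by (intro sum_mono) simp
  also have "\<dots> = d * real (card (coset_simplex n \<mu> T W t))" by (simp add: cS)
  finally have "(T - C) ^ n / P \<le> d * real (card (coset_simplex n \<mu> T W t))"
    using card_lattice_simplex_bounds[where T = "T - C" and \<mu> = \<mu> and n = n, OF \<mu>, folded P_def] T by simp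
  then show "(T - C) ^ n / V \<le> real (card (coset_simplex n \<mu> T W t))"
    using P d by (simp add: V field_simps)
  have "d * real (card (coset_simplex n \<mu> T W t)) = (\<Sum>s\<in>S. real (card (coset_simplex n \<mu> T W t)))" by (simp add: cS)
  also have "\<dots> \<le> real (card (lattice_simplex n \<mu> (T + C)))"
    unfolding total of_nat_sum
    using card_coset_simplex_mono[where T = T and \<mu> = \<mu>, OF W det \<mu> t Sc, folded C_def] by (intro sum_mono) simp
  also have "\<dots> \<le> (T + C + (\<Sum>i<n. \<mu> i)) ^ n / P"
    using card_lattice_simplex_bounds[where T = "T + C" and \<mu> = \<mu> and n = n, OF \<mu>, folded P_def] T C0 by simp
  finally show "real (card (coset_simplex n \<mu> T W t)) \<le> (T + C + (\<Sum>i<n. \<mu> i)) ^ n / V"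
    using P d by (simp add: V field_simps)
qed

text \<open>The coset may vary with k, because the constants in
  \<open>card_coset_simplex_bounds\<close> involve only W and the weights.\<close>

lemma card_coset_simplex_asymptotic:
  fixes W :: "int mat" and t :: "nat \<Rightarrow> int Matrix.vec"
  assumes W: "W \<in> carrier_mat n n" and det: "Determinant.det W \<noteq> 0" and \<mu>: "\<And>i. i < n \<Longrightarrow> \<mu> i > 0"
    and t: "\<And>k. t k \<in> carrier_vec n" and \<kappa>: "\<kappa> > 0" and n: "n > 0"
  shows "(\<lambda>k::nat. real (card (coset_simplex n \<mu> (\<kappa> * real k) W (t k))) -
     \<kappa> ^ n / (fact n * (\<Prod>i<n. \<mu> i) * of_int \<bar>Determinant.det W\<bar>) * real k ^ n) \<in> O(\<lambda>k. real k ^ (n - 1))"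
proof -
  define C where "C = of_int \<bar>Determinant.det W\<bar> * (\<Sum>i<n. \<mu> i)"
  define V where "V = fact n * (\<Prod>i<n. \<mu> i) * of_int \<bar>Determinant.det W\<bar>"
  \<comment> \<open>B is the gain in the upper bound and dominates C, the loss in the lower one, so
    a single constant c serves both estimates.\<close>
  define B where "B = C + (\<Sum>i<n. \<mu> i)"
  have sum0: "(\<Sum>i<n. \<mu> i) \<ge> 0" using \<mu> by (intro sum_nonneg) (auto intro: less_imp_le)
  have C0: "C \<ge> 0" unfolding C_def using sum0 by simp
  have B: "B \<ge> C" "B \<ge> 0" using sum0 C0 by (auto simp: B_def)
  have V: "V > 0" unfolding V_def using \<mu> det by (intro mult_pos_pos prod_pos) auto
  obtain m where m: "n = Suc m" using n by (cases n) auto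
  define c where "c = real n * B * (\<kappa> + B) ^ m / V"
  have "norm (real (card (coset_simplex n \<mu> (\<kappa> * real k) W (t k))) - \<kappa> ^ n / V * real k ^ n) \<le> c * norm (real k ^ (n - 1))"
    if k: "k \<ge> max 1 (nat \<lceil>C / \<kappa>\<rceil>)" for k
  proof -
    define T where "T = \<kappa> * real k"
    have k1: "real k \<ge> 1" using k by simp
    have "C / \<kappa> \<le> real k" using k by (metis le_nat_iff max.bounded_iff of_nat_ceiling order_trans real_nat_ceiling_ge of_nat_le_iff)
    then have T: "T \<ge> C" using \<kappa> by (simp add: T_def field_simps)
    then have T0: "T \<ge> 0" using C0 by linarith
    have le: "(T + B) ^ m \<le> (\<kappa> + B) ^ m * real k ^ m"
    proof -
      have "B \<le> B * real k" using B(2) k1 by (simp add: mult_le_cancel_left1)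
      then have "T + B \<le> (\<kappa> + B) * real k" by (simp add: T_def algebra_simps)
      then show ?thesis using T0 B(2) by (simp add: power_mono flip: power_mult_distrib)
    qed
    have "real (card (coset_simplex n \<mu> T W (t k))) \<le> (T + C + (\<Sum>i<n. \<mu> i)) ^ n / V"
      using card_coset_simplex_bounds(2)[where T = T and \<mu> = \<mu>, OF W det \<mu> t] T by (simp add: C_def V_def)
    then have "real (card (coset_simplex n \<mu> T W (t k))) - T ^ n / V \<le> ((T + B) ^ n - T ^ n) / V"
      by (simp add: B_def diff_divide_distrib add_ac)
    also have "\<dots> \<le> (real n * B * (T + B) ^ m) / V"
      using power_diff_bounds(1)[of T "T + B" m] T0 B V by (intro divide_right_mono) (auto simp: m)
    also have "\<dots> \<le> (real n * B * ((\<kappa> + B) ^ m * real k ^ m)) / V"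
      using le B V by (intro divide_right_mono mult_left_mono) auto
    also have "\<dots> = c * real k ^ m" by (simp add: c_def)
    finally have U: "real (card (coset_simplex n \<mu> T W (t k))) - T ^ n / V \<le> c * real k ^ m" .
    have "(T - C) ^ n / V \<le> real (card (coset_simplex n \<mu> T W (t k)))"
      using card_coset_simplex_bounds(1)[where T = T and \<mu> = \<mu>, OF W det \<mu> t] T by (simp add: C_def V_def)
    then have "T ^ n / V - real (card (coset_simplex n \<mu> T W (t k))) \<le> (T ^ n - (T - C) ^ n) / V"
      by (simp add: diff_divide_distrib)
    also have "\<dots> \<le> (real n * C * T ^ m) / V"
      using power_diff_bounds(1)[of "T - C" T m] T C0 V by (intro divide_right_mono) (auto simp: m)
    also have "\<dots> \<le> (real n * B * ((\<kappa> + B) ^ m * real k ^ m)) / V"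
    proof -
      have "T ^ m \<le> (T + B) ^ m" using T0 B(2) by (intro power_mono) auto
      then have "T ^ m \<le> (\<kappa> + B) ^ m * real k ^ m" using le by linarith
      then show ?thesis using B V C0 T0 by (intro divide_right_mono mult_mono) auto
    qed
    also have "\<dots> = c * real k ^ m" by (simp add: c_def)
    finally have "\<bar>real (card (coset_simplex n \<mu> T W (t k))) - T ^ n / V\<bar> \<le> c * real k ^ m" using U by simp
    moreover have "T ^ n / V = \<kappa> ^ n / V * real k ^ n" by (simp add: T_def power_mult_distrib)
    moreover have "norm (real k ^ (n - 1)) = real k ^ m" by (simp add: m)
    ultimately show ?thesis unfolding T_def real_norm_def by (simp only:)
  qed
  then show ?thesis unfolding V_def[symmetric]
    by (intro bigoI[of _ c] eventually_sequentiallyI[of "max 1 (nat \<lceil>C / \<kappa>\<rceil>)"])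
qed

section \<open>The lattice of exponents\<close>

text \<open>The congruences for weight k = 0, that is, the exponent vectors of modular units.
  Coordinate i is the exponent with index i + 1.\<close>

definition unit_lattice :: "nat \<Rightarrow> int Matrix.vec set" where
  "unit_lattice N = {x \<in> carrier_vec (N div 2). 12 dvd (\<Sum>i<N div 2. vec_index x i) \<and>
     int (N * gcd 2 N) dvd (\<Sum>i<N div 2. (int i + 1) ^ 2 * vec_index x i)}"

text \<open>All columns of B_N live on the indices 1, 2, 3 and one further j. Contributions are
  added, so j may coincide with a small index; j = 1 with d = 0 stands for no further entry.\<close>

definition short_vec :: "nat \<Rightarrow> int \<Rightarrow> int \<Rightarrow> int \<Rightarrow> nat \<Rightarrow> int \<Rightarrow> int Matrix.vec" where
  "short_vec m a b c j d = Matrix.vec m (\<lambda>i. (if i = 0 then a else 0) + (if i = 1 then b else 0) +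
     (if i = 2 then c else 0) + (if i = j - 1 then d else 0))"

lemma sum_short_vec:
  assumes "m \<ge> 3" "1 \<le> j" "j \<le> m"
  shows "(\<Sum>i<m. f i * vec_index (short_vec m a b c j d) i) = f 0 * a + f 1 * b + f 2 * c + f (j - 1) * d"
proof -
  have "(\<Sum>i<m. f i * vec_index (short_vec m a b c j d) i) =
     (\<Sum>i<m. (if i = 0 then f i * a else 0) + (if i = 1 then f i * b else 0) + (if i = 2 then f i * c else 0) + (if i = j - 1 then f i * d else 0))"
    by (intro sum.cong refl) (auto simp: short_vec_def algebra_simps)
  also have "\<dots> = f 0 * a + f 1 * b + f 2 * c + f (j - 1) * d"
    using assms by (simp add: sum.distrib)
  finally show ?thesis .
qed

text \<open>For m \<ge> 3 the first multiple of 3 is j_1 = 3, which is substituted here: j_1^2 - 4 =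
  5 and j_1^2 - 1 = 8. The divisions by 3 are exact.\<close>

definition int_B_columns :: "nat \<Rightarrow> int Matrix.vec list" where
  "int_B_columns N =
    (let m = N div 2; M = int (N * gcd 2 N); r = (2 * M) mod 3 in
      [short_vec m 16 (- 4) 0 1 0, short_vec m ((- M + 5 * r) div 3) ((M - 8 * r) div 3) r 1 0]
      @ map (\<lambda>j. short_vec m ((int j ^ 2 - 4) div 3) (- ((int j ^ 2 - 1) div 3)) 0 j 1)
          (filter (\<lambda>j. \<not> 3 dvd j) [3..<m + 1])
      @ [short_vec m 5 (- 8) 3 1 0]
      @ map (\<lambda>j. short_vec m ((int j ^ 2 - 9) div 3) (- ((int j ^ 2 - 9) div 3)) (- 1) j 1)
          (filter (\<lambda>j. 3 dvd j) [4..<m + 1]))"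

definition int_B_matrix :: "nat \<Rightarrow> int mat" where
  "int_B_matrix N = (if N = 5 then mat_of_rows_list 2 [[16, -5], [-4, 5]] else mat_of_cols (N div 2) (int_B_columns N))"

lemma square_mod_3:
  fixes j :: int
  shows "\<not> 3 dvd j \<Longrightarrow> 3 dvd j ^ 2 - 1" "\<not> 3 dvd j \<Longrightarrow> 3 dvd j ^ 2 - 4" "3 dvd j \<Longrightarrow> 3 dvd j ^ 2 - 9"
proof -
  have a: "3 dvd j ^ 2 - 1" if "\<not> 3 dvd j"
  proof -
    have "j mod 3 = 1 \<or> j mod 3 = 2" using that by presburger
    then have "3 dvd j - 1 \<or> 3 dvd j + 1" by presburger
    moreover have "j ^ 2 - 1 = (j - 1) * (j + 1)" by (simp add: power2_eq_square algebra_simps)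
    ultimately show ?thesis by auto
  qed
  then show "\<not> 3 dvd j \<Longrightarrow> 3 dvd j ^ 2 - 1" .
  show "\<not> 3 dvd j \<Longrightarrow> 3 dvd j ^ 2 - 4" using a by presburger
  show "3 dvd j \<Longrightarrow> 3 dvd j ^ 2 - 9" by (auto simp: power2_eq_square)
qed

lemma length_int_B_columns:
  assumes "N \<ge> 6"
  shows "length (int_B_columns N) = N div 2"
proof -
  define m where "m = N div 2"
  have m: "m \<ge> 3" using assms by (simp add: m_def)
  have u: "[3..<m + 1] = 3 # [4..<m + 1]" using m by (simp add: upt_conv_Cons)
  have "length (filter (\<lambda>j. \<not> 3 dvd j) [4..<m + 1]) + length (filter (\<lambda>j. 3 dvd j) [4..<m + 1]) = m - 3"
  proof -
    have "length (filter (\<lambda>j. 3 dvd j) L) + length (filter (\<lambda>j. \<not> 3 dvd j) L) = length L" for L :: "nat list"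
      by (rule sum_length_filter_compl)
    moreover have "length [4..<m + 1] = m - 3" by (simp only: length_upt)
    ultimately show ?thesis by (metis add.commute)
  qed
  moreover have "filter (\<lambda>j. \<not> 3 dvd j) [3..<m + 1] = filter (\<lambda>j. \<not> 3 dvd j) [4..<m + 1]" unfolding u by simp
  ultimately show ?thesis using m unfolding int_B_columns_def Let_def m_def[symmetric] by simp
qed

lemma int_B_matrix_carrier:
  assumes "N \<ge> 5"
  shows "int_B_matrix N \<in> carrier_mat (N div 2) (N div 2)"
proof (cases "N = 5")
  case True
  then show ?thesis by (auto simp: int_B_matrix_def mat_of_rows_list_def)
next
  case False
  then have "length (int_B_columns N) = N div 2" using length_int_B_columns[of N] assms by simp
  then show ?thesis using False mat_of_cols_carrier(1)[of "N div 2" "int_B_columns N"] by (simp add: int_B_matrix_def)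
qed

text \<open>The equations a + b + r = 0 and a + 4 b + 9 r = M have a solution with denominators 3; r
  = 2 M modulo 3 is the choice that makes a and b integral.\<close>

lemma r_const_divisibility:
  fixes M :: int
  defines "r \<equiv> (2 * M) mod 3"
  shows "3 dvd - M + 5 * r" "3 dvd M - 8 * r"
  unfolding r_def by presburger+

lemma B_columns_eq:
  assumes N: "N \<ge> 6"
  shows "B_columns N = map (map_vec real_of_int) (int_B_columns N)"
proof -
  define m where "m = N div 2"
  have m: "m \<ge> 3" using N by (simp add: m_def)
  have u: "[3..<m + 1] = 3 # [4..<m + 1]" using m by (simp add: upt_conv_Cons)
  have js: "filter (\<lambda>j. 3 dvd j) [3..<m + 1] = 3 # filter (\<lambda>j. 3 dvd j) [4..<m + 1]" unfolding u by simp
  define M where "M = N * gcd 2 N"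
  have div: "real_of_int (z div 3) = real_of_int z / 3" if "3 dvd z" for z :: int
    using that by (simp add: real_of_int_div)
  have "int (2 * M mod 3) = 2 * int M mod 3" by (simp add: zmod_int)
  then have r: "real (2 * M mod 3) = real_of_int (2 * int M mod 3)" by (metis of_int_of_nat_eq)
  define R where "R = 2 * int M mod 3"
  obtain aN where aN: "- int M + 5 * R = 3 * aN" using r_const_divisibility(1)[of "int M"] by (auto simp: R_def)
  obtain bN where bN: "int M - 8 * R = 3 * bN" using r_const_divisibility(2)[of "int M"] by (auto simp: R_def)
  have aR: "- real M + 5 * real_of_int R = 3 * real_of_int aN" using arg_cong[OF aN, of real_of_int] by simp
  have bR: "real M - 8 * real_of_int R = 3 * real_of_int bN" using arg_cong[OF bN, of real_of_int] by simp
  have c1: "16 \<cdot>\<^sub>v e_vec m 1 - 4 \<cdot>\<^sub>v e_vec m 2 = map_vec real_of_int (short_vec m 16 (- 4) 0 1 0)"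
    by (rule eq_vecI) (auto simp: e_vec_def short_vec_def unit_vec_def)
  have c2: "((- real M + 5 * real (2 * M mod 3)) / 3) \<cdot>\<^sub>v e_vec m 1 + ((real M - 8 * real (2 * M mod 3)) / 3) \<cdot>\<^sub>v e_vec m 2 +
      real (2 * M mod 3) \<cdot>\<^sub>v e_vec m 3 =
      map_vec real_of_int (short_vec m ((- int M + 5 * (2 * int M mod 3)) div 3) ((int M - 8 * (2 * int M mod 3)) div 3) (2 * int M mod 3) 1 0)"
    unfolding r R_def[symmetric] aN bN aR bR
    by (rule eq_vecI) (auto simp: e_vec_def short_vec_def unit_vec_def)
  have c3: "(real 3 ^ 2 - 4) \<cdot>\<^sub>v e_vec m 1 - (real 3 ^ 2 - 1) \<cdot>\<^sub>v e_vec m 2 + 3 \<cdot>\<^sub>v e_vec m 3 = map_vec real_of_int (short_vec m 5 (- 8) 3 1 0)"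
    by (rule eq_vecI) (auto simp: e_vec_def short_vec_def unit_vec_def)
  have cj: "((real j ^ 2 - 4) / 3) \<cdot>\<^sub>v e_vec m 1 - ((real j ^ 2 - 1) / 3) \<cdot>\<^sub>v e_vec m 2 + e_vec m j =
      map_vec real_of_int (short_vec m ((int j ^ 2 - 4) div 3) (- ((int j ^ 2 - 1) div 3)) 0 j 1)"
    if "\<not> 3 dvd j" for j
  proof -
    have "\<not> 3 dvd int j" using that by presburger
    then show ?thesis
      by (intro eq_vecI) (auto simp: e_vec_def short_vec_def unit_vec_def div square_mod_3)
  qed
  have ct: "((real j ^ 2 - real 3 ^ 2) / 3) \<cdot>\<^sub>v (e_vec m 1 - e_vec m 2) - e_vec m 3 + e_vec m j =
      map_vec real_of_int (short_vec m ((int j ^ 2 - 9) div 3) (- ((int j ^ 2 - 9) div 3)) (- 1) j 1)"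
    if "3 dvd j" for j
  proof -
    have "3 dvd int j" using that by presburger
    then obtain u where u: "int j ^ 2 - 9 = 3 * u" using square_mod_3(3) by (metis dvdE)
    have uR: "real j ^ 2 - real 3 ^ 2 = 3 * real_of_int u" using arg_cong[OF u, of real_of_int] by simp
    show ?thesis
      unfolding u uR by (rule eq_vecI) (auto simp: e_vec_def short_vec_def unit_vec_def)
  qed
  show ?thesis
    unfolding B_columns_def int_B_columns_def Let_def m_def[symmetric] js M_def[symmetric] list.sel
    using c1 c2 c3 cj ct by (simp add: o_def)
qed

lemma B_matrix_eq:
  assumes N: "N \<ge> 5"
  shows "B_matrix N = map_mat real_of_int (int_B_matrix N)"
proof (cases "N = 5")
  case True
  then show ?thesis by (auto simp: B_matrix_def int_B_matrix_def mat_of_rows_list_def nth_Cons' intro!: eq_matI)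
next
  case False
  then have N6: "N \<ge> 6" using N by simp
  have dim: "dim_vec c = N div 2" if "c \<in> set (int_B_columns N)" for c
    using that by (auto simp: int_B_columns_def Let_def short_vec_def)
  show ?thesis
    unfolding B_matrix_def int_B_matrix_def B_columns_eq[OF N6] using False
    by (auto intro!: eq_matI simp: mat_of_cols_index dim)
qed

lemma unit_lattice_add: "x \<in> unit_lattice N \<Longrightarrow> y \<in> unit_lattice N \<Longrightarrow> x + y \<in> unit_lattice N"
  by (auto simp: unit_lattice_def sum.distrib distrib_left)

lemma unit_lattice_smult: "x \<in> unit_lattice N \<Longrightarrow> k \<cdot>\<^sub>v x \<in> unit_lattice N"
proof -
  assume x: "x \<in> unit_lattice N"
  then have xc: "x \<in> carrier_vec (N div 2)" by (simp add: unit_lattice_def)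
  have "(\<Sum>i<N div 2. vec_index (k \<cdot>\<^sub>v x) i) = k * (\<Sum>i<N div 2. vec_index x i)"
    "(\<Sum>i<N div 2. (int i + 1) ^ 2 * vec_index (k \<cdot>\<^sub>v x) i) = k * (\<Sum>i<N div 2. (int i + 1) ^ 2 * vec_index x i)"
    using xc by (simp_all add: sum_distrib_left mult_ac)
  then show ?thesis using x by (simp add: unit_lattice_def)
qed

lemma unit_lattice_minus:
  assumes "x \<in> unit_lattice N" "y \<in> unit_lattice N"
  shows "x - y \<in> unit_lattice N"
proof -
  have "x - y = x + (- 1) \<cdot>\<^sub>v y" using assms by (intro eq_vecI) (auto simp: unit_lattice_def)
  then show ?thesis using assms by (simp add: unit_lattice_add unit_lattice_smult)
qed

lemma lattice_image_smult:
  assumes W: "W \<in> carrier_mat n n" and "x \<in> lattice_image n W"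
  shows "k \<cdot>\<^sub>v x \<in> lattice_image n W"
proof -
  obtain u where u: "u \<in> carrier_vec n" "x = W *\<^sub>v u" using assms by (auto simp: lattice_image_def)
  have "k \<cdot>\<^sub>v x = W *\<^sub>v (k \<cdot>\<^sub>v u)"
    using W u by (intro eq_vecI) (auto simp: scalar_prod_def sum_distrib_left mult_ac intro!: sum.cong)
  then show ?thesis using u unfolding lattice_image_def by fastforce
qed

lemma col_in_lattice_image:
  fixes W :: "int mat"
  assumes W: "W \<in> carrier_mat n n" and i: "i < n"
  shows "col W i \<in> lattice_image n W"
proof -
  have "W *\<^sub>v unit_vec n i = col W i" using W i by (intro eq_vecI) auto
  then show ?thesis unfolding lattice_image_def by (metis (mono_tags, lifting) mem_Collect_eq unit_vec_carrier)
qed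

lemma lattice_image_subset_unit_lattice:
  assumes W: "W \<in> carrier_mat (N div 2) (N div 2)"
    and cols: "\<And>i. i < N div 2 \<Longrightarrow> col W i \<in> unit_lattice N"
  shows "lattice_image (N div 2) W \<subseteq> unit_lattice N"
proof
  fix z assume "z \<in> lattice_image (N div 2) W"
  then obtain x where x: "x \<in> carrier_vec (N div 2)" "z = W *\<^sub>v x" by (auto simp: lattice_image_def)
  define m where "m = N div 2"
  have zi: "vec_index z i = (\<Sum>j<m. W $$ (i, j) * vec_index x j)" if "i < m" for i
    using that x W by (simp add: scalar_prod_def m_def lessThan_atLeast0)
  have lin: "(\<Sum>i<m. f i * vec_index z i) = (\<Sum>j<m. vec_index x j * (\<Sum>i<m. f i * vec_index (col W j) i))" for f
  proof -
    have "(\<Sum>i<m. f i * vec_index z i) = (\<Sum>i<m. \<Sum>j<m. f i * (W $$ (i, j) * vec_index x j))"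
      by (simp add: zi sum_distrib_left)
    also have "\<dots> = (\<Sum>j<m. \<Sum>i<m. f i * (W $$ (i, j) * vec_index x j))" by (rule sum.swap)
    also have "\<dots> = (\<Sum>j<m. vec_index x j * (\<Sum>i<m. f i * vec_index (col W j) i))"
      using W by (intro sum.cong refl) (simp add: sum_distrib_left mult_ac m_def)
    finally show ?thesis .
  qed
  have "12 dvd (\<Sum>i<m. 1 * vec_index z i)"
    unfolding lin using cols by - (rule dvd_sum, rule dvd_mult, simp add: unit_lattice_def m_def)
  moreover have "int (N * gcd 2 N) dvd (\<Sum>i<m. (int i + 1) ^ 2 * vec_index z i)"
    unfolding lin using cols by - (rule dvd_sum, rule dvd_mult, simp add: unit_lattice_def m_def)
  moreover have "z \<in> carrier_vec m" using x W by (auto simp: m_def)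
  ultimately show "z \<in> unit_lattice N" by (simp add: unit_lattice_def m_def)
qed

lemma short_vec_in_unit_lattice_iff:
  assumes "N \<ge> 6" "1 \<le> j" "j \<le> N div 2"
  shows "short_vec (N div 2) a b c j d \<in> unit_lattice N \<longleftrightarrow>
    12 dvd a + b + c + d \<and> int (N * gcd 2 N) dvd a + 4 * b + 9 * c + int j ^ 2 * d"
proof -
  have m: "N div 2 \<ge> 3" using assms by simp
  have j: "int (j - 1) + 1 = int j" using assms by simp
  have s: "(\<Sum>i<N div 2. vec_index (short_vec (N div 2) a b c j d) i) = a + b + c + d"
    using sum_short_vec[OF m assms(2,3), of "\<lambda>_. 1"] by simp
  have "(\<Sum>i<N div 2. (int i + 1) ^ 2 * vec_index (short_vec (N div 2) a b c j d) i) = a + 4 * b + 9 * c + int j ^ 2 * d"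
    using sum_short_vec[OF m assms(2,3), of "\<lambda>i. (int i + 1) ^ 2" a b c d] j by simp
  with s show ?thesis by (simp add: unit_lattice_def short_vec_def[of "N div 2"])
qed

lemma lattice_image_int_B_matrix_5: "lattice_image 2 (int_B_matrix 5) = unit_lattice 5"
proof -
  have W: "int_B_matrix 5 \<in> carrier_mat 2 2" using int_B_matrix_carrier[of 5] by simp
  have ent: "int_B_matrix 5 $$ (0, 0) = 16" "int_B_matrix 5 $$ (0, 1) = -5" "int_B_matrix 5 $$ (1, 0) = -4" "int_B_matrix 5 $$ (1, 1) = 5"
    by (simp_all add: int_B_matrix_def mat_of_rows_list_def)
  have mult: "int_B_matrix 5 *\<^sub>v x = vec_of_list [16 * vec_index x 0 - 5 * vec_index x 1, - 4 * vec_index x 0 + 5 * vec_index x 1]"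
    if "x \<in> carrier_vec 2" for x
  proof (rule eq_vecI)
    fix i assume "i < dim_vec (vec_of_list [16 * vec_index x 0 - 5 * vec_index x 1, - 4 * vec_index x 0 + 5 * vec_index x 1])"
    then have "i = 0 \<or> i = 1" by auto
    then show "vec_index (int_B_matrix 5 *\<^sub>v x) i = vec_index (vec_of_list [16 * vec_index x 0 - 5 * vec_index x 1, - 4 * vec_index x 0 + 5 * vec_index x 1]) i"
      using that W ent by (auto simp: scalar_prod_def numeral_2_eq_2)
  qed (use W in auto)
  have ul: "x \<in> unit_lattice 5 \<longleftrightarrow> x \<in> carrier_vec 2 \<and> 12 dvd vec_index x 0 + vec_index x 1 \<and> 5 dvd vec_index x 0 + 4 * vec_index x 1" for x
  proof -
    have "gcd 2 (5::nat) = 1" using coprime_iff_gcd_eq_1[of 2 "5::nat"] by simp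
    moreover have "(5::nat) div 2 = 2" "{..<2::nat} = {0, 1}" by auto
    ultimately show ?thesis unfolding unit_lattice_def by simp
  qed
  show ?thesis
  proof (intro equalityI subsetI)
    fix z assume "z \<in> lattice_image 2 (int_B_matrix 5)"
    then obtain x where x: "x \<in> carrier_vec 2" "z = int_B_matrix 5 *\<^sub>v x" by (auto simp: lattice_image_def)
    have "z \<in> carrier_vec 2" using x W by auto
    moreover have "vec_index z 0 = 16 * vec_index x 0 - 5 * vec_index x 1" "vec_index z 1 = - 4 * vec_index x 0 + 5 * vec_index x 1"
      unfolding x(2) mult[OF x(1)] by simp_all
    ultimately show "z \<in> unit_lattice 5" unfolding ul by presburger
  next
    fix z assume "z \<in> unit_lattice 5"
    then have z: "z \<in> carrier_vec 2" "12 dvd vec_index z 0 + vec_index z 1" "5 dvd vec_index z 0 + 4 * vec_index z 1" unfolding ul by auto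
    \<comment> \<open>The rows of B_5 add up to (12, 0), which gives the first coefficient; the
      second row then gives the other.\<close>
    obtain u where u: "vec_index z 0 + vec_index z 1 = 12 * u" using z(2) by blast
    have "5 dvd 4 * u + vec_index z 1" using z(3) u by presburger
    then obtain v where v: "4 * u + vec_index z 1 = 5 * v" by blast
    define x where "x = vec_of_list [u, v]"
    have x: "x \<in> carrier_vec 2" "vec_index x 0 = u" "vec_index x 1 = v" by (simp_all add: x_def carrier_vecI)
    have "z = int_B_matrix 5 *\<^sub>v x"
    proof (rule eq_vecI)
      fix i assume "i < dim_vec (int_B_matrix 5 *\<^sub>v x)"
      then have "i = 0 \<or> i = 1" using W by auto
      then show "vec_index z i = vec_index (int_B_matrix 5 *\<^sub>v x) i"
        unfolding mult[OF x(1)] x using u v by auto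
    qed (use z W in auto)
    then show "z \<in> lattice_image 2 (int_B_matrix 5)" using x(1) unfolding lattice_image_def by blast
  qed
qed

text \<open>The columns with j \<ge> 4 have entry 1 at j, so coordinates can be cleared from the top
  down. On three coordinates the sum and the sum weighted by squares take the values (12, 0) on the
  first column, (0, M) on the second and (0, 0) on (5, -8, 3), which generates the common
  kernel.\<close>

lemma lattice_image_int_B_matrix:
  assumes N: "N \<ge> 5"
  shows "lattice_image (N div 2) (int_B_matrix N) = unit_lattice N"
proof (cases "N = 5")
  case True
  then show ?thesis using lattice_image_int_B_matrix_5 by simp
next
  case False
  then have N6: "N \<ge> 6" using N by simp
  define m where "m = N div 2"
  have m: "m \<ge> 3" using N6 by (simp add: m_def)
  define M where "M = int (N * gcd 2 N)"
  define r where "r = (2 * M) mod 3"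
  define W where "W = int_B_matrix N"
  have W: "W \<in> carrier_mat m m" unfolding W_def m_def by (rule int_B_matrix_carrier[OF N])
  have len: "length (int_B_columns N) = m" unfolding m_def by (rule length_int_B_columns[OF N6])
  have dim: "c \<in> carrier_vec m" if "c \<in> set (int_B_columns N)" for c
    using that by (auto simp: int_B_columns_def Let_def short_vec_def m_def)
  have col: "col W i = int_B_columns N ! i" if "i < m" for i
    using that len dim False by (simp add: W_def int_B_matrix_def m_def[symmetric] col_mat_of_cols)
  have colG: "c \<in> lattice_image m W" if "c \<in> set (int_B_columns N)" for c
    using that len col col_in_lattice_image[OF W] by (metis in_set_conv_nth)
  obtain aN where aN: "- M + 5 * r = 3 * aN" using r_const_divisibility(1)[of M] by (auto simp: r_def)
  obtain bN where bN: "M - 8 * r = 3 * bN" using r_const_divisibility(2)[of M] by (auto simp: r_def)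
  have cols_eq: "int_B_columns N = [short_vec m 16 (- 4) 0 1 0, short_vec m aN bN r 1 0]
      @ map (\<lambda>j. short_vec m ((int j ^ 2 - 4) div 3) (- ((int j ^ 2 - 1) div 3)) 0 j 1)
          (filter (\<lambda>j. \<not> 3 dvd j) [3..<m + 1])
      @ [short_vec m 5 (- 8) 3 1 0]
      @ map (\<lambda>j. short_vec m ((int j ^ 2 - 9) div 3) (- ((int j ^ 2 - 9) div 3)) (- 1) j 1)
          (filter (\<lambda>j. 3 dvd j) [4..<m + 1])"
    unfolding int_B_columns_def Let_def m_def[symmetric] M_def[symmetric] r_def[symmetric] aN bN by simp
  note mem = short_vec_in_unit_lattice_iff[OF N6, folded m_def M_def]
  have cj: "short_vec m ((int j ^ 2 - 4) div 3) (- ((int j ^ 2 - 1) div 3)) 0 j 1 \<in> unit_lattice N"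
    if "\<not> 3 dvd j" "3 \<le> j" "j \<le> m" for j
  proof -
    have "\<not> 3 dvd int j" using that by presburger
    then obtain u v where uv: "int j ^ 2 - 4 = 3 * u" "int j ^ 2 - 1 = 3 * v" using square_mod_3 by (metis dvdE)
    have d: "(int j ^ 2 - 4) div 3 = u" "(int j ^ 2 - 1) div 3 = v" using uv by simp_all
    have eqs: "u + - v + 0 + 1 = 0" "u + 4 * - v + 9 * 0 + int j ^ 2 * 1 = 0" using uv by linarith+
    show ?thesis unfolding d
    proof (subst mem)
      show "12 dvd u + - v + 0 + 1 \<and> M dvd u + 4 * - v + 9 * 0 + int j ^ 2 * 1" unfolding eqs by simp
    qed (use that in auto)
  qed
  have ct: "short_vec m ((int j ^ 2 - 9) div 3) (- ((int j ^ 2 - 9) div 3)) (- 1) j 1 \<in> unit_lattice N"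
    if "3 dvd j" "4 \<le> j" "j \<le> m" for j
  proof -
    have "3 dvd int j" using that by presburger
    then obtain u where u: "int j ^ 2 - 9 = 3 * u" using square_mod_3 by (metis dvdE)
    then have d: "(int j ^ 2 - 9) div 3 = u" by simp
    have eqs: "u + - u + - 1 + 1 = 0" "u + 4 * - u + 9 * - 1 + int j ^ 2 * 1 = 0" using u by linarith+
    show ?thesis unfolding d
    proof (subst mem)
      show "12 dvd u + - u + - 1 + 1 \<and> M dvd u + 4 * - u + 9 * - 1 + int j ^ 2 * 1" unfolding eqs by simp
    qed (use that in auto)
  qed
  have c12: "short_vec m 16 (- 4) 0 1 0 \<in> unit_lattice N" "short_vec m 5 (- 8) 3 1 0 \<in> unit_lattice N"
    using m by (simp_all add: mem)
  have c2: "short_vec m aN bN r 1 0 \<in> unit_lattice N"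
  proof -
    have "aN + bN + r = 0" "aN + 4 * bN + 9 * r = M" using aN bN by linarith+
    then show ?thesis using m by (simp add: mem)
  qed
  have cL: "c \<in> unit_lattice N" if "c \<in> set (int_B_columns N)" for c
    using that c12 c2 cj ct unfolding cols_eq by auto
  have sub: "lattice_image m W \<subseteq> unit_lattice N"
    unfolding m_def using W cL col len by (intro lattice_image_subset_unit_lattice) (auto simp: m_def)
  have G1: "short_vec m 16 (- 4) 0 1 0 \<in> lattice_image m W" "short_vec m aN bN r 1 0 \<in> lattice_image m W"
    "short_vec m 5 (- 8) 3 1 0 \<in> lattice_image m W"
    by (rule colG, simp add: cols_eq)+
  have base: "x \<in> lattice_image m W" if x: "x \<in> unit_lattice N" and z: "\<And>i. 3 \<le> i \<Longrightarrow> i < m \<Longrightarrow> vec_index x i = 0" for x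
  proof -
    have xc: "x \<in> carrier_vec m" using x by (simp add: unit_lattice_def m_def)
    have xs: "x = short_vec m (vec_index x 0) (vec_index x 1) (vec_index x 2) 1 0"
    proof (rule eq_vecI)
      fix i assume "i < dim_vec (short_vec m (vec_index x 0) (vec_index x 1) (vec_index x 2) 1 0)"
      then have i: "i < m" by (simp add: short_vec_def)
      consider "i = 0" | "i = 1" | "i = 2" | "3 \<le> i" by linarith
      then show "vec_index x i = vec_index (short_vec m (vec_index x 0) (vec_index x 1) (vec_index x 2) 1 0) i"
        by cases (use i z in \<open>auto simp: short_vec_def\<close>)
    qed (use xc in \<open>simp add: short_vec_def\<close>)
    have "12 dvd vec_index x 0 + vec_index x 1 + vec_index x 2" "M dvd vec_index x 0 + 4 * vec_index x 1 + 9 * vec_index x 2"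
      using x m by (subst (asm) xs, simp add: mem)+
    then obtain s t where s: "vec_index x 0 + vec_index x 1 + vec_index x 2 = 12 * s"
      and t: "vec_index x 0 + 4 * vec_index x 1 + 9 * vec_index x 2 = M * t" by (metis dvdE)
    \<comment> \<open>What is left after s times the first and t times the second column; both sums
      vanish on it, so it is a multiple of (5, -8, 3).\<close>
    define X Y Z where "X = vec_index x 0 - 16 * s - t * aN" and "Y = vec_index x 1 + 4 * s - t * bN" and "Z = vec_index x 2 - t * r"
    have e1: "X + Y + Z = 0"
    proof -
      have "X + Y + Z = (vec_index x 0 + vec_index x 1 + vec_index x 2 - 12 * s) - t * (aN + bN + r)"
        by (simp add: X_def Y_def Z_def algebra_simps)
      moreover have "aN + bN + r = 0" using aN bN by linarith
      ultimately show ?thesis using s by simp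
    qed
    have e2: "X + 4 * Y + 9 * Z = 0"
    proof -
      have "X + 4 * Y + 9 * Z = (vec_index x 0 + 4 * vec_index x 1 + 9 * vec_index x 2) - t * (aN + 4 * bN + 9 * r)"
        by (simp add: X_def Y_def Z_def algebra_simps)
      moreover have "aN + 4 * bN + 9 * r = M" using aN bN by linarith
      ultimately show ?thesis using t by (simp add: mult.commute)
    qed
    have "3 * Y + 8 * Z = 0" using e1 e2 by linarith
    then have "3 dvd Z" by presburger
    then obtain w where w: "Z = 3 * w" by blast
    have XY: "Y = - 8 * w" "X = 5 * w" using \<open>3 * Y + 8 * Z = 0\<close> e1 w by linarith+
    have "x = s \<cdot>\<^sub>v short_vec m 16 (- 4) 0 1 0 + t \<cdot>\<^sub>v short_vec m aN bN r 1 0 + w \<cdot>\<^sub>v short_vec m 5 (- 8) 3 1 0"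
      using XY w unfolding X_def Y_def Z_def by (subst xs) (intro eq_vecI, auto simp: short_vec_def algebra_simps)
    then show ?thesis using G1 by (metis lattice_image_add[OF W] lattice_image_smult[OF W])
  qed
  have peel: "x \<in> unit_lattice N \<Longrightarrow> (\<And>i. 3 + h \<le> i \<Longrightarrow> i < m \<Longrightarrow> vec_index x i = 0) \<Longrightarrow> x \<in> lattice_image m W" for h x
  proof (induction h arbitrary: x)
    case 0
    then show ?case using base by simp
  next
    case (Suc h)
    show ?case
    proof (cases "3 + h < m")
      case False
      then show ?thesis using base[OF Suc.prems(1)] Suc.IH[OF Suc.prems(1)] by auto
    next
      case True
      \<comment> \<open>Position 3 + h belongs to j = 4 + h; the column for this j has entry 1 there
        and zeros beyond.\<close>
      define j where "j = 4 + h"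
      have j: "4 \<le> j" "j \<le> m" "j - 1 = 3 + h" using True by (auto simp: j_def)
      obtain c where c: "c \<in> set (int_B_columns N)" "vec_index c (3 + h) = 1" "\<And>i. 3 + Suc h \<le> i \<Longrightarrow> i < m \<Longrightarrow> vec_index c i = 0"
      proof (cases "3 dvd j")
        case True
        then have "j \<in> set (filter (\<lambda>j. 3 dvd j) [4..<m + 1])" unfolding set_filter mem_Collect_eq set_upt using True j by auto
        then have "short_vec m ((int j ^ 2 - 9) div 3) (- ((int j ^ 2 - 9) div 3)) (- 1) j 1 \<in> set (int_B_columns N)"
          unfolding cols_eq set_append set_map by (intro UnI2 imageI)
        then show ?thesis by (rule that) (use j \<open>3 + h < m\<close> in \<open>simp_all add: short_vec_def\<close>)
      next
        case False
        then have "j \<in> set (filter (\<lambda>j. \<not> 3 dvd j) [3..<m + 1])" unfolding set_filter mem_Collect_eq set_upt using False j by auto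
        then have "short_vec m ((int j ^ 2 - 4) div 3) (- ((int j ^ 2 - 1) div 3)) 0 j 1 \<in> set (int_B_columns N)"
          unfolding cols_eq set_append set_map by (rule UnI2[OF UnI1[OF imageI]])
        then show ?thesis by (rule that) (use j \<open>3 + h < m\<close> in \<open>simp_all add: short_vec_def\<close>)
      qed
      have xc: "x \<in> carrier_vec m" using Suc.prems(1) by (simp add: unit_lattice_def m_def)
      have cc: "c \<in> carrier_vec m" using dim c(1) .
      define y where "y = x - vec_index x (3 + h) \<cdot>\<^sub>v c"
      have "y \<in> unit_lattice N" unfolding y_def by (intro unit_lattice_minus unit_lattice_smult Suc.prems(1) cL[OF c(1)])
      moreover have "vec_index y i = 0" if "3 + h \<le> i" "i < m" for i
        using that c(2,3) Suc.prems(2)[of i] xc cc by (cases "i = 3 + h") (auto simp: y_def)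
      ultimately have "y \<in> lattice_image m W" by (rule Suc.IH)
      moreover have "x = y + vec_index x (3 + h) \<cdot>\<^sub>v c" using xc cc by (intro eq_vecI) (auto simp: y_def)
      ultimately show ?thesis using lattice_image_add[OF W] lattice_image_smult[OF W colG[OF c(1)]] by metis
    qed
  qed
  have "x \<in> lattice_image m W" if "x \<in> unit_lattice N" for x
    by (rule peel[of x m]) (use that in auto)
  then show ?thesis using sub unfolding m_def W_def by blast
qed

section \<open>Orders at the cusps and the class matrix\<close>

lemma B2_frac_cong_sign:
  assumes "\<epsilon> \<in> {1, -1}" "[x' = \<epsilon> * x] (mod g)" "g > 0"
  shows "B2 (frac (real j * of_int x' / of_int g)) = B2 (frac (real j * of_int x / of_int g))"
proof -
  obtain t where "x' = \<epsilon> * x + g * t" using assms(2) by (metis cong_iff_lin cong_sym)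
  then have "real j * of_int x' / of_int g = real_of_int \<epsilon> * (real j * of_int x / of_int g) + of_int (int j * t)"
    using assms(3) by (simp add: field_simps)
  then have "B2 (frac (real j * of_int x' / of_int g)) = B2 (frac (real_of_int \<epsilon> * (real j * of_int x / of_int g)))"
    by (simp only: B2_frac_add_int)
  then show ?thesis using assms(1) B2_frac_uminus by auto
qed

lemma cusp_order_cong:
  assumes "\<epsilon> \<in> {1, -1}" "[p' = \<epsilon> * p] (mod g)" "g > 0"
  shows "cusp_order N k b p' g = cusp_order N k b p g"
  unfolding cusp_order_def by (simp only: B2_frac_cong_sign[OF assms])

text \<open>By \<open>orbit_reps_cover\<close>, every cusp shares its gcd with N, and its numerator
  up to sign modulo that gcd, with one of the representatives; \<open>cusp_order\<close> sees
  nothing else.\<close>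

lemma theta_product_modular_iff_orbit_reps:
  assumes N: "N \<ge> 5" and reps: "orbit_reps N a c"
  shows "theta_product N (2 * k) b \<in> modular_forms k N \<longleftrightarrow>
     12 dvd int k + (\<Sum>j=1..N div 2. b j) \<and> int (N * gcd 2 N) dvd (\<Sum>j=1..N div 2. int j ^ 2 * b j) \<and>
     (\<forall>i\<le>N div 2. 0 \<le> cusp_order N k b (a i) (gcd (c i) (int N)))"
proof -
  have g: "gcd y (int N) > 0" for y using N by simp
  have "(\<forall>p r. coprime p r \<longrightarrow> 0 \<le> cusp_order N k b p (gcd r (int N))) \<longleftrightarrow>
      (\<forall>i\<le>N div 2. 0 \<le> cusp_order N k b (a i) (gcd (c i) (int N)))" (is "?l \<longleftrightarrow> ?r")
  proof
    assume ?l
    moreover have "coprime (a i) (c i)" if "i \<le> N div 2" for i using reps that by (simp add: orbit_reps_def)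
    ultimately show ?r by blast
  next
    assume r: ?r
    show ?l
    proof (intro allI impI)
      fix p r :: int assume pr: "coprime p r"
      have N1: "N > 1" using N by simp
      obtain i where i: "i \<le> N div 2" "gcd r (int N) = gcd (c i) (int N)"
        "\<exists>\<epsilon>\<in>{1, -1}. [p = \<epsilon> * a i] (mod gcd (c i) (int N))"
        by (rule orbit_reps_cover[OF N1 reps pr])
      then obtain \<epsilon> where "\<epsilon> \<in> {1, -1}" "[p = \<epsilon> * a i] (mod gcd (c i) (int N))" by blast
      then have "cusp_order N k b p (gcd (c i) (int N)) = cusp_order N k b (a i) (gcd (c i) (int N))"
        using cusp_order_cong g by blast
      then show "0 \<le> cusp_order N k b p (gcd r (int N))" using r i by simp
    qed
  qed
  then show ?thesis using theta_product_modular_iff[of N k b] N by simp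
qed

text \<open>The B_2 part of the orders has degree 0 for each j. Passing to residue pairs removes the
  representatives and leaves \<open>sum_totatives_B2_zero\<close>.\<close>

lemma sum_orbit_reps_B2:
  assumes N: "N \<ge> 5" and reps: "orbit_reps N a c" and j: "0 < j" "j < N"
  shows "(\<Sum>i=0..N div 2. real (card (galois_orbit N (cusp N (a i) (c i)))) *
    (of_int (gcd (c i) (int N)) * B2 (frac (real j * of_int (a i) / of_int (gcd (c i) (int N)))))) = 0"
proof -
  define G where "G = (\<lambda>g x. real_of_int g * B2 (frac (real j * of_int x / of_int g)))"
  have G: "G g x' = G g x" if "\<epsilon> \<in> {1, -1}" "[x' = \<epsilon> * x] (mod g)" "g > 0" for g x x' \<epsilon>
    unfolding G_def by (simp only: B2_frac_cong_sign[OF that])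
  have "(\<Sum>i=0..N div 2. real (card (galois_orbit N (cusp N (a i) (c i)))) * G (gcd (c i) (int N)) (a i)) =
    1 / 2 * (\<Sum>y\<in>{0<..N}. \<Sum>x\<in>totatives (gcd y N). G (int (gcd y N)) (int x))" by (rule sum_orbit_reps[OF N reps G])
  also have "\<dots> = 0" using sum_totatives_B2_zero[OF j] by (simp add: G_def del: gcd_Suc_0)
  finally show ?thesis by (simp add: G_def)
qed

text \<open>The same transfer for the constant part of the orders; 12 is the 24 of
  \<open>sum_totatives_R_const\<close> halved by the double cover.\<close>

lemma sum_orbit_reps_level:
  assumes N: "N \<ge> 5" and reps: "orbit_reps N a c"
  shows "(\<Sum>i=0..N div 2. real (card (galois_orbit N (cusp N (a i) (c i)))) * of_int (gcd (c i) (int N))) = 12 * R_const N"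
proof -
  have "(\<Sum>i=0..N div 2. real (card (galois_orbit N (cusp N (a i) (c i)))) * of_int (gcd (c i) (int N))) =
    1 / 2 * (\<Sum>y\<in>{0<..N}. \<Sum>x\<in>totatives (gcd y N). of_int (int (gcd y N)))"
    by (rule sum_orbit_reps[OF N reps, of "\<lambda>g x. of_int g"]) simp
  also have "\<dots> = 12 * R_const N" using sum_totatives_R_const[of N] N by simp
  finally show ?thesis .
qed

lemma orbit_size_pos:
  assumes N: "N \<ge> 5" and ac: "coprime a c"
  shows "card (galois_orbit N (cusp N a c)) > 0"
proof -
  have "finite (pair_class N a (gcd c (int N)))"
    using finite_residue_pairs by (rule finite_subset[rotated]) (auto simp: pair_class_def)
  moreover have "pair_class N a (gcd c (int N)) \<noteq> {}"
  proof -
    have N0: "N > 0" using N by simp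
    obtain x y where "(x, y) \<in> residue_pairs N" "[x = a] (mod gcd c (int N))" "gcd y (int N) = gcd c (int N)"
      by (rule residue_pair_of[OF N0 ac])
    then have "(x, y) \<in> pair_class N a (gcd c (int N))" by (simp add: pair_class_def)
    then show ?thesis by blast
  qed
  ultimately have "card (pair_class N a (gcd c (int N))) > 0" by (simp add: card_gt_0_iff)
  then show ?thesis using card_pair_class[OF N ac] by simp
qed

lemma orbit_size_last:
  assumes N: "N \<ge> 5" and reps: "orbit_reps N a c"
  shows "card (galois_orbit N (cusp N (a (N div 2)) (c (N div 2)))) = 1"
  using card_galois_orbit_infinity[of N] reps N by (simp add: orbit_reps_def)

lemma A_matrix_carrier: "A_matrix N a c \<in> carrier_mat (N div 2) (N div 2)"
  by (simp add: A_matrix_def)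

text \<open>A kernel vector is a combination of the functions B_2(\<langle>j x\<rangle>) that
  vanishes at all representatives except possibly i\<infinity>. The degree relation extends this to
  i\<infinity>, hence to all cusps, against the independence in
  \<open>B2_combination_zero\<close>.\<close>

lemma det_A_matrix_nonzero:
  assumes N: "N \<ge> 5" and reps: "orbit_reps N a c"
  shows "Determinant.det (A_matrix N a c) \<noteq> 0"
proof
  define m where "m = N div 2"
  assume "Determinant.det (A_matrix N a c) = 0"
  then obtain v where v: "v \<in> carrier_vec m" "v \<noteq> 0\<^sub>v m" "A_matrix N a c *\<^sub>v v = 0\<^sub>v m"
    using det_0_iff_vec_prod_zero[OF A_matrix_carrier] unfolding m_def by blast
  define u where "u = (\<lambda>j. vec_index v (j - 1))"
  define g where "g = (\<lambda>r. gcd (c r) (int N))"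
  define F where "F = (\<lambda>g x. \<Sum>j=1..m. u j * B2 (frac (real j * of_int x / real_of_int g)))"
  define \<mu> where "\<mu> = (\<lambda>r. card (galois_orbit N (cusp N (a r) (c r))))"
  have g: "g r > 0" for r using N by (simp add: g_def)
  have F0: "F (g r) (a r) = 0" if r: "r < m" for r
  proof -
    have "0 = vec_index (A_matrix N a c *\<^sub>v v) r" using v(3) r by simp
    also have "\<dots> = (\<Sum>i<m. of_int (g r) / 2 * B2 (frac (real (i + 1) * of_int (a r) / of_int (g r))) * vec_index v i)"
      using r v(1) unfolding A_matrix_def m_def[symmetric] g_def
      by (auto simp: scalar_prod_def atLeast0LessThan Let_def intro!: sum.cong)
    also have "\<dots> = of_int (g r) / 2 * F (g r) (a r)"
      unfolding F_def One_nat_def sum.atLeast1_atMost_eq by (simp add: u_def sum_distrib_left mult_ac)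
    finally show ?thesis using g[of r] by simp
  qed
  have "(\<Sum>i=0..m. real (\<mu> i) * (of_int (g i) * F (g i) (a i))) =
      (\<Sum>j=1..m. u j * (\<Sum>i=0..m. real (\<mu> i) * (of_int (g i) * B2 (frac (real j * of_int (a i) / of_int (g i))))))"
    unfolding F_def sum_distrib_left by (subst sum.swap) (simp add: mult_ac)
  also have "\<dots> = 0"
  proof (intro sum.neutral ballI)
    fix j assume "j \<in> {1..m}"
    then have "0 < j" "j < N" using N by (auto simp: m_def)
    from sum_orbit_reps_B2[OF N reps this]
    show "u j * (\<Sum>i=0..m. real (\<mu> i) * (of_int (g i) * B2 (frac (real j * of_int (a i) / of_int (g i))))) = 0"
      unfolding \<mu>_def g_def m_def by simp
  qed
  finally have "(\<Sum>i=0..m. real (\<mu> i) * (of_int (g i) * F (g i) (a i))) = 0" .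
  moreover have "(\<Sum>i=0..m. real (\<mu> i) * (of_int (g i) * F (g i) (a i))) = real (\<mu> m) * (of_int (g m) * F (g m) (a m))"
    by (rule sum.mono_neutral_cong_right[of "{0..m}" "{m}", simplified]) (auto simp: F0)
  moreover have "\<mu> m = 1" unfolding \<mu>_def m_def by (rule orbit_size_last[OF N reps])
  ultimately have "F (g m) (a m) = 0" using g[of m] by simp
  then have F0': "F (g r) (a r) = 0" if "r \<le> m" for r using that F0 by (cases "r = m") auto
  have "(\<Sum>j=1..m. u j * B2 (frac (real j * of_int X / real N))) = 0" for X :: int
  proof -
    \<comment> \<open>In lowest terms X / N is x / h with h dvd N, so the value at X is the one at
      the cusp [x/h].\<close>
    define d where "d = gcd X (int N)"
    define x where "x = X div d"
    define h where "h = int N div d"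
    have d: "d > 0" "X = d * x" "int N = d * h" using N by (auto simp: d_def x_def h_def)
    have xh: "coprime x h" unfolding x_def h_def d_def using N by (intro div_gcd_coprime) auto
    have h: "h > 0" using d N by (metis of_nat_0_less_iff zero_less_mult_pos gr_zeroI not_numeral_le_zero)
    have gh: "gcd h (int N) = h" using d h by simp
    have N1: "N > 1" using N by simp
    obtain i where i: "i \<le> N div 2" "gcd h (int N) = gcd (c i) (int N)"
        "\<exists>\<epsilon>\<in>{1, -1}. [x = \<epsilon> * a i] (mod gcd (c i) (int N))"
      by (rule orbit_reps_cover[OF N1 reps xh])
    then obtain \<epsilon> where e: "\<epsilon> \<in> {1, -1}" "[x = \<epsilon> * a i] (mod g i)" unfolding g_def by blast
    have "real N = of_int (d * h)" using d(3) by (metis of_int_of_nat_eq)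
    then have "real j * of_int X / real N = real j * of_int x / of_int h" for j
      using d(1,2) by simp
    then have "(\<Sum>j=1..m. u j * B2 (frac (real j * of_int X / real N))) = F (g i) x"
      using i(2) gh by (simp add: F_def g_def)
    also have "\<dots> = F (g i) (a i)" unfolding F_def by (simp only: B2_frac_cong_sign[OF e g])
    finally show ?thesis using F0' i(1) by (simp add: m_def)
  qed
  then have "u j = 0" if "j \<in> {1..m}" for j
    using B2_combination_zero[of N u j] N that unfolding m_def by simp
  then have "vec_index v i = 0" if "i < m" for i using that unfolding u_def by (metis add_diff_cancel_left' atLeastAtMost_iff le_add1 plus_1_eq_Suc Suc_leI)
  then have "v = 0\<^sub>v m" using v(1) by (intro eq_vecI) auto
  then show False using v(2) by contradiction
qed

text \<open>The lattice spanned by the columns is \<open>unit_lattice\<close>, which contains D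
  times every unit vector for D = 12 N gcd(2, N); so no nonzero vector is orthogonal to all
  columns.\<close>

lemma det_int_B_matrix_nonzero:
  assumes N: "N \<ge> 5"
  shows "Determinant.det (int_B_matrix N) \<noteq> 0"
proof
  define m where "m = N div 2"
  define B where "B = int_B_matrix N"
  have B: "B \<in> carrier_mat m m" unfolding B_def m_def by (rule int_B_matrix_carrier[OF N])
  assume "Determinant.det (int_B_matrix N) = 0"
  then have "Determinant.det (transpose_mat B) = 0" using B by (simp add: det_transpose B_def)
  then obtain v where v: "v \<in> carrier_vec m" "v \<noteq> 0\<^sub>v m" "transpose_mat B *\<^sub>v v = 0\<^sub>v m"
    using det_0_iff_vec_prod_zero[of "transpose_mat B" m] B by auto
  define D where "D = 12 * int (N * gcd 2 N)"
  have "vec_index v i = 0" if i: "i < m" for i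
  proof -
    have "D \<cdot>\<^sub>v unit_vec m i \<in> unit_lattice N"
    proof -
      have delta: "(\<Sum>l<m. f l * vec_index (D \<cdot>\<^sub>v unit_vec m i) l) = f i * D" for f :: "nat \<Rightarrow> int"
      proof -
        have "(\<Sum>l<m. f l * vec_index (D \<cdot>\<^sub>v unit_vec m i) l) = (\<Sum>l<m. if l = i then f i * D else 0)"
          using i by (intro sum.cong) (auto simp: unit_vec_def)
        then show ?thesis using i by simp
      qed
      have "(\<Sum>l<m. vec_index (D \<cdot>\<^sub>v unit_vec m i) l) = D" using delta[of "\<lambda>_. 1"] by simp
      moreover note delta[of "\<lambda>l. (int l + 1) ^ 2"]
      ultimately show ?thesis unfolding unit_lattice_def m_def[symmetric] mem_Collect_eq
        by (simp only: smult_carrier_vec unit_vec_carrier D_def) simp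
    qed
    then obtain x where x: "x \<in> carrier_vec m" "D \<cdot>\<^sub>v unit_vec m i = B *\<^sub>v x"
      unfolding lattice_image_int_B_matrix[OF N, symmetric] B_def m_def lattice_image_def by auto
    have "v \<bullet> (D \<cdot>\<^sub>v unit_vec m i) = (transpose_mat B *\<^sub>v v) \<bullet> x"
      unfolding x(2) using transpose_vec_mult_scalar[OF B x(1) v(1)] by simp
    also have "\<dots> = 0" unfolding v(3) using x(1) by simp
    finally have "D * vec_index v i = 0" using v(1) i by simp
    then show ?thesis using N by (simp add: D_def)
  qed
  then have "v = 0\<^sub>v m" using v(1) by (intro eq_vecI) auto
  then show False using v(2) by contradiction
qed

lemma det_class_matrix:
  assumes N: "N \<ge> 5"
  shows "Determinant.det (class_matrix N a c) = Determinant.det (A_matrix N a c) * of_int (Determinant.det (int_B_matrix N))"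
proof -
  have B: "int_B_matrix N \<in> carrier_mat (N div 2) (N div 2)" by (rule int_B_matrix_carrier[OF N])
  then show ?thesis unfolding class_matrix_def B_matrix_eq[OF N]
    by (subst det_mult[OF A_matrix_carrier]) (simp_all add: of_int_hom.hom_det)
qed

lemma det_class_matrix_nonzero:
  assumes N: "N \<ge> 5" and reps: "orbit_reps N a c"
  shows "Determinant.det (class_matrix N a c) \<noteq> 0"
  using det_A_matrix_nonzero[OF assms] det_int_B_matrix_nonzero[OF N] det_class_matrix[OF N] by simp

text \<open>This is 12 N A_N. With x the residue of j a modulo g, the entry is 6 N g B_2(x / g),
  whose coefficients are integers because g divides N.\<close>

definition int_A_matrix :: "nat \<Rightarrow> (nat \<Rightarrow> int) \<Rightarrow> (nat \<Rightarrow> int) \<Rightarrow> int mat" where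
  "int_A_matrix N a c = Matrix.mat (N div 2) (N div 2) (\<lambda>(r, i).
     let g = gcd (c r) (int N); x = (int (i + 1) * a r) mod g
     in 6 * (int N div g) * x ^ 2 - 6 * int N * x + int N * g)"

lemma int_A_matrix_carrier: "int_A_matrix N a c \<in> carrier_mat (N div 2) (N div 2)"
  by (simp add: int_A_matrix_def)

lemma int_A_matrix_entry:
  assumes N: "N > 0" and r: "r < N div 2" and i: "i < N div 2"
  shows "of_int (int_A_matrix N a c $$ (r, i)) = 6 * real N * of_int (gcd (c r) (int N)) *
    B2 (frac (real (i + 1) * of_int (a r) / of_int (gcd (c r) (int N))))"
proof -
  define g where "g = gcd (c r) (int N)"
  define x where "x = (int (i + 1) * a r) mod g"
  have g: "g > 0" "g dvd int N" using N by (simp_all add: g_def)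
  obtain h where h: "int N = g * h" using g(2) by blast
  have hN: "real N = of_int g * of_int h" using h by (metis of_int_mult of_int_of_nat_eq)
  have "of_int (int (i + 1) * a r) = of_int x + of_int g * real_of_int (int (i + 1) * a r div g)"
    unfolding x_def by (metis mod_mult_div_eq of_int_add of_int_mult)
  then have "real (i + 1) * of_int (a r) / of_int g = of_int x / of_int g + of_int (int (i + 1) * a r div g)"
    using g by (simp add: field_simps)
  then have "frac (real (i + 1) * of_int (a r) / of_int g) = frac (of_int x / of_int g)" by (simp add: frac_def)
  also have "\<dots> = of_int x / of_int g"
    using pos_mod_bound[OF g(1)] pos_mod_sign[OF g(1)] g(1) unfolding frac_eq x_def by (simp add: field_simps)
  finally have f: "frac (real (i + 1) * of_int (a r) / of_int g) = of_int x / of_int g" .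
  have "int_A_matrix N a c $$ (r, i) = 6 * (int N div g) * x ^ 2 - 6 * int N * x + int N * g"
    using r i by (simp add: int_A_matrix_def Let_def g_def x_def)
  also have "int N div g = h" using h g by simp
  finally have "of_int (int_A_matrix N a c $$ (r, i)) =
      6 * of_int h * of_int x ^ 2 - 6 * real N * of_int x + real N * of_int g" by simp
  also have "\<dots> = 6 * real N * of_int g * B2 (of_int x / of_int g)"
    unfolding hN B2_def using g by (simp add: field_simps power2_eq_square)
  also have "\<dots> = 6 * real N * of_int g * B2 (frac (real (i + 1) * of_int (a r) / of_int g))" unfolding f ..
  finally show ?thesis unfolding g_def .
qed

lemma int_A_matrix_eq:
  assumes N: "N > 0"
  shows "map_mat of_int (int_A_matrix N a c) = (12 * real N) \<cdot>\<^sub>m A_matrix N a c"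
proof (rule eq_matI)
  fix r i assume "r < dim_row ((12 * real N) \<cdot>\<^sub>m A_matrix N a c)" "i < dim_col ((12 * real N) \<cdot>\<^sub>m A_matrix N a c)"
  then have "r < N div 2" "i < N div 2" by (simp_all add: A_matrix_def)
  then show "map_mat real_of_int (int_A_matrix N a c) $$ (r, i) = ((12 * real N) \<cdot>\<^sub>m A_matrix N a c) $$ (r, i)"
    using int_A_matrix_entry[OF N, of r i a c] int_A_matrix_carrier[of N a c]
    by (simp add: A_matrix_def Let_def)
qed (simp_all add: A_matrix_def int_A_matrix_def)

lemma det_int_A_matrix:
  assumes N: "N > 0"
  shows "of_int (Determinant.det (int_A_matrix N a c)) = (12 * real N) ^ (N div 2) * Determinant.det (A_matrix N a c)"
proof -
  have "real_of_int (Determinant.det (int_A_matrix N a c)) = Determinant.det (map_mat of_int (int_A_matrix N a c))"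
    by (rule of_int_hom.hom_det[symmetric])
  also have "\<dots> = (12 * real N) ^ (N div 2) * Determinant.det (A_matrix N a c)"
    unfolding int_A_matrix_eq[OF N] by (simp add: A_matrix_def)
  finally show ?thesis .
qed

definition exponent_vec :: "nat \<Rightarrow> (nat \<Rightarrow> int) \<Rightarrow> int Matrix.vec" where
  "exponent_vec N b = Matrix.vec (N div 2) (\<lambda>i. b (i + 1))"

text \<open>Entry r is 12 N g times \<open>cusp_order\<close>; the summand N k g comes from the term
  k / 12.\<close>

definition order_vec :: "nat \<Rightarrow> (nat \<Rightarrow> int) \<Rightarrow> (nat \<Rightarrow> int) \<Rightarrow> nat \<Rightarrow> int Matrix.vec \<Rightarrow> int Matrix.vec" where
  "order_vec N a c k x = Matrix.vec (N div 2) (\<lambda>r. int N * int k * gcd (c r) (int N)) + int_A_matrix N a c *\<^sub>v x"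

lemma exponent_vec_carrier: "exponent_vec N b \<in> carrier_vec (N div 2)"
  by (simp add: exponent_vec_def)

lemma order_vec_carrier: "order_vec N a c k x \<in> carrier_vec (N div 2)"
  unfolding order_vec_def by (intro carrier_vecI) (simp add: int_A_matrix_def)

lemma order_vec_index:
  assumes N: "N > 0" and r: "r < N div 2"
  shows "of_int (vec_index (order_vec N a c k (exponent_vec N b)) r) =
    12 * real N * of_int (gcd (c r) (int N)) * cusp_order N k b (a r) (gcd (c r) (int N))"
proof -
  define g where "g = gcd (c r) (int N)"
  have A: "dim_row (int_A_matrix N a c) = N div 2" "dim_col (int_A_matrix N a c) = N div 2"
    using int_A_matrix_carrier[of N a c] by auto
  have "vec_index (order_vec N a c k (exponent_vec N b)) r =
      int N * int k * g + (\<Sum>i<N div 2. int_A_matrix N a c $$ (r, i) * b (i + 1))"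
    using r A by (simp add: order_vec_def exponent_vec_def scalar_prod_def g_def atLeast0LessThan)
  then have "of_int (vec_index (order_vec N a c k (exponent_vec N b)) r) =
      real N * real k * of_int g + (\<Sum>i<N div 2. real_of_int (int_A_matrix N a c $$ (r, i)) * of_int (b (i + 1)))"
    by simp
  also have "\<dots> = real N * real k * of_int g +
      (\<Sum>i<N div 2. 6 * real N * of_int g * B2 (frac (real (i + 1) * of_int (a r) / of_int g)) * of_int (b (i + 1)))"
    using int_A_matrix_entry[OF N r] by (simp add: g_def)
  also have "\<dots> = 12 * real N * of_int g * cusp_order N k b (a r) g"
    unfolding cusp_order_def One_nat_def sum.atLeast1_atMost_eq
    by (simp add: algebra_simps sum_distrib_left)
  finally show ?thesis by (simp only: g_def)
qed

text \<open>The valence formula for these products: the B_2 parts cancel by degree 0, and the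
  constant parts add up to k R_N, whatever the exponents are.\<close>

lemma weighted_sum_cusp_order:
  assumes N: "N \<ge> 5" and reps: "orbit_reps N a c"
  shows "(\<Sum>i=0..N div 2. real (card (galois_orbit N (cusp N (a i) (c i)))) *
    (of_int (gcd (c i) (int N)) * cusp_order N k b (a i) (gcd (c i) (int N)))) = real k * R_const N"
proof -
  define \<mu> where "\<mu> = (\<lambda>i. real (card (galois_orbit N (cusp N (a i) (c i)))))"
  define g where "g = (\<lambda>i. real_of_int (gcd (c i) (int N)))"
  define \<beta> where "\<beta> = (\<lambda>i j. B2 (frac (real j * of_int (a i) / g i)))"
  have "(\<Sum>i=0..N div 2. \<mu> i * (g i * cusp_order N k b (a i) (gcd (c i) (int N)))) =
      (\<Sum>i=0..N div 2. real k / 12 * (\<mu> i * g i) + 1 / 2 * (\<Sum>j=1..N div 2. of_int (b j) * (\<mu> i * (g i * \<beta> i j))))"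
    by (intro sum.cong refl) (simp add: cusp_order_def \<beta>_def g_def algebra_simps sum_distrib_left)
  also have "\<dots> = real k / 12 * (\<Sum>i=0..N div 2. \<mu> i * g i) +
      1 / 2 * (\<Sum>i=0..N div 2. \<Sum>j=1..N div 2. of_int (b j) * (\<mu> i * (g i * \<beta> i j)))"
    by (simp add: sum.distrib sum_distrib_left)
  also have "(\<Sum>i=0..N div 2. \<mu> i * g i) = 12 * R_const N"
    unfolding \<mu>_def g_def by (rule sum_orbit_reps_level[OF N reps])
  also have "(\<Sum>i=0..N div 2. \<Sum>j=1..N div 2. of_int (b j) * (\<mu> i * (g i * \<beta> i j))) =
      (\<Sum>j=1..N div 2. of_int (b j) * (\<Sum>i=0..N div 2. \<mu> i * (g i * \<beta> i j)))"
    unfolding sum_distrib_left by (rule sum.swap)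
  also have "\<dots> = 0"
  proof (intro sum.neutral ballI)
    fix j assume "j \<in> {1..N div 2}"
    then have "0 < j" "j < N" using N by auto
    from sum_orbit_reps_B2[OF N reps this] have "(\<Sum>i=0..N div 2. \<mu> i * (g i * \<beta> i j)) = 0"
      unfolding \<mu>_def g_def \<beta>_def .
    then show "of_int (b j) * (\<Sum>i=0..N div 2. \<mu> i * (g i * \<beta> i j)) = 0" by simp
  qed
  finally show ?thesis by (simp add: \<mu>_def g_def)
qed

text \<open>The coordinates are the scaled orders at the first m representatives. By the valence
  formula and \<mu>_m = 1, the slack in the weighted inequality is 12 N g times the order at
  i\<infinity>, which thus becomes the last face.\<close>

lemma order_vec_in_lattice_simplex_iff:
  assumes N: "N \<ge> 5" and reps: "orbit_reps N a c"
  shows "order_vec N a c k (exponent_vec N b) \<in> lattice_simplex (N div 2)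
      (\<lambda>i. real (card (galois_orbit N (cusp N (a i) (c i))))) (12 * real N * R_const N * real k) \<longleftrightarrow>
    (\<forall>i\<le>N div 2. 0 \<le> cusp_order N k b (a i) (gcd (c i) (int N)))"
proof -
  define m where "m = N div 2"
  define \<mu> where "\<mu> = (\<lambda>i. real (card (galois_orbit N (cusp N (a i) (c i)))))"
  define g where "g = (\<lambda>i. real_of_int (gcd (c i) (int N)))"
  define o' where "o' = (\<lambda>i. cusp_order N k b (a i) (gcd (c i) (int N)))"
  define y where "y = order_vec N a c k (exponent_vec N b)"
  have N0: "N > 0" using N by simp
  have g: "g i > 0" for i using N by (simp add: g_def)
  have yi: "of_int (vec_index y r) = 12 * real N * (g r * o' r)" if "r < m" for r
    using order_vec_index[OF N0, of r a c k b] that unfolding y_def m_def g_def o'_def by simp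
  have "\<mu> m = 1" using orbit_size_last[OF N reps] by (simp add: \<mu>_def m_def)
  then have "(\<Sum>i<m. \<mu> i * (g i * o' i)) + g m * o' m = real k * R_const N"
    using weighted_sum_cusp_order[OF N reps, of k b]
    unfolding m_def[symmetric] \<mu>_def[symmetric] g_def[symmetric] o'_def[symmetric]
    by (simp add: atLeast0AtMost lessThan_Suc_atMost[symmetric] \<mu>_def g_def o'_def)
  moreover have "(\<Sum>i<m. \<mu> i * of_int (vec_index y i)) = 12 * real N * (\<Sum>i<m. \<mu> i * (g i * o' i))"
    by (simp add: yi sum_distrib_left mult_ac)
  ultimately have "(\<Sum>i<m. \<mu> i * of_int (vec_index y i)) = 12 * real N * (real k * R_const N - g m * o' m)"
    by (metis add_diff_cancel_right')
  then have "(\<Sum>i<m. \<mu> i * of_int (vec_index y i)) = 12 * real N * R_const N * real k - 12 * real N * (g m * o' m)"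
    by (simp add: algebra_simps)
  then have "(\<Sum>i<m. \<mu> i * of_int (vec_index y i)) \<le> 12 * real N * R_const N * real k \<longleftrightarrow> 0 \<le> 12 * real N * (g m * o' m)"
    by simp
  then have "(\<Sum>i<m. \<mu> i * of_int (vec_index y i)) \<le> 12 * real N * R_const N * real k \<longleftrightarrow> 0 \<le> g m * o' m"
    using N0 by (simp add: zero_le_mult_iff)
  moreover have "0 \<le> vec_index y i \<longleftrightarrow> 0 \<le> g i * o' i" if "i < m" for i
  proof -
    have "0 \<le> vec_index y i \<longleftrightarrow> 0 \<le> real_of_int (vec_index y i)" by simp
    then show ?thesis unfolding yi[OF that] using N0 by (simp add: zero_le_mult_iff)
  qed
  moreover have "0 \<le> g i * o' i \<longleftrightarrow> 0 \<le> o' i" for i using g[of i] by (simp add: zero_le_mult_iff)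
  ultimately have "y \<in> lattice_simplex m \<mu> (12 * real N * R_const N * real k) \<longleftrightarrow> (\<forall>i<m. 0 \<le> o' i) \<and> 0 \<le> o' m"
    using order_vec_carrier[of N a c k "exponent_vec N b"] unfolding lattice_simplex_def y_def m_def by simp
  also have "\<dots> \<longleftrightarrow> (\<forall>i\<le>m. 0 \<le> o' i)" by (auto simp: le_less)
  finally show ?thesis unfolding y_def m_def \<mu>_def o'_def .
qed

text \<open>A particular solution of the congruences in weight k: (-3, 3, -1) has sum -1 and
  weighted sum -3 + 12 - 9 = 0. For N = 5 there are only two coordinates, and (-3, 2) has sum -1 and
  weighted sum 5.\<close>

definition base_vec :: "nat \<Rightarrow> nat \<Rightarrow> int Matrix.vec" where
  "base_vec N k = (if N = 5 then Matrix.vec 2 (\<lambda>i. if i = 0 then - 3 * int k else 2 * int k)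
     else short_vec (N div 2) (- 3 * int k) (3 * int k) (- int k) 1 0)"

lemma base_vec_carrier: "base_vec N k \<in> carrier_vec (N div 2)"
  by (auto simp: base_vec_def short_vec_def)

lemma base_vec_sums:
  assumes N: "N \<ge> 5"
  shows "(\<Sum>i<N div 2. vec_index (base_vec N k) i) = - int k"
    and "int (N * gcd 2 N) dvd (\<Sum>i<N div 2. (int i + 1) ^ 2 * vec_index (base_vec N k) i)"
proof -
  show "(\<Sum>i<N div 2. vec_index (base_vec N k) i) = - int k"
  proof (cases "N = 5")
    case True
    then have "{..<N div 2} = {0, 1}" by auto
    then show ?thesis using True by (simp add: base_vec_def)
  next
    case False
    then have "N div 2 \<ge> 3" using N by simp
    then show ?thesis using False sum_short_vec[of "N div 2" 1 "\<lambda>_. 1"] by (simp add: base_vec_def)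
  qed
  show "int (N * gcd 2 N) dvd (\<Sum>i<N div 2. (int i + 1) ^ 2 * vec_index (base_vec N k) i)"
  proof (cases "N = 5")
    case True
    then have "{..<N div 2} = {0, 1}" by auto
    moreover have "gcd 2 N = 1" using True by (simp add: gcd_nat.simps[of 2 5])
    ultimately show ?thesis using True by (simp add: base_vec_def)
  next
    case False
    then have "N div 2 \<ge> 3" using N by simp
    then show ?thesis using False sum_short_vec[of "N div 2" 1 "\<lambda>i. (int i + 1) ^ 2"] by (simp add: base_vec_def)
  qed
qed

lemma exponent_vec_unit_lattice_iff:
  assumes N: "N \<ge> 5"
  shows "exponent_vec N b - base_vec N k \<in> unit_lattice N \<longleftrightarrow>
    12 dvd int k + (\<Sum>j=1..N div 2. b j) \<and> int (N * gcd 2 N) dvd (\<Sum>j=1..N div 2. int j ^ 2 * b j)"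
proof -
  have v: "base_vec N k \<in> carrier_vec (N div 2)" by (rule base_vec_carrier)
  define z where "z = exponent_vec N b - base_vec N k"
  have z: "z \<in> carrier_vec (N div 2)" unfolding z_def using v by (rule minus_carrier_vec[OF exponent_vec_carrier])
  have p: "vec_index z i = b (i + 1) - vec_index (base_vec N k) i" if "i < N div 2" for i
    unfolding z_def using that carrier_vecD[OF v] by (simp add: exponent_vec_def)
  have "(\<Sum>i<N div 2. vec_index z i) = (\<Sum>i<N div 2. b (i + 1) - vec_index (base_vec N k) i)"
    by (intro sum.cong refl p) simp
  also have "\<dots> = (\<Sum>i<N div 2. b (i + 1)) - (- int k)"
    unfolding sum_subtractf base_vec_sums(1)[OF N] ..
  also have "(\<Sum>i<N div 2. b (i + 1)) = (\<Sum>j=1..N div 2. b j)"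
    unfolding One_nat_def sum.atLeast1_atMost_eq by simp
  finally have 1: "(\<Sum>i<N div 2. vec_index z i) = int k + (\<Sum>j=1..N div 2. b j)" by simp
  have "(\<Sum>i<N div 2. (int i + 1) ^ 2 * vec_index z i) =
      (\<Sum>i<N div 2. (int i + 1) ^ 2 * b (i + 1) - (int i + 1) ^ 2 * vec_index (base_vec N k) i)"
    by (intro sum.cong refl) (simp only: p lessThan_iff right_diff_distrib)
  also have "\<dots> = (\<Sum>i<N div 2. (int i + 1) ^ 2 * b (i + 1)) - (\<Sum>i<N div 2. (int i + 1) ^ 2 * vec_index (base_vec N k) i)"
    by (rule sum_subtractf)
  also have "(\<Sum>i<N div 2. (int i + 1) ^ 2 * b (i + 1)) = (\<Sum>j=1..N div 2. int j ^ 2 * b j)"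
  proof -
    have "int i + 1 = int (Suc i)" for i by simp
    then show ?thesis unfolding One_nat_def sum.atLeast1_atMost_eq by (simp only: Suc_eq_plus1 add_0)
  qed
  finally have 2: "int (N * gcd 2 N) dvd (\<Sum>i<N div 2. (int i + 1) ^ 2 * vec_index z i) \<longleftrightarrow>
      int (N * gcd 2 N) dvd (\<Sum>j=1..N div 2. int j ^ 2 * b j)"
    using dvd_diff_left_iff[OF base_vec_sums(2)[OF N, of k]] by (simp only:)
  show ?thesis unfolding z_def[symmetric] unit_lattice_def mem_Collect_eq 1 2 using z by blast
qed

lemma L_set_eq:
  assumes N: "N \<ge> 5" and reps: "orbit_reps N a c"
  shows "L_set N k = {b \<in> {1..N div 2} \<rightarrow>\<^sub>E UNIV. exponent_vec N b - base_vec N k \<in> unit_lattice N \<and>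
    order_vec N a c k (exponent_vec N b) \<in> lattice_simplex (N div 2)
      (\<lambda>i. real (card (galois_orbit N (cusp N (a i) (c i))))) (12 * real N * R_const N * real k)}"
  unfolding L_set_def theta_product_modular_iff_orbit_reps[OF N reps] exponent_vec_unit_lattice_iff[OF N]
    order_vec_in_lattice_simplex_iff[OF N reps] by simp

lemma order_vec_diff:
  assumes "x \<in> carrier_vec (N div 2)" "z \<in> carrier_vec (N div 2)"
  shows "order_vec N a c k x - order_vec N a c k z = int_A_matrix N a c *\<^sub>v (x - z)"
  unfolding mult_minus_distrib_mat_vec[OF int_A_matrix_carrier assms] order_vec_def
  using int_A_matrix_carrier[of N a c] by (intro eq_vecI) auto

lemma det_int_A_matrix_nonzero:
  assumes N: "N \<ge> 5" and reps: "orbit_reps N a c"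
  shows "Determinant.det (int_A_matrix N a c) \<noteq> 0"
proof
  assume "Determinant.det (int_A_matrix N a c) = 0"
  then show False using det_int_A_matrix[of N a c] det_A_matrix_nonzero[OF N reps] N by simp
qed

lemma lattice_image_mult:
  assumes A: "A \<in> carrier_mat n n" and B: "B \<in> carrier_mat n n"
  shows "lattice_image n (A * B) = (\<lambda>x. A *\<^sub>v x) ` lattice_image n B"
proof -
  have "(A * B) *\<^sub>v x = A *\<^sub>v (B *\<^sub>v x)" if "x \<in> carrier_vec n" for x by (rule assoc_mult_mat_vec[OF A B that])
  then show ?thesis unfolding lattice_image_def by (auto simp: image_iff) metis+
qed

text \<open>The exponents form a coset of B_N Z^m, and the affine map \<open>order_vec\<close> has
  an invertible linear part; so it carries this coset bijectively to one of the product lattice, and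
  the order conditions to the simplex.\<close>

lemma bij_betw_L_set:
  assumes N: "N \<ge> 5" and reps: "orbit_reps N a c"
  shows "bij_betw (\<lambda>b. order_vec N a c k (exponent_vec N b)) (L_set N k)
    (coset_simplex (N div 2) (\<lambda>i. real (card (galois_orbit N (cusp N (a i) (c i))))) (12 * real N * R_const N * real k)
      (int_A_matrix N a c * int_B_matrix N) (order_vec N a c k (base_vec N k)))"
proof -
  define m where "m = N div 2"
  define A where "A = int_A_matrix N a c"
  have A: "A \<in> carrier_mat m m" unfolding A_def m_def by (rule int_A_matrix_carrier)
  have B: "int_B_matrix N \<in> carrier_mat m m" unfolding m_def by (rule int_B_matrix_carrier[OF N])
  have det: "Determinant.det A \<noteq> 0" unfolding A_def by (rule det_int_A_matrix_nonzero[OF N reps])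
  have inj: "x = z" if "x \<in> carrier_vec m" "z \<in> carrier_vec m" "A *\<^sub>v x = A *\<^sub>v z" for x z
  proof -
    have "A *\<^sub>v (x - z) = 0\<^sub>v m" unfolding mult_minus_distrib_mat_vec[OF A that(1,2)] that(3) using A that(2) by simp
    then have "x - z = 0\<^sub>v m" using det_0_iff_vec_prod_zero[OF A] det that(1,2) minus_carrier_vec by blast
    show ?thesis
    proof (rule eq_vecI)
      fix i assume "i < dim_vec z"
      then have "vec_index (x - z) i = 0" using \<open>x - z = 0\<^sub>v m\<close> that by simp
      then show "vec_index x i = vec_index z i" using \<open>i < dim_vec z\<close> that by simp
    qed (use that in simp)
  qed
  have img: "lattice_image m (A * int_B_matrix N) = (\<lambda>x. A *\<^sub>v x) ` unit_lattice N"
    using lattice_image_mult[OF A B] lattice_image_int_B_matrix[OF N] by (simp only: m_def)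
  define t where "t = order_vec N a c k (base_vec N k)"
  define S where "S = lattice_simplex m (\<lambda>i. real (card (galois_orbit N (cusp N (a i) (c i))))) (12 * real N * R_const N * real k)"
  have L: "L_set N k = {b \<in> {1..m} \<rightarrow>\<^sub>E UNIV. exponent_vec N b - base_vec N k \<in> unit_lattice N \<and> order_vec N a c k (exponent_vec N b) \<in> S}"
    unfolding L_set_eq[OF N reps] S_def m_def ..
  have bc: "base_vec N k \<in> carrier_vec m" unfolding m_def by (rule base_vec_carrier)
  have ec: "exponent_vec N b \<in> carrier_vec m" for b unfolding m_def by (rule exponent_vec_carrier)
  have diff: "order_vec N a c k x - order_vec N a c k z = A *\<^sub>v (x - z)" if "x \<in> carrier_vec m" "z \<in> carrier_vec m" for x z
    using order_vec_diff[of x N z a c k] that unfolding m_def A_def by simp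
  have "bij_betw (\<lambda>b. order_vec N a c k (exponent_vec N b)) (L_set N k) {y \<in> S. y - t \<in> lattice_image m (A * int_B_matrix N)}"
    unfolding bij_betw_def
  proof (intro conjI inj_onI equalityI subsetI)
    fix b b' assume b: "b \<in> L_set N k" "b' \<in> L_set N k" "order_vec N a c k (exponent_vec N b) = order_vec N a c k (exponent_vec N b')"
    have "A *\<^sub>v (exponent_vec N b - exponent_vec N b') = 0\<^sub>v m"
      unfolding diff[OF ec ec, symmetric] b(3)
      by (intro eq_vecI) (simp_all add: carrier_vecD[OF order_vec_carrier] m_def)
    also have "\<dots> = A *\<^sub>v 0\<^sub>v m" using A by (intro eq_vecI) (auto simp: scalar_prod_def)
    finally have "A *\<^sub>v (exponent_vec N b - exponent_vec N b') = A *\<^sub>v 0\<^sub>v m" .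
    then have "exponent_vec N b - exponent_vec N b' = 0\<^sub>v m" using inj ec by simp
    then have eq: "b (i + 1) = b' (i + 1)" if "i < m" for i
    proof -
      have "vec_index (exponent_vec N b - exponent_vec N b') i = 0"
        using \<open>exponent_vec N b - exponent_vec N b' = 0\<^sub>v m\<close> that by simp
      then show ?thesis using that by (simp add: exponent_vec_def m_def)
    qed
    show "b = b'"
    proof (rule PiE_ext)
      show "b \<in> {1..m} \<rightarrow>\<^sub>E UNIV" "b' \<in> {1..m} \<rightarrow>\<^sub>E UNIV" using b by (simp_all add: L)
      fix j assume "j \<in> {1..m}"
      then have "j - 1 < m" "j - 1 + 1 = j" by auto
      then show "b j = b' j" using eq[of "j - 1"] by metis
    qed
  next
    fix y assume "y \<in> (\<lambda>b. order_vec N a c k (exponent_vec N b)) ` L_set N k"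
    then obtain b where b: "b \<in> L_set N k" "y = order_vec N a c k (exponent_vec N b)" by blast
    then show "y \<in> {y \<in> S. y - t \<in> lattice_image m (A * int_B_matrix N)}"
      unfolding img t_def L by (simp add: diff[OF ec bc])
  next
    fix y assume "y \<in> {y \<in> S. y - t \<in> lattice_image m (A * int_B_matrix N)}"
    then obtain z where z: "y \<in> S" "z \<in> unit_lattice N" "y - t = A *\<^sub>v z" unfolding img by blast
    have zc: "z \<in> carrier_vec m" using z by (simp add: unit_lattice_def m_def)
    have yc: "y \<in> carrier_vec m" using z(1) by (simp add: S_def lattice_simplex_def)
    \<comment> \<open>Restricted to {1..m}, because the members of \<open>L_set\<close> are
      extensional functions on that index set.\<close>
    define b where "b = (\<lambda>j\<in>{1..m}. vec_index (base_vec N k + z) (j - 1))"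
    have e: "exponent_vec N b = base_vec N k + z"
      using bc zc by (intro eq_vecI) (auto simp: exponent_vec_def b_def m_def)
    have ez: "exponent_vec N b - base_vec N k = z" unfolding e using bc zc by (intro eq_vecI) auto
    have "order_vec N a c k (exponent_vec N b) - t = y - t" unfolding t_def diff[OF ec bc] ez z(3)[unfolded t_def] ..
    then have "order_vec N a c k (exponent_vec N b) = y"
    proof -
      assume eq: "order_vec N a c k (exponent_vec N b) - t = y - t"
      have tc: "t \<in> carrier_vec m" "order_vec N a c k (exponent_vec N b) \<in> carrier_vec m"
        using order_vec_carrier[of N a c k] by (simp_all add: t_def m_def)
      have "order_vec N a c k (exponent_vec N b) = (order_vec N a c k (exponent_vec N b) - t) + t" using tc by (intro eq_vecI) auto
      also have "\<dots> = y" unfolding eq using tc yc by (intro eq_vecI) auto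
      finally show ?thesis .
    qed
    moreover have "b \<in> {1..m} \<rightarrow>\<^sub>E UNIV" by (simp add: b_def)
    ultimately have "b \<in> L_set N k" using z ez by (simp add: L)
    then show "y \<in> (\<lambda>b. order_vec N a c k (exponent_vec N b)) ` L_set N k"
      using \<open>order_vec N a c k (exponent_vec N b) = y\<close> by blast
  qed
  then show ?thesis by (simp add: coset_simplex_def S_def t_def A_def m_def)
qed

lemma R_const_pos: 
  assumes "N > 0" shows "R_const N > 0"
proof -
  have "(\<Sum>d | d dvd N. real d * real (totient d) * real (totient (N div d))) > 0"
    using assms by (intro sum_pos) (auto intro: Nat.gr0I)
  then show ?thesis by (simp add: R_const_def)
qed

theorem theorem4p2:
  fixes N m :: nat and a c :: "nat \<Rightarrow> int" and \<mu> :: "nat \<Rightarrow> nat"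
  assumes "N \<ge> 5" and "m = N div 2"
    and "orbit_reps N a c"
    and "\<And>i. i \<le> m \<Longrightarrow> \<mu> i = card (galois_orbit N (cusp N (a i) (c i)))"
  shows "Determinant.det (class_matrix N a c) \<noteq> 0 \<and>
    (\<forall>k. finite (L_set N k)) \<and>
    (\<lambda>k::nat. real (card (L_set N k))
        - R_const N ^ m
          / (fact m * (\<Prod>i=0..m. real (\<mu> i)) * \<bar>Determinant.det (class_matrix N a c)\<bar>)
          * real k ^ m)
      \<in> O(\<lambda>k. real k ^ (m - 1))"
proof (intro conjI allI)
  note N = assms(1) and reps = assms(3)
  define \<nu> where "\<nu> = (\<lambda>i. real (card (galois_orbit N (cusp N (a i) (c i)))))"
  define W where "W = int_A_matrix N a c * int_B_matrix N"
  define \<kappa> where "\<kappa> = 12 * real N * R_const N"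
  define t where "t = (\<lambda>k. order_vec N a c k (base_vec N k))"
  show "Determinant.det (class_matrix N a c) \<noteq> 0" by (rule det_class_matrix_nonzero[OF N reps])
  have bij: "bij_betw (\<lambda>b. order_vec N a c k (exponent_vec N b)) (L_set N k) (coset_simplex m \<nu> (\<kappa> * real k) W (t k))" for k
    using bij_betw_L_set[OF N reps, of k] by (simp add: \<nu>_def W_def \<kappa>_def t_def assms(2))
  have \<nu>: "\<nu> i > 0" if "i < m" for i
    using orbit_size_pos[OF N, of "a i" "c i"] reps that by (simp add: \<nu>_def orbit_reps_def assms(2))
  show "finite (L_set N k)" for k
  proof -
    have "finite (coset_simplex m \<nu> (\<kappa> * real k) W (t k))"
      using finite_lattice_simplex[of m \<nu>] \<nu> by (simp add: coset_simplex_def)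
    then show ?thesis using bij_betw_finite[OF bij] by blast
  qed
  have A: "int_A_matrix N a c \<in> carrier_mat m m" and B: "int_B_matrix N \<in> carrier_mat m m"
    using int_A_matrix_carrier[of N a c] int_B_matrix_carrier[OF N] by (simp_all add: assms(2))
  have W: "W \<in> carrier_mat m m" unfolding W_def using A B by (rule mult_carrier_mat)
  have detW: "Determinant.det W = Determinant.det (int_A_matrix N a c) * Determinant.det (int_B_matrix N)"
    unfolding W_def by (rule det_mult[OF A B])
  have W0: "Determinant.det W \<noteq> 0"
    unfolding detW using det_int_A_matrix_nonzero[OF N reps] det_int_B_matrix_nonzero[OF N] by simp
  have N0: "N > 0" using N by simp
  \<comment> \<open>Scaling the m rows by 12 N multiplies the index by (12 N)^m; the same power
    enters the volume through \<kappa> and cancels in \<open>coef\<close>.\<close>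
  have "real_of_int (Determinant.det W) = (12 * real N) ^ m * Determinant.det (class_matrix N a c)"
    unfolding detW of_int_mult det_int_A_matrix[OF N0] det_class_matrix[OF N] by (simp add: assms(2))
  then have absW: "real_of_int \<bar>Determinant.det W\<bar> = (12 * real N) ^ m * \<bar>Determinant.det (class_matrix N a c)\<bar>"
    by (simp add: abs_mult)
  have "m > 0" using N by (simp add: assms(2))
  have "(\<Prod>i=0..m. real (\<mu> i)) = (\<Prod>i=0..m. \<nu> i)"
    using assms(4) by (intro prod.cong) (auto simp: \<nu>_def)
  \<comment> \<open>The last factor is \<mu>_m = 1, the orbit size of i\<infinity>.\<close>
  also have "\<dots> = (\<Prod>i<m. \<nu> i)"
    using orbit_size_last[OF N reps] by (simp add: atLeast0AtMost lessThan_Suc_atMost[symmetric] \<nu>_def assms(2))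
  finally have prod: "(\<Prod>i=0..m. real (\<mu> i)) = (\<Prod>i<m. \<nu> i)" .
  have coef: "\<kappa> ^ m / (fact m * (\<Prod>i<m. \<nu> i) * of_int \<bar>Determinant.det W\<bar>) =
      R_const N ^ m / (fact m * (\<Prod>i=0..m. real (\<mu> i)) * \<bar>Determinant.det (class_matrix N a c)\<bar>)"
    unfolding prod absW \<kappa>_def power_mult_distrib using N0 by simp
  have "\<kappa> > 0" using R_const_pos[OF N0] N0 by (simp add: \<kappa>_def)
  moreover have "t k \<in> carrier_vec m" for k unfolding t_def assms(2) by (rule order_vec_carrier)
  ultimately have "(\<lambda>k::nat. real (card (coset_simplex m \<nu> (\<kappa> * real k) W (t k))) -
     \<kappa> ^ m / (fact m * (\<Prod>i<m. \<nu> i) * of_int \<bar>Determinant.det W\<bar>) * real k ^ m) \<in> O(\<lambda>k. real k ^ (m - 1))"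
    using card_coset_simplex_asymptotic[OF W W0, where \<mu> = \<nu> and t = t and \<kappa> = \<kappa>] \<nu> \<open>m > 0\<close> by blast
  then show "(\<lambda>k::nat. real (card (L_set N k)) - R_const N ^ m
          / (fact m * (\<Prod>i=0..m. real (\<mu> i)) * \<bar>Determinant.det (class_matrix N a c)\<bar>) * real k ^ m)
      \<in> O(\<lambda>k. real k ^ (m - 1))"
    unfolding coef bij_betw_same_card[OF bij] .
qed

end
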